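(* Consider the one-dimensional (integrated) Kuramoto–Sivashinsky equation on the domain $\Omega=(0,L)\subset\mathbb{R}$, $$u_t+u_{xxxx}+u_{xx}+\tfrac12 (u_x)^2=0\quad\text{in }(0,L)\times(0,T),\qquad u(x,0)=u_0(x)\quad\text{in }(0,L),$$ with the boundary conditions $$u_x(0)=u_{xxx}(0)=u_x(L)=u_{xxx}(L)=0 .$$ Given $T>0$ and $u_0\in H^1((0,L))$ satisfying these boundary conditions, there exists a solution $u$ of this problem such that $$u\in L^\infty([0,T];L^2((0,L)))\cap L^2([0,T];H^3((0,L))).$$ Furthermore, this solution is unique, and is Gevrey regular in space for $t>0$.
   Context: $L^2$ and $H^s$ denote the usual Lebesgue and ($L^2$-based) Sobolev spaces. Gevrey regularity means spatial analyticity in the following sense: on the torus $\mathbb{T}^n=\mathbb{R}^n/(2\pi\mathbb{Z})^n$, a function $u\in L^2(\mathbb{T}^n)$ with Fourier coefficients $u_{\mathbf k}$ belongs to the Gevrey class $G^{s/2}_\sigma(\mathbb{T}^n)$, $\sigma>0$, if $$\sum_{\mathbf k\in\mathbb{Z}^n}|u_{\mathbf k}|^2(1+|\mathbf k|^2)^s e^{2\sigma(1+|\mathbf k|^2)^{1/2}}<\infty,$$ and such functions are called Gevrey regular; they are spatially analytic. In the present problem on $(0,L)$, "Gevrey regular in space" is used synonymously with analytic in space. *)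

theory Defs
  imports "HOL-Analysis.Analysis"
begin

section \<open>Sobolev spaces on \<open>(0,L)\<close>\<close>

definition smooth_fun :: "(real \<Rightarrow> real) \<Rightarrow> bool" where
  "smooth_fun f \<longleftrightarrow> (\<forall>n x. (deriv ^^ n) f field_differentiable (at x))"

definition test_fun :: "real \<Rightarrow> (real \<Rightarrow> real) \<Rightarrow> bool" where
  "test_fun L \<phi> \<longleftrightarrow> smooth_fun \<phi> \<and>
     (\<exists>a b. 0 < a \<and> b < L \<and> (\<forall>x. x \<notin> {a..b} \<longrightarrow> \<phi> x = 0))"

abbreviation dom_measure :: "real \<Rightarrow> real measure" where
  "dom_measure L \<equiv> lebesgue_on {0<..<L}"

definition L2_fun :: "real \<Rightarrow> (real \<Rightarrow> real) \<Rightarrow> bool" where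
  "L2_fun L f \<longleftrightarrow> f \<in> borel_measurable (dom_measure L) \<and>
     integrable (dom_measure L) (\<lambda>x. (f x)\<^sup>2)"

definition L2_norm :: "real \<Rightarrow> (real \<Rightarrow> real) \<Rightarrow> real" where
  "L2_norm L f = sqrt (\<integral>x. (f x)\<^sup>2 \<partial>dom_measure L)"

definition has_weak_deriv :: "real \<Rightarrow> nat \<Rightarrow> (real \<Rightarrow> real) \<Rightarrow> (real \<Rightarrow> real) \<Rightarrow> bool" where
  "has_weak_deriv L k f g \<longleftrightarrow>
     (\<forall>\<phi>. test_fun L \<phi> \<longrightarrow>
        (\<integral>x. f x * (deriv ^^ k) \<phi> x \<partial>dom_measure L)
          = (- 1) ^ k * (\<integral>x. g x * \<phi> x \<partial>dom_measure L))"

text \<open>A representative of the \<open>k\<close>-th weak derivative, which is determined up to a null set.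
  It is only meaningful for functions that have a weak derivative of order \<open>k\<close> in \<open>L\<^sup>2\<close>.\<close>

definition weak_deriv :: "real \<Rightarrow> nat \<Rightarrow> (real \<Rightarrow> real) \<Rightarrow> real \<Rightarrow> real" where
  "weak_deriv L k f = (SOME g. L2_fun L g \<and> has_weak_deriv L k f g)"

definition sobolev :: "real \<Rightarrow> nat \<Rightarrow> (real \<Rightarrow> real) \<Rightarrow> bool" where
  "sobolev L k f \<longleftrightarrow> L2_fun L f \<and>
     (\<forall>j\<le>k. \<exists>g. L2_fun L g \<and> has_weak_deriv L j f g)"

definition sobolev_norm :: "real \<Rightarrow> nat \<Rightarrow> (real \<Rightarrow> real) \<Rightarrow> real" where
  "sobolev_norm L k f = sqrt (\<Sum>j\<le>k. (L2_norm L (weak_deriv L j f))\<^sup>2)"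

section \<open>Time-dependent functions\<close>

text \<open>A time-dependent function is written \<open>u t x\<close>.  An element of
  \<open>L\<^sup>p([0,T];X)\<close>, for \<open>X\<close> one of the separable spaces \<open>L\<^sup>2((0,L))\<close>, \<open>H\<^sup>3((0,L))\<close>, is represented
  by a jointly measurable \<open>u\<close>; membership does not change when \<open>u\<close> is modified on a
  null set of \<open>(t,x)\<close>.  By contrast, \<open>C_L2\<close> singles out the representative that is
  continuous on \<open>[0,T]\<close> with values in \<open>L\<^sup>2((0,L))\<close>, so that \<open>u(t)\<close> makes sense
  for every \<open>t\<close>.\<close>

definition jointly_measurable :: "real \<Rightarrow> real \<Rightarrow> (real \<Rightarrow> real \<Rightarrow> real) \<Rightarrow> bool" where
  "jointly_measurable L T u \<longleftrightarrow>
     (\<lambda>(t, x). u t x) \<in> borel_measurable (lebesgue_on ({0..T} \<times> {0<..<L}))"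

definition Linf_L2 :: "real \<Rightarrow> real \<Rightarrow> (real \<Rightarrow> real \<Rightarrow> real) \<Rightarrow> bool" where
  "Linf_L2 L T u \<longleftrightarrow> jointly_measurable L T u \<and>
     (\<exists>C. AE t in lebesgue_on {0..T}. L2_fun L (u t) \<and> L2_norm L (u t) \<le> C)"

definition L2_sobolev :: "real \<Rightarrow> real \<Rightarrow> nat \<Rightarrow> (real \<Rightarrow> real \<Rightarrow> real) \<Rightarrow> bool" where
  "L2_sobolev L T k u \<longleftrightarrow> jointly_measurable L T u \<and>
     (AE t in lebesgue_on {0..T}. sobolev L k (u t)) \<and>
     integrable (lebesgue_on {0..T}) (\<lambda>t. (sobolev_norm L k (u t))\<^sup>2)"

definition C_L2 :: "real \<Rightarrow> real \<Rightarrow> (real \<Rightarrow> real \<Rightarrow> real) \<Rightarrow> bool" where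
  "C_L2 L T u \<longleftrightarrow> (\<forall>t\<in>{0..T}. L2_fun L (u t)) \<and>
     (\<forall>s\<in>{0..T}. ((\<lambda>t. L2_norm L (\<lambda>x. u t x - u s x)) \<longlongrightarrow> 0) (at s within {0..T}))"

section \<open>Boundary conditions\<close>

text \<open>The conditions \<open>f\<^sub>x = f\<^sub>x\<^sub>x\<^sub>x = 0\<close> at \<open>0\<close> and \<open>L\<close> in the classical sense, with one-sided
  derivatives at the endpoints.\<close>

definition classical_bc :: "real \<Rightarrow> (real \<Rightarrow> real) \<Rightarrow> bool" where
  "classical_bc L f \<longleftrightarrow> (\<exists>f1 f2 f3.
     (\<forall>x\<in>{0..L}. (f has_real_derivative f1 x) (at x within {0..L}) \<and>
                 (f1 has_real_derivative f2 x) (at x within {0..L}) \<and>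
                 (f2 has_real_derivative f3 x) (at x within {0..L})) \<and>
     continuous_on {0..L} f3 \<and>
     f1 0 = 0 \<and> f3 0 = 0 \<and> f1 L = 0 \<and> f3 L = 0)"

text \<open>For \<open>f \<in> H\<^sup>1\<close> neither \<open>f\<^sub>x\<close> nor \<open>f\<^sub>x\<^sub>x\<^sub>x\<close> has a trace, so the boundary conditions
  are understood as membership in the \<open>H\<^sup>1\<close>-closure of the functions that satisfy them classically.\<close>

definition H1_bc :: "real \<Rightarrow> (real \<Rightarrow> real) \<Rightarrow> bool" where
  "H1_bc L f \<longleftrightarrow> sobolev L 1 f \<and>
     (\<forall>\<epsilon>>0. \<exists>\<phi>. classical_bc L \<phi> \<and> sobolev_norm L 1 (\<lambda>x. f x - \<phi> x) < \<epsilon>)"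

text \<open>The trace of an a.e. defined function at \<open>a \<in> {0, L}\<close>, taken through its continuous
  representative.\<close>

definition has_trace :: "real \<Rightarrow> (real \<Rightarrow> real) \<Rightarrow> real \<Rightarrow> real \<Rightarrow> bool" where
  "has_trace L f a c \<longleftrightarrow> (\<exists>g. continuous_on {0..L} g \<and>
     (AE x in dom_measure L. f x = g x) \<and> g a = c)"

section \<open>Solutions of the Kuramoto--Sivashinsky equation\<close>

text \<open>For \<open>u(t) \<in> H\<^sup>3\<close> the condition \<open>u\<^sub>x = 0\<close> is imposed on the traces.  The condition
  \<open>u\<^sub>x\<^sub>x\<^sub>x = 0\<close> is natural: it is encoded by the absence of boundary terms in
  \<open>\<integral> u\<^sub>x\<^sub>x\<^sub>x\<^sub>x v = - \<integral> u\<^sub>x\<^sub>x\<^sub>x v\<^sub>x\<close> for test functions \<open>v\<close> that are smooth up to the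
  boundary and unrestricted there.  The equation is integrated over \<open>[0,t]\<close>, which
  includes the initial condition.\<close>

definition KS_solution :: "real \<Rightarrow> real \<Rightarrow> (real \<Rightarrow> real) \<Rightarrow> (real \<Rightarrow> real \<Rightarrow> real) \<Rightarrow> bool" where
  "KS_solution L T u0 u \<longleftrightarrow>
     Linf_L2 L T u \<and> L2_sobolev L T 3 u \<and>
     (AE t in lebesgue_on {0..T}.
        has_trace L (weak_deriv L 1 (u t)) 0 0 \<and> has_trace L (weak_deriv L 1 (u t)) L 0) \<and>
     (\<forall>v. smooth_fun v \<longrightarrow>
        (AE t in lebesgue_on {0..T}.
           (\<integral>x. u t x * v x \<partial>dom_measure L) - (\<integral>x. u0 x * v x \<partial>dom_measure L)
           = (\<integral>s. (\<integral>x. weak_deriv L 3 (u s) x * deriv v x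
                        - weak_deriv L 2 (u s) x * v x
                        - 1 / 2 * (weak_deriv L 1 (u s) x)\<^sup>2 * v x \<partial>dom_measure L)
                \<partial>lebesgue_on {0..t})))"

section \<open>Spatial analyticity\<close>

definition real_analytic_on :: "real set \<Rightarrow> (real \<Rightarrow> real) \<Rightarrow> bool" where
  "real_analytic_on S f \<longleftrightarrow> (\<forall>x0\<in>S. \<exists>r>0. \<exists>a :: nat \<Rightarrow> real.
     \<forall>x\<in>S. \<bar>x - x0\<bar> < r \<longrightarrow> (\<lambda>n. a n * (x - x0) ^ n) sums f x)"

end

theory Submission
  imports Defs "HOL-Complex_Analysis.Complex_Analysis" "HOL-Library.Diagonal_Subsequence"
begin

text \<open>Expand in the cosines \<open>cos (k \<pi> x / L)\<close>, which satisfy the boundary conditions.  The cosine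
  coefficients of a weak solution solve an infinite system of integral equations, in which the coefficients
  of \<open>u\<^sub>x\<^sup>2\<close> are limits of finite convolutions; conversely, a solution of the system that is
  bounded in \<open>L\<^sup>2\<close> with \<open>\<integral> \<Sum> \<lambda>\<^sub>k\<^sup>6 a\<^sub>k\<^sup>2 < \<infinity>\<close> sums to a weak solution.  Existence is by Galerkin truncation:
  since \<open>\<integral> u\<^sub>x\<^sup>2 u\<^sub>x\<^sub>x = 0\<close>, the quantity \<open>\<Sum> \<lambda>\<^sub>k\<^sup>2 a\<^sub>k\<^sup>2\<close> grows at most exponentially
  and controls the dissipation, uniformly in the truncation.  Spatial analyticity is the Foias--Temam
  argument: started at any time, \<open>\<Sum> exp (2 s \<lambda>\<^sub>k) \<lambda>\<^sub>k\<^sup>2 a\<^sub>k\<^sup>2\<close> stays bounded for a time \<open>s\<close> that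
  depends only on the energy bound.  Uniqueness is a Gronwall estimate for the difference of two
  coefficient sequences.\<close>

section \<open>Fourier coefficients on an interval\<close>

text \<open>Four obstacles shape the details. Weak derivatives are tested only on functions
  supported inside \<open>(0, L)\<close>, while the cosines and the \<open>v\<close> of the weak
  equation live up to the boundary. Cutoffs bridge the gap; the boundary term they create disappears
  either because the test function vanishes at the ends (sines against \<open>u\<close> and
  \<open>u\<^sub>x\<^sub>x\<close>) or because the trace of \<open>u\<^sub>x\<close> does (cosines
  against \<open>u\<^sub>x\<close>). The energy sees only frequencies \<open>k > 0\<close>; the mean
  does not influence \<open>u\<^sub>x\<close>, so it is left out of the Galerkin system and
  recovered by integrating its equation. Galerkin solutions converge only coefficient by
  coefficient, which says nothing about the convolutions in \<open>u\<^sub>x\<^sup>2\<close>; the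
  Gevrey bound, uniform in the truncation, supplies at each \<open>t > 0\<close> a summable majorant
  of \<open>lam k * |a k|\<close>, and \<open>t = 0\<close> is a null set. Uniqueness compares
  solutions whose \<open>H\<^sup>3\<close> norm is merely square integrable in time, hence a
  Gronwall lemma with an integrable kernel.\<close>

lemma power_le_fact_exp:
  assumes "0 \<le> (x :: real)"
  shows "x ^ m \<le> fact m * exp x"
proof -
  have "(\<Sum>n\<in>{m}. x ^ n /\<^sub>R fact n) \<le> (\<Sum>n. x ^ n /\<^sub>R fact n)"
    using assms by (intro sum_le_suminf summable_exp_generic) auto
  then have "x ^ m / fact m \<le> exp x"
    by (simp add: exp_def divide_inverse_commute)
  then show ?thesis by (simp add: pos_divide_le_eq mult.commute)
qed

locale interval =
  fixes L :: real
  assumes L_pos: "0 < L"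
begin

abbreviation M :: "real measure" where "M \<equiv> dom_measure L"

lemma finite_measure_M: "finite_measure M"
  by (rule finite_measure_lebesgue_on) (simp add: lmeasurable_interval)

lemma measure_M [simp]: "measure M {0<..<L} = L"
  using L_pos by (simp add: measure_restrict_space)

lemma integrable_M_const [simp]: "integrable M (\<lambda>x. c :: real)"
  by (rule finite_measure.integrable_const[OF finite_measure_M])

lemma continuous_integrable_M:
  assumes "continuous_on {0..L} f"
  shows "integrable M (f :: real \<Rightarrow> real)"
proof -
  have "f absolutely_integrable_on {0..L}"
    using absolutely_integrable_continuous_real[OF assms] .
  then have "f absolutely_integrable_on {0<..<L}"
    by (rule set_integrable_subset) auto
  then show ?thesis
    by (simp add: set_integrable_def integrable_restrict_space)
qed

lemma continuous_measurable_M: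
  fixes f :: "real \<Rightarrow> real"
  assumes "continuous_on {0..L} f"
  shows "f \<in> borel_measurable M"
  using continuous_integrable_M[OF assms] by (rule borel_measurable_integrable)

lemma integral_M_eq:
  assumes "continuous_on {0..L} f"
  shows "(\<integral>x. f x \<partial>M) = integral {0..L} (f :: real \<Rightarrow> real)"
proof -
  have "(\<integral>x. f x \<partial>M) = integral {0<..<L} f"
    by (rule lebesgue_integral_eq_integral[OF continuous_integrable_M[OF assms]]) simp
  then show ?thesis by (simp add: integral_open_interval_real)
qed

lemma FTC_M:
  assumes "\<And>x. x \<in> {0..L} \<Longrightarrow> (F has_real_derivative f x) (at x within {0..L})"
    and "continuous_on {0..L} f"
  shows "(\<integral>x. f x \<partial>M) = F L - F 0"
proof -
  have "(f has_integral F L - F 0) {0..L}"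
    using L_pos assms(1)
    by (intro fundamental_theorem_of_calculus) (auto simp: has_real_derivative_iff_has_vector_derivative)
  then show ?thesis
    using integral_M_eq[OF assms(2)] by (simp add: integral_unique)
qed

lemma L2_measurable: "L2_fun L f \<Longrightarrow> f \<in> borel_measurable M"
  by (simp add: L2_fun_def)

lemma L2_square_integrable: "L2_fun L f \<Longrightarrow> integrable M (\<lambda>x. (f x)\<^sup>2)"
  by (simp add: L2_fun_def)

lemma L2_mult_integrable:
  assumes "L2_fun L f" "L2_fun L g"
  shows "integrable M (\<lambda>x. f x * g x)"
proof (rule Bochner_Integration.integrable_bound)
  show "integrable M (\<lambda>x. (f x)\<^sup>2 + (g x)\<^sup>2)"
    using assms by (simp add: L2_fun_def)
  show "(\<lambda>x. f x * g x) \<in> borel_measurable M"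
    using assms by (auto simp: L2_fun_def intro: borel_measurable_times)
  have "\<bar>a * b\<bar> \<le> a\<^sup>2 + b\<^sup>2" for a b :: real
  proof -
    have "2 * (\<bar>a\<bar> * \<bar>b\<bar>) \<le> \<bar>a\<bar>\<^sup>2 + \<bar>b\<bar>\<^sup>2"
      using sum_squares_bound[of "\<bar>a\<bar>" "\<bar>b\<bar>"] by simp
    moreover have "0 \<le> \<bar>a\<bar> * \<bar>b\<bar>" by simp
    ultimately show ?thesis unfolding abs_mult power2_abs by linarith
  qed
  then show "AE x in M. norm (f x * g x) \<le> norm ((f x)\<^sup>2 + (g x)\<^sup>2)"
    by (intro AE_I2) (simp)
qed

lemma L2_continuous: "continuous_on {0..L} f \<Longrightarrow> L2_fun L f"
  unfolding L2_fun_def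
  by (auto intro!: continuous_measurable_M continuous_integrable_M continuous_intros)

lemma L2_integrable: "L2_fun L f \<Longrightarrow> integrable M f"
  using L2_mult_integrable[of f "\<lambda>_. 1"] L2_continuous[of "\<lambda>_. 1"] by simp

lemma L2_cmult: "L2_fun L f \<Longrightarrow> L2_fun L (\<lambda>x. c * f x)"
  by (auto simp: L2_fun_def power_mult_distrib intro: borel_measurable_times)

lemma L2_add:
  assumes "L2_fun L f" "L2_fun L g"
  shows "L2_fun L (\<lambda>x. f x + g x)"
proof -
  have "(f x + g x)\<^sup>2 = (f x)\<^sup>2 + (g x)\<^sup>2 + 2 * (f x * g x)" for x
    by (simp add: power2_sum)
  then show ?thesis
    using assms L2_mult_integrable[OF assms] unfolding L2_fun_def
    by (auto intro: borel_measurable_add)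
qed

lemma L2_sum:
  assumes "\<And>i. i \<in> A \<Longrightarrow> L2_fun L (f i)"
  shows "L2_fun L (\<lambda>x. \<Sum>i\<in>A. f i x)"
  using assms
proof (induction A rule: infinite_finite_induct)
  case (insert i A)
  then show ?case using L2_add by simp
qed (auto simp: L2_fun_def)

text \<open>Expand \<open>0 \<le> \<integral> (f - g)\<^sup>2\<close> for the orthogonal projection
  \<open>g\<close> of \<open>f\<close> onto the span: both \<open>\<integral> f g\<close> and
  \<open>\<integral> g\<^sup>2\<close> equal the left-hand sum.\<close>

lemma bessel_inequality:
  fixes \<phi> :: "nat \<Rightarrow> real \<Rightarrow> real"
  assumes f: "L2_fun L f" and \<phi>: "\<And>k. k \<in> A \<Longrightarrow> L2_fun L (\<phi> k)"
    and orth: "\<And>j k. j \<in> A \<Longrightarrow> k \<in> A \<Longrightarrow> (\<integral>x. \<phi> j x * \<phi> k x \<partial>M) = (if j = k then n k else 0)"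
    and n: "\<And>k. k \<in> A \<Longrightarrow> n k > 0" and fin: "finite A"
  shows "(\<Sum>k\<in>A. (\<integral>x. f x * \<phi> k x \<partial>M)\<^sup>2 / n k) \<le> (\<integral>x. (f x)\<^sup>2 \<partial>M)"
proof -
  define c where "c k = (\<integral>x. f x * \<phi> k x \<partial>M)" for k
  define g where "g x = (\<Sum>k\<in>A. c k / n k * \<phi> k x)" for x
  have g: "L2_fun L g" unfolding g_def using \<phi> by (intro L2_sum L2_cmult) auto
  have ig: "(\<integral>x. h x * g x \<partial>M) = (\<Sum>k\<in>A. c k / n k * (\<integral>x. h x * \<phi> k x \<partial>M))"
    if "L2_fun L h" for h
  proof -
    have "(\<integral>x. h x * g x \<partial>M) = (\<integral>x. (\<Sum>k\<in>A. c k / n k * (h x * \<phi> k x)) \<partial>M)"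
      unfolding g_def by (simp add: sum_distrib_left mult_ac)
    also have "\<dots> = (\<Sum>k\<in>A. c k / n k * (\<integral>x. h x * \<phi> k x \<partial>M))"
      using L2_mult_integrable[OF that \<phi>] by (subst Bochner_Integration.integral_sum) auto
    finally show ?thesis .
  qed
  have fg: "(\<integral>x. f x * g x \<partial>M) = (\<Sum>k\<in>A. (c k)\<^sup>2 / n k)"
    unfolding ig[OF f] by (simp add: c_def[symmetric] power2_eq_square)
  have pg: "(\<integral>x. \<phi> k x * g x \<partial>M) = c k" if "k \<in> A" for k
  proof -
    have "(\<integral>x. \<phi> k x * g x \<partial>M) = (\<Sum>j\<in>A. c j / n j * (if k = j then n j else 0))"
      unfolding ig[OF \<phi>[OF that]] using orth that by (intro sum.cong) auto
    also have "\<dots> = (\<Sum>j\<in>A. if k = j then c k else 0)"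
      using n[OF that] by (intro sum.cong) auto
    also have "\<dots> = c k" using that fin by simp
    finally show ?thesis .
  qed
  have gg: "(\<integral>x. g x * g x \<partial>M) = (\<Sum>k\<in>A. (c k)\<^sup>2 / n k)"
    unfolding ig[OF g] using pg by (intro sum.cong) (auto simp: mult.commute power2_eq_square)
  have "0 \<le> (\<integral>x. (f x - g x)\<^sup>2 \<partial>M)" by simp
  also have "(\<lambda>x. (f x - g x)\<^sup>2) = (\<lambda>x. (f x)\<^sup>2 - 2 * (f x * g x) + g x * g x)"
    by (auto simp: power2_eq_square algebra_simps)
  also have "(\<integral>x. (f x)\<^sup>2 - 2 * (f x * g x) + g x * g x \<partial>M) =
      (\<integral>x. (f x)\<^sup>2 \<partial>M) - 2 * (\<Sum>k\<in>A. (c k)\<^sup>2 / n k) + (\<Sum>k\<in>A. (c k)\<^sup>2 / n k)"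
    using L2_mult_integrable[OF f g] L2_mult_integrable[OF g g] L2_square_integrable[OF f]
    by (simp add: fg gg)
  finally show ?thesis by (simp add: c_def)
qed

section \<open>Cosines and sines on the interval: orthogonality and Bessel inequalities\<close>

definition lam :: "nat \<Rightarrow> real" where "lam k = real k * pi / L"

abbreviation cs :: "nat \<Rightarrow> real \<Rightarrow> real" where "cs k x \<equiv> cos (lam k * x)"
abbreviation sn :: "nat \<Rightarrow> real \<Rightarrow> real" where "sn k x \<equiv> sin (lam k * x)"

lemma lam_0 [simp]: "lam 0 = 0" by (simp add: lam_def)
lemma lam_nonneg [simp]: "0 \<le> lam k" using L_pos by (simp add: lam_def)
lemma lam_pos: "0 < k \<Longrightarrow> 0 < lam k" using L_pos by (simp add: lam_def)
lemma lam_eq_0_iff [simp]: "lam k = 0 \<longleftrightarrow> k = 0" using L_pos by (simp add: lam_def)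
lemma lam_add: "lam (j + k) = lam j + lam k" by (simp add: lam_def algebra_simps add_divide_distrib)
lemma lam_L: "lam k * L = real k * pi" using L_pos by (simp add: lam_def)
lemma lam_mono: "j \<le> k \<Longrightarrow> lam j \<le> lam k"
  using L_pos by (simp add: lam_def divide_right_mono mult_right_mono)

lemma sn_L [simp]: "sn k L = 0" by (simp add: lam_L sin_npi)

lemma integral_cs: "(\<integral>x. cs k x \<partial>M) = (if k = 0 then L else 0)"
proof (cases "k = 0")
  case False
  have "(\<integral>x. cs k x \<partial>M) = sn k L / lam k - sn k 0 / lam k"
    using False by (intro FTC_M) (auto intro!: derivative_eq_intros continuous_intros)
  then show ?thesis using False by simp
qed simp

text \<open>On naturals one of \<open>j - k\<close> and \<open>k - j\<close> is 0, so their sum is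
  the distance of \<open>j\<close> and \<open>k\<close>. A natural index keeps every product inside
  the system \<open>cs\<close>.\<close>

lemma cs_times_cs: "cs j x * cs k x = (cs ((j - k) + (k - j)) x + cs (j + k) x) / 2"
proof (cases "j \<le> k")
  case True
  then have "lam k = lam j + lam (k - j)" by (simp flip: lam_add)
  then show ?thesis using True by (simp add: cos_times_cos lam_add) (simp add: algebra_simps)
next
  case False
  then have "lam j = lam k + lam (j - k)" by (simp flip: lam_add)
  then show ?thesis using False by (simp add: cos_times_cos lam_add) (simp add: algebra_simps)
qed

lemma sn_times_sn: "sn j x * sn k x = (cs ((j - k) + (k - j)) x - cs (j + k) x) / 2"
proof (cases "j \<le> k")
  case True
  then have "lam k = lam j + lam (k - j)" by (simp flip: lam_add)
  moreover have "cos (lam j * x - lam k * x) = cos (lam k * x - lam j * x)"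
    by (metis cos_minus minus_diff_eq)
  ultimately show ?thesis using True by (simp add: sin_times_sin lam_add) (simp add: algebra_simps)
next
  case False
  then have "lam j = lam k + lam (j - k)" by (simp flip: lam_add)
  then show ?thesis using False by (simp add: sin_times_sin lam_add) (simp add: algebra_simps)
qed

text \<open>The squared norm of \<open>cs k\<close> (see \<open>orthogonal_cs\<close>), doubled at
  \<open>k = 0\<close> where the cosine is constant.\<close>

definition nrm :: "nat \<Rightarrow> real" where "nrm k = (if k = 0 then L else L / 2)"

lemma nrm_pos [simp]: "0 < nrm k" using L_pos by (simp add: nrm_def)
lemma nrm_nonneg [simp]: "0 \<le> nrm k" using nrm_pos[of k] by linarith
lemma nrm_nonzero [simp]: "nrm k \<noteq> 0" using nrm_pos[of k] by linarith
lemma nrm_le: "nrm k \<le> L" using L_pos by (simp add: nrm_def)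
lemma nrm_ge: "L / 2 \<le> nrm k" using L_pos by (simp add: nrm_def)

lemma cont_trig [simp, continuous_intros]:
  "continuous_on S (cs k)" "continuous_on S (sn k)"
  by (auto intro!: continuous_intros)

lemma L2_trig [simp]: "L2_fun L (cs k)" "L2_fun L (sn k)"
  by (auto intro!: L2_continuous)

lemma integrable_cs [simp]: "integrable M (cs k)"
  by (rule continuous_integrable_M) simp

lemma orthogonal_cs: "(\<integral>x. cs j x * cs k x \<partial>M) = (if j = k then nrm k else 0)"
  by (simp add: cs_times_cs integral_cs nrm_def)

lemma orthogonal_sn:
  assumes "j \<noteq> 0" "k \<noteq> 0"
  shows "(\<integral>x. sn j x * sn k x \<partial>M) = (if j = k then L / 2 else 0)"
  using assms by (simp add: sn_times_sn integral_cs)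

text \<open>Normalised so that the coefficients of a cosine series are recovered exactly
  (\<open>ft_cser\<close>).\<close>

definition ft :: "(real \<Rightarrow> real) \<Rightarrow> nat \<Rightarrow> real" where
  "ft f k = (\<integral>x. f x * cs k x \<partial>M) / nrm k"

lemma integral_cs_ft: "(\<integral>x. f x * cs k x \<partial>M) = nrm k * ft f k"
  by (simp add: ft_def)

lemma bessel_cs:
  assumes "L2_fun L f"
  shows "(\<Sum>k\<in>{..K}. nrm k * (ft f k)\<^sup>2) \<le> (\<integral>x. (f x)\<^sup>2 \<partial>M)"
proof -
  have "(\<Sum>k\<in>{..K}. nrm k * (ft f k)\<^sup>2) = (\<Sum>k\<in>{..K}. (\<integral>x. f x * cs k x \<partial>M)\<^sup>2 / nrm k)"
    by (intro sum.cong) (auto simp: ft_def power2_eq_square field_simps)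
  also have "\<dots> \<le> (\<integral>x. (f x)\<^sup>2 \<partial>M)"
    by (rule bessel_inequality[OF assms]) (auto simp: orthogonal_cs)
  finally show ?thesis .
qed

lemma bessel_sn:
  assumes "L2_fun L f"
  shows "(\<Sum>k\<in>{1..K}. (\<integral>x. f x * sn k x \<partial>M)\<^sup>2) \<le> L / 2 * (\<integral>x. (f x)\<^sup>2 \<partial>M)"
proof -
  have "(\<Sum>k\<in>{1..K}. (\<integral>x. f x * sn k x \<partial>M)\<^sup>2 / (L / 2)) \<le> (\<integral>x. (f x)\<^sup>2 \<partial>M)"
    using L_pos by (intro bessel_inequality[OF assms]) (auto simp: orthogonal_sn)
  then show ?thesis
    using L_pos by (simp only: sum_divide_distrib[symmetric] pos_divide_le_eq) (simp add: mult.commute)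
qed

section \<open>Completeness and cosine series\<close>

lemma integrable_mult_continuous:
  assumes "integrable M f" "continuous_on {0..L} (h :: real \<Rightarrow> real)"
  shows "integrable M (\<lambda>x. f x * h x)"
proof -
  have "bounded (h ` {0..L})"
    by (rule compact_imp_bounded[OF compact_continuous_image[OF assms(2) compact_Icc]])
  then obtain B where "\<forall>y \<in> h ` {0..L}. norm y \<le> B"
    unfolding bounded_iff by blast
  then have B: "\<And>x. x \<in> {0..L} \<Longrightarrow> \<bar>h x\<bar> \<le> B" by simp
  show ?thesis
  proof (rule Bochner_Integration.integrable_bound)
    show "integrable M (\<lambda>x. B * f x)" using assms(1) by simp
    show "(\<lambda>x. f x * h x) \<in> borel_measurable M"
      using assms by (intro borel_measurable_times borel_measurable_integrable[OF assms(1)] continuous_measurable_M)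
    show "AE x in M. norm (f x * h x) \<le> norm (B * f x)"
    proof (rule AE_I2)
      fix x assume "x \<in> space M"
      then have "\<bar>h x\<bar> \<le> \<bar>B\<bar>" using B[of x] by simp
      then show "norm (f x * h x) \<le> norm (B * f x)"
        using mult_left_mono[of "\<bar>h x\<bar>" "\<bar>B\<bar>" "\<bar>f x\<bar>"] by (simp add: abs_mult mult.commute)
    qed
  qed
qed

text \<open>The product formula replaces one factor \<open>cs 1 x\<close> by the mean of two
  neighbouring frequencies, so the induction must keep \<open>k\<close> arbitrary. It extends the
  hypothesis to all polynomials in \<open>cs 1 x\<close>.\<close>

lemma integral_cs_power:
  assumes f: "integrable M f" and z: "\<And>k. (\<integral>x. f x * cs k x \<partial>M) = 0"
  shows "(\<integral>x. f x * (cs 1 x ^ n * cs k x) \<partial>M) = 0"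
proof (induction n arbitrary: k)
  case 0
  then show ?case using z by simp
next
  case (Suc n)
  have i: "integrable M (\<lambda>x. f x * (cs 1 x ^ n * cs j x))" for j
    by (intro integrable_mult_continuous[OF f] continuous_intros)
  have e: "f x * (cs 1 x ^ Suc n * cs k x) =
      (f x * (cs 1 x ^ n * cs ((1 - k) + (k - 1)) x) + f x * (cs 1 x ^ n * cs (1 + k) x)) / 2" for x
  proof -
    have "f x * (cs 1 x ^ Suc n * cs k x) = f x * cs 1 x ^ n * (cs 1 x * cs k x)"
      by (simp add: mult_ac)
    then show ?thesis unfolding cs_times_cs by (simp add: algebra_simps add_divide_distrib)
  qed
  show ?case unfolding e by (simp only: Bochner_Integration.integral_divide_zero Bochner_Integration.integral_add[OF i i] Suc)
      simp
qed

text \<open>\<open>cs 1\<close> maps \<open>[0, L]\<close> homeomorphically onto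
  \<open>[-1, 1]\<close>, so Stone-Weierstrass approximates \<open>h\<close> uniformly by
  polynomials in \<open>cs 1 x\<close>, against which \<open>f\<close> integrates to 0. Uniform
  approximation is what an \<open>f\<close> that is merely integrable requires.\<close>

lemma integral_eq_0_if_ft_eq_0:
  assumes f: "integrable M f" and z: "\<And>k. ft f k = 0" and h: "continuous_on {0..L} h"
  shows "(\<integral>x. f x * h x \<partial>M) = 0"
proof -
  define I where "I = (\<integral>x. \<bar>f x\<bar> \<partial>M)"
  have I0: "0 \<le> I" unfolding I_def by simp
  have z': "(\<integral>x. f x * cs k x \<partial>M) = 0" for k using z[of k] by (simp add: ft_def)
  have small: "\<bar>\<integral>x. f x * h x \<partial>M\<bar> \<le> e * I" if e: "e > 0" for e
  proof -
    have "continuous_on {-1..1} (\<lambda>y. h (arccos y * (L / pi)))"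
      using L_pos arccos_bounded
      by (intro continuous_on_compose2[OF h] continuous_intros) (auto simp: field_simps)
    then obtain p where p: "real_polynomial_function p"
      "\<And>y. y \<in> {-1..1} \<Longrightarrow> \<bar>h (arccos y * (L / pi)) - p y\<bar> < e"
      using Stone_Weierstrass_real_polynomial_function[of "{-1..1::real}" _ e] e by auto
    obtain a n where pn: "p = (\<lambda>x. \<Sum>i\<le>n. a i * x ^ i)"
      using p(1) by (auto simp: real_polynomial_function_iff_sum)
    have cp: "continuous_on {0..L} (\<lambda>x. p (cs 1 x))" unfolding pn by (intro continuous_intros)
    have ip: "(\<integral>x. f x * p (cs 1 x) \<partial>M) = 0"
    proof -
      have ii: "integrable M (\<lambda>x. f x * (cs 1 x ^ i * cs 0 x))" for i
        by (intro integrable_mult_continuous[OF f] continuous_intros)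
      have "(\<integral>x. f x * p (cs 1 x) \<partial>M) = (\<integral>x. (\<Sum>i\<le>n. a i * (f x * (cs 1 x ^ i * cs 0 x))) \<partial>M)"
        unfolding pn by (simp add: sum_distrib_left mult_ac)
      also have "\<dots> = (\<Sum>i\<le>n. a i * (\<integral>x. f x * (cs 1 x ^ i * cs 0 x) \<partial>M))"
        using ii by (subst Bochner_Integration.integral_sum) auto
      also have "\<dots> = 0" by (simp only: integral_cs_power[OF f z'] mult_zero_right sum.neutral_const)
      finally show ?thesis .
    qed
    have "(\<integral>x. f x * h x \<partial>M) = (\<integral>x. f x * (h x - p (cs 1 x)) \<partial>M)"
      using ip integrable_mult_continuous[OF f h] integrable_mult_continuous[OF f cp]
      by (simp add: right_diff_distrib)
    also have "\<bar>\<dots>\<bar> \<le> (\<integral>x. \<bar>f x * (h x - p (cs 1 x))\<bar> \<partial>M)"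
      by (rule integral_abs_bound)
    also have "\<dots> \<le> (\<integral>x. \<bar>f x\<bar> * e \<partial>M)"
    proof (rule integral_mono)
      show "integrable M (\<lambda>x. \<bar>f x * (h x - p (cs 1 x))\<bar>)"
        by (intro integrable_abs integrable_mult_continuous[OF f] continuous_intros h cp)
      show "integrable M (\<lambda>x. \<bar>f x\<bar> * e)" using f by simp
      fix x assume "x \<in> space M"
      then have x: "0 < x" "x < L" by auto
      have "arccos (cs 1 x) = lam 1 * x"
      proof (rule arccos_cos)
        show "0 \<le> lam 1 * x" using x by simp
        have "lam 1 * x \<le> lam 1 * L" using x by (intro mult_left_mono) auto
        then show "lam 1 * x \<le> pi" by (simp add: lam_L)
      qed
      then have "arccos (cs 1 x) * (L / pi) = x" using L_pos by (simp add: lam_def)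
      then have "\<bar>h x - p (cs 1 x)\<bar> < e" using p(2)[of "cs 1 x"] by simp
      then show "\<bar>f x * (h x - p (cs 1 x))\<bar> \<le> \<bar>f x\<bar> * e"
        by (simp add: abs_mult mult_left_mono)
    qed
    finally show ?thesis by (simp add: I_def mult.commute)
  qed
  have "\<bar>\<integral>x. f x * h x \<partial>M\<bar> \<le> 0"
  proof (rule field_le_epsilon)
    fix e :: real assume e: "0 < e"
    have "\<bar>\<integral>x. f x * h x \<partial>M\<bar> \<le> e / (I + 1) * I" using small[of "e / (I + 1)"] e I0 by simp
    also have "\<dots> \<le> e" using e I0 by (simp add: field_simps)
    finally show "\<bar>\<integral>x. f x * h x \<partial>M\<bar> \<le> 0 + e" by simp
  qed
  then show ?thesis by simp
qed

text \<open>A measurable function is an almost everywhere limit of continuous ones; testing \<open>f\<close> with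
  the truncations of these to \<open>[-1,1]\<close> gives \<open>\<integral> f * clip f = 0\<close>.\<close>

theorem cosine_completeness:
  assumes f: "integrable M f" and z: "\<And>k. ft f k = 0"
  shows "AE x in M. f x = 0"
proof -
  define clip where "clip y = max (-1) (min 1 (y :: real))" for y
  have clip: "isCont clip y" "\<bar>clip y\<bar> \<le> 1" for y
    unfolding clip_def by (auto intro!: continuous_intros)
  have ccont: "continuous_on UNIV clip"
    using clip(1) by (simp add: continuous_at_imp_continuous_on)
  have "f measurable_on {0<..<L}"
    using f by (subst measurable_on_iff_borel_measurable) auto
  then obtain N g where N: "negligible N" and g: "\<And>n. continuous_on UNIV (g n)"
    and lim: "\<And>x. x \<notin> N \<Longrightarrow> (\<lambda>n. g n x) \<longlonglongrightarrow> (if x \<in> {0<..<L} then f x else 0)"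
    by (auto simp: measurable_on_def)
  have cg: "continuous_on {0..L} (\<lambda>x. clip (g n x))" for n
    by (rule continuous_on_compose2[OF ccont continuous_on_subset[OF g]]) auto
  have N0: "AE x in M. x \<notin> N"
  proof -
    have "AE x in lebesgue. x \<notin> N"
      using N by (simp add: negligible_iff_null_sets AE_not_in)
    then show ?thesis by (auto simp: AE_restrict_space_iff elim: eventually_mono)
  qed
  have "(\<lambda>n. \<integral>x. f x * clip (g n x) \<partial>M) \<longlonglongrightarrow> (\<integral>x. f x * clip (f x) \<partial>M)"
  proof (rule integral_dominated_convergence)
    show "(\<lambda>x. f x * clip (f x)) \<in> borel_measurable M"
      using f borel_measurable_continuous_onI[OF ccont]
      by (intro borel_measurable_times measurable_compose[of f M borel clip]) auto
    show "(\<lambda>x. f x * clip (g n x)) \<in> borel_measurable M" for n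
      by (intro borel_measurable_times borel_measurable_integrable[OF f] continuous_measurable_M cg)
    show "integrable M (\<lambda>x. \<bar>f x\<bar>)" using f by simp
    show "AE x in M. (\<lambda>n. f x * clip (g n x)) \<longlonglongrightarrow> f x * clip (f x)"
      using N0 AE_space
    proof eventually_elim
      case (elim x)
      then have "(\<lambda>n. g n x) \<longlonglongrightarrow> f x" using lim[of x] by simp
      then show ?case by (intro tendsto_intros isCont_tendsto_compose[OF clip(1)])
    qed
    show "AE x in M. norm (f x * clip (g n x)) \<le> \<bar>f x\<bar>" for n
      using clip(2) by (intro AE_I2) (simp add: abs_mult mult_left_le)
  qed
  then have 0: "(\<integral>x. f x * clip (f x) \<partial>M) = 0"
    using integral_eq_0_if_ft_eq_0[OF f z cg] by (simp add: LIMSEQ_const_iff)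
  have int: "integrable M (\<lambda>x. f x * clip (f x))"
  proof (rule Bochner_Integration.integrable_bound[OF f])
    show "(\<lambda>x. f x * clip (f x)) \<in> borel_measurable M"
      using f borel_measurable_continuous_onI[OF ccont]
      by (intro borel_measurable_times measurable_compose[of f M borel clip]) auto
    show "AE x in M. norm (f x * clip (f x)) \<le> norm (f x)"
      using clip(2) by (intro AE_I2) (simp add: abs_mult mult_left_le)
  qed
  have "AE x in M. 0 \<le> f x * clip (f x)"
    by (intro AE_I2) (auto simp: clip_def max_def min_def zero_le_mult_iff)
  then have "AE x in M. f x * clip (f x) = 0"
    using 0 integral_nonneg_eq_0_iff_AE[OF int] by blast
  then show ?thesis by eventually_elim (auto simp: clip_def max_def min_def split: if_splits)
qed

corollary ft_eq_imp_AE_eq: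
  assumes "integrable M f" "integrable M g" "\<And>k. ft f k = ft g k"
  shows "AE x in M. f x = g x"
proof -
  have "AE x in M. f x - g x = 0"
  proof (rule cosine_completeness)
    fix k
    have "integrable M (\<lambda>x. f x * cs k x)" "integrable M (\<lambda>x. g x * cs k x)"
      using assms by (auto intro!: integrable_mult_continuous)
    then show "ft (\<lambda>x. f x - g x) k = 0"
      using assms(3)[of k] by (simp add: ft_def left_diff_distrib diff_divide_distrib)
  qed (use assms in auto)
  then show ?thesis by eventually_elim simp
qed

section \<open>Absolutely convergent cosine and sine series\<close>

definition cser :: "(nat \<Rightarrow> real) \<Rightarrow> real \<Rightarrow> real" where "cser a x = (\<Sum>k. a k * cs k x)"
definition sser :: "(nat \<Rightarrow> real) \<Rightarrow> real \<Rightarrow> real" where "sser a x = (\<Sum>k. a k * sn k x)"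

lemma abs_trig_le: "\<bar>c * cs k x\<bar> \<le> \<bar>c\<bar>" "\<bar>c * sn k x\<bar> \<le> \<bar>c\<bar>"
  by (simp_all add: abs_mult mult_left_le)

lemma summable_trig:
  assumes "summable (\<lambda>k. \<bar>a k\<bar>)"
  shows "summable (\<lambda>k. a k * cs k x)" "summable (\<lambda>k. a k * sn k x)"
proof -
  show "summable (\<lambda>k. a k * cs k x)"
    by (rule summable_comparison_test'[OF assms, of 0]) (use abs_trig_le in simp)
  show "summable (\<lambda>k. a k * sn k x)"
    by (rule summable_comparison_test'[OF assms, of 0]) (use abs_trig_le in simp)
qed

lemma trig_series_abs_le:
  assumes "summable (\<lambda>k. \<bar>a k\<bar>)"
  shows "\<bar>cser a x\<bar> \<le> (\<Sum>k. \<bar>a k\<bar>)" "\<bar>sser a x\<bar> \<le> (\<Sum>k. \<bar>a k\<bar>)"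
proof -
  have s: "summable (\<lambda>k. \<bar>a k * cs k x\<bar>)" "summable (\<lambda>k. \<bar>a k * sn k x\<bar>)"
    by (rule summable_comparison_test'[OF assms, of 0], use abs_trig_le in simp)+
  show "\<bar>cser a x\<bar> \<le> (\<Sum>k. \<bar>a k\<bar>)"
    unfolding cser_def
    by (rule order_trans[OF summable_rabs[OF s(1)] suminf_le[OF abs_trig_le(1) s(1) assms]])
  show "\<bar>sser a x\<bar> \<le> (\<Sum>k. \<bar>a k\<bar>)"
    unfolding sser_def
    by (rule order_trans[OF summable_rabs[OF s(2)] suminf_le[OF abs_trig_le(2) s(2) assms]])
qed

lemma continuous_trig_series:
  assumes "summable (\<lambda>k. \<bar>a k\<bar>)"
  shows "continuous_on S (cser a)" "continuous_on S (sser a)"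
proof -
  have u: "uniform_limit S (\<lambda>n x. \<Sum>k<n. a k * cs k x) (cser a) sequentially"
    "uniform_limit S (\<lambda>n x. \<Sum>k<n. a k * sn k x) (sser a) sequentially"
    unfolding cser_def[abs_def] sser_def[abs_def]
    using abs_trig_le by (intro Weierstrass_m_test[OF _ assms]; simp)+
  have c: "continuous_on S (\<lambda>x. \<Sum>k<n. a k * cs k x)" "continuous_on S (\<lambda>x. \<Sum>k<n. a k * sn k x)" for n
    by (intro continuous_intros)+
  show "continuous_on S (cser a)"
    by (rule uniform_limit_theorem[OF always_eventually u(1)]) (simp_all add: c)
  show "continuous_on S (sser a)"
    by (rule uniform_limit_theorem[OF always_eventually u(2)]) (simp_all add: c)
qed

text \<open>The absolute integrals are dominated by \<open>\<integral> |g|\<close> times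
  \<open>|a k|\<close>, which licenses termwise integration; a general family \<open>\<phi>\<close>
  serves cosines and sines at once.\<close>

lemma integral_mult_series:
  fixes \<phi> :: "nat \<Rightarrow> real \<Rightarrow> real"
  assumes g: "integrable M g" and \<phi>: "\<And>k. continuous_on {0..L} (\<phi> k)" "\<And>k x. \<bar>\<phi> k x\<bar> \<le> 1"
    and a: "summable (\<lambda>k. \<bar>a k\<bar>)"
  shows "(\<lambda>k. a k * (\<integral>x. g x * \<phi> k x \<partial>M)) sums (\<integral>x. g x * (\<Sum>k. a k * \<phi> k x) \<partial>M)"
proof -
  have i: "integrable M (\<lambda>x. a k * (g x * \<phi> k x))" for k
    using integrable_mult_continuous[OF g \<phi>(1)] by simp
  have b: "\<bar>a k * (g x * \<phi> k x)\<bar> \<le> \<bar>g x\<bar> * \<bar>a k\<bar>" for k x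
  proof -
    have "\<bar>a k * (g x * \<phi> k x)\<bar> = \<bar>g x\<bar> * \<bar>a k\<bar> * \<bar>\<phi> k x\<bar>" by (simp add: abs_mult)
    also have "\<dots> \<le> \<bar>g x\<bar> * \<bar>a k\<bar> * 1" by (intro mult_left_mono \<phi>(2)) auto
    finally show ?thesis by simp
  qed
  have s: "summable (\<lambda>k. \<bar>a k * (g x * \<phi> k x)\<bar>)" for x
    by (rule summable_comparison_test'[OF summable_mult[OF a, of "\<bar>g x\<bar>"], of 0]) (use b in simp)
  have "(\<lambda>k. \<integral>x. a k * (g x * \<phi> k x) \<partial>M) sums (\<integral>x. (\<Sum>k. a k * (g x * \<phi> k x)) \<partial>M)"
  proof (rule sums_integral[OF i])
    show "AE x in M. summable (\<lambda>k. norm (a k * (g x * \<phi> k x)))" using s by simp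
    show "summable (\<lambda>k. \<integral>x. norm (a k * (g x * \<phi> k x)) \<partial>M)"
    proof (rule summable_comparison_test')
      show "summable (\<lambda>k. (\<integral>x. \<bar>g x\<bar> \<partial>M) * \<bar>a k\<bar>)" using a by (rule summable_mult)
      fix k
      have "(\<integral>x. \<bar>a k * (g x * \<phi> k x)\<bar> \<partial>M) \<le> (\<integral>x. \<bar>g x\<bar> * \<bar>a k\<bar> \<partial>M)"
        using b g i by (intro integral_mono) auto
      then show "norm (\<integral>x. norm (a k * (g x * \<phi> k x)) \<partial>M) \<le> (\<integral>x. \<bar>g x\<bar> \<partial>M) * \<bar>a k\<bar>"
        by simp
    qed
  qed
  moreover have "(\<Sum>k. a k * (g x * \<phi> k x)) = g x * (\<Sum>k. a k * \<phi> k x)" for x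
  proof -
    have "\<bar>a k * \<phi> k x\<bar> \<le> \<bar>a k\<bar>" for k
      using \<phi>(2)[of k x] by (simp add: abs_mult mult_left_le)
    then have "summable (\<lambda>k. a k * \<phi> k x)"
      by (intro summable_comparison_test'[OF a, of 0]) simp
    then show ?thesis by (simp add: suminf_mult[symmetric] mult_ac)
  qed
  ultimately show ?thesis by simp
qed

lemma integral_mult_cser:
  assumes "integrable M g" "summable (\<lambda>k. \<bar>a k\<bar>)"
  shows "(\<lambda>k. a k * (\<integral>x. g x * cs k x \<partial>M)) sums (\<integral>x. g x * cser a x \<partial>M)"
  unfolding cser_def by (rule integral_mult_series[of g cs, OF assms(1) _ _ assms(2)]) simp_all

lemma integral_mult_sser:
  assumes "integrable M g" "summable (\<lambda>k. \<bar>a k\<bar>)"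
  shows "(\<lambda>k. a k * (\<integral>x. g x * sn k x \<partial>M)) sums (\<integral>x. g x * sser a x \<partial>M)"
  unfolding sser_def by (rule integral_mult_series[of g sn, OF assms(1) _ _ assms(2)]) simp_all

lemma ft_cser:
  assumes "summable (\<lambda>k. \<bar>a k\<bar>)"
  shows "ft (cser a) k = a k"
proof -
  have "(\<lambda>j. a j * (\<integral>x. cs k x * cs j x \<partial>M)) sums (\<integral>x. cs k x * cser a x \<partial>M)"
    by (rule integral_mult_cser[OF _ assms]) simp
  moreover have "(\<lambda>j. a j * (\<integral>x. cs k x * cs j x \<partial>M)) = (\<lambda>j. if j = k then a k * nrm k else 0)"
    by (auto simp: orthogonal_cs fun_eq_iff)
  moreover have "(\<lambda>j. if j = k then a k * nrm k else 0) sums (a k * nrm k)"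
    by (rule sums_single)
  ultimately have "(\<integral>x. cs k x * cser a x \<partial>M) = a k * nrm k"
    using sums_unique2 by metis
  then show ?thesis by (simp add: ft_def mult.commute)
qed

text \<open>Orthogonality makes the coefficients of the series equal to those of \<open>f\<close>,
  and completeness then identifies the two functions.\<close>

lemma AE_eq_cser_ft:
  assumes "integrable M f" "summable (\<lambda>k. \<bar>ft f k\<bar>)"
  shows "AE x in M. f x = cser (ft f) x"
  by (rule ft_eq_imp_AE_eq[OF assms(1) continuous_integrable_M[OF continuous_trig_series(1)[OF assms(2)]]])
     (simp only: ft_cser[OF assms(2)])

section \<open>Trading a power of the frequency for summability\<close>

lemma summable_inverse_lam2: "summable (\<lambda>k. 1 / (lam k)\<^sup>2)"
proof -
  have "summable (\<lambda>k. (L / pi)\<^sup>2 * inverse (real k ^ 2))"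
    by (rule summable_mult[OF inverse_power_summable]) simp
  moreover have "(L / pi)\<^sup>2 * inverse (real k ^ 2) = 1 / (lam k)\<^sup>2" for k
    using L_pos by (cases "k = 0") (simp_all add: lam_def field_simps power2_eq_square)
  ultimately show ?thesis by simp
qed

text \<open>\<open>lam 0 = 0\<close> and division by zero yields 0, so the sum in effect ranges over
  \<open>k > 0\<close>. The constant enters the Gevrey time and the uniqueness estimate.\<close>

definition S0 :: real where "S0 = (\<Sum>k. 1 / (lam k)\<^sup>2)"

lemma S0_nonneg: "0 \<le> S0"
  unfolding S0_def by (rule suminf_nonneg[OF summable_inverse_lam2]) simp

lemma sum_inverse_lam2_le: "finite A \<Longrightarrow> (\<Sum>k\<in>A. 1 / (lam k)\<^sup>2) \<le> S0"
  unfolding S0_def by (rule sum_le_suminf[OF summable_inverse_lam2]) auto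

text \<open>Young's inequality for the factorisation of \<open>lam k ^ m * |a|\<close> into
  \<open>lam k ^ (m + 1) * |a|\<close> and \<open>1 / lam k\<close>: one extra derivative in the
  square sum pays for absolute summability.\<close>

lemma lam_power_abs_le:
  assumes "k \<noteq> 0"
  shows "lam k ^ m * \<bar>a\<bar> \<le> (lam k ^ (2 * m + 2) * a\<^sup>2 + 1 / (lam k)\<^sup>2) / 2"
proof -
  have "2 * (lam k ^ (m + 1) * \<bar>a\<bar>) * (1 / lam k) \<le> (lam k ^ (m + 1) * \<bar>a\<bar>)\<^sup>2 + (1 / lam k)\<^sup>2"
    by (rule sum_squares_bound)
  moreover have "(lam k ^ (m + 1) * \<bar>a\<bar>)\<^sup>2 = lam k ^ (2 * m + 2) * a\<^sup>2"
    by (simp only: power_mult_distrib power2_abs power_mult[symmetric]) (simp add: mult.commute)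
  ultimately show ?thesis using assms by (simp add: power_divide)
qed

lemma summable_lam_power:
  assumes "summable (\<lambda>k. lam k ^ (2 * m + 2) * (a k)\<^sup>2)"
  shows "summable (\<lambda>k. lam k ^ m * \<bar>a k\<bar>)"
proof (rule summable_comparison_test')
  show "summable (\<lambda>k. (lam k ^ (2 * m + 2) * (a k)\<^sup>2 + 1 / (lam k)\<^sup>2) / 2)"
    by (intro summable_divide summable_add assms summable_inverse_lam2)
  \<comment> \<open>The comparison starts at 1: the majorant vanishes at \<open>k = 0\<close>, but
    for \<open>m = 0\<close> the term there is \<open>|a 0|\<close>.\<close>
  fix k :: nat assume "k \<ge> 1"
  then show "norm (lam k ^ m * \<bar>a k\<bar>) \<le> (lam k ^ (2 * m + 2) * (a k)\<^sup>2 + 1 / (lam k)\<^sup>2) / 2"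
    using lam_power_abs_le[of k m "a k"] by simp
qed

text \<open>Cauchy-Schwarz with the same factorisation. \<open>m \<noteq> 0\<close> removes the term
  of index 0, which the weighted square sum cannot see.\<close>

lemma suminf_lam_power_le:
  assumes "summable (\<lambda>k. lam k ^ (2 * m + 2) * (a k)\<^sup>2)" "m \<noteq> 0"
  shows "(\<Sum>k. lam k ^ m * \<bar>a k\<bar>)\<^sup>2 \<le> S0 * (\<Sum>k. lam k ^ (2 * m + 2) * (a k)\<^sup>2)"
proof (rule LIMSEQ_le_const2)
  show "(\<lambda>n. (\<Sum>k<n. lam k ^ m * \<bar>a k\<bar>)\<^sup>2) \<longlonglongrightarrow> (\<Sum>k. lam k ^ m * \<bar>a k\<bar>)\<^sup>2"
    by (intro tendsto_intros summable_LIMSEQ summable_lam_power assms)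
  have "(\<Sum>k<n. lam k ^ m * \<bar>a k\<bar>)\<^sup>2 \<le> S0 * (\<Sum>k. lam k ^ (2 * m + 2) * (a k)\<^sup>2)" for n
  proof -
    have e: "lam k ^ m * \<bar>a k\<bar> = (1 / lam k) * (lam k ^ (m + 1) * \<bar>a k\<bar>)" for k
      using assms(2) by (cases "k = 0") auto
    have "(\<Sum>k<n. lam k ^ m * \<bar>a k\<bar>)\<^sup>2 \<le> (\<Sum>k<n. (1 / lam k)\<^sup>2) * (\<Sum>k<n. (lam k ^ (m + 1) * \<bar>a k\<bar>)\<^sup>2)"
      unfolding e by (rule Cauchy_Schwarz_ineq_sum)
    also have "\<dots> = (\<Sum>k<n. 1 / (lam k)\<^sup>2) * (\<Sum>k<n. lam k ^ (2 * m + 2) * (a k)\<^sup>2)"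
      by (simp only: power_mult_distrib power2_abs power_mult[symmetric] power_divide power_one) (simp add: mult.commute)
    also have "\<dots> \<le> S0 * (\<Sum>k. lam k ^ (2 * m + 2) * (a k)\<^sup>2)"
      by (intro mult_mono sum_inverse_lam2_le sum_le_suminf assms S0_nonneg sum_nonneg) auto
    finally show ?thesis .
  qed
  then show "\<exists>N. \<forall>n\<ge>N. (\<Sum>k<n. lam k ^ m * \<bar>a k\<bar>)\<^sup>2 \<le> S0 * (\<Sum>k. lam k ^ (2 * m + 2) * (a k)\<^sup>2)"
    by blast
qed

text \<open>Nonzero frequencies are at least \<open>lam 1\<close>, so lowering the power costs only
  the constant factor \<open>1 / lam 1 ^ (m - j)\<close>.\<close>

lemma summable_lam_mono:
  assumes "summable (\<lambda>k. lam k ^ m * \<bar>a k\<bar>)" "j \<le> m"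
  shows "summable (\<lambda>k. lam k ^ j * \<bar>a k\<bar>)"
proof (rule summable_comparison_test')
  show "summable (\<lambda>k. inverse (lam 1 ^ (m - j)) * (lam k ^ m * \<bar>a k\<bar>))"
    by (intro summable_mult assms)
  fix k :: nat assume "k \<ge> 1"
  then have "lam 1 ^ (m - j) \<le> lam k ^ (m - j)" by (intro power_mono lam_mono) auto
  then have "1 \<le> inverse (lam 1 ^ (m - j)) * lam k ^ (m - j)"
    using lam_pos[of 1] by (simp add: field_simps)
  then have "lam k ^ j * \<bar>a k\<bar> * 1 \<le> lam k ^ j * \<bar>a k\<bar> * (inverse (lam 1 ^ (m - j)) * lam k ^ (m - j))"
    by (rule mult_left_mono) simp
  also have "\<dots> = inverse (lam 1 ^ (m - j)) * ((lam k ^ j * lam k ^ (m - j)) * \<bar>a k\<bar>)"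
    by (simp only: mult_ac)
  also have "lam k ^ j * lam k ^ (m - j) = lam k ^ m"
    using assms(2) by (simp flip: power_add)
  finally show "norm (lam k ^ j * \<bar>a k\<bar>) \<le> inverse (lam 1 ^ (m - j)) * (lam k ^ m * \<bar>a k\<bar>)"
    by simp
qed

text \<open>The Weierstrass test, applied to the differentiated series, justifies differentiating
  termwise.\<close>

lemma has_derivative_trig_series:
  assumes s: "summable (\<lambda>k. lam k * \<bar>a k\<bar>)"
  shows "(cser a has_real_derivative - sser (\<lambda>k. lam k * a k) x) (at x)"
    "(sser a has_real_derivative cser (\<lambda>k. lam k * a k) x) (at x)"
proof -
  have s0: "summable (\<lambda>k. \<bar>a k\<bar>)" using summable_lam_mono[of 1 a 0] s by simp
  have s1: "summable (\<lambda>k. \<bar>lam k * a k\<bar>)" using s by (simp add: abs_mult)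
  have u1: "uniformly_convergent_on UNIV (\<lambda>n x. \<Sum>i<n. - (lam i * a i) * sn i x)"
    by (rule Weierstrass_m_test'[OF _ s1]) (use abs_trig_le(2)[of "- (lam _ * a _)"] in simp)
  have u2: "uniformly_convergent_on UNIV (\<lambda>n x. \<Sum>i<n. lam i * a i * cs i x)"
    by (rule Weierstrass_m_test'[OF _ s1]) (use abs_trig_le(1) in simp)
  have d1: "((\<lambda>x. a k * cs k x) has_real_derivative - (lam k * a k) * sn k x) (at x within UNIV)"
    "((\<lambda>x. a k * sn k x) has_real_derivative lam k * a k * cs k x) (at x within UNIV)" for k x
    by (auto intro!: derivative_eq_intros)
  have "((\<lambda>x. \<Sum>k. a k * cs k x) has_real_derivative (\<Sum>k. - (lam k * a k) * sn k x)) (at x)"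
    by (rule has_field_derivative_series'(2)[OF convex_UNIV d1(1) u1 UNIV_I summable_trig(1)[OF s0]]) simp
  moreover have "(\<Sum>k. - (lam k * a k) * sn k x) = - sser (\<lambda>k. lam k * a k) x"
    unfolding sser_def using suminf_minus[OF summable_trig(2)[OF s1]] by simp
  ultimately show "(cser a has_real_derivative - sser (\<lambda>k. lam k * a k) x) (at x)"
    unfolding cser_def[abs_def] by simp
  show "(sser a has_real_derivative cser (\<lambda>k. lam k * a k) x) (at x)"
    unfolding sser_def[abs_def] cser_def
    by (rule has_field_derivative_series'(2)[OF convex_UNIV d1(2) u2 UNIV_I summable_trig(2)[OF s0]]) simp
qed

section \<open>Exponential decay of coefficients and analyticity\<close>

lemma summable_exp_lam:
  assumes "0 < \<delta>"
  shows "summable (\<lambda>k. exp (- \<delta> * lam k))"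
proof -
  have "exp (- \<delta> * lam k) = exp (- \<delta> * (pi / L)) ^ k" for k
    by (simp add: lam_def exp_of_nat_mult[symmetric] mult_ac)
  then show ?thesis using assms L_pos by (simp add: summable_geometric)
qed

text \<open>Half of the exponential absorbs the power, by \<open>power_le_fact_exp\<close> at
  \<open>\<delta> / 2 * lam k\<close>; the other half still gives a geometric series.\<close>

lemma summable_exp_decay:
  assumes \<delta>: "0 < \<delta>" and a: "\<And>k. \<bar>a k\<bar> \<le> C * exp (- \<delta> * lam k)"
  shows "summable (\<lambda>k. lam k ^ m * \<bar>a k\<bar>)"
proof (rule summable_comparison_test')
  show "summable (\<lambda>k. (fact m / (\<delta> / 2) ^ m * C) * exp (- (\<delta> / 2) * lam k))"
    using \<delta> by (intro summable_mult[OF summable_exp_lam]) simp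
  fix k :: nat
  have e1: "(\<delta> / 2 * lam k) ^ m \<le> fact m * exp (\<delta> / 2 * lam k)"
    using \<delta> by (intro power_le_fact_exp) simp
  have "lam k ^ m = (\<delta> / 2 * lam k) ^ m / (\<delta> / 2) ^ m"
    using \<delta> by (simp only: power_mult_distrib) simp
  also have "\<dots> \<le> fact m * exp (\<delta> / 2 * lam k) / (\<delta> / 2) ^ m"
    using \<delta> by (intro divide_right_mono e1) auto
  finally have "lam k ^ m \<le> fact m / (\<delta> / 2) ^ m * exp (\<delta> / 2 * lam k)" by simp
  then have "lam k ^ m * \<bar>a k\<bar> \<le> (fact m / (\<delta> / 2) ^ m * exp (\<delta> / 2 * lam k)) * (C * exp (- \<delta> * lam k))"
    using \<delta> by (intro mult_mono a) auto
  also have "\<dots> = (fact m / (\<delta> / 2) ^ m * C) * (exp (\<delta> / 2 * lam k) * exp (- \<delta> * lam k))"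
    by (simp only: mult_ac)
  also have "exp (\<delta> / 2 * lam k) * exp (- \<delta> * lam k) = exp (- (\<delta> / 2) * lam k)"
    by (simp only: exp_add[symmetric]) (simp add: field_simps)
  finally show "norm (lam k ^ m * \<bar>a k\<bar>) \<le> (fact m / (\<delta> / 2) ^ m * C) * exp (- (\<delta> / 2) * lam k)"
    by simp
qed

text \<open>Since \<open>|cos z| \<le> exp |Im z|\<close>, the series converges uniformly on the
  strip \<open>|Im z| < \<delta> / 2\<close>, half of the decay rate being spent on the growth of
  the cosines. Its sum is holomorphic there and extends \<open>cser a\<close> from the real
  axis.\<close>

lemma real_analytic_cser:
  assumes \<delta>: "0 < \<delta>" and a: "\<And>k. \<bar>a k\<bar> \<le> C * exp (- \<delta> * lam k)"
  shows "real_analytic_on S (cser a)"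
proof -
  define F :: "complex \<Rightarrow> complex" where
    "F z = (\<Sum>k. of_real (a k) * cos (of_real (lam k) * z))" for z
  define U where "U = {z :: complex. \<bar>Im z\<bar> < \<delta> / 2}"
  have U: "open U" unfolding U_def
    by (intro open_Collect_less continuous_intros)
  have cosb: "norm (cos z) \<le> exp \<bar>Im z\<bar>" for z :: complex
  proof -
    have "norm (cos z) \<le> (norm (exp (\<i> * z)) + norm (exp (- (\<i> * z)))) / 2"
      using norm_triangle_ineq[of "exp (\<i> * z)" "exp (- (\<i> * z))"]
      unfolding cos_exp_eq by (simp add: norm_divide del: norm_exp_eq_Re)
    also have "\<dots> = (exp (- Im z) + exp (Im z)) / 2" by simp
    also have "\<dots> \<le> (exp \<bar>Im z\<bar> + exp \<bar>Im z\<bar>) / 2"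
      by (intro divide_right_mono add_mono) auto
    also have "\<dots> = exp \<bar>Im z\<bar>" by simp
    finally show ?thesis .
  qed
  have C: "0 \<le> C" using order_trans[OF abs_ge_zero a[of 0]] by simp
  have bound: "norm (of_real (a k) * cos (of_real (lam k) * z)) \<le> C * exp (- (\<delta> / 2) * lam k)"
    if "z \<in> U" for k z
  proof -
    have "norm (of_real (a k) * cos (of_real (lam k) * z)) \<le> \<bar>a k\<bar> * exp \<bar>Im (of_real (lam k) * z)\<bar>"
      by (simp only: norm_mult norm_of_real) (intro mult_left_mono cosb abs_ge_zero)
    also have "\<dots> = \<bar>a k\<bar> * exp (lam k * \<bar>Im z\<bar>)" by (simp add: abs_mult)
    also have "\<dots> \<le> C * exp (- \<delta> * lam k) * exp (lam k * (\<delta> / 2))"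
    proof (rule mult_mono)
      have "lam k * \<bar>Im z\<bar> \<le> lam k * (\<delta> / 2)"
        using that unfolding U_def by (intro mult_left_mono) auto
      then show "exp (lam k * \<bar>Im z\<bar>) \<le> exp (lam k * (\<delta> / 2))" by simp
    qed (use a C in auto)
    also have "\<dots> = C * exp (- (\<delta> / 2) * lam k)"
      by (simp only: mult.assoc exp_add[symmetric]) (simp add: field_simps)
    finally show ?thesis .
  qed
  have sm: "summable (\<lambda>k. C * exp (- (\<delta> / 2) * lam k))"
    using \<delta> by (intro summable_mult[OF summable_exp_lam]) simp
  have ul: "uniform_limit U (\<lambda>n z. \<Sum>k<n. of_real (a k) * cos (of_real (lam k) * z)) F sequentially"
    unfolding F_def[abs_def]
    by (rule Weierstrass_m_test[OF bound sm])
  have hol: "F holomorphic_on U"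
  proof (rule holomorphic_uniform_sequence[OF U])
    show "(\<lambda>z. \<Sum>k<n. of_real (a k) * cos (of_real (lam k) * z)) holomorphic_on U" for n
      by (intro holomorphic_intros)
    fix z assume "z \<in> U"
    then obtain d where "d > 0" "cball z d \<subseteq> U" using U open_contains_cball by blast
    then show "\<exists>d>0. cball z d \<subseteq> U \<and> uniform_limit (cball z d)
        (\<lambda>n z. \<Sum>k<n. of_real (a k) * cos (of_real (lam k) * z)) F sequentially"
      using uniform_limit_on_subset[OF ul] by blast
  qed
  have Fr: "F (of_real x) = of_real (cser a x)" for x
  proof -
    have "of_real x \<in> U" using \<delta> by (simp add: U_def)
    then have "(\<lambda>k. of_real (a k) * cos (of_real (lam k) * of_real x)) sums F (of_real x)"
      unfolding F_def
      by (intro summable_sums summable_comparison_test'[OF sm] bound)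
    then have "(\<lambda>k. of_real (a k * cs k x) :: complex) sums F (of_real x)"
      by (simp add: cos_of_real[symmetric])
    moreover have "(\<lambda>k. of_real (a k * cs k x) :: complex) sums of_real (cser a x)"
      unfolding cser_def using summable_exp_decay[OF \<delta> a, of 0]
      by (intro sums_of_real summable_sums summable_trig) simp
    ultimately show ?thesis using sums_unique2 by blast
  qed
  show ?thesis
    unfolding real_analytic_on_def
  proof (intro ballI exI conjI allI impI)
    fix x0 x :: real assume x: "\<bar>x - x0\<bar> < \<delta> / 2"
    have "F holomorphic_on ball (of_real x0) (\<delta> / 2)"
    proof (rule holomorphic_on_subset[OF hol], rule subsetI)
      fix z assume "z \<in> ball (complex_of_real x0) (\<delta> / 2)"
      then have "norm (z - of_real x0) < \<delta> / 2" by (simp add: dist_norm norm_minus_commute)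
      then have "\<bar>Im (z - of_real x0)\<bar> < \<delta> / 2" using abs_Im_le_cmod le_less_trans by blast
      then show "z \<in> U" by (simp add: U_def)
    qed
    moreover have "of_real x \<in> ball (complex_of_real x0) (\<delta> / 2)"
    proof -
      have "norm (of_real x - of_real x0 :: complex) = \<bar>x - x0\<bar>"
        by (metis norm_of_real of_real_diff)
      then show ?thesis using x by (simp add: dist_norm norm_minus_commute)
    qed
    ultimately have "(\<lambda>n. (deriv ^^ n) F (of_real x0) / fact n * (of_real x - of_real x0) ^ n) sums F (of_real x)"
      by (rule holomorphic_power_series)
    \<comment> \<open>Real parts of the complex expansion at real points give a real power series
      directly.\<close>
    then have "(\<lambda>n. Re ((deriv ^^ n) F (of_real x0) / fact n * (of_real x - of_real x0) ^ n)) sums Re (F (of_real x))"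
      by (rule sums_Re)
    moreover have "Re (w * (of_real x - of_real x0) ^ n) = Re w * (x - x0) ^ n" for w n
    proof -
      have "w * (of_real x - of_real x0) ^ n = w * of_real ((x - x0) ^ n)" by simp
      then show ?thesis by (simp only: Re_complex_of_real times_complex.sel Im_complex_of_real mult_zero_right diff_zero)
    qed
    ultimately show "(\<lambda>n. Re ((deriv ^^ n) F (of_real x0) / fact n) * (x - x0) ^ n) sums cser a x"
      by (simp only: Fr Re_complex_of_real)
  qed (use \<delta> in simp)
qed

end

section \<open>Smooth functions and cutoffs\<close>

text \<open>Coinduction for smoothness: an application has to exhibit a family stable under
  \<open>deriv\<close>, never a formula for the n-th derivative.\<close>

lemma smooth_fun_coinduct:
  assumes "f \<in> S" "\<And>g x. g \<in> S \<Longrightarrow> g field_differentiable (at x)" "\<And>g. g \<in> S \<Longrightarrow> deriv g \<in> S"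
  shows "smooth_fun f"
proof -
  have "(deriv ^^ n) f \<in> S" for n
    by (induction n) (use assms in auto)
  then show ?thesis using assms(2) unfolding smooth_fun_def by blast
qed

lemma smooth_fun_deriv: "smooth_fun f \<Longrightarrow> smooth_fun (deriv f)"
proof -
  assume f: "smooth_fun f"
  have "(deriv ^^ n) (deriv f) = (deriv ^^ Suc n) f" for n
    by (simp add: funpow_swap1)
  then show ?thesis using f unfolding smooth_fun_def by metis
qed

lemma smooth_fun_differentiable: "smooth_fun f \<Longrightarrow> f field_differentiable (at x)"
  unfolding smooth_fun_def by (metis funpow_0)

lemma smooth_fun_has_derivative: "smooth_fun f \<Longrightarrow> (f has_real_derivative deriv f x) (at x)"
  using smooth_fun_differentiable DERIV_deriv_iff_field_differentiable by blast

lemma smooth_fun_continuous: "smooth_fun f \<Longrightarrow> continuous_on S f"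
  using smooth_fun_differentiable field_differentiable_imp_continuous_at
    continuous_at_imp_continuous_on by blast

text \<open>Products alone are not stable under differentiation; by the Leibniz rule finite sums of
  them are, which makes this the invariant family for \<open>smooth_fun_mult\<close>.\<close>

inductive product_sum :: "(real \<Rightarrow> real) \<Rightarrow> bool" where
  product_sum_mult: "smooth_fun f \<Longrightarrow> smooth_fun g \<Longrightarrow> product_sum (\<lambda>x. f x * g x)"
| product_sum_add: "product_sum p \<Longrightarrow> product_sum q \<Longrightarrow> product_sum (\<lambda>x. p x + q x)"

lemma product_sum_deriv:
  assumes "product_sum p"
  shows "(\<forall>x. p field_differentiable (at x)) \<and> product_sum (deriv p)"
  using assms
proof induction
  case (product_sum_mult f g)
  have "((\<lambda>x. f x * g x) has_real_derivative f x * deriv g x + deriv f x * g x) (at x)" for x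
    by (rule DERIV_mult'[OF smooth_fun_has_derivative smooth_fun_has_derivative]) fact+
  then have d: "(\<lambda>x. f x * g x) field_differentiable (at x)"
    "deriv (\<lambda>x. f x * g x) = (\<lambda>x. f x * deriv g x + deriv f x * g x)" for x
    by (auto simp: field_differentiable_def intro: DERIV_imp_deriv)
  show ?case unfolding d(2)
    using d(1) product_sum_mult by (auto intro!: product_sum.intros smooth_fun_deriv)
next
  case (product_sum_add p q)
  then have "((\<lambda>x. p x + q x) has_real_derivative deriv p x + deriv q x) (at x)" for x
    by (auto intro!: DERIV_add simp: DERIV_deriv_iff_field_differentiable)
  then have d: "(\<lambda>x. p x + q x) field_differentiable (at x)"
    "deriv (\<lambda>x. p x + q x) = (\<lambda>x. deriv p x + deriv q x)" for x
    by (auto simp: field_differentiable_def intro: DERIV_imp_deriv)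
  show ?case unfolding d(2)
    using d(1) product_sum_add by (auto intro!: product_sum.intros)
qed

lemma smooth_fun_mult:
  assumes "smooth_fun f" "smooth_fun g"
  shows "smooth_fun (\<lambda>x. f x * g x)"
  by (rule smooth_fun_coinduct[of _ "Collect product_sum"])
     (use assms product_sum_deriv in \<open>auto intro: product_sum_mult\<close>)

lemma smooth_fun_trig: "smooth_fun (\<lambda>x. a * cos (c * x) + b * sin (c * x))"
proof (rule smooth_fun_coinduct[of _ "{g. \<exists>a b. g = (\<lambda>x. a * cos (c * x) + b * sin (c * x))}"])
  have d: "((\<lambda>x. a * cos (c * x) + b * sin (c * x)) has_real_derivative
      (b * c) * cos (c * x) + (- (a * c)) * sin (c * x)) (at x)" for a b x
    by (auto intro!: derivative_eq_intros)
  fix g assume "g \<in> {g. \<exists>a b. g = (\<lambda>x. a * cos (c * x) + b * sin (c * x))}"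
  then obtain a b where g: "g = (\<lambda>x. a * cos (c * x) + b * sin (c * x))" by blast
  show "g field_differentiable (at x)" for x
    unfolding g field_differentiable_def using d by blast
  have "deriv g = (\<lambda>x. (b * c) * cos (c * x) + (- (a * c)) * sin (c * x))"
    unfolding g using d by (blast intro: DERIV_imp_deriv)
  then show "deriv g \<in> {g. \<exists>a b. g = (\<lambda>x. a * cos (c * x) + b * sin (c * x))}" by blast
qed blast

text \<open>The classical function \<open>exp (- 1 / Q)\<close> extended by 0 to
  \<open>Q \<le> 0\<close>. The numerator \<open>r\<close> and the pole order \<open>m\<close> are
  added so that, for fixed \<open>Q\<close>, differentiation stays inside the family.\<close>

definition flat :: "real poly \<Rightarrow> real poly \<Rightarrow> nat \<Rightarrow> real \<Rightarrow> real" where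
  "flat Q r m x = (if 0 < poly Q x then poly r x * (1 / poly Q x) ^ m * exp (- (1 / poly Q x)) else 0)"

lemma power_mult_exp_minus_le:
  assumes "0 \<le> (x :: real)"
  shows "x ^ m * exp (- x) \<le> fact m"
proof -
  have "x ^ m * exp (- x) \<le> (fact m * exp x) * exp (- x)"
    by (intro mult_right_mono power_le_fact_exp assms) simp
  also have "\<dots> = fact m" by (simp add: mult.assoc flip: exp_add)
  finally show ?thesis .
qed

text \<open>Where \<open>Q > 0\<close> this is the quotient rule over the common denominator
  \<open>Q ^ (m + 2)\<close>; where \<open>Q < 0\<close> the function is locally 0; at a zero of
  \<open>Q\<close> the exponential beats every pole.\<close>

lemma flat_has_derivative:
  "(flat Q r m has_real_derivative
     flat Q (pderiv r * Q * Q - smult (real m) (r * pderiv Q * Q) + r * pderiv Q) (m + 2) x) (at x)"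
proof -
  have cQ: "continuous_on UNIV (poly Q)" by (intro continuous_intros)
  consider "0 < poly Q x" | "poly Q x < 0" | "poly Q x = 0" by linarith
  then show ?thesis
  proof cases
    case 1
    let ?q = "poly Q x"
    have d: "((\<lambda>x. poly r x * (1 / poly Q x) ^ m * exp (- (1 / poly Q x))) has_real_derivative
      ((poly r x * (real m * (1 / ?q) ^ (m - 1) * (- (poly (pderiv Q) x) / (?q * ?q))) + poly (pderiv r) x * (1 / ?q) ^ m)
        * exp (- (1 / ?q)) + poly r x * (1 / ?q) ^ m * (exp (- (1 / ?q)) * (poly (pderiv Q) x / (?q * ?q))))) (at x)"
      using 1 by (auto intro!: derivative_eq_intros poly_DERIV) (simp add: algebra_simps)
    have e: "((poly r x * (real m * (1 / ?q) ^ (m - 1) * (- (poly (pderiv Q) x) / (?q * ?q))) + poly (pderiv r) x * (1 / ?q) ^ m)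
        * exp (- (1 / ?q)) + poly r x * (1 / ?q) ^ m * (exp (- (1 / ?q)) * (poly (pderiv Q) x / (?q * ?q))))
      = flat Q (pderiv r * Q * Q - smult (real m) (r * pderiv Q * Q) + r * pderiv Q) (m + 2) x"
    proof -
      obtain p where p: "p = 1 / ?q" by simp
      have q: "?q * p = 1" "1 / ?q = p" "\<And>y. y / (?q * ?q) = y * (p * p)" using 1 by (auto simp: p)
      \<comment> \<open>At \<open>m = 0\<close> the exponent \<open>m - 1\<close> truncates, but the
        factor \<open>real m\<close> makes both sides 0.\<close>
      have m: "real m * p ^ (m - 1) * (p * p) = real m * (p ^ m * p)" by (cases m) auto
      have "flat Q (pderiv r * Q * Q - smult (real m) (r * pderiv Q * Q) + r * pderiv Q) (m + 2) x =
        (poly (pderiv r) x * (?q * p) * (?q * p) - real m * (poly r x * poly (pderiv Q) x * (?q * p)) * p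
           + poly r x * poly (pderiv Q) x * (p * p)) * p ^ m * exp (- p)"
        using 1 unfolding flat_def q(2) by (simp add: algebra_simps power_add power2_eq_square)
      also have "\<dots> = (poly (pderiv r) x * p ^ m - poly r x * poly (pderiv Q) x * (real m * (p ^ m * p))
           + poly r x * poly (pderiv Q) x * (p * p) * p ^ m) * exp (- p)"
        unfolding q(1) by (simp add: algebra_simps)
      also have "\<dots> = ((poly r x * (real m * (1 / ?q) ^ (m - 1) * (- (poly (pderiv Q) x) / (?q * ?q))) + poly (pderiv r) x * (1 / ?q) ^ m)
        * exp (- (1 / ?q)) + poly r x * (1 / ?q) ^ m * (exp (- (1 / ?q)) * (poly (pderiv Q) x / (?q * ?q))))"
        unfolding m[symmetric] q(2,3) by (simp add: algebra_simps)
      finally show ?thesis by simp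
    qed
    have ev: "\<forall>\<^sub>F y in nhds x. poly r y * (1 / poly Q y) ^ m * exp (- (1 / poly Q y)) = flat Q r m y"
    proof -
      have "open {y. 0 < poly Q y}" using cQ by (intro open_Collect_less continuous_intros)
      then have "\<forall>\<^sub>F y in nhds x. y \<in> {y. 0 < poly Q y}" using 1 by (intro eventually_nhds_in_open) auto
      then show ?thesis by eventually_elim (simp add: flat_def)
    qed
    show ?thesis
      by (rule iffD1[OF DERIV_cong_ev[OF refl ev e] d])
  next
    case 2
    have "open {y. poly Q y < 0}" using cQ by (intro open_Collect_less continuous_intros)
    then have "\<forall>\<^sub>F y in nhds x. y \<in> {y. poly Q y < 0}" using 2 by (intro eventually_nhds_in_open) auto
    then have ev: "\<forall>\<^sub>F y in nhds x. 0 = flat Q r m y" by eventually_elim (simp add: flat_def)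
    have d: "((\<lambda>y. 0) has_real_derivative 0) (at x)" by simp
    show ?thesis
      by (rule iffD1[OF DERIV_cong_ev[OF refl ev] d]) (use 2 in \<open>simp add: flat_def\<close>)
  next
    case 3
    \<comment> \<open>Spending two more powers of \<open>1 / Q\<close> in
      \<open>power_mult_exp_minus_le\<close> bounds the function by a multiple of
      \<open>Q\<^sup>2\<close>, whose derivative vanishes at the zero of \<open>Q\<close>; the
      difference quotient therefore tends to 0.\<close>
    have b: "\<bar>flat Q r m y\<bar> \<le> \<bar>poly r y\<bar> * fact (m + 2) * (poly Q y)\<^sup>2" for y
    proof (cases "0 < poly Q y")
      case True
      have "(1 / poly Q y) ^ m * exp (- (1 / poly Q y)) = (1 / poly Q y) ^ (m + 2) * exp (- (1 / poly Q y)) * (poly Q y)\<^sup>2"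
        using True by (simp add: power_divide power_add power2_eq_square)
      also have "\<dots> \<le> fact (m + 2) * (poly Q y)\<^sup>2"
        using True by (intro mult_right_mono power_mult_exp_minus_le) auto
      finally have "\<bar>poly r y\<bar> * ((1 / poly Q y) ^ m * exp (- (1 / poly Q y))) \<le> \<bar>poly r y\<bar> * (fact (m + 2) * (poly Q y)\<^sup>2)"
        by (rule mult_left_mono) simp
      then show ?thesis using True by (simp add: flat_def abs_mult mult.assoc)
    qed (simp add: flat_def)
    have "((\<lambda>y. (poly Q y)\<^sup>2) has_real_derivative 2 * poly Q x * poly (pderiv Q) x) (at x)"
      by (auto intro!: derivative_eq_intros poly_DERIV)
    then have "((\<lambda>y. (poly Q y)\<^sup>2 / (y - x)) \<longlongrightarrow> 0) (at x)"
      using 3 by (simp add: has_field_derivative_iff)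
    then have "((\<lambda>y. \<bar>poly r y\<bar> * fact (m + 2) * \<bar>(poly Q y)\<^sup>2 / (y - x)\<bar>) \<longlongrightarrow> \<bar>poly r x\<bar> * fact (m + 2) * \<bar>0\<bar>) (at x)"
      by (intro tendsto_intros tendsto_poly)
    then have l: "((\<lambda>y. \<bar>poly r y\<bar> * fact (m + 2) * \<bar>(poly Q y)\<^sup>2 / (y - x)\<bar>) \<longlongrightarrow> 0) (at x)" by simp
    have "((\<lambda>y. flat Q r m y / (y - x)) \<longlongrightarrow> 0) (at x)"
    proof (rule Lim_null_comparison[OF always_eventually l], rule allI)
      fix y
      have "norm (flat Q r m y / (y - x)) = \<bar>flat Q r m y\<bar> * \<bar>1 / (y - x)\<bar>" by (simp add: abs_mult)
      also have "\<dots> \<le> \<bar>poly r y\<bar> * fact (m + 2) * (poly Q y)\<^sup>2 * \<bar>1 / (y - x)\<bar>"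
        by (rule mult_right_mono[OF b]) simp
      also have "\<dots> = \<bar>poly r y\<bar> * fact (m + 2) * \<bar>(poly Q y)\<^sup>2 / (y - x)\<bar>"
        by (simp add: abs_mult)
      finally show "norm (flat Q r m y / (y - x)) \<le> \<bar>poly r y\<bar> * fact (m + 2) * \<bar>(poly Q y)\<^sup>2 / (y - x)\<bar>" .
    qed
    then show ?thesis using 3 by (simp add: has_field_derivative_iff flat_def)
  qed
qed

lemma smooth_fun_flat: "smooth_fun (flat Q r m)"
proof (rule smooth_fun_coinduct[of _ "{g. \<exists>r m. g = flat Q r m}"])
  fix g assume "g \<in> {g. \<exists>r m. g = flat Q r m}"
  then obtain r m where g: "g = flat Q r m" by blast
  show "g field_differentiable (at x)" for x
    unfolding g field_differentiable_def using flat_has_derivative by blast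
  have "deriv g = flat Q (pderiv r * Q * Q - smult (real m) (r * pderiv Q * Q) + r * pderiv Q) (m + 2)"
    unfolding g using flat_has_derivative by (blast intro: DERIV_imp_deriv)
  then show "deriv g \<in> {g. \<exists>r m. g = flat Q r m}" by blast
qed blast

lemma test_fun_smooth: "test_fun L \<phi> \<Longrightarrow> smooth_fun \<phi>"
  by (simp add: test_fun_def)

lemma test_fun_deriv:
  assumes "test_fun L \<phi>"
  shows "test_fun L (deriv \<phi>)"
proof -
  obtain a b where ab: "0 < a" "b < L" "\<And>x. x \<notin> {a..b} \<Longrightarrow> \<phi> x = 0"
    using assms unfolding test_fun_def by blast
  have "deriv \<phi> x = 0" if "x \<notin> {a..b}" for x
  proof -
    have "open (- {a..b})" by (rule open_Compl[OF closed_atLeastAtMost])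
    then have "\<forall>\<^sub>F y in nhds x. y \<in> - {a..b}" using that by (intro eventually_nhds_in_open) auto
    then have ev: "\<forall>\<^sub>F y in nhds x. 0 = \<phi> y" by eventually_elim (use ab in auto)
    have d: "((\<lambda>y. 0 :: real) has_real_derivative 0) (at x)" by simp
    have "(\<phi> has_real_derivative 0) (at x)"
      by (rule iffD1[OF DERIV_cong_ev[OF refl ev refl] d])
    then show ?thesis by (rule DERIV_imp_deriv)
  qed
  then show ?thesis
    using smooth_fun_deriv[OF test_fun_smooth[OF assms]] ab(1,2) unfolding test_fun_def by metis
qed

lemma test_fun_mult:
  assumes "test_fun L \<phi>" "smooth_fun v"
  shows "test_fun L (\<lambda>x. \<phi> x * v x)"
  using assms smooth_fun_mult unfolding test_fun_def by fastforce

section \<open>Cutoffs exhausting the interval, and tests up to the boundary\<close>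

context interval begin

text \<open>The polynomial is \<open>(n + 1) x (L - x) - 1\<close>, positive only at a distance from
  both ends, and its positivity sets increase to \<open>(0, L)\<close>. Hence \<open>cut n\<close>
  has compact support in the open interval and tends to 1 there.\<close>

definition cut :: "nat \<Rightarrow> real \<Rightarrow> real" where
  "cut n = flat [: - 1, real (Suc n) * L, - real (Suc n) :] 1 0"

definition cut' :: "nat \<Rightarrow> real \<Rightarrow> real" where
  "cut' n = flat [: - 1, real (Suc n) * L, - real (Suc n) :] (pderiv [: - 1, real (Suc n) * L, - real (Suc n) :]) 2"

definition cq :: "nat \<Rightarrow> real \<Rightarrow> real" where "cq n x = real (Suc n) * (x * (L - x)) - 1"

lemma cut_eq: "cut n x = (if 0 < cq n x then exp (- (1 / cq n x)) else 0)"
proof -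
  have "poly [: - 1, real (Suc n) * L, - real (Suc n) :] x = cq n x"
    by (simp add: cq_def algebra_simps)
  then show ?thesis unfolding cut_def flat_def by simp
qed

lemma cut'_eq: "cut' n x = (if 0 < cq n x then real (Suc n) * (L - 2 * x) * (1 / cq n x)\<^sup>2 * exp (- (1 / cq n x)) else 0)"
proof -
  have "poly [: - 1, real (Suc n) * L, - real (Suc n) :] x = cq n x"
    by (simp add: cq_def algebra_simps)
  moreover have "poly (pderiv [: - 1, real (Suc n) * L, - real (Suc n) :]) x = real (Suc n) * (L - 2 * x)"
    by (simp add: pderiv_pCons algebra_simps)
  ultimately show ?thesis unfolding cut'_def flat_def by simp
qed

lemma cut_has_derivative: "(cut n has_real_derivative cut' n x) (at x)"
  unfolding cut_def cut'_def
  using flat_has_derivative[of "[: - 1, real (Suc n) * L, - real (Suc n) :]" 1 0 x]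
  by (simp add: numeral_2_eq_2)

lemma smooth_cut: "smooth_fun (cut n)"
  unfolding cut_def by (rule smooth_fun_flat)

lemma continuous_cut [continuous_intros]: "continuous_on S (cut n)" "continuous_on S (cut' n)"
  unfolding cut_def cut'_def by (rule smooth_fun_continuous[OF smooth_fun_flat])+

lemma cut_nonneg: "0 \<le> cut n x" and cut_le_1: "cut n x \<le> 1"
  by (auto simp: cut_eq)

lemma abs_cut_le: "\<bar>cut n x\<bar> \<le> 1"
  using cut_nonneg[of n x] cut_le_1[of n x] by (simp add: abs_of_nonneg)

lemma filterlim_cq:
  assumes "0 < x" "x < L"
  shows "filterlim (\<lambda>n. cq n x) at_top sequentially"
proof -
  have "filterlim (\<lambda>n. x * (L - x) * real n) at_top sequentially"
    using assms by (intro filterlim_tendsto_pos_mult_at_top[OF tendsto_const _ filterlim_real_sequentially]) simp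
  then have "filterlim (\<lambda>n. (x * (L - x) - 1) + x * (L - x) * real n) at_top sequentially"
    by (rule filterlim_tendsto_add_at_top[OF tendsto_const])
  then show ?thesis by (simp add: cq_def algebra_simps)
qed

lemma inverse_cq_tendsto_0:
  assumes "0 < x" "x < L"
  shows "(\<lambda>n. 1 / cq n x) \<longlonglongrightarrow> 0"
  by (rule tendsto_divide_0[OF tendsto_const filterlim_at_top_imp_at_infinity[OF filterlim_cq[OF assms]]])

lemma cq_eventually_pos:
  assumes "0 < x" "x < L"
  shows "\<forall>\<^sub>F n in sequentially. 0 < cq n x"
  using filterlim_cq[OF assms] by (simp add: filterlim_at_top_dense)

lemma cut_tendsto_1:
  assumes "0 < x" "x < L"
  shows "(\<lambda>n. cut n x) \<longlonglongrightarrow> 1"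
proof -
  have "(\<lambda>n. exp (- (1 / cq n x))) \<longlonglongrightarrow> exp (- 0)"
    by (intro tendsto_intros inverse_cq_tendsto_0 assms)
  moreover have "\<forall>\<^sub>F n in sequentially. exp (- (1 / cq n x)) = cut n x"
    using cq_eventually_pos[OF assms] by eventually_elim (simp add: cut_eq)
  ultimately show ?thesis using Lim_transform_eventually by fastforce
qed

text \<open>The derivative grows with \<open>n\<close>, but \<open>(n + 1) x (L - x)\<close> is
  exactly \<open>cq n x + 1\<close>, so the weight \<open>x (L - x)\<close> turns it into an
  expression in \<open>1 / cq n x\<close> alone that is bounded and tends to 0 with
  \<open>1 / cq n x\<close>.\<close>

lemma cut'_bound_aux:
  assumes "0 < x" "x < L" "0 < cq n x"
  shows "x * (L - x) * \<bar>cut' n x\<bar> \<le> L * ((1 / cq n x) ^ 1 * exp (- (1 / cq n x)) + (1 / cq n x) ^ 2 * exp (- (1 / cq n x)))"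
proof -
  let ?q = "cq n x"
  have q: "(?q + 1) * (1 / ?q)\<^sup>2 = (1 / ?q) ^ 1 + (1 / ?q) ^ 2"
    using assms(3) by (simp add: field_simps power2_eq_square)
  have "x * (L - x) * \<bar>cut' n x\<bar> = \<bar>L - 2 * x\<bar> * ((?q + 1) * (1 / ?q)\<^sup>2 * exp (- (1 / ?q)))"
    using assms by (simp add: cut'_eq abs_mult cq_def)
  also have "\<dots> \<le> L * ((?q + 1) * (1 / ?q)\<^sup>2 * exp (- (1 / ?q)))"
    using assms by (intro mult_right_mono) auto
  finally show ?thesis unfolding q by (simp add: distrib_right)
qed

lemma cut'_bound:
  assumes "0 < x" "x < L"
  shows "x * (L - x) * \<bar>cut' n x\<bar> \<le> 3 * L"
proof (cases "0 < cq n x")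
  case True
  \<comment> \<open>\<open>fact 1 + fact 2\<close> is the 3 of the claim.\<close>
  have "L * ((1 / cq n x) ^ 1 * exp (- (1 / cq n x)) + (1 / cq n x) ^ 2 * exp (- (1 / cq n x))) \<le> L * (fact 1 + fact 2)"
    using True L_pos by (intro mult_left_mono add_mono power_mult_exp_minus_le) auto
  then show ?thesis using cut'_bound_aux[OF assms True] by (simp add: mult.commute)
next
  case False
  then show ?thesis using L_pos by (simp add: cut'_eq)
qed

lemma cut'_tendsto_0:
  assumes "0 < x" "x < L"
  shows "(\<lambda>n. cut' n x) \<longlonglongrightarrow> 0"
proof -
  have c: "0 < x * (L - x)" using assms by simp
  have "(\<lambda>n. L * ((1 / cq n x) ^ 1 * exp (- (1 / cq n x)) + (1 / cq n x) ^ 2 * exp (- (1 / cq n x)))) \<longlonglongrightarrow>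
      L * (0 ^ 1 * exp (- 0) + 0 ^ 2 * exp (- 0))"
    by (intro tendsto_intros inverse_cq_tendsto_0 assms)
  then have l: "(\<lambda>n. L * ((1 / cq n x) ^ 1 * exp (- (1 / cq n x)) + (1 / cq n x) ^ 2 * exp (- (1 / cq n x)))) \<longlonglongrightarrow> 0"
    by simp
  have "(\<lambda>n. x * (L - x) * cut' n x) \<longlonglongrightarrow> 0"
  proof (rule Lim_null_comparison[OF _ l])
    show "\<forall>\<^sub>F n in sequentially. norm (x * (L - x) * cut' n x) \<le>
        L * ((1 / cq n x) ^ 1 * exp (- (1 / cq n x)) + (1 / cq n x) ^ 2 * exp (- (1 / cq n x)))"
      using cq_eventually_pos[OF assms]
    proof eventually_elim
      case (elim n)
      have "norm (x * (L - x) * cut' n x) = x * (L - x) * \<bar>cut' n x\<bar>"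
        using c by (simp only: real_norm_def abs_mult[of "x * (L - x)"] abs_of_pos)
      then show ?case using cut'_bound_aux[OF assms elim] by simp
    qed
  qed
  then have "(\<lambda>n. (1 / (x * (L - x))) * (x * (L - x) * cut' n x)) \<longlonglongrightarrow> (1 / (x * (L - x))) * 0"
    by (rule tendsto_mult_left)
  moreover have "(1 / (x * (L - x))) * (x * (L - x) * cut' n x) = cut' n x" for n
    using assms by simp
  ultimately show ?thesis by (simp only: mult_zero_right)
qed

lemma test_fun_cut:
  assumes "smooth_fun v"
  shows "test_fun L (\<lambda>x. cut n x * v x)"
proof (rule test_fun_mult[OF _ assms])
  \<comment> \<open>To the left of \<open>a\<close>, the product \<open>(n + 1) x (L - x)\<close> is
    at most \<open>(n + 1) a L = 1\<close>, so \<open>cq n\<close> is not positive; the reflection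
    of \<open>x\<close> to \<open>L - x\<close> handles the other end.\<close>
  define a where "a = 1 / (real (Suc n) * L)"
  have a: "0 < a" "real (Suc n) * (a * L) = 1" using L_pos by (auto simp: a_def)
  have e: "real (Suc n) * (y * (L - y)) \<le> 1" if "y < a" for y
  proof (cases "0 \<le> y")
    case True
    have "y * (L - y) \<le> y * L" using True by (intro mult_left_mono) auto
    also have "\<dots> \<le> a * L" using that L_pos by (intro mult_right_mono) auto
    finally have "y * (L - y) \<le> a * L" .
    then have "real (Suc n) * (y * (L - y)) \<le> real (Suc n) * (a * L)" by (rule mult_left_mono) simp
    then show ?thesis unfolding a(2) .
  next
    case False
    then have "y * (L - y) \<le> 0" using L_pos by (intro mult_nonpos_nonneg) auto
    then have "real (Suc n) * (y * (L - y)) \<le> 0" by (rule mult_nonneg_nonpos[rotated]) simp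
    then show ?thesis by linarith
  qed
  have "cut n x = 0" if out: "x \<notin> {a..L - a}" for x
  proof -
    consider "x < a" | "L - x < a" using out by force
    then have "real (Suc n) * (x * (L - x)) \<le> 1"
      using e[of x] e[of "L - x"] by cases (auto simp: mult.commute)
    then show ?thesis by (simp add: cut_eq cq_def)
  qed
  then show "test_fun L (cut n)"
    unfolding test_fun_def using smooth_cut a(1) by (intro conjI exI[of _ a] exI[of _ "L - a"]) auto
qed

lemma cut_integral_tendsto:
  assumes "integrable M h"
  shows "(\<lambda>n. \<integral>x. h x * cut n x \<partial>M) \<longlonglongrightarrow> (\<integral>x. h x \<partial>M)"
proof (rule integral_dominated_convergence)
  show "h \<in> borel_measurable M" using assms by simp
  show "(\<lambda>x. h x * cut n x) \<in> borel_measurable M" for n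
    using integrable_mult_continuous[OF assms continuous_cut(1)] by simp
  show "integrable M (\<lambda>x. \<bar>h x\<bar>)" using assms by simp
  show "AE x in M. (\<lambda>n. h x * cut n x) \<longlonglongrightarrow> h x"
  proof (rule AE_I2)
    fix x assume "x \<in> space M"
    then have "(\<lambda>n. h x * cut n x) \<longlonglongrightarrow> h x * 1" by (intro tendsto_mult tendsto_const cut_tendsto_1) auto
    then show "(\<lambda>n. h x * cut n x) \<longlonglongrightarrow> h x" by simp
  qed
  show "AE x in M. norm (h x * cut n x) \<le> \<bar>h x\<bar>" for n
    by (intro AE_I2) (simp add: abs_mult mult_left_le abs_cut_le)
qed

text \<open>A factor \<open>v\<close> vanishing linearly at both ends makes
  \<open>cut' n * v\<close> bounded uniformly in \<open>n\<close>, by \<open>cut'_bound\<close>;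
  dominated convergence applies because \<open>cut' n\<close> tends to 0 pointwise.\<close>

lemma cut'_integral_tendsto_0:
  assumes h: "integrable M h" and v: "continuous_on {0..L} v"
    and b: "\<And>x. 0 < x \<Longrightarrow> x < L \<Longrightarrow> \<bar>v x\<bar> \<le> C * (x * (L - x))"
  shows "(\<lambda>n. \<integral>x. h x * (cut' n x * v x) \<partial>M) \<longlonglongrightarrow> 0"
proof -
  have C: "0 \<le> C"
  proof (rule ccontr)
    assume "\<not> 0 \<le> C"
    then have "C * (L / 2 * (L - L / 2)) < 0" using L_pos by (intro mult_neg_pos) auto
    moreover have "0 \<le> C * (L / 2 * (L - L / 2))"
      using order_trans[OF abs_ge_zero b[of "L / 2"]] L_pos by simp
    ultimately show False by linarith
  qed
  have bb: "\<bar>cut' n x * v x\<bar> \<le> C * (3 * L)" if "0 < x" "x < L" for n x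
  proof -
    have "\<bar>cut' n x * v x\<bar> \<le> \<bar>cut' n x\<bar> * (C * (x * (L - x)))"
      unfolding abs_mult by (rule mult_left_mono[OF b[OF that]]) simp
    also have "\<dots> = C * (x * (L - x) * \<bar>cut' n x\<bar>)" by (simp add: mult_ac)
    also have "\<dots> \<le> C * (3 * L)" by (intro mult_left_mono cut'_bound that C)
    finally show ?thesis .
  qed
  have "(\<lambda>n. \<integral>x. h x * (cut' n x * v x) \<partial>M) \<longlonglongrightarrow> (\<integral>x. 0 \<partial>M)"
  proof (rule integral_dominated_convergence)
    show "(\<lambda>x. h x * (cut' n x * v x)) \<in> borel_measurable M" for n
      by (intro borel_measurable_integrable integrable_mult_continuous h continuous_intros v)
    show "integrable M (\<lambda>x. \<bar>h x\<bar> * (C * (3 * L)))" using h by simp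
    show "AE x in M. (\<lambda>n. h x * (cut' n x * v x)) \<longlonglongrightarrow> 0"
    proof (rule AE_I2)
      fix x assume "x \<in> space M"
      then have "(\<lambda>n. h x * (cut' n x * v x)) \<longlonglongrightarrow> h x * (0 * v x)"
        by (intro tendsto_mult tendsto_const cut'_tendsto_0) auto
      then show "(\<lambda>n. h x * (cut' n x * v x)) \<longlonglongrightarrow> 0" by simp
    qed
    show "AE x in M. norm (h x * (cut' n x * v x)) \<le> \<bar>h x\<bar> * (C * (3 * L))" for n
      using bb by (intro AE_I2) (simp only: real_norm_def abs_mult[of "h _"], auto intro!: mult_left_mono)
  qed simp
  then show ?thesis by simp
qed

text \<open>Test with the compactly supported \<open>cut n * v\<close> and let \<open>n\<close>
  grow. The boundary survives only in the term with \<open>cut' n\<close>, left as hypothesis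
  \<open>z\<close>: it can vanish on account of \<open>v\<close> or on account of
  \<open>f\<close>.\<close>

lemma weak_deriv_test_cut:
  assumes f: "L2_fun L f" and g: "L2_fun L g" and w: "has_weak_deriv L 1 f g" and v: "smooth_fun v"
    and z: "(\<lambda>n. \<integral>x. f x * (cut' n x * v x) \<partial>M) \<longlonglongrightarrow> 0"
  shows "(\<integral>x. f x * deriv v x \<partial>M) = - (\<integral>x. g x * v x \<partial>M)"
proof -
  note fi = L2_integrable[OF f] and gi = L2_integrable[OF g]
  note vc = smooth_fun_continuous[OF v] smooth_fun_continuous[OF smooth_fun_deriv[OF v]]
  have d: "deriv (\<lambda>x. cut n x * v x) = (\<lambda>x. cut n x * deriv v x + cut' n x * v x)" for n
    by (rule ext, rule DERIV_imp_deriv, rule DERIV_mult'[OF cut_has_derivative smooth_fun_has_derivative[OF v]])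
  have e: "(\<integral>x. f x * deriv v x * cut n x \<partial>M) + (\<integral>x. f x * (cut' n x * v x) \<partial>M) = - (\<integral>x. g x * v x * cut n x \<partial>M)" for n
  proof -
    have i: "integrable M (\<lambda>x. f x * (deriv v x * cut n x))" "integrable M (\<lambda>x. f x * (cut' n x * v x))"
      by (intro integrable_mult_continuous fi continuous_intros vc)+
    have "(\<integral>x. f x * deriv (\<lambda>x. cut n x * v x) x \<partial>M) = - (\<integral>x. g x * (cut n x * v x) \<partial>M)"
      using w test_fun_cut[OF v, of n] unfolding has_weak_deriv_def by simp
    moreover have "f x * deriv (\<lambda>x. cut n x * v x) x = f x * (deriv v x * cut n x) + f x * (cut' n x * v x)" for x
      unfolding d by (simp add: algebra_simps)
    ultimately have "(\<integral>x. f x * (deriv v x * cut n x) \<partial>M) + (\<integral>x. f x * (cut' n x * v x) \<partial>M) = - (\<integral>x. g x * (cut n x * v x) \<partial>M)"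
      using Bochner_Integration.integral_add[OF i] by simp
    then show ?thesis by (simp add: mult_ac)
  qed
  have "(\<lambda>n. (\<integral>x. f x * deriv v x * cut n x \<partial>M) + (\<integral>x. f x * (cut' n x * v x) \<partial>M)) \<longlonglongrightarrow> (\<integral>x. f x * deriv v x \<partial>M) + 0"
    by (intro tendsto_add z cut_integral_tendsto integrable_mult_continuous fi vc)
  moreover have "(\<lambda>n. - (\<integral>x. g x * v x * cut n x \<partial>M)) \<longlonglongrightarrow> - (\<integral>x. g x * v x \<partial>M)"
    by (intro tendsto_minus cut_integral_tendsto integrable_mult_continuous gi vc)
  ultimately show ?thesis unfolding e using LIMSEQ_unique by fastforce
qed

text \<open>The sine is \<open>lam k\<close>-Lipschitz and vanishes at both ends, so it is bounded
  by \<open>lam k\<close> times the distance to the nearer end; the other factor of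
  \<open>x (L - x)\<close> is then at least \<open>L / 2\<close>.\<close>

lemma abs_sn_le:
  assumes "0 < x" "x < L"
  shows "\<bar>sn k x\<bar> \<le> (2 * lam k / L) * (x * (L - x))"
proof -
  have s: "\<bar>sn k y\<bar> \<le> lam k * y" if "0 \<le> y" for y
    using abs_sin_x_le_abs_x[of "lam k * y"] that by (simp add: abs_mult)
  have "sn k x = - cos (real k * pi) * sn k (L - x)"
  proof -
    have "lam k * x = real k * pi - lam k * (L - x)" using lam_L[of k] by (simp add: right_diff_distrib)
    then show ?thesis by (simp add: sin_diff sin_npi)
  qed
  then have "\<bar>sn k x\<bar> = \<bar>cos (real k * pi)\<bar> * \<bar>sn k (L - x)\<bar>" by (simp add: abs_mult)
  also have "\<dots> = \<bar>sn k (L - x)\<bar>" by (simp add: cos_npi)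
  finally have r: "\<bar>sn k x\<bar> \<le> lam k * (L - x)" using s[of "L - x"] assms by simp
  have eq: "(2 * lam k / L) * (x * (L - x)) = lam k * (2 / L * (x * (L - x)))" by simp
  show ?thesis unfolding eq
  proof (cases "x \<le> L / 2")
    case True
    have "L * x \<le> 2 * (L - x) * x" using True assms by (intro mult_right_mono) auto
    then have "x \<le> 2 / L * (x * (L - x))" using L_pos by (simp add: field_simps)
    then have "lam k * x \<le> lam k * (2 / L * (x * (L - x)))" by (rule mult_left_mono) simp
    with s[of x] assms show "\<bar>sn k x\<bar> \<le> lam k * (2 / L * (x * (L - x)))" by linarith
  next
    case False
    have "L * (L - x) \<le> 2 * x * (L - x)" using False assms by (intro mult_right_mono) auto
    then have "L - x \<le> 2 / L * (x * (L - x))" using L_pos by (simp add: field_simps)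
    then have "lam k * (L - x) \<le> lam k * (2 / L * (x * (L - x)))" by (rule mult_left_mono) simp
    with r show "\<bar>sn k x\<bar> \<le> lam k * (2 / L * (x * (L - x)))" by linarith
  qed
qed

lemma smooth_cs: "smooth_fun (cs k)" and smooth_sn: "smooth_fun (sn k)"
  using smooth_fun_trig[of 1 "lam k" 0] smooth_fun_trig[of 0 "lam k" 1] by auto

lemma deriv_cs: "deriv (cs k) x = - lam k * sn k x" and deriv_sn: "deriv (sn k) x = lam k * cs k x"
  by (rule DERIV_imp_deriv; auto intro!: derivative_eq_intros)+

text \<open>The sine itself supplies the vanishing at the ends, so no boundary term appears.\<close>

lemma weak_deriv_sine_coeff:
  assumes "L2_fun L f" "L2_fun L g" "has_weak_deriv L 1 f g"
  shows "(\<integral>x. g x * sn k x \<partial>M) = - lam k * (\<integral>x. f x * cs k x \<partial>M)"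
proof -
  have "(\<integral>x. f x * deriv (sn k) x \<partial>M) = - (\<integral>x. g x * sn k x \<partial>M)"
    by (rule weak_deriv_test_cut[OF assms smooth_sn])
       (rule cut'_integral_tendsto_0[OF L2_integrable[OF assms(1)] cont_trig(2) abs_sn_le])
  moreover have "(\<integral>x. f x * deriv (sn k) x \<partial>M) = lam k * (\<integral>x. f x * cs k x \<partial>M)"
    unfolding deriv_sn mult.left_commute[of _ "lam k"] by simp
  ultimately show ?thesis by simp
qed

section \<open>Weak derivatives\<close>

text \<open>\<open>cut n\<close> increases up to the midpoint and decreases after it, so the
  integral is its total variation, at most twice its maximum.\<close>

lemma integral_abs_cut'_le: "(\<integral>x. \<bar>cut' n x\<bar> \<partial>M) \<le> 2"
proof -
  \<comment> \<open>An antiderivative of \<open>|cut' n|\<close>: \<open>min\<close> and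
    \<open>max\<close> freeze one branch on each half, and the decreasing branch enters with
    reversed sign.\<close>
  define G where "G x = cut n (min x (L / 2)) + (cut n (L / 2) - cut n (max x (L / 2)))" for x
  have G: "continuous_on {0..L} G" unfolding G_def
    by (intro continuous_intros continuous_on_compose2[OF continuous_cut(1)[of UNIV n]]) auto
  have d: "(G has_vector_derivative \<bar>cut' n x\<bar>) (at x)" if x: "x \<in> {0<..<L} - {L / 2}" for x
  proof (cases "x < L / 2")
    case True
    have "(G has_real_derivative cut' n x) (at x)"
    proof (rule has_field_derivative_transform_within_open[OF cut_has_derivative])
      show "open {..<L / 2}" by simp
    qed (use True in \<open>auto simp: G_def\<close>)
    moreover have "0 \<le> cut' n x" using True by (simp add: cut'_eq)
    ultimately show ?thesis by (simp add: has_real_derivative_iff_has_vector_derivative)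
  next
    case False
    then have f: "L / 2 < x" using x by auto
    have "(G has_real_derivative (0 + (0 - cut' n x))) (at x)"
    proof (rule has_field_derivative_transform_within_open)
      show "((\<lambda>x. cut n (L / 2) + (cut n (L / 2) - cut n x)) has_real_derivative (0 + (0 - cut' n x))) (at x)"
        by (intro DERIV_add DERIV_diff DERIV_const cut_has_derivative)
      show "open {L / 2<..}" by simp
    qed (use f in \<open>auto simp: G_def\<close>)
    moreover have "cut' n x \<le> 0" using f
      by (auto simp: cut'_eq mult_le_0_iff zero_le_mult_iff)
    ultimately show ?thesis by (simp add: has_real_derivative_iff_has_vector_derivative)
  qed
  have "((\<lambda>x. \<bar>cut' n x\<bar>) has_integral G L - G 0) {0..L}"
    by (rule fundamental_theorem_of_calculus_interior_strong[of "{L / 2}"]) (use L_pos d G in auto)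
  then have "(\<integral>x. \<bar>cut' n x\<bar> \<partial>M) = G L - G 0"
    by (subst integral_M_eq) (auto intro!: continuous_intros simp: integral_unique)
  also have "\<dots> \<le> 2"
    using L_pos cut_nonneg[of n 0] cut_nonneg[of n L] cut_le_1[of n "L / 2"] by (simp add: G_def)
  finally show ?thesis .
qed

text \<open>Uniform continuity gives the bound \<open>e\<close> within distance \<open>d\<close> of
  the ends; elsewhere \<open>x (L - x) \<ge> d\<^sup>2\<close>, so \<open>C = B / d\<^sup>2\<close>
  with a global bound \<open>B\<close> suffices.\<close>

lemma vanishing_at_ends_bound:
  assumes F: "continuous_on {0..L} F" "F 0 = 0" "F L = 0" and e: "0 < (e :: real)"
  shows "\<exists>C\<ge>0. \<forall>x\<in>{0..L}. \<bar>F x\<bar> \<le> e + C * (x * (L - x))"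
proof -
  have "bounded (F ` {0..L})"
    by (rule compact_imp_bounded[OF compact_continuous_image[OF F(1) compact_Icc]])
  then obtain B where "\<forall>y \<in> F ` {0..L}. norm y \<le> B" unfolding bounded_iff by blast
  then have B: "\<And>x. x \<in> {0..L} \<Longrightarrow> \<bar>F x\<bar> \<le> B" by simp
  have "uniformly_continuous_on {0..L} F"
    by (rule compact_uniformly_continuous[OF F(1) compact_Icc])
  then obtain d where d: "d > 0" "\<And>x y. x \<in> {0..L} \<Longrightarrow> y \<in> {0..L} \<Longrightarrow> dist y x < d \<Longrightarrow> dist (F y) (F x) < e"
    using e unfolding uniformly_continuous_on_def by meson
  have B0: "0 \<le> B" using B[of 0] L_pos F by simp
  have "\<bar>F x\<bar> \<le> e + B / d\<^sup>2 * (x * (L - x))" if x: "x \<in> {0..L}" for x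
  proof -
    have nn: "0 \<le> B / d\<^sup>2 * (x * (L - x))" using x B0 by simp
    consider "x < d" | "L - x < d" | "d \<le> x" "d \<le> L - x" by linarith
    then show ?thesis
    proof cases
      case 1
      then have "\<bar>F x\<bar> < e" using d(2)[of 0 x] x L_pos F(2) by (simp add: dist_real_def)
      then show ?thesis using nn by linarith
    next
      case 2
      then have "\<bar>F x\<bar> < e" using d(2)[of L x] x L_pos F(3) by (simp add: dist_real_def)
      then show ?thesis using nn by linarith
    next
      case 3
      then have "d * d \<le> x * (L - x)" using d(1) by (intro mult_mono) auto
      then have "B / d\<^sup>2 * d\<^sup>2 \<le> B / d\<^sup>2 * (x * (L - x))" using B0 by (intro mult_left_mono) (auto simp: power2_eq_square)
      then have "B \<le> B / d\<^sup>2 * (x * (L - x))" using d(1) by simp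
      then show ?thesis using B[OF x] e by linarith
    qed
  qed
  then show ?thesis using B0 by (intro exI[of _ "B / d\<^sup>2"]) auto
qed

text \<open>Here the vanishing comes from \<open>f\<close>, through its continuous representative,
  but without a rate. Splitting by \<open>vanishing_at_ends_bound\<close> leaves a part of size
  \<open>e\<close>, paired with the bounded total variation of \<open>cut n\<close>, and a part that
  vanishes linearly and is handled by dominated convergence.\<close>

lemma weak_deriv_zero_trace:
  assumes f: "L2_fun L f" and g: "L2_fun L g" and w: "has_weak_deriv L 1 f g"
    and F: "continuous_on {0..L} F" "F 0 = 0" "F L = 0" "AE x in M. f x = F x" and v: "smooth_fun v"
  shows "(\<integral>x. f x * deriv v x \<partial>M) = - (\<integral>x. g x * v x \<partial>M)"
proof (rule weak_deriv_test_cut[OF f g w v])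
  note vc = smooth_fun_continuous[OF v, of "{0..L}"]
  have "bounded (v ` {0..L})"
    by (rule compact_imp_bounded[OF compact_continuous_image[OF vc compact_Icc]])
  then obtain B where "\<forall>y \<in> v ` {0..L}. norm y \<le> B" unfolding bounded_iff by blast
  then have B: "\<And>x. x \<in> {0..L} \<Longrightarrow> \<bar>v x\<bar> \<le> B" by simp
  then have B0: "0 \<le> B" using order_trans[OF abs_ge_zero B[of 0]] L_pos by simp
  have fF: "(\<integral>x. f x * (cut' n x * v x) \<partial>M) = (\<integral>x. F x * (cut' n x * v x) \<partial>M)" for n
  proof (rule integral_cong_AE)
    show "(\<lambda>x. f x * (cut' n x * v x)) \<in> borel_measurable M"
      by (intro borel_measurable_integrable integrable_mult_continuous L2_integrable f continuous_intros vc)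
    show "(\<lambda>x. F x * (cut' n x * v x)) \<in> borel_measurable M"
      by (intro continuous_measurable_M continuous_intros vc F)
    show "AE x in M. f x * (cut' n x * v x) = F x * (cut' n x * v x)"
      using F(4) by eventually_elim simp
  qed
  show "(\<lambda>n. \<integral>x. f x * (cut' n x * v x) \<partial>M) \<longlonglongrightarrow> 0"
    unfolding fF
  proof (rule LIMSEQ_I)
    fix r :: real assume r: "0 < r"
    \<comment> \<open>Chosen so that the part of size \<open>e\<close> contributes at most
      \<open>2 B e \<le> r / 2\<close>; the \<open>+ 1\<close> covers \<open>B = 0\<close>.\<close>
    define e where "e = r / (4 * (B + 1))"
    have e: "0 < e" using r B0 by (simp add: e_def)
    have "0 < 4 * (B + 1)" using B0 by simp
    then have nz: "4 * (B + 1) \<noteq> 0" by (rule less_imp_neq[symmetric])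
    have "r = e * (4 * (B + 1))" using iffD1[OF nonzero_eq_divide_eq[OF nz] e_def] by (rule sym)
    also have "\<dots> = 4 * (B * e) + 4 * e" by (simp add: algebra_simps)
    finally have eB: "B * e * 2 \<le> r / 2" using e by linarith
    obtain C where C: "0 \<le> C" "\<And>x. x \<in> {0..L} \<Longrightarrow> \<bar>F x\<bar> \<le> e + C * (x * (L - x))"
      using vanishing_at_ends_bound[OF F(1-3) e] by blast
    have "(\<lambda>n. \<integral>x. \<bar>cut' n x\<bar> * (x * (L - x)) \<partial>M) \<longlonglongrightarrow> (\<integral>x. 0 \<partial>M)"
    proof (rule integral_dominated_convergence)
      show "(\<lambda>x. \<bar>cut' n x\<bar> * (x * (L - x))) \<in> borel_measurable M" for n
        by (intro continuous_measurable_M continuous_intros)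
      show "integrable M (\<lambda>x. 3 * L)" by simp
      show "AE x in M. (\<lambda>n. \<bar>cut' n x\<bar> * (x * (L - x))) \<longlonglongrightarrow> 0"
      proof (rule AE_I2)
        fix x assume "x \<in> space M"
        then have "(\<lambda>n. \<bar>cut' n x\<bar> * (x * (L - x))) \<longlonglongrightarrow> \<bar>0\<bar> * (x * (L - x))"
          by (intro tendsto_mult tendsto_const tendsto_rabs cut'_tendsto_0) auto
        then show "(\<lambda>n. \<bar>cut' n x\<bar> * (x * (L - x))) \<longlonglongrightarrow> 0" by simp
      qed
      show "AE x in M. norm (\<bar>cut' n x\<bar> * (x * (L - x))) \<le> 3 * L" for n
        using cut'_bound by (intro AE_I2) (simp add: abs_mult mult_ac)
    qed simp
    then have "(\<lambda>n. B * C * (\<integral>x. \<bar>cut' n x\<bar> * (x * (L - x)) \<partial>M)) \<longlonglongrightarrow> B * C * 0"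
      by (intro tendsto_mult_left) simp
    from LIMSEQ_D[OF this, of "r / 2"] r
    obtain n0 where n0: "\<And>n. n \<ge> n0 \<Longrightarrow> norm (B * C * (\<integral>x. \<bar>cut' n x\<bar> * (x * (L - x)) \<partial>M) - B * C * 0) < r / 2"
      by auto
    have "norm ((\<integral>x. F x * (cut' n x * v x) \<partial>M) - 0) < r" if n: "n \<ge> n0" for n
    proof -
      have p: "\<bar>F x * (cut' n x * v x)\<bar> \<le> B * e * \<bar>cut' n x\<bar> + B * C * (\<bar>cut' n x\<bar> * (x * (L - x)))"
        if x: "x \<in> space M" for x
      proof -
        have xx: "x \<in> {0..L}" using x by auto
        have "\<bar>F x * (cut' n x * v x)\<bar> = \<bar>F x\<bar> * (\<bar>cut' n x\<bar> * \<bar>v x\<bar>)" by (simp add: abs_mult)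
        also have "\<dots> \<le> (e + C * (x * (L - x))) * (\<bar>cut' n x\<bar> * B)"
          using xx C e by (intro mult_mono mult_left_mono C B) auto
        finally show ?thesis by (simp add: algebra_simps)
      qed
      have "\<bar>\<integral>x. F x * (cut' n x * v x) \<partial>M\<bar> \<le> (\<integral>x. \<bar>F x * (cut' n x * v x)\<bar> \<partial>M)"
        by (rule integral_abs_bound)
      also have "\<dots> \<le> (\<integral>x. B * e * \<bar>cut' n x\<bar> + B * C * (\<bar>cut' n x\<bar> * (x * (L - x))) \<partial>M)"
        by (rule integral_mono[OF _ _ p]) (intro continuous_integrable_M continuous_intros F vc)+
      also have "\<dots> = B * e * (\<integral>x. \<bar>cut' n x\<bar> \<partial>M) + B * C * (\<integral>x. \<bar>cut' n x\<bar> * (x * (L - x)) \<partial>M)"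
      proof -
        have "integrable M (\<lambda>x. \<bar>cut' n x\<bar>)" "integrable M (\<lambda>x. \<bar>cut' n x\<bar> * (x * (L - x)))"
          by (intro continuous_integrable_M continuous_intros)+
        then show ?thesis by simp
      qed
      also have "\<dots> \<le> B * e * 2 + B * C * (\<integral>x. \<bar>cut' n x\<bar> * (x * (L - x)) \<partial>M)"
        using B0 e by (intro add_right_mono mult_left_mono integral_abs_cut'_le) auto
      also have "\<dots> < r" using n0[OF n] eB unfolding mult_zero_right diff_zero real_norm_def by linarith
      finally show ?thesis by simp
    qed
    then show "\<exists>n0. \<forall>n\<ge>n0. norm ((\<integral>x. F x * (cut' n x * v x) \<partial>M) - 0) < r" by blast
  qed
qed

text \<open>The products \<open>cut n * cs k\<close> are test functions, so in the limit all cosine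
  coefficients of \<open>g\<close> vanish and completeness applies.\<close>

lemma test_fun_integral_zero_imp_AE:
  assumes g: "integrable M g" and z: "\<And>\<phi>. test_fun L \<phi> \<Longrightarrow> (\<integral>x. g x * \<phi> x \<partial>M) = 0"
  shows "AE x in M. g x = 0"
proof (rule cosine_completeness[OF g])
  fix k
  have "(\<lambda>n. \<integral>x. g x * cs k x * cut n x \<partial>M) \<longlonglongrightarrow> (\<integral>x. g x * cs k x \<partial>M)"
    by (intro cut_integral_tendsto integrable_mult_continuous g cont_trig)
  moreover have "(\<integral>x. g x * cs k x * cut n x \<partial>M) = 0" for n
    using z[OF test_fun_cut[OF smooth_cs, of n k]] by (simp add: mult_ac)
  ultimately have "(\<integral>x. g x * cs k x \<partial>M) = 0" by (simp add: LIMSEQ_const_iff)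
  then show "ft g k = 0" by (simp add: ft_def)
qed

lemma test_fun_integrable: "integrable M g \<Longrightarrow> test_fun L \<phi> \<Longrightarrow> integrable M (\<lambda>x. g x * \<phi> x)"
  by (rule integrable_mult_continuous[OF _ smooth_fun_continuous[OF test_fun_smooth]])

lemma has_weak_deriv_unique:
  assumes "L2_fun L g" "L2_fun L h" "has_weak_deriv L k f g" "has_weak_deriv L k f h"
  shows "AE x in M. g x = h x"
proof -
  have "AE x in M. g x - h x = 0"
  proof (rule test_fun_integral_zero_imp_AE)
    show "integrable M (\<lambda>x. g x - h x)" using L2_integrable assms by simp
    fix \<phi> assume t: "test_fun L \<phi>"
    have "(\<integral>x. f x * (deriv ^^ k) \<phi> x \<partial>M) = (- 1) ^ k * (\<integral>x. g x * \<phi> x \<partial>M)"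
      using assms(3) t unfolding has_weak_deriv_def by blast
    moreover have "(\<integral>x. f x * (deriv ^^ k) \<phi> x \<partial>M) = (- 1) ^ k * (\<integral>x. h x * \<phi> x \<partial>M)"
      using assms(4) t unfolding has_weak_deriv_def by blast
    ultimately have "(- 1) ^ k * (\<integral>x. g x * \<phi> x \<partial>M) = (- 1) ^ k * (\<integral>x. h x * \<phi> x \<partial>M)"
      by (rule trans[OF sym])
    then have "(\<integral>x. g x * \<phi> x \<partial>M) = (\<integral>x. h x * \<phi> x \<partial>M)" by simp
    then show "(\<integral>x. (g x - h x) * \<phi> x \<partial>M) = 0"
      using test_fun_integrable[OF L2_integrable[OF assms(1)] t] test_fun_integrable[OF L2_integrable[OF assms(2)] t]
      by (simp add: left_diff_distrib)
  qed
  then show ?thesis by eventually_elim simp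
qed

text \<open>Makes the choice in \<open>weak_deriv\<close> harmless: as soon as some weak derivative
  in \<open>L\<^sup>2\<close> exists, the chosen one is a weak derivative too and agrees with it
  almost everywhere.\<close>

lemma weak_deriv_AE_eq:
  assumes "L2_fun L g" "has_weak_deriv L k f g"
  shows "L2_fun L (weak_deriv L k f)" "has_weak_deriv L k f (weak_deriv L k f)"
    "AE x in M. weak_deriv L k f x = g x"
proof -
  have "L2_fun L (weak_deriv L k f) \<and> has_weak_deriv L k f (weak_deriv L k f)"
    unfolding weak_deriv_def by (rule someI[of _ g]) (use assms in auto)
  then show "L2_fun L (weak_deriv L k f)" "has_weak_deriv L k f (weak_deriv L k f)"
    "AE x in M. weak_deriv L k f x = g x"
    using has_weak_deriv_unique assms by auto
qed

lemma sobolev_weak_deriv: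
  assumes "sobolev L k f" "j \<le> k"
  shows "L2_fun L (weak_deriv L j f)" "has_weak_deriv L j f (weak_deriv L j f)"
proof -
  obtain g where "L2_fun L g" "has_weak_deriv L j f g" using assms unfolding sobolev_def by blast
  then show "L2_fun L (weak_deriv L j f)" "has_weak_deriv L j f (weak_deriv L j f)"
    using weak_deriv_AE_eq by auto
qed

lemma has_weak_deriv_0: "has_weak_deriv L 0 f f"
  by (simp add: has_weak_deriv_def)

text \<open>Test the identity of order \<open>j\<close> with \<open>deriv \<phi>\<close> and compare
  it with the identity of order \<open>j + 1\<close> for \<open>\<phi>\<close>.\<close>

lemma has_weak_deriv_step:
  assumes "has_weak_deriv L j f g" "has_weak_deriv L (Suc j) f h"
  shows "has_weak_deriv L 1 g h"
  unfolding has_weak_deriv_def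
proof (intro allI impI)
  fix \<phi> assume t: "test_fun L \<phi>"
  have "(\<integral>x. f x * (deriv ^^ j) (deriv \<phi>) x \<partial>M) = (- 1) ^ j * (\<integral>x. g x * deriv \<phi> x \<partial>M)"
    using assms(1) test_fun_deriv[OF t] unfolding has_weak_deriv_def by blast
  moreover have "(\<integral>x. f x * (deriv ^^ Suc j) \<phi> x \<partial>M) = (- 1) ^ Suc j * (\<integral>x. h x * \<phi> x \<partial>M)"
    using assms(2) t unfolding has_weak_deriv_def by blast
  moreover have "(deriv ^^ j) (deriv \<phi>) = (deriv ^^ Suc j) \<phi>"
    by (simp add: funpow_swap1)
  ultimately have "(- 1) ^ j * (\<integral>x. g x * deriv \<phi> x \<partial>M) = (- 1) ^ j * (- (\<integral>x. h x * \<phi> x \<partial>M))"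
    by simp
  then have "(\<integral>x. g x * deriv \<phi> x \<partial>M) = - (\<integral>x. h x * \<phi> x \<partial>M)"
    by (subst (asm) mult_left_cancel) simp_all
  then show "(\<integral>x. g x * (deriv ^^ 1) \<phi> x \<partial>M) = (- 1) ^ 1 * (\<integral>x. h x * \<phi> x \<partial>M)"
    by simp
qed

lemma has_weak_deriv_classical:
  assumes w: "has_weak_deriv L j f g"
    and d: "\<And>x. (g has_real_derivative h x) (at x)" and h: "continuous_on {0..L} h"
  shows "has_weak_deriv L (Suc j) f h"
  unfolding has_weak_deriv_def
proof (intro allI impI)
  fix \<phi> assume t: "test_fun L \<phi>"
  note s = test_fun_smooth[OF t]
  have gc: "continuous_on {0..L} g"
    by (intro continuous_at_imp_continuous_on ballI DERIV_isCont[OF d])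
  have c: "continuous_on {0..L} (\<lambda>x. g x * deriv \<phi> x)" "continuous_on {0..L} (\<lambda>x. h x * \<phi> x)"
    by (intro continuous_intros gc h smooth_fun_continuous smooth_fun_deriv s)+
  obtain a b where ab: "0 < a" "b < L" "\<And>x. x \<notin> {a..b} \<Longrightarrow> \<phi> x = 0"
    using t unfolding test_fun_def by blast
  have "(\<integral>x. g x * deriv \<phi> x + h x * \<phi> x \<partial>M) = g L * \<phi> L - g 0 * \<phi> 0"
  proof (rule FTC_M)
    show "continuous_on {0..L} (\<lambda>x. g x * deriv \<phi> x + h x * \<phi> x)" by (intro continuous_on_add c)
    show "((\<lambda>x. g x * \<phi> x) has_real_derivative g x * deriv \<phi> x + h x * \<phi> x) (at x within {0..L})" for x
      by (rule has_field_derivative_at_within[OF DERIV_mult'[OF d smooth_fun_has_derivative[OF s]]])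
  qed
  also have "\<dots> = 0" using ab(3)[of 0] ab(3)[of L] ab(1,2) by simp
  finally have e: "(\<integral>x. g x * deriv \<phi> x \<partial>M) = - (\<integral>x. h x * \<phi> x \<partial>M)"
    using c[THEN continuous_integrable_M] by simp
  have "(\<integral>x. f x * (deriv ^^ Suc j) \<phi> x \<partial>M) = (\<integral>x. f x * (deriv ^^ j) (deriv \<phi>) x \<partial>M)"
    by (simp add: funpow_swap1)
  also have "\<dots> = (- 1) ^ j * (\<integral>x. g x * deriv \<phi> x \<partial>M)"
    using w test_fun_deriv[OF t] unfolding has_weak_deriv_def by blast
  finally show "(\<integral>x. f x * (deriv ^^ Suc j) \<phi> x \<partial>M) = (- 1) ^ Suc j * (\<integral>x. h x * \<phi> x \<partial>M)"
    unfolding e by simp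
qed

end

section \<open>Galerkin approximations\<close>

text \<open>Picard iteration in a weighted sup norm: in the unknown
  \<open>exp (- 2 K t) x(t)\<close> the integral operator is a contraction with factor 1/2 on the
  whole interval, whatever its length.\<close>

theorem lipschitz_ode_solution:
  fixes F :: "'a::banach \<Rightarrow> 'a" and x0 :: 'a
  assumes lip: "\<And>x y. norm (F x - F y) \<le> K * norm (x - y)" and K: "0 < K" and T: "0 \<le> T"
  shows "\<exists>x. x 0 = x0 \<and> (\<forall>t\<in>{0..T}. (x has_vector_derivative F (x t)) (at t within {0..T}))"
proof -
  have Fc: "continuous_on S F" for S
    by (rule continuous_on_subset[OF lipschitz_on_continuous_on[OF lipschitz_onI[of UNIV F K]]])
       (use lip K in \<open>auto simp: dist_norm\<close>)
  \<comment> \<open>Clamping time to \<open>[0, T]\<close> turns functions on the interval into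
    bounded continuous functions on the line, the complete space in which the fixed point is
    sought.\<close>
  define c where "c t = max 0 (min T t)" for t :: real
  have c: "continuous_on S c" "c t \<in> {0..T}" for S t
    using T unfolding c_def[abs_def] by (auto intro!: continuous_intros)
  define G where "G y s = F (exp (2 * K * s) *\<^sub>R apply_bcontfun y s)" for y :: "real \<Rightarrow>\<^sub>C 'a" and s
  have Gc: "continuous_on S (G y)" for y S
    unfolding G_def by (rule continuous_on_compose2[OF Fc[of UNIV]]) (auto intro!: continuous_intros)
  have Gi: "G y integrable_on {0..u}" for y u
    by (rule integrable_continuous_real[OF Gc])
  define P where "P y u = exp (- 2 * K * u) *\<^sub>R (x0 + integral {0..u} (G y))" for y u
  have Pc: "continuous_on {0..T} (P y)" for y
    unfolding P_def by (intro continuous_intros indefinite_integral_continuous_1 Gi)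
  have mem: "(\<lambda>t. P y (c t)) \<in> bcontfun" for y
  proof -
    have "continuous_on UNIV (\<lambda>t. P y (c t))"
      by (rule continuous_on_compose2[OF Pc c(1)]) (use c(2) in auto)
    moreover have "bounded (range (\<lambda>t. P y (c t)))"
      by (rule bounded_subset[OF compact_imp_bounded[OF compact_continuous_image[OF Pc compact_Icc]]])
         (use c(2) in auto)
    ultimately show ?thesis by (simp add: bcontfun_def)
  qed
  define \<Phi> where "\<Phi> y = Bcontfun (\<lambda>t. P y (c t))" for y
  have ap: "apply_bcontfun (\<Phi> y) t = P y (c t)" for y t
    unfolding \<Phi>_def by (simp add: Bcontfun_inverse[OF mem])
  have "\<exists>!y. \<Phi> y = y"
  proof (rule banach_fix_type[of "1 / 2"])
    show "\<forall>y z. dist (\<Phi> y) (\<Phi> z) \<le> 1 / 2 * dist y z"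
    proof (intro allI dist_bound)
      fix y z :: "real \<Rightarrow>\<^sub>C 'a" and t :: real
      define u where "u = c t"
      have u: "u \<in> {0..T}" unfolding u_def by (rule c(2))
      \<comment> \<open>The Lipschitz constant times the weight, \<open>K * exp (2 K s)\<close>,
        integrates to at most \<open>exp (2 K u) / 2\<close>: the origin of the contraction
        factor.\<close>
      have ei: "((\<lambda>s. K * exp (2 * K * s) * dist y z) has_integral
          (exp (2 * K * u) / 2 * dist y z - exp (2 * K * 0) / 2 * dist y z)) {0..u}"
        by (rule fundamental_theorem_of_calculus)
           (use u in \<open>auto intro!: derivative_eq_intros simp flip: has_real_derivative_iff_has_vector_derivative\<close>)
      have "dist (P y u) (P z u) = exp (- 2 * K * u) * norm (integral {0..u} (\<lambda>s. G y s - G z s))"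
        using Gi unfolding P_def dist_norm
        by (simp add: Henstock_Kurzweil_Integration.integral_diff flip: scaleR_diff_right)
      also have "norm (integral {0..u} (\<lambda>s. G y s - G z s)) \<le> integral {0..u} (\<lambda>s. K * exp (2 * K * s) * dist y z)"
      proof (rule integral_norm_bound_integral)
        show "(\<lambda>s. G y s - G z s) integrable_on {0..u}" by (intro integrable_diff Gi)
        show "(\<lambda>s. K * exp (2 * K * s) * dist y z) integrable_on {0..u}" using ei by blast
        fix s
        have "norm (G y s - G z s) \<le> K * norm (exp (2 * K * s) *\<^sub>R apply_bcontfun y s - exp (2 * K * s) *\<^sub>R apply_bcontfun z s)"
          unfolding G_def by (rule lip)
        also have "\<dots> = K * exp (2 * K * s) * dist (apply_bcontfun y s) (apply_bcontfun z s)"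
          by (simp add: dist_norm flip: scaleR_diff_right)
        also have "\<dots> \<le> K * exp (2 * K * s) * dist y z"
          using K by (intro mult_left_mono dist_bounded) auto
        finally show "norm (G y s - G z s) \<le> K * exp (2 * K * s) * dist y z" .
      qed
      also have "\<dots> \<le> exp (2 * K * u) / 2 * dist y z"
        unfolding integral_unique[OF ei] by simp
      also have "exp (- 2 * K * u) * (exp (2 * K * u) / 2 * dist y z) = (exp (- 2 * K * u) * exp (2 * K * u)) / 2 * dist y z"
        by simp
      also have "\<dots> = 1 / 2 * dist y z" by (simp flip: exp_add)
      finally show "dist (apply_bcontfun (\<Phi> y) t) (apply_bcontfun (\<Phi> z) t) \<le> 1 / 2 * dist y z"
        by (simp add: ap u_def)
    qed
  qed auto
  then obtain y where y: "\<Phi> y = y" by blast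
  define x where "x t = x0 + integral {0..t} (G y)" for t
  have Gx: "G y t = F (x t)" if "t \<in> {0..T}" for t
  proof -
    have "apply_bcontfun y t = P y t" using ap[of y t] y that by (simp add: c_def)
    then have "exp (2 * K * t) *\<^sub>R apply_bcontfun y t = (exp (2 * K * t) * exp (- 2 * K * t)) *\<^sub>R x t"
      by (simp add: P_def x_def)
    then show ?thesis by (simp add: G_def flip: exp_add)
  qed
  have "(x has_vector_derivative F (x t)) (at t within {0..T})" if t: "t \<in> {0..T}" for t
  proof -
    have "((\<lambda>t. x0 + integral {0..t} (G y)) has_vector_derivative 0 + G y t) (at t within {0..T})"
      by (intro has_vector_derivative_add has_vector_derivative_const
          integral_has_vector_derivative Gc t)
    then show ?thesis using Gx[OF t] unfolding x_def[abs_def] by simp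
  qed
  moreover have "x 0 = x0" by (simp add: x_def)
  ultimately show ?thesis by blast
qed

text \<open>Identity on the ball of radius \<open>R\<close> and radial projection onto its sphere
  outside; written as a scalar multiple, so that a quadratic map can pull the factor out.\<close>

definition retract :: "real \<Rightarrow> 'a::real_normed_vector \<Rightarrow> 'a" where
  "retract R a = (1 / max 1 (norm a / R)) *\<^sub>R a"

lemma norm_retract_le:
  assumes "0 < R"
  shows "norm (retract R a) \<le> R"
proof -
  have "norm a / R \<le> max 1 (norm a / R)" by simp
  then have "norm a \<le> R * max 1 (norm a / R)" using assms by (simp only: pos_divide_le_eq mult.commute)
  then show ?thesis by (simp add: retract_def pos_divide_le_eq max_def)
qed

text \<open>With denominators \<open>s\<close> and \<open>t\<close> the difference splits into
  \<open>(a - b) / s\<close> and a multiple of \<open>b\<close> of norm \<open>|t - s| / s\<close>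
  times \<open>norm b / t \<le> R\<close>; each is at most \<open>norm (a - b)\<close>.\<close>

lemma retract_lipschitz:
  assumes R: "0 < R"
  shows "norm (retract R a - retract R b) \<le> 2 * norm (a - b)"
proof -
  define s t where "s = max 1 (norm a / R)" and "t = max 1 (norm b / R)"
  have st: "1 \<le> s" "1 \<le> t" "norm b / R \<le> t" by (auto simp: s_def t_def)
  have "\<bar>t - s\<bar> \<le> \<bar>norm b / R - norm a / R\<bar>" unfolding s_def t_def by linarith
  also have "\<dots> \<le> norm (a - b) / R"
    using norm_triangle_ineq3[of a b] R by (simp add: abs_minus_commute divide_right_mono flip: diff_divide_distrib)
  finally have ts: "\<bar>t - s\<bar> \<le> norm (a - b) / R" .
  have "retract R a - retract R b = (1 / s) *\<^sub>R (a - b) + ((t - s) / (s * t)) *\<^sub>R b"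
  proof -
    have "(t - s) / (s * t) = 1 / s - 1 / t" using st by (simp add: diff_divide_distrib)
    then show ?thesis unfolding retract_def s_def[symmetric] t_def[symmetric]
      by (simp add: scaleR_diff_right scaleR_diff_left)
  qed
  then have "norm (retract R a - retract R b) \<le> \<bar>1 / s\<bar> * norm (a - b) + \<bar>(t - s) / (s * t)\<bar> * norm b"
    using norm_triangle_ineq[of "(1 / s) *\<^sub>R (a - b)" "((t - s) / (s * t)) *\<^sub>R b"] by simp
  also have "\<bar>(t - s) / (s * t)\<bar> * norm b = \<bar>t - s\<bar> * (1 / s) * (norm b / t)"
    using st by (simp add: abs_mult)
  also have "\<dots> \<le> (norm (a - b) / R) * 1 * R"
  proof (intro mult_mono ts)
    have "norm b \<le> t * R" using st(3) R by (simp only: pos_divide_le_eq)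
    then show "norm b / t \<le> R" using st by (simp add: pos_divide_le_eq mult.commute)
  qed (use st R in auto)
  also have "\<bar>1 / s\<bar> * norm (a - b) \<le> 1 * norm (a - b)" using st by (intro mult_right_mono) auto
  finally show ?thesis using R by simp
qed

section \<open>The truncated nonlinearity in cosine coefficients\<close>

context interval begin

text \<open>The symbol of \<open>\<partial>\<^sub>x\<^sup>4 + \<partial>\<^sub>x\<^sup>2\<close> on
  \<open>cs k\<close>; it is negative for \<open>0 < lam k < 1\<close>, the finitely many linearly
  unstable modes.\<close>

definition mu :: "nat \<Rightarrow> real" where "mu k = lam k ^ 4 - (lam k)\<^sup>2"

text \<open>Minus the derivative of the truncated cosine series; the sign disappears in the square.
  The mean \<open>a 0\<close> does not enter.\<close>

definition gx :: "nat \<Rightarrow> (nat \<Rightarrow> real) \<Rightarrow> real \<Rightarrow> real" where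
  "gx N a x = (\<Sum>j\<in>{1..N}. lam j * a j * sn j x)"

definition qN :: "nat \<Rightarrow> (nat \<Rightarrow> real) \<Rightarrow> nat \<Rightarrow> real" where
  "qN N a k = ft (\<lambda>x. (gx N a x)\<^sup>2) k"

text \<open>The polarisation of \<open>qN\<close>, used to bound differences of the quadratic
  term.\<close>

definition BN :: "nat \<Rightarrow> (nat \<Rightarrow> real) \<Rightarrow> (nat \<Rightarrow> real) \<Rightarrow> nat \<Rightarrow> real" where
  "BN N a b k = ft (\<lambda>x. gx N a x * gx N b x) k"

lemma qN_BN: "qN N a k = BN N a a k" by (simp add: qN_def BN_def power2_eq_square)

lemma continuous_gx [continuous_intros]: "continuous_on S (gx N a)"
  unfolding gx_def by (intro continuous_intros)

lemma gx_linear: "gx N (\<lambda>j. c * a j) x = c * gx N a x" "gx N (\<lambda>j. a j - b j) x = gx N a x - gx N b x"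
  by (simp_all add: gx_def sum_distrib_left mult_ac sum_subtractf algebra_simps)

lemma qN_scale: "qN N (\<lambda>j. c * a j) k = c\<^sup>2 * qN N a k"
  by (simp add: qN_def ft_def gx_linear power_mult_distrib mult_ac)

lemma abs_gx_le:
  assumes "\<And>j. j \<in> {1..N} \<Longrightarrow> \<bar>a j\<bar> \<le> A"
  shows "\<bar>gx N a x\<bar> \<le> (\<Sum>j\<in>{1..N}. lam j) * A"
proof -
  have "\<bar>gx N a x\<bar> \<le> (\<Sum>j\<in>{1..N}. \<bar>lam j * a j * sn j x\<bar>)" unfolding gx_def by (rule sum_abs)
  also have "\<dots> \<le> (\<Sum>j\<in>{1..N}. lam j * A)"
  proof (rule sum_mono)
    fix j assume "j \<in> {1..N}"
    then have "\<bar>lam j * a j\<bar> \<le> lam j * A" using assms by (simp add: abs_mult mult_left_mono)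
    then show "\<bar>lam j * a j * sn j x\<bar> \<le> lam j * A" using abs_trig_le(2)[of "lam j * a j" j x] by linarith
  qed
  finally show ?thesis by (simp add: sum_distrib_right)
qed

text \<open>The constant depends on the truncation \<open>N\<close>; it serves the Lipschitz
  property of the Galerkin vector field and not the uniform estimates.\<close>

lemma BN_bound:
  assumes "\<And>j. j \<in> {1..N} \<Longrightarrow> \<bar>a j\<bar> \<le> A" "\<And>j. j \<in> {1..N} \<Longrightarrow> \<bar>b j\<bar> \<le> B" "0 \<le> A" "0 \<le> B"
  shows "\<bar>BN N a b k\<bar> \<le> 2 * (\<Sum>j\<in>{1..N}. lam j)\<^sup>2 * A * B"
proof -
  let ?G = "\<Sum>j\<in>{1..N}. lam j"
  have G: "0 \<le> ?G" by (intro sum_nonneg) simp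
  have p: "\<bar>gx N a x * gx N b x * cs k x\<bar> \<le> (?G * A) * (?G * B)" for x
  proof -
    have "\<bar>gx N a x * gx N b x * cs k x\<bar> \<le> \<bar>gx N a x\<bar> * \<bar>gx N b x\<bar>"
      using abs_trig_le(1)[of "gx N a x * gx N b x" k x] by (simp add: abs_mult)
    also have "\<dots> \<le> (?G * A) * (?G * B)"
      using G assms by (intro mult_mono abs_gx_le) auto
    finally show ?thesis .
  qed
  have "\<bar>\<integral>x. gx N a x * gx N b x * cs k x \<partial>M\<bar> \<le> (\<integral>x. \<bar>gx N a x * gx N b x * cs k x\<bar> \<partial>M)"
    by (rule integral_abs_bound)
  also have "\<dots> \<le> (\<integral>x. (?G * A) * (?G * B) \<partial>M)"
    by (rule integral_mono[OF _ _ p]) (intro continuous_integrable_M continuous_intros)+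
  also have "\<dots> = ?G\<^sup>2 * A * B * L" by (simp add: power2_eq_square mult_ac)
  finally have "\<bar>\<integral>x. gx N a x * gx N b x * cs k x \<partial>M\<bar> / nrm k \<le> ?G\<^sup>2 * A * B * L / nrm k"
    by (rule divide_right_mono) simp
  also have "\<dots> \<le> ?G\<^sup>2 * A * B * L / (L / 2)"
    using assms L_pos nrm_ge[of k] by (intro divide_left_mono mult_nonneg_nonneg) auto
  also have "\<dots> = 2 * ?G\<^sup>2 * A * B" using L_pos by simp
  finally show ?thesis by (simp add: BN_def ft_def)
qed

lemma BN_diff: "BN N a a k - BN N b b k = BN N (\<lambda>j. a j - b j) a k + BN N b (\<lambda>j. a j - b j) k"
proof -
  have i: "integrable M (\<lambda>x. gx N a x * gx N b x * cs k x)" for a b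
    by (intro continuous_integrable_M continuous_intros)
  show ?thesis
    unfolding BN_def ft_def gx_linear using i
    by (simp add: left_diff_distrib right_diff_distrib diff_divide_distrib)
qed

lemma gx_has_derivative:
  "(gx N a has_real_derivative (\<Sum>j\<in>{1..N}. (lam j)\<^sup>2 * a j * cs j x)) (at x)"
  unfolding gx_def[abs_def] by (auto intro!: derivative_eq_intros sum.cong simp: power2_eq_square)

text \<open>The sum is a multiple of the integral of \<open>u\<^sub>x\<^sup>2 u\<^sub>x\<^sub>x = (u\<^sub>x\<^sup>3 / 3)\<^sub>x\<close>, and \<open>u\<^sub>x\<close> vanishes at the ends.\<close>

lemma energy_cancellation: "(\<Sum>k\<in>{1..N}. (lam k)\<^sup>2 * a k * qN N a k) = 0"
proof -
  let ?h = "\<lambda>x. \<Sum>j\<in>{1..N}. (lam j)\<^sup>2 * a j * cs j x"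
  have "(\<integral>x. (gx N a x)\<^sup>2 * ?h x \<partial>M) = (gx N a L) ^ 3 / 3 - (gx N a 0) ^ 3 / 3"
  proof (rule FTC_M)
    show "((\<lambda>x. (gx N a x) ^ 3 / 3) has_real_derivative (gx N a x)\<^sup>2 * ?h x) (at x within {0..L})" for x
      by (rule has_field_derivative_at_within) (auto intro!: derivative_eq_intros gx_has_derivative)
    show "continuous_on {0..L} (\<lambda>x. (gx N a x)\<^sup>2 * ?h x)" by (intro continuous_intros)
  qed
  also have "\<dots> = 0" by (simp add: gx_def)
  finally have 0: "(\<integral>x. (gx N a x)\<^sup>2 * ?h x \<partial>M) = 0" .
  have "(\<integral>x. (gx N a x)\<^sup>2 * ?h x \<partial>M) = (\<integral>x. (\<Sum>k\<in>{1..N}. (lam k)\<^sup>2 * a k * ((gx N a x)\<^sup>2 * cs k x)) \<partial>M)"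
    by (simp add: sum_distrib_left mult_ac)
  also have "\<dots> = (\<Sum>k\<in>{1..N}. (lam k)\<^sup>2 * a k * (\<integral>x. (gx N a x)\<^sup>2 * cs k x \<partial>M))"
    by (subst Bochner_Integration.integral_sum) (auto intro!: continuous_integrable_M continuous_intros)
  also have "\<dots> = (\<Sum>k\<in>{1..N}. L / 2 * ((lam k)\<^sup>2 * a k * qN N a k))"
    unfolding integral_cs_ft by (intro sum.cong refl) (simp add: qN_def nrm_def)
  finally show ?thesis using 0 L_pos by (simp flip: sum_distrib_left sum_divide_distrib)
qed

text \<open>Exhibits \<open>qN\<close> as a polynomial in finitely many coefficients, whence its
  continuity and measurability in time.\<close>

lemma qN_poly:
  "qN N a k = (\<Sum>j\<in>{1..N}. \<Sum>l\<in>{1..N}. (lam j * a j) * (lam l * a l) * ft (\<lambda>x. sn j x * sn l x) k)"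
proof -
  have i: "integrable M (\<lambda>x. (lam j * a j) * (lam l * a l) * (sn j x * sn l x * cs k x))" for j l
    by (intro continuous_integrable_M continuous_intros)
  have "(gx N a x)\<^sup>2 * cs k x =
     (\<Sum>j\<in>{1..N}. \<Sum>l\<in>{1..N}. (lam j * a j) * (lam l * a l) * (sn j x * sn l x * cs k x))" for x
    unfolding gx_def power2_eq_square sum_product
    unfolding sum_distrib_right by (intro sum.cong refl) (simp only: mult_ac)
  then have "(\<integral>x. (gx N a x)\<^sup>2 * cs k x \<partial>M) =
     (\<integral>x. (\<Sum>j\<in>{1..N}. \<Sum>l\<in>{1..N}. (lam j * a j) * (lam l * a l) * (sn j x * sn l x * cs k x)) \<partial>M)"
    by simp
  also have "\<dots> = (\<Sum>j\<in>{1..N}. \<integral>x. (\<Sum>l\<in>{1..N}. (lam j * a j) * (lam l * a l) * (sn j x * sn l x * cs k x)) \<partial>M)"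
    by (rule Bochner_Integration.integral_sum[OF Bochner_Integration.integrable_sum[OF i]])
  also have "\<dots> = (\<Sum>j\<in>{1..N}. \<Sum>l\<in>{1..N}. \<integral>x. (lam j * a j) * (lam l * a l) * (sn j x * sn l x * cs k x) \<partial>M)"
    by (intro sum.cong refl Bochner_Integration.integral_sum i)
  also have "\<dots> = (\<Sum>j\<in>{1..N}. \<Sum>l\<in>{1..N}. (lam j * a j) * (lam l * a l) * (\<integral>x. sn j x * sn l x * cs k x \<partial>M))"
    by simp
  finally show ?thesis
    unfolding qN_def ft_def by (simp only: sum_divide_distrib times_divide_eq_right)
qed

lemma qN_expand:
  assumes "k \<noteq> 0"
  shows "qN N a k = (\<Sum>j\<in>{1..N}. \<Sum>l\<in>{1..N}. (lam j * a j) * (lam l * a l) *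
     ((if (j - l) + (l - j) = k then 1 else 0) - (if j + l = k then 1 else 0))) / 2"
proof -
  have c: "ft (\<lambda>x. sn j x * sn l x) k =
      ((if (j - l) + (l - j) = k then 1 else 0) - (if j + l = k then 1 else 0)) / 2" for j l
  proof -
    have i: "integrable M (\<lambda>x. cs m x * cs k x)" for m
      by (intro continuous_integrable_M continuous_intros)
    have "(\<integral>x. sn j x * sn l x * cs k x \<partial>M) =
      (\<integral>x. (cs ((j - l) + (l - j)) x * cs k x - cs (j + l) x * cs k x) / 2 \<partial>M)"
      unfolding sn_times_sn by (simp add: algebra_simps)
    also have "\<dots> = ((\<integral>x. cs ((j - l) + (l - j)) x * cs k x \<partial>M) - (\<integral>x. cs (j + l) x * cs k x \<partial>M)) / 2"
      by (simp only: Bochner_Integration.integral_divide_zero Bochner_Integration.integral_diff[OF i i])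
    finally show ?thesis unfolding orthogonal_cs ft_def by simp
  qed
  show ?thesis unfolding qN_poly c by (simp only: times_divide_eq_right sum_divide_distrib)
qed

text \<open>Interacting pairs satisfy \<open>k \<le> j + l\<close>, so the exponential weight is
  submultiplicative along them. A Schur test does the rest: for given \<open>j\<close> and
  \<open>k\<close> at most three \<open>l\<close> interact, and the 1/2 of the sine product turns 3
  into 3/2.\<close>

lemma qN_gevrey_bound:
  assumes k: "k \<noteq> 0" and r: "0 \<le> r"
  shows "exp (r * lam k) * \<bar>qN N a k\<bar> \<le> 3 / 2 * (\<Sum>j\<in>{1..N}. exp (2 * r * lam j) * (lam j)\<^sup>2 * (a j)\<^sup>2)"
proof -
  define B where "B j = exp (r * lam j) * \<bar>lam j * a j\<bar>" for j
  \<comment> \<open>Dominates the absolute value of the kernel in \<open>qN_expand\<close>; its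
    symmetry allows the two squares from Young's inequality to be exchanged.\<close>
  define ind where "ind j l = (if j = l + k then 1 else 0 :: real) + (if l = j + k then 1 else 0) + (if j + l = k then 1 else 0)" for j l
  have B2: "(B j)\<^sup>2 = exp (2 * r * lam j) * (lam j)\<^sup>2 * (a j)\<^sup>2" for j
  proof -
    have "(exp (r * lam j))\<^sup>2 = exp (2 * r * lam j)" by (simp add: power2_eq_square flip: exp_add)
    then show ?thesis by (simp add: B_def power_mult_distrib)
  qed
  have ind1: "(\<Sum>l\<in>{1..N}. (B j)\<^sup>2 * ind j l) \<le> 3 * (B j)\<^sup>2" for j
  proof -
    have "(\<Sum>l\<in>{1..N}. (B j)\<^sup>2 * ind j l) \<le> (\<Sum>l\<in>{1..N}. (if l = j - k then (B j)\<^sup>2 else 0) + (if l = j + k then (B j)\<^sup>2 else 0) + (if l = k - j then (B j)\<^sup>2 else 0))"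
      by (intro sum_mono) (auto simp: ind_def)
    also have "\<dots> \<le> 3 * (B j)\<^sup>2" by (simp add: sum.distrib)
    finally show ?thesis .
  qed
  have sym: "ind j l = ind l j" for j l by (auto simp: ind_def)
  have t: "exp (r * lam k) * \<bar>(lam j * a j) * (lam l * a l) *
     ((if (j - l) + (l - j) = k then 1 else 0) - (if j + l = k then 1 else 0))\<bar> \<le> ((B j)\<^sup>2 * ind j l + (B l)\<^sup>2 * ind l j) / 2" for j l
  proof (cases "(j - l) + (l - j) = k \<or> j + l = k")
    case True
    then have "k \<le> j + l" by auto
    then have "lam k \<le> lam j + lam l" using lam_mono[of k "j + l"] by (simp add: lam_add)
    then have "r * lam k \<le> r * lam j + r * lam l" using r by (simp flip: distrib_left add: mult_left_mono)
    then have e: "exp (r * lam k) \<le> exp (r * lam j) * exp (r * lam l)" by (simp flip: exp_add)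
    have i1: "1 \<le> ind j l" using True k unfolding ind_def by (cases "j \<le> l") auto
    have i2: "\<bar>(if (j - l) + (l - j) = k then 1 else 0) - (if j + l = k then 1 else 0 :: real)\<bar> \<le> 1" by simp
    have "exp (r * lam k) * \<bar>(lam j * a j) * (lam l * a l) *
       ((if (j - l) + (l - j) = k then 1 else 0) - (if j + l = k then 1 else 0))\<bar>
       \<le> (exp (r * lam j) * exp (r * lam l)) * (\<bar>lam j * a j\<bar> * \<bar>lam l * a l\<bar> * 1)"
      unfolding abs_mult[of "(lam j * a j) * (lam l * a l)"] abs_mult[of "lam j * a j" "lam l * a l"]
      by (intro mult_mono mult_left_mono e i2) auto
    also have "\<dots> = B j * B l" by (simp add: B_def mult_ac)
    also have "\<dots> \<le> ((B j)\<^sup>2 + (B l)\<^sup>2) / 2" using sum_squares_bound[of "B j" "B l"] by simp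
    also have "\<dots> \<le> ((B j)\<^sup>2 * ind j l + (B l)\<^sup>2 * ind l j) / 2"
      using mult_left_mono[OF i1, of "(B j)\<^sup>2"] mult_left_mono[OF i1, of "(B l)\<^sup>2"] unfolding sym[of l j] by simp
    finally show ?thesis .
  next
    case False
    then show ?thesis by (auto simp: ind_def)
  qed
  have "exp (r * lam k) * \<bar>qN N a k\<bar> \<le> (\<Sum>j\<in>{1..N}. \<Sum>l\<in>{1..N}. ((B j)\<^sup>2 * ind j l + (B l)\<^sup>2 * ind l j) / 2) / 2"
  proof -
    have "exp (r * lam k) * \<bar>qN N a k\<bar> = \<bar>exp (r * lam k) * qN N a k\<bar>" by (simp add: abs_mult)
    also have "\<dots> = \<bar>\<Sum>j\<in>{1..N}. \<Sum>l\<in>{1..N}. exp (r * lam k) * ((lam j * a j) * (lam l * a l) *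
     ((if (j - l) + (l - j) = k then 1 else 0) - (if j + l = k then 1 else 0)))\<bar> / 2"
      unfolding qN_expand[OF k] by (simp add: sum_distrib_left)
    also have "\<dots> \<le> (\<Sum>j\<in>{1..N}. \<Sum>l\<in>{1..N}. \<bar>exp (r * lam k) * ((lam j * a j) * (lam l * a l) *
     ((if (j - l) + (l - j) = k then 1 else 0) - (if j + l = k then 1 else 0)))\<bar>) / 2"
      by (intro divide_right_mono order_trans[OF sum_abs] sum_mono sum_abs) auto
    also have "\<dots> \<le> (\<Sum>j\<in>{1..N}. \<Sum>l\<in>{1..N}. ((B j)\<^sup>2 * ind j l + (B l)\<^sup>2 * ind l j) / 2) / 2"
      using t unfolding abs_mult[of "exp (r * lam k)"] abs_exp_cancel by (intro divide_right_mono sum_mono) auto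
    finally show ?thesis .
  qed
  also have "\<dots> = (\<Sum>j\<in>{1..N}. \<Sum>l\<in>{1..N}. (B j)\<^sup>2 * ind j l) / 2"
  proof -
    have "(\<Sum>j\<in>{1..N}. \<Sum>l\<in>{1..N}. (B l)\<^sup>2 * ind l j) = (\<Sum>j\<in>{1..N}. \<Sum>l\<in>{1..N}. (B j)\<^sup>2 * ind j l)"
      by (rule sum.swap)
    then show ?thesis by (simp only: sum_divide_distrib[symmetric] sum.distrib) simp
  qed
  also have "\<dots> \<le> (\<Sum>j\<in>{1..N}. 3 * (B j)\<^sup>2) / 2"
    by (intro divide_right_mono sum_mono ind1) simp
  finally show ?thesis by (simp only: B2 sum_distrib_left[symmetric])
qed

end

text \<open>With a metric on the indices, \<open>nat \<Rightarrow>\<^sub>C real\<close> is the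
  Banach space of bounded sequences, a single state space for the Galerkin systems of every size
  \<open>N\<close>. Distances below 1 force equality, so the metric induces the discrete
  topology.\<close>

instantiation nat :: metric_space
begin

definition dist_nat :: "nat \<Rightarrow> nat \<Rightarrow> real" where "dist_nat m n = \<bar>real m - real n\<bar>"
definition uniformity_nat :: "(nat \<times> nat) filter" where
  "uniformity_nat = (INF e\<in>{0<..}. principal {(x, y). dist x y < e})"

instance
proof
  show "(uniformity :: (nat \<times> nat) filter) = (INF e\<in>{0<..}. principal {(x, y). dist x y < e})"
    by (rule uniformity_nat_def)
  fix U :: "nat set"
  have eq: "x = y" if d: "dist x y < 1" for x y :: nat
  proof (rule linorder_cases[of x y])
    assume "x < y"
    then have "real (Suc x) \<le> real y" by (simp only: of_nat_le_iff Suc_le_eq)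
    then show ?thesis using d by (simp add: dist_nat_def)
  next
    assume "y < x"
    then have "real (Suc y) \<le> real x" by (simp only: of_nat_le_iff Suc_le_eq)
    then show ?thesis using d by (simp add: dist_nat_def)
  qed
  have "\<forall>\<^sub>F (x', y) in uniformity. x' = x \<longrightarrow> y \<in> U" if "x \<in> U" for x
    unfolding uniformity_nat_def
    by (rule eventually_INF1[of 1]) (use that eq in \<open>auto simp: eventually_principal\<close>)
  then show "open U = (\<forall>x\<in>U. \<forall>\<^sub>F (x', y) in uniformity. x' = x \<longrightarrow> y \<in> U)"
    by (simp add: open_discrete)
qed (auto simp: dist_nat_def)

end

instance bcontfun :: (metric_space, banach) banach ..

lemma deriv_nonpos_imp_le_initial:
  fixes f :: "real \<Rightarrow> real"
  assumes d: "\<And>s. s \<in> {0..T} \<Longrightarrow> (f has_real_derivative f' s) (at s within {0..T})"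
    and n: "\<And>s. s \<in> {0..T} \<Longrightarrow> f' s \<le> 0" and t: "t \<in> {0..T}"
  shows "f t \<le> f 0"
proof (cases "t = 0")
  case False
  then have t0: "0 < t" using t by simp
  have "continuous_on {0..T} f" using d by (rule DERIV_continuous_on)
  then have c: "continuous_on {0..t} f" by (rule continuous_on_subset) (use t in auto)
  have "\<exists>y. (f has_real_derivative y) (at x) \<and> y \<le> 0" if x: "0 < x" "x < t" for x
  proof -
    have "at x within {0..T} = at x" using x t by (intro at_within_interior) auto
    then show ?thesis using d[of x] n[of x] x t by auto
  qed
  then show ?thesis using DERIV_nonpos_imp_decreasing_open[OF less_imp_le[OF t0] _ c] by blast
qed simp

section \<open>A priori estimates and global solvability of the Galerkin system\<close>

context interval begin

text \<open>The scalar \<open>\<theta>\<close> may be any function of time, because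
  \<open>energy_cancellation\<close> removes the nonlinearity at each instant; this covers the
  retracted system as well as the original one. The weight \<open>exp (- t)\<close> absorbs the
  unstable low modes.\<close>

lemma galerkin_energy:
  assumes ode: "\<And>k t. k \<in> {1..N} \<Longrightarrow> t \<in> {0..T} \<Longrightarrow>
      (a k has_real_derivative - mu k * a k t - \<theta> t * qN N (\<lambda>j. a j t) k) (at t within {0..T})"
    and t: "t \<in> {0..T}"
  shows "exp (- t) * (\<Sum>k\<in>{1..N}. (lam k)\<^sup>2 * (a k t)\<^sup>2) +
      integral {0..t} (\<lambda>s. exp (- s) * (\<Sum>k\<in>{1..N}. lam k ^ 6 * (a k s)\<^sup>2))
    \<le> (\<Sum>k\<in>{1..N}. (lam k)\<^sup>2 * (a k 0)\<^sup>2)"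
proof -
  define E where "E s = (\<Sum>k\<in>{1..N}. (lam k)\<^sup>2 * (a k s)\<^sup>2)" for s
  define D where "D s = (\<Sum>k\<in>{1..N}. lam k ^ 6 * (a k s)\<^sup>2)" for s
  define E' where "E' s = (\<Sum>k\<in>{1..N}. (lam k)\<^sup>2 * (2 * a k s * (- mu k * a k s - \<theta> s * qN N (\<lambda>j. a j s) k)))" for s
  have ac: "continuous_on {0..T} (a k)" if "k \<in> {1..N}" for k
    using ode[OF that] by (rule DERIV_continuous_on)
  have Dc: "continuous_on {0..T} (\<lambda>s. exp (- s) * D s)"
    unfolding D_def by (intro continuous_intros ac)
  have dE: "(E has_real_derivative E' s) (at s within {0..T})" if s: "s \<in> {0..T}" for s
    unfolding E_def[abs_def] E'_def
  proof (rule DERIV_sum)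
    fix k assume k: "k \<in> {1..N}"
    show "((\<lambda>s. (lam k)\<^sup>2 * (a k s)\<^sup>2) has_real_derivative
        (lam k)\<^sup>2 * (2 * a k s * (- mu k * a k s - \<theta> s * qN N (\<lambda>j. a j s) k))) (at s within {0..T})"
      using ode[OF k s] by (auto intro!: derivative_eq_intros)
  qed
  have E'_le: "E' s - E s + D s \<le> 0" for s
  proof -
    have "E' s = (\<Sum>k\<in>{1..N}. - 2 * (lam k)\<^sup>2 * mu k * (a k s)\<^sup>2) - 2 * \<theta> s * (\<Sum>k\<in>{1..N}. (lam k)\<^sup>2 * a k s * qN N (\<lambda>j. a j s) k)"
      unfolding E'_def sum_distrib_left sum_subtractf[symmetric]
      by (intro sum.cong refl) (simp add: algebra_simps power2_eq_square)
    then have "E' s = (\<Sum>k\<in>{1..N}. - 2 * (lam k)\<^sup>2 * mu k * (a k s)\<^sup>2)"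
      unfolding energy_cancellation by simp
    \<comment> \<open>The linear part completes a square: \<open>- 2 \<lambda>\<^sup>2
      (\<lambda>\<^sup>4 - \<lambda>\<^sup>2) - \<lambda>\<^sup>2 + \<lambda>\<^sup>6 = -
      \<lambda>\<^sup>2 (\<lambda>\<^sup>2 - 1)\<^sup>2\<close> with
      \<open>\<lambda> = lam k\<close>. This fixes the growth rate 1 and the dissipation
      \<open>D\<close> together.\<close>
    then have "E' s - E s + D s = (\<Sum>k\<in>{1..N}. - ((lam k)\<^sup>2 * ((lam k)\<^sup>2 - 1)\<^sup>2 * (a k s)\<^sup>2))"
      unfolding E_def D_def
      by (simp only: sum_subtractf[symmetric] sum.distrib[symmetric])
         (intro sum.cong refl, simp add: mu_def power2_eq_square algebra_simps power_numeral_reduce)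
    also have "\<dots> \<le> 0" by (intro sum_nonpos) simp
    finally show ?thesis .
  qed
  define H where "H s = exp (- s) * E s + integral {0..s} (\<lambda>s. exp (- s) * D s)" for s
  have "H t \<le> H 0"
  proof (rule deriv_nonpos_imp_le_initial[OF _ _ t])
    fix s assume s: "s \<in> {0..T}"
    have "((\<lambda>s. integral {0..s} (\<lambda>s. exp (- s) * D s)) has_real_derivative exp (- s) * D s) (at s within {0..T})"
      unfolding has_real_derivative_iff_has_vector_derivative
      by (rule integral_has_vector_derivative[OF Dc s])
    then show "(H has_real_derivative exp (- s) * (E' s - E s + D s)) (at s within {0..T})"
      unfolding H_def[abs_def] using dE[OF s] by (auto intro!: derivative_eq_intros simp: algebra_simps)
    show "exp (- s) * (E' s - E s + D s) \<le> 0"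
      using E'_le[of s] by (simp add: mult_le_0_iff)
  qed
  then show ?thesis by (simp add: H_def E_def D_def)
qed

lemma galerkin_energy_bounds:
  assumes ode: "\<And>k t. k \<in> {1..N} \<Longrightarrow> t \<in> {0..T} \<Longrightarrow>
      (a k has_real_derivative - mu k * a k t - \<theta> t * qN N (\<lambda>j. a j t) k) (at t within {0..T})"
    and t: "t \<in> {0..T}"
  shows "(\<Sum>k\<in>{1..N}. (lam k)\<^sup>2 * (a k t)\<^sup>2) \<le> exp T * (\<Sum>k\<in>{1..N}. (lam k)\<^sup>2 * (a k 0)\<^sup>2)"
    "integral {0..T} (\<lambda>s. \<Sum>k\<in>{1..N}. lam k ^ 6 * (a k s)\<^sup>2) \<le> exp T * (\<Sum>k\<in>{1..N}. (lam k)\<^sup>2 * (a k 0)\<^sup>2)"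
proof -
  define E where "E s = (\<Sum>k\<in>{1..N}. (lam k)\<^sup>2 * (a k s)\<^sup>2)" for s
  define D where "D s = (\<Sum>k\<in>{1..N}. lam k ^ 6 * (a k s)\<^sup>2)" for s
  have en: "exp (- s) * E s + integral {0..s} (\<lambda>s. exp (- s) * D s) \<le> E 0" if "s \<in> {0..T}" for s
    unfolding E_def D_def by (rule galerkin_energy[OF ode that])
  have ac: "continuous_on {0..T} (a k)" if "k \<in> {1..N}" for k
    using ode[OF that] by (rule DERIV_continuous_on)
  have Dc1: "continuous_on {0..T} D"
    unfolding D_def by (intro continuous_intros ac)
  have Dc: "continuous_on {0..T} D" "continuous_on {0..T} (\<lambda>s. exp (- s) * D s)"
    by (intro continuous_intros Dc1)+
  have D0: "0 \<le> D s" and E0: "0 \<le> E s" for s unfolding D_def E_def by (intro sum_nonneg; simp)+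
  have i0: "0 \<le> integral {0..s} (\<lambda>s. exp (- s) * D s)" for s
    by (cases "(\<lambda>s. exp (- s) * D s) integrable_on {0..s}")
       (auto intro!: integral_nonneg simp: D0 not_integrable_integral)
  have "exp (- t) * E t \<le> E 0" using en[OF t] i0[of t] by linarith
  then have "exp t * (exp (- t) * E t) \<le> exp t * E 0" by (rule mult_left_mono) simp
  also have "exp t * (exp (- t) * E t) = E t" by (simp add: mult.assoc[symmetric] flip: exp_add)
  also have "exp t * E 0 \<le> exp T * E 0" using t E0 by (intro mult_right_mono) auto
  finally show "(\<Sum>k\<in>{1..N}. (lam k)\<^sup>2 * (a k t)\<^sup>2) \<le> exp T * (\<Sum>k\<in>{1..N}. (lam k)\<^sup>2 * (a k 0)\<^sup>2)"
    by (simp add: E_def)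
  have T: "T \<in> {0..T}" using t by simp
  have "integral {0..T} D \<le> integral {0..T} (\<lambda>s. exp T * (exp (- s) * D s))"
  proof (rule integral_le)
    show "D integrable_on {0..T}" by (rule integrable_continuous_real[OF Dc(1)])
    show "(\<lambda>s. exp T * (exp (- s) * D s)) integrable_on {0..T}"
      by (intro integrable_continuous_real continuous_on_mult_left Dc(2))
    fix s assume "s \<in> {0..T}"
    then have "1 \<le> exp T * exp (- s)" by (simp flip: exp_add)
    then have "1 * D s \<le> (exp T * exp (- s)) * D s" by (rule mult_right_mono[OF _ D0])
    then show "D s \<le> exp T * (exp (- s) * D s)" by (simp add: mult.assoc)
  qed
  also have "\<dots> = exp T * integral {0..T} (\<lambda>s. exp (- s) * D s)" by simp
  also have "\<dots> \<le> exp T * E 0"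
  proof (rule mult_left_mono)
    have "0 \<le> exp (- T) * E T" using E0 by simp
    then show "integral {0..T} (\<lambda>s. exp (- s) * D s) \<le> E 0" using en[OF T] by linarith
  qed simp
  finally show "integral {0..T} (\<lambda>s. \<Sum>k\<in>{1..N}. lam k ^ 6 * (a k s)\<^sup>2) \<le> exp T * (\<Sum>k\<in>{1..N}. (lam k)\<^sup>2 * (a k 0)\<^sup>2)"
    unfolding D_def E_def .
qed

text \<open>The Galerkin nonlinearity is composed with the radial retraction onto a ball, which makes the
  system globally Lipschitz.  The retraction multiplies the nonlinearity by a scalar, so the energy
  estimate is unaffected and shows that the solution never leaves the ball.\<close>

lemma galerkin_solution_exists:
  assumes T: "0 \<le> T"
  shows "\<exists>a. (\<forall>k\<in>{1..N}. a k 0 = \<alpha> k \<and> (\<forall>t\<in>{0..T}.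
      (a k has_real_derivative - mu k * a k t - 1 / 2 * qN N (\<lambda>j. a j t) k) (at t within {0..T})))"
proof -
  define G where "G = (\<Sum>j\<in>{1..N}. lam j)"
  define E0 where "E0 = (\<Sum>k\<in>{1..N}. (lam k)\<^sup>2 * (\<alpha> k)\<^sup>2)"
  \<comment> \<open>The energy bound gives \<open>lam 1 * |a k| \<le> sqrt (exp T * E0)\<close>, so
    solutions stay within this radius in the sup norm; the \<open>+ 1\<close> keeps \<open>R\<close>
    positive.\<close>
  define R where "R = sqrt (exp T * E0) / lam 1 + 1"
  have l1: "0 < lam 1" by (rule lam_pos) simp
  have E0: "0 \<le> E0" unfolding E0_def by (intro sum_nonneg) simp
  have R: "0 < R" using E0 l1 unfolding R_def by (intro add_nonneg_pos) auto
  define f where "f v k = (if k \<in> {1..N} then - mu k * apply_bcontfun v k - 1 / 2 * qN N (apply_bcontfun (retract R v)) k else 0)"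
    for v :: "nat \<Rightarrow>\<^sub>C real" and k
  define F where "F v = Bcontfun (f v)" for v
  have finsupp: "g \<in> bcontfun" if "\<And>k. k \<notin> {1..N} \<Longrightarrow> g k = 0" for g :: "nat \<Rightarrow> real"
  proof -
    have "range g \<subseteq> insert 0 (g ` {1..N})"
    proof
      fix y assume "y \<in> range g"
      then obtain k where "y = g k" by blast
      then show "y \<in> insert 0 (g ` {1..N})" using that[of k] by (cases "k \<in> {1..N}") auto
    qed
    then have "finite (range g)" by (rule finite_subset) simp
    then have "bounded (range g)" by (rule finite_imp_bounded)
    moreover have "continuous_on UNIV g" by simp
    ultimately show ?thesis by (simp add: bcontfun_def)
  qed
  have Fa: "apply_bcontfun (F v) k = f v k" for v k
    unfolding F_def by (subst Bcontfun_inverse[OF finsupp]) (auto simp: f_def)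
  \<comment> \<open>\<open>4 * G\<^sup>2 * R\<close> is the 1/2 of the nonlinearity times the
    \<open>8 * G\<^sup>2 * R\<close> found below: two bilinear terms, each with a factor 2 from
    \<open>BN_bound\<close> and a factor 2 from \<open>retract_lipschitz\<close>.\<close>
  define K where "K = (\<Sum>k\<in>{1..N}. \<bar>mu k\<bar>) + 4 * G\<^sup>2 * R + 1"
  have K: "0 < K" unfolding K_def using R by (intro add_nonneg_pos add_nonneg_nonneg sum_nonneg) auto
  have lip: "norm (F v - F w) \<le> K * norm (v - w)" for v w
  proof (rule norm_bound)
    fix k
    show "norm (apply_bcontfun (F v - F w) k) \<le> K * norm (v - w)"
    proof (cases "k \<in> {1..N}")
      case True
      let ?a = "apply_bcontfun (retract R v)" and ?b = "apply_bcontfun (retract R w)"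
      have ab: "\<bar>?a j\<bar> \<le> R" "\<bar>?b j\<bar> \<le> R" for j
        using norm_bounded[of "retract R v" j] norm_bounded[of "retract R w" j]
          norm_retract_le[OF R, of v] norm_retract_le[OF R, of w] by auto
      have d: "\<bar>?a j - ?b j\<bar> \<le> 2 * norm (v - w)" for j
        using norm_bounded[of "retract R v - retract R w" j] retract_lipschitz[OF R, of v w] by simp
      have "\<bar>qN N ?a k - qN N ?b k\<bar> \<le> \<bar>BN N (\<lambda>j. ?a j - ?b j) ?a k\<bar> + \<bar>BN N ?b (\<lambda>j. ?a j - ?b j) k\<bar>"
        unfolding qN_BN BN_diff by (rule abs_triangle_ineq)
      also have "\<dots> \<le> 2 * G\<^sup>2 * (2 * norm (v - w)) * R + 2 * G\<^sup>2 * R * (2 * norm (v - w))"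
        unfolding G_def using R by (intro add_mono BN_bound ab d) auto
      finally have q: "\<bar>qN N ?a k - qN N ?b k\<bar> \<le> 8 * G\<^sup>2 * R * norm (v - w)"
        by (simp add: mult_ac)
      have vw: "\<bar>apply_bcontfun v k - apply_bcontfun w k\<bar> \<le> norm (v - w)"
        using norm_bounded[of "v - w" k] by simp
      have "apply_bcontfun (F v - F w) k = - mu k * (apply_bcontfun v k - apply_bcontfun w k) - 1 / 2 * (qN N ?a k - qN N ?b k)"
        using True by (simp add: Fa f_def algebra_simps)
      then have "norm (apply_bcontfun (F v - F w) k) \<le> \<bar>mu k\<bar> * \<bar>apply_bcontfun v k - apply_bcontfun w k\<bar> + 1 / 2 * \<bar>qN N ?a k - qN N ?b k\<bar>"
        using abs_triangle_ineq4[of "- mu k * (apply_bcontfun v k - apply_bcontfun w k)" "1 / 2 * (qN N ?a k - qN N ?b k)"]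
        by (simp add: abs_mult)
      also have "\<dots> \<le> (\<Sum>k\<in>{1..N}. \<bar>mu k\<bar>) * norm (v - w) + 1 / 2 * (8 * G\<^sup>2 * R * norm (v - w))"
        using True by (intro add_mono mult_mono q vw member_le_sum sum_nonneg) auto
      also have "\<dots> \<le> K * norm (v - w)" by (simp add: K_def algebra_simps)
      finally show ?thesis .
    next
      case False
      then show ?thesis using K by (auto simp: Fa f_def)
    qed
  qed
  define x0 where "x0 = Bcontfun (\<lambda>k. if k \<in> {1..N} then \<alpha> k else 0)"
  have x0: "apply_bcontfun x0 k = (if k \<in> {1..N} then \<alpha> k else 0)" for k
    unfolding x0_def by (subst Bcontfun_inverse[OF finsupp]) auto
  obtain x where x: "x 0 = x0" "\<And>t. t \<in> {0..T} \<Longrightarrow> (x has_vector_derivative F (x t)) (at t within {0..T})"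
    using lipschitz_ode_solution[of F K, OF lip K T] by blast
  define a where "a k t = apply_bcontfun (x t) k" for k t
  have bl: "bounded_linear (\<lambda>v. apply_bcontfun v k)" for k :: nat
    by (rule bounded_linear_intro[where K = 1]) (simp_all add: norm_bounded del: real_norm_def)
  have da: "(a k has_vector_derivative f (x t) k) (at t within {0..T})" if "t \<in> {0..T}" for k t
    using bounded_linear.has_vector_derivative[OF bl x(2)[OF that], of k]
    unfolding a_def[abs_def] Fa .
  have a0: "a k 0 = (if k \<in> {1..N} then \<alpha> k else 0)" for k by (simp add: a_def x x0)
  \<comment> \<open>\<open>qN\<close> is quadratic, so the retraction contributes the square of its
    scalar factor. Inside the ball this is 1, and the original coefficient 1/2 returns.\<close>
  define \<theta> where "\<theta> t = (1 / max 1 (norm (x t) / R))\<^sup>2 / 2" for t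
  have ode: "(a k has_real_derivative - mu k * a k t - \<theta> t * qN N (\<lambda>j. a j t) k) (at t within {0..T})"
    if k: "k \<in> {1..N}" and t: "t \<in> {0..T}" for k t
  proof -
    have "apply_bcontfun (retract R (x t)) = (\<lambda>j. (1 / max 1 (norm (x t) / R)) * a j t)"
      by (auto simp: retract_def a_def fun_eq_iff)
    then have "f (x t) k = - mu k * a k t - \<theta> t * qN N (\<lambda>j. a j t) k"
      using k by (simp only: f_def qN_scale if_True a_def \<theta>_def)
    then show ?thesis using da[OF t, of k] by (simp add: has_real_derivative_iff_has_vector_derivative)
  qed
  \<comment> \<open>The norm is a supremum over all indices, so the components at 0 and beyond
    \<open>N\<close> have to be controlled as well.\<close>
  have outside: "a k t = 0" if k: "k \<notin> {1..N}" and t: "t \<in> {0..T}" for k t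
  proof -
    have "(a k has_vector_derivative 0) (at s within {0..T})" if "s \<in> {0..T}" for s
      using da[OF that, of k] k by (auto simp: f_def)
    then obtain c where "\<And>s. s \<in> {0..T} \<Longrightarrow> a k s = c"
      using has_vector_derivative_zero_constant[of "{0..T}" "a k"] by auto
    then have "a k t = a k 0" using t T by auto
    then show ?thesis using a0[of k] k by auto
  qed
  have small: "norm (x t) \<le> R" if t: "t \<in> {0..T}" for t
  proof (rule norm_bound)
    fix k
    show "norm (apply_bcontfun (x t) k) \<le> R"
    proof (cases "k \<in> {1..N}")
      case True
      have "(lam 1 * \<bar>a k t\<bar>)\<^sup>2 = (lam 1)\<^sup>2 * (a k t)\<^sup>2" by (simp add: power_mult_distrib)
      also have "\<dots> \<le> (lam k)\<^sup>2 * (a k t)\<^sup>2"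
        using True by (intro mult_right_mono power_mono lam_mono) auto
      also have "\<dots> \<le> (\<Sum>k\<in>{1..N}. (lam k)\<^sup>2 * (a k t)\<^sup>2)"
        using True by (intro member_le_sum) auto
      also have "\<dots> \<le> exp T * E0"
        using galerkin_energy_bounds(1)[OF ode t] unfolding E0_def a0 by simp
      finally have "lam 1 * \<bar>a k t\<bar> \<le> sqrt (exp T * E0)" by (rule real_le_rsqrt)
      then have "\<bar>a k t\<bar> \<le> sqrt (exp T * E0) / lam 1"
        using l1 by (simp only: pos_le_divide_eq mult.commute)
      then show ?thesis by (simp add: R_def a_def)
    next
      case False
      then show ?thesis using outside[OF False t] R by (simp add: a_def)
    qed
  qed
  have \<theta>: "\<theta> t = 1 / 2" if "t \<in> {0..T}" for t
    using small[OF that] R by (simp add: \<theta>_def max_def)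
  show ?thesis
  proof (intro exI[of _ a] ballI conjI)
    fix k t assume k: "k \<in> {1..N}" and t: "t \<in> {0..T}"
    show "(a k has_real_derivative - mu k * a k t - 1 / 2 * qN N (\<lambda>j. a j t) k) (at t within {0..T})"
      using ode[OF k t] unfolding \<theta>[OF t] .
  qed (simp add: a0)
qed

text \<open>The exponential weight costs \<open>k\<close> in the linear part, which the fourth-order dissipation absorbs;
  the remaining Riccati inequality \<open>Z' \<le> C Z\<^sup>2\<close> is integrated through \<open>1 / Z\<close>.\<close>

lemma galerkin_gevrey:
  assumes ode: "\<And>k t. k \<in> {1..N} \<Longrightarrow> t \<in> {0..T} \<Longrightarrow>
      (a k has_real_derivative - mu k * a k t - 1 / 2 * qN N (\<lambda>j. a j t) k) (at t within {0..T})"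
    and E: "\<And>t. t \<in> {0..T} \<Longrightarrow> (\<Sum>k\<in>{1..N}. (lam k)\<^sup>2 * (a k t)\<^sup>2) \<le> m"
    and t: "t \<in> {0..T}" and s: "0 \<le> s" "s \<le> t" "2 * (4 + S0) * (1 + m) * s \<le> 1"
  shows "(\<Sum>k\<in>{1..N}. exp (2 * s * lam k) * (lam k)\<^sup>2 * (a k t)\<^sup>2) \<le> 2 * (1 + m)"
proof -
  \<comment> \<open>The clock restarts at \<open>t - s\<close>: the weight exponent \<open>r\<close>
    equals the elapsed time, so at \<open>r = 0\<close> only the plain energy is involved.\<close>
  define b where "b k r = a k (t - s + r)" for k r
  define Y where "Y r = (\<Sum>k\<in>{1..N}. exp (2 * r * lam k) * (lam k)\<^sup>2 * (b k r)\<^sup>2)" for r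
  define q where "q k r = qN N (\<lambda>j. b j r) k" for k r
  define Y' where "Y' r = (\<Sum>k\<in>{1..N}. exp (2 * r * lam k) * (lam k)\<^sup>2 *
      (2 * lam k * (b k r)\<^sup>2 + 2 * b k r * (- mu k * b k r - 1 / 2 * q k r)))" for r
  have m0: "0 \<le> m" using order_trans[OF sum_nonneg E[OF t]] by simp
  have Y0: "0 \<le> Y r" for r unfolding Y_def by (intro sum_nonneg) simp
  have db: "(b k has_real_derivative - mu k * b k r - 1 / 2 * q k r) (at r within {0..s})"
    if k: "k \<in> {1..N}" and r: "r \<in> {0..s}" for k r
  proof -
    have tr: "t - s + r \<in> {0..T}" using r s t by auto
    have g: "((\<lambda>r. t - s + r) has_real_derivative 1) (at r within {0..s})"
      by (auto intro!: derivative_eq_intros)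
    have im: "(\<lambda>r. t - s + r) ` {0..s} \<subseteq> {0..T}" using s t by auto
    have "((a k \<circ> (\<lambda>r. t - s + r)) has_real_derivative (- mu k * b k r - 1 / 2 * q k r) * 1) (at r within {0..s})"
      by (rule DERIV_image_chain[OF DERIV_subset[OF _ im] g])
         (use ode[OF k tr] in \<open>simp add: b_def q_def\<close>)
    then show ?thesis by (simp add: o_def b_def[abs_def])
  qed
  have dY: "(Y has_real_derivative Y' r) (at r within {0..s})" if r: "r \<in> {0..s}" for r
    unfolding Y_def[abs_def] Y'_def
  proof (rule DERIV_sum)
    fix k assume k: "k \<in> {1..N}"
    have e: "((\<lambda>r. exp (2 * r * lam k)) has_real_derivative 2 * lam k * exp (2 * r * lam k)) (at r within {0..s})"
      by (auto intro!: derivative_eq_intros)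
    have p: "((\<lambda>r. (b k r)\<^sup>2) has_real_derivative 2 * b k r * (- mu k * b k r - 1 / 2 * q k r)) (at r within {0..s})"
      by (rule DERIV_cong[OF DERIV_power[OF db[OF k r]]]) simp
    have "((\<lambda>r. (exp (2 * r * lam k) * (lam k)\<^sup>2) * (b k r)\<^sup>2) has_real_derivative
        (exp (2 * r * lam k) * (lam k)\<^sup>2) * (2 * b k r * (- mu k * b k r - 1 / 2 * q k r))
        + (2 * lam k * exp (2 * r * lam k) * (lam k)\<^sup>2) * (b k r)\<^sup>2) (at r within {0..s})"
      by (rule DERIV_mult'[OF DERIV_cmult_right[OF e] p])
    then show "((\<lambda>r. exp (2 * r * lam k) * (lam k)\<^sup>2 * (b k r)\<^sup>2) has_real_derivative
        exp (2 * r * lam k) * (lam k)\<^sup>2 * (2 * lam k * (b k r)\<^sup>2 + 2 * b k r * (- mu k * b k r - 1 / 2 * q k r)))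
        (at r within {0..s})"
      by (rule DERIV_cong) (simp add: algebra_simps)
  qed
  have Y'_le: "Y' r \<le> (4 + S0) * (1 + Y r)\<^sup>2" if r: "r \<in> {0..s}" for r
  proof -
    define w where "w k = exp (r * lam k) * (lam k * \<bar>b k r\<bar>)" for k
    have ee: "exp (2 * r * lam k) = (exp (r * lam k))\<^sup>2" for k
      by (simp add: power2_eq_square flip: exp_add)
    have w2: "(w k)\<^sup>2 = exp (2 * r * lam k) * (lam k)\<^sup>2 * (b k r)\<^sup>2" for k
      by (simp add: w_def ee power_mult_distrib)
    have summand: "exp (2 * r * lam k) * (lam k)\<^sup>2 * (2 * lam k * (b k r)\<^sup>2 + 2 * b k r * (- mu k * b k r - 1 / 2 * q k r))
        \<le> 4 * (w k)\<^sup>2 + (Y r)\<^sup>2 * (1 / (lam k)\<^sup>2)" if k: "k \<in> {1..N}" for k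
    proof -
      have lk: "0 < lam k" using k by (intro lam_pos) auto
      have Q: "exp (r * lam k) * \<bar>q k r\<bar> \<le> 3 / 2 * Y r"
        unfolding q_def Y_def using k r by (intro qN_gevrey_bound) auto
      have "- (exp (2 * r * lam k) * (lam k)\<^sup>2 * b k r * q k r) \<le> \<bar>exp (2 * r * lam k) * (lam k)\<^sup>2 * b k r * q k r\<bar>"
        by linarith
      also have "\<dots> = lam k * w k * (exp (r * lam k) * \<bar>q k r\<bar>)"
        unfolding ee by (simp add: abs_mult w_def power2_eq_square mult_ac)
      also have "\<dots> \<le> lam k * w k * (3 / 2 * Y r)"
        by (intro mult_left_mono Q) (simp add: w_def)
      \<comment> \<open>Split for Young's inequality: one of the two multiples of
        \<open>lam k ^ 4 * (w k)\<^sup>2\<close> in the dissipation is spent, and the leftover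
        \<open>(Y r)\<^sup>2 / (lam k)\<^sup>2\<close> sums to at most
        \<open>S0 * (Y r)\<^sup>2\<close>.\<close>
      also have "\<dots> = 2 * ((lam k)\<^sup>2 * w k) * (3 / 4 * Y r / lam k)"
        using lk by (simp add: power2_eq_square)
      also have "\<dots> \<le> ((lam k)\<^sup>2 * w k)\<^sup>2 + (3 / 4 * Y r / lam k)\<^sup>2" by (rule sum_squares_bound)
      also have "(3 / 4 * Y r / lam k)\<^sup>2 = 9 / 16 * ((Y r)\<^sup>2 * (1 / (lam k)\<^sup>2))"
        by (simp add: power_divide power_mult_distrib power2_eq_square)
      also have "\<dots> \<le> (Y r)\<^sup>2 * (1 / (lam k)\<^sup>2)"
      proof -
        have "0 \<le> (Y r)\<^sup>2 * (1 / (lam k)\<^sup>2)" by simp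
        then show ?thesis by linarith
      qed
      also have "((lam k)\<^sup>2 * w k)\<^sup>2 = lam k ^ 4 * (w k)\<^sup>2" by (simp add: power_mult_distrib flip: power_mult)
      finally have n: "- (exp (2 * r * lam k) * (lam k)\<^sup>2 * b k r * q k r) \<le> lam k ^ 4 * (w k)\<^sup>2 + (Y r)\<^sup>2 * (1 / (lam k)\<^sup>2)"
        by simp
      \<comment> \<open>The term \<open>2 * lam k\<close> comes from the growing weight. The two
        squares show that the left side is at most 13/4, rounded up to 4.\<close>
      have lin: "2 * lam k - 2 * mu k + lam k ^ 4 \<le> 4"
      proof -
        have "0 \<le> (lam k - 1)\<^sup>2 + ((lam k)\<^sup>2 - 3 / 2)\<^sup>2" by simp
        then show ?thesis by (simp add: mu_def power2_eq_square power4_eq_xxxx algebra_simps)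
      qed
      have "exp (2 * r * lam k) * (lam k)\<^sup>2 * (2 * lam k * (b k r)\<^sup>2 + 2 * b k r * (- mu k * b k r - 1 / 2 * q k r))
        = (2 * lam k - 2 * mu k) * (w k)\<^sup>2 - exp (2 * r * lam k) * (lam k)\<^sup>2 * b k r * q k r"
        unfolding w2 by (simp add: algebra_simps power2_eq_square)
      also have "\<dots> \<le> (2 * lam k - 2 * mu k) * (w k)\<^sup>2 + (lam k ^ 4 * (w k)\<^sup>2 + (Y r)\<^sup>2 * (1 / (lam k)\<^sup>2))"
        using n by linarith
      also have "\<dots> = (2 * lam k - 2 * mu k + lam k ^ 4) * (w k)\<^sup>2 + (Y r)\<^sup>2 * (1 / (lam k)\<^sup>2)"
        by (simp add: algebra_simps)
      also have "\<dots> \<le> 4 * (w k)\<^sup>2 + (Y r)\<^sup>2 * (1 / (lam k)\<^sup>2)"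
        by (intro add_right_mono mult_right_mono lin) simp
      finally show ?thesis .
    qed
    have "Y' r \<le> (\<Sum>k\<in>{1..N}. 4 * (w k)\<^sup>2 + (Y r)\<^sup>2 * (1 / (lam k)\<^sup>2))"
      unfolding Y'_def by (rule sum_mono[OF summand])
    also have "\<dots> = 4 * Y r + (Y r)\<^sup>2 * (\<Sum>k\<in>{1..N}. 1 / (lam k)\<^sup>2)"
      unfolding sum.distrib sum_distrib_left[symmetric] w2 Y_def by simp
    also have "\<dots> \<le> 4 * Y r + (Y r)\<^sup>2 * S0"
      by (intro add_left_mono mult_left_mono sum_inverse_lam2_le) auto
    also have "\<dots> \<le> 4 * (1 + Y r)\<^sup>2 + (1 + Y r)\<^sup>2 * S0"
    proof (intro add_mono mult_right_mono S0_nonneg power_mono)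
      show "4 * Y r \<le> 4 * (1 + Y r)\<^sup>2" using Y0[of r] by (simp add: power2_sum)
    qed (use Y0 in auto)
    finally show ?thesis by (simp add: algebra_simps)
  qed
  have "- 1 / (1 + Y s) - (4 + S0) * s \<le> - 1 / (1 + Y 0) - (4 + S0) * 0"
  proof (rule deriv_nonpos_imp_le_initial[where T = s])
    fix r assume r: "r \<in> {0..s}"
    have nz: "1 + Y r \<noteq> 0" using Y0[of r] by linarith
    show "((\<lambda>r. - 1 / (1 + Y r) - (4 + S0) * r) has_real_derivative Y' r / (1 + Y r)\<^sup>2 - (4 + S0)) (at r within {0..s})"
      using nz by (auto intro!: derivative_eq_intros dY[OF r] simp: power2_eq_square)
    have "0 < (1 + Y r)\<^sup>2" using Y0[of r] by (intro zero_less_power) linarith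
    then have "Y' r / (1 + Y r)\<^sup>2 \<le> 4 + S0"
      using Y'_le[OF r] by (simp only: pos_divide_le_eq)
    then show "Y' r / (1 + Y r)\<^sup>2 - (4 + S0) \<le> 0" by simp
  qed (use s in auto)
  then have main: "1 / (1 + Y 0) - (4 + S0) * s \<le> 1 / (1 + Y s)" by simp
  have "Y 0 \<le> m"
    unfolding Y_def b_def using E[of "t - s"] s t by simp
  then have a: "1 / (1 + m) \<le> 1 / (1 + Y 0)" using Y0[of 0] by (intro divide_left_mono) auto
  \<comment> \<open>The admissible length of \<open>s\<close> leaves half of
    \<open>1 / (1 + m)\<close>, which becomes the final bound \<open>2 * (1 + m)\<close>.\<close>
  have c: "(4 + S0) * s \<le> 1 / (1 + m) / 2"
    using s(3) m0 by (simp add: pos_le_divide_eq algebra_simps)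
  have arith: "p / 2 \<le> v" if "w - z \<le> v" "p \<le> w" "z \<le> p / 2" for p v w z :: real
    using that by linarith
  have "1 / (1 + m) / 2 \<le> 1 / (1 + Y s)" by (rule arith[OF main a c])
  then have "1 + Y s \<le> 2 * (1 + m)"
    using Y0[of s] m0 by (simp add: divide_simps)
  then show ?thesis unfolding Y_def b_def by simp
qed

end

section \<open>Passage to the limit\<close>

lemma indefinite_integral_continuous_lebesgue:
  fixes f :: "real \<Rightarrow> real"
  assumes f: "integrable (lebesgue_on {0..T}) f"
  shows "continuous_on {0..T} (\<lambda>t. \<integral>s. f s \<partial>lebesgue_on {0..t})"
    and "\<And>t. t \<in> {0..T} \<Longrightarrow> integrable (lebesgue_on {0..t}) f"
proof -
  have sub: "integrable (lebesgue_on {0..t}) f" if "t \<in> {0..T}" for t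
  proof -
    have "set_integrable lebesgue {0..T} f"
      using f by (simp add: set_integrable_def integrable_restrict_space)
    then have "set_integrable lebesgue {0..t} f"
      by (rule set_integrable_subset) (use that in auto)
    then show ?thesis by (simp add: set_integrable_def integrable_restrict_space)
  qed
  then show "\<And>t. t \<in> {0..T} \<Longrightarrow> integrable (lebesgue_on {0..t}) f" .
  have "f integrable_on {0..T}"
    by (rule integrable_on_lebesgue_on[OF f]) simp
  then have "continuous_on {0..T} (\<lambda>t. integral {0..t} f)"
    by (rule indefinite_integral_continuous_1)
  moreover have "integral {0..t} f = (\<integral>s. f s \<partial>lebesgue_on {0..t})" if "t \<in> {0..T}" for t
    using lebesgue_integral_eq_integral[OF sub[OF that]] by simp
  ultimately show "continuous_on {0..T} (\<lambda>t. \<integral>s. f s \<partial>lebesgue_on {0..t})"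
    by (rule continuous_on_eq)
qed

lemma continuous_imp_integrable_lebesgue_on:
  fixes f :: "real \<Rightarrow> real"
  assumes "continuous_on {a..b} f"
  shows "integrable (lebesgue_on {a..b}) f"
  using absolutely_integrable_continuous_real[OF assms]
  by (simp add: set_integrable_def integrable_restrict_space)

section \<open>The nonlinearity of an infinite coefficient sequence\<close>

context interval begin

lemma gx_cong: "(\<And>j. j \<in> {1..N} \<Longrightarrow> a j = b j) \<Longrightarrow> gx N a = gx N b"
  unfolding gx_def[abs_def] by (intro ext sum.cong refl) auto

lemma qN_cong: "(\<And>j. j \<in> {1..N} \<Longrightarrow> a j = b j) \<Longrightarrow> qN N a k = qN N b k"
  unfolding qN_def using gx_cong[of N a b] by simp

text \<open>Parseval read off the coefficient of index 0: by orthogonality of the sines only the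
  diagonal of the double sum contributes to the mean of the square.\<close>

lemma integral_gx_square: "(\<integral>x. (gx N a x)\<^sup>2 \<partial>M) = L / 2 * (\<Sum>j\<in>{1..N}. (lam j)\<^sup>2 * (a j)\<^sup>2)"
proof -
  have o: "ft (\<lambda>x. sn j x * sn l x) 0 = (if l = j then 1 / 2 else 0)" if "j \<in> {1..N}" "l \<in> {1..N}" for j l
    using that L_pos by (auto simp: ft_def orthogonal_sn nrm_def)
  have "qN N a 0 = (\<Sum>j\<in>{1..N}. \<Sum>l\<in>{1..N}. if l = j then (lam j)\<^sup>2 * (a j)\<^sup>2 / 2 else 0)"
    unfolding qN_poly by (intro sum.cong refl) (auto simp: o power2_eq_square)
  also have "\<dots> = (\<Sum>j\<in>{1..N}. (lam j)\<^sup>2 * (a j)\<^sup>2 / 2)"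
    by (intro sum.cong refl) simp
  finally have "qN N a 0 = (\<Sum>j\<in>{1..N}. (lam j)\<^sup>2 * (a j)\<^sup>2) / 2" by (simp only: sum_divide_distrib)
  moreover have "(\<integral>x. (gx N a x)\<^sup>2 \<partial>M) = L * qN N a 0"
    using L_pos by (simp add: qN_def ft_def nrm_def)
  ultimately show ?thesis by simp
qed

lemma abs_qN_le: "\<bar>qN N a k\<bar> \<le> (\<Sum>j\<in>{1..N}. (lam j)\<^sup>2 * (a j)\<^sup>2)"
proof -
  have "\<bar>\<integral>x. (gx N a x)\<^sup>2 * cs k x \<partial>M\<bar> \<le> (\<integral>x. \<bar>(gx N a x)\<^sup>2 * cs k x\<bar> \<partial>M)"
    by (rule integral_abs_bound)
  also have "\<dots> \<le> (\<integral>x. (gx N a x)\<^sup>2 \<partial>M)"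
  proof (rule integral_mono)
    show "\<bar>(gx N a x)\<^sup>2 * cs k x\<bar> \<le> (gx N a x)\<^sup>2" for x using abs_trig_le(1)[of "(gx N a x)\<^sup>2" k x] by simp
  qed (intro continuous_integrable_M continuous_intros)+
  finally have b: "\<bar>\<integral>x. (gx N a x)\<^sup>2 * cs k x \<partial>M\<bar> \<le> L / 2 * (\<Sum>j\<in>{1..N}. (lam j)\<^sup>2 * (a j)\<^sup>2)"
    unfolding integral_gx_square .
  also have "\<dots> \<le> nrm k * (\<Sum>j\<in>{1..N}. (lam j)\<^sup>2 * (a j)\<^sup>2)"
    by (intro mult_right_mono nrm_ge sum_nonneg) simp
  finally show ?thesis unfolding qN_def ft_def
    by (simp only: abs_divide abs_of_pos[OF nrm_pos] pos_divide_le_eq[OF nrm_pos] mult.commute)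
qed

text \<open>Minus the derivative of \<open>cser a\<close>, and the limit of
  \<open>gx\<close>.\<close>

definition ux :: "(nat \<Rightarrow> real) \<Rightarrow> real \<Rightarrow> real" where "ux a = sser (\<lambda>j. lam j * a j)"

lemma ux_eq: "ux a x = (\<Sum>k. lam k * a k * sn k x)"
  by (simp add: ux_def sser_def)

text \<open>Convergence of each coefficient is upgraded by the common summable majorant
  \<open>B\<close>: Tannery's theorem gives pointwise convergence of the derivatives with a uniform
  bound, and dominated convergence passes to the coefficients of their squares.\<close>

lemma
  assumes N: "filterlim N at_top sequentially" and b: "\<And>k. (\<lambda>n. b n k) \<longlonglongrightarrow> a k"
    and B: "\<And>n k. lam k * \<bar>b n k\<bar> \<le> B k" and sB: "summable B"
  shows summable_limit: "summable (\<lambda>k. lam k * \<bar>a k\<bar>)"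
    and qN_tendsto: "(\<lambda>n. qN (N n) (b n) k) \<longlonglongrightarrow> ft (\<lambda>x. (ux a x)\<^sup>2) k"
proof -
  have Bk: "lam k * \<bar>a k\<bar> \<le> B k" for k
  proof (rule tendsto_upperbound)
    show "(\<lambda>n. lam k * \<bar>b n k\<bar>) \<longlonglongrightarrow> lam k * \<bar>a k\<bar>" by (intro tendsto_intros b)
  qed (use B in auto)
  show sa: "summable (\<lambda>k. lam k * \<bar>a k\<bar>)"
    by (rule summable_comparison_test'[OF sB, of 0]) (use Bk in simp)
  have B0: "0 \<le> B k" for k using Bk[of k] by (rule order_trans[rotated]) simp
  have g: "(\<lambda>n. gx (N n) (b n) x) \<longlonglongrightarrow> ux a x" for x
  proof -
    define c where "c k n = (if k \<in> {1..N n} then lam k * b n k * sn k x else 0)" for k n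
    have c_lim: "(\<lambda>n. c k n) \<longlonglongrightarrow> lam k * a k * sn k x" for k
    proof (cases "k = 0")
      case False
      have "\<forall>\<^sub>F n in sequentially. k \<le> N n" using N by (simp add: filterlim_at_top)
      then have "\<forall>\<^sub>F n in sequentially. lam k * b n k * sn k x = c k n"
        by eventually_elim (use False in \<open>simp add: c_def\<close>)
      moreover have "(\<lambda>n. lam k * b n k * sn k x) \<longlonglongrightarrow> lam k * a k * sn k x"
        by (intro tendsto_intros b)
      ultimately show ?thesis by (rule Lim_transform_eventually[rotated])
    qed (simp add: c_def)
    have c_le: "norm (c k n) \<le> B k" for k n
    proof -
      have "\<bar>lam k * b n k * sn k x\<bar> \<le> lam k * \<bar>b n k\<bar>"
        using abs_trig_le(2)[of "lam k * b n k" k x] by (simp add: abs_mult)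
      then show ?thesis using B[of k n] B0[of k] by (simp add: c_def)
    qed
    have "(\<lambda>n. suminf (\<lambda>k. c k n)) \<longlonglongrightarrow> (\<Sum>k. lam k * a k * sn k x)"
      using tannerys_theorem[of c "\<lambda>k. lam k * a k * sn k x" sequentially B] c_lim c_le sB
      by (auto intro: always_eventually)
    moreover have "suminf (\<lambda>k. c k n) = gx (N n) (b n) x" for n
      unfolding gx_def by (subst suminf_finite[of "{1..N n}"]) (auto simp: c_def)
    ultimately show ?thesis by (simp add: ux_eq)
  qed
  have gb: "\<bar>gx (N n) (b n) x\<bar> \<le> suminf B" for n x
  proof -
    have "\<bar>gx (N n) (b n) x\<bar> \<le> (\<Sum>j\<in>{1..N n}. \<bar>lam j * b n j * sn j x\<bar>)" unfolding gx_def by (rule sum_abs)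
    also have "\<dots> \<le> (\<Sum>j\<in>{1..N n}. B j)"
    proof (rule sum_mono)
      fix j
      show "\<bar>lam j * b n j * sn j x\<bar> \<le> B j"
        using abs_trig_le(2)[of "lam j * b n j" j x] B[of j n] by (simp add: abs_mult)
    qed
    also have "\<dots> \<le> suminf B" by (rule sum_le_suminf[OF sB]) (use B0 in auto)
    finally show ?thesis .
  qed
  have uc: "continuous_on S (ux a)" for S
    unfolding ux_def by (rule continuous_trig_series(2)) (use sa in \<open>simp add: abs_mult\<close>)
  have "(\<lambda>n. \<integral>x. (gx (N n) (b n) x)\<^sup>2 * cs k x \<partial>M) \<longlonglongrightarrow> (\<integral>x. (ux a x)\<^sup>2 * cs k x \<partial>M)"
  proof (rule integral_dominated_convergence)
    show "(\<lambda>x. (ux a x)\<^sup>2 * cs k x) \<in> borel_measurable M"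
      by (intro continuous_measurable_M continuous_intros uc)
    show "(\<lambda>x. (gx (N n) (b n) x)\<^sup>2 * cs k x) \<in> borel_measurable M" for n
      by (intro continuous_measurable_M continuous_intros)
    show "integrable M (\<lambda>x. (suminf B)\<^sup>2)" by simp
    show "AE x in M. (\<lambda>n. (gx (N n) (b n) x)\<^sup>2 * cs k x) \<longlonglongrightarrow> (ux a x)\<^sup>2 * cs k x"
      by (intro AE_I2 tendsto_intros g)
    show "AE x in M. norm ((gx (N n) (b n) x)\<^sup>2 * cs k x) \<le> (suminf B)\<^sup>2" for n
    proof (rule AE_I2)
      fix x
      have "\<bar>(gx (N n) (b n) x)\<^sup>2 * cs k x\<bar> \<le> \<bar>gx (N n) (b n) x\<bar>\<^sup>2"
        using abs_trig_le(1)[of "(gx (N n) (b n) x)\<^sup>2" k x] by simp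
      also have "\<dots> \<le> (suminf B)\<^sup>2" by (rule power_mono[OF gb]) simp
      finally show "norm ((gx (N n) (b n) x)\<^sup>2 * cs k x) \<le> (suminf B)\<^sup>2" by simp
    qed
  qed
  then show "(\<lambda>n. qN (N n) (b n) k) \<longlonglongrightarrow> ft (\<lambda>x. (ux a x)\<^sup>2) k"
    unfolding qN_def ft_def by (intro tendsto_divide tendsto_const) auto
qed

text \<open>Defined as a limit so that it is measurable in \<open>a\<close> without further assumptions.\<close>

definition Qc :: "(nat \<Rightarrow> real) \<Rightarrow> nat \<Rightarrow> real" where "Qc a k = lim (\<lambda>N. qN N a k)"

lemma
  assumes "summable (\<lambda>k. lam k * \<bar>a k\<bar>)"
  shows qN_tendsto_Qc: "(\<lambda>N. qN N a k) \<longlonglongrightarrow> Qc a k" and Qc_eq: "Qc a k = ft (\<lambda>x. (ux a x)\<^sup>2) k"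
proof -
  have l: "(\<lambda>N. qN N a k) \<longlonglongrightarrow> ft (\<lambda>x. (ux a x)\<^sup>2) k"
    by (rule qN_tendsto[of "\<lambda>n. n" "\<lambda>_. a" a, OF filterlim_ident _ _ assms]) auto
  then show "Qc a k = ft (\<lambda>x. (ux a x)\<^sup>2) k" unfolding Qc_def by (rule limI)
  then show "(\<lambda>N. qN N a k) \<longlonglongrightarrow> Qc a k" using l by simp
qed

lemma continuous_ux: "summable (\<lambda>k. lam k * \<bar>a k\<bar>) \<Longrightarrow> continuous_on S (ux a)"
  unfolding ux_def by (rule continuous_trig_series(2)) (simp add: abs_mult)

lemma abs_ux_le:
  assumes "summable (\<lambda>k. lam k * \<bar>a k\<bar>)"
  shows "\<bar>ux a x\<bar> \<le> (\<Sum>k. lam k * \<bar>a k\<bar>)"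
  using trig_series_abs_le(2)[of "\<lambda>k. lam k * a k" x] assms unfolding ux_def by (simp add: abs_mult)

lemma borel_measurable_qN:
  assumes "\<And>k. (\<lambda>s. p s k) \<in> borel_measurable \<M>"
  shows "(\<lambda>s. qN N (p s) k) \<in> borel_measurable \<M>"
  unfolding qN_poly by (intro borel_measurable_sum borel_measurable_times borel_measurable_const assms)

lemma borel_measurable_Qc:
  assumes "\<And>k. (\<lambda>s. p s k) \<in> borel_measurable \<M>"
  shows "(\<lambda>s. Qc (p s) k) \<in> borel_measurable \<M>"
  unfolding Qc_def by (intro borel_measurable_lim_metric borel_measurable_qN assms)

lemma abs_Qc_le:
  assumes "summable (\<lambda>k. lam k * \<bar>a k\<bar>)" "\<And>N. (\<Sum>j\<in>{1..N}. (lam j)\<^sup>2 * (a j)\<^sup>2) \<le> m"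
  shows "\<bar>Qc a k\<bar> \<le> m"
proof (rule tendsto_upperbound)
  show "(\<lambda>N. \<bar>qN N a k\<bar>) \<longlonglongrightarrow> \<bar>Qc a k\<bar>" by (intro tendsto_rabs qN_tendsto_Qc assms)
qed (use order_trans[OF abs_qN_le assms(2)] in auto)

end

lemma AE_lebesgue_on_neq: "AE s in lebesgue_on S. s \<noteq> (c :: real)" if "S \<in> sets lebesgue"
proof -
  have "AE s in lebesgue. s \<noteq> c" by (rule AE_completion[OF AE_lborel_singleton])
  then show ?thesis using that by (auto simp: AE_restrict_space_iff elim: eventually_mono)
qed

text \<open>Arzela-Ascoli for each fixed \<open>k\<close>, followed by a diagonal choice; the
  constants \<open>b k\<close> and \<open>c k\<close> may grow in \<open>k\<close> without
  restriction.\<close>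

lemma pointwise_diagonal_subsequence:
  fixes A :: "nat \<Rightarrow> nat \<Rightarrow> real \<Rightarrow> real"
  assumes b: "\<And>N k t. t \<in> {0..T} \<Longrightarrow> \<bar>A N k t\<bar> \<le> b k"
    and lip: "\<And>N k s t. s \<in> {0..T} \<Longrightarrow> t \<in> {0..T} \<Longrightarrow> \<bar>A N k s - A N k t\<bar> \<le> c k * \<bar>s - t\<bar>"
  shows "\<exists>r g. strict_mono (r :: nat \<Rightarrow> nat) \<and> (\<forall>k. \<forall>t\<in>{0..T}. (\<lambda>n. A (r n) k t) \<longlonglongrightarrow> g k t)"
proof -
  interpret subseqs "\<lambda>k s. \<exists>g. \<forall>t\<in>{0..T}. (\<lambda>n. A (s n) k t) \<longlonglongrightarrow> g t"
  proof
    fix k and s :: "nat \<Rightarrow> nat"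
    have eq: "\<exists>d>0. \<forall>n y. y \<in> {0..T} \<and> norm (x - y) < d \<longrightarrow> norm (A (s n) k x - A (s n) k y) < e"
      if x: "x \<in> {0..T}" and e: "0 < e" for x e
    proof (intro exI[of _ "e / (\<bar>c k\<bar> + 1)"] conjI allI impI)
      show "0 < e / (\<bar>c k\<bar> + 1)" using e by (intro divide_pos_pos) auto
      fix n y assume y: "y \<in> {0..T} \<and> norm (x - y) < e / (\<bar>c k\<bar> + 1)"
      have "\<bar>A (s n) k x - A (s n) k y\<bar> \<le> c k * \<bar>x - y\<bar>" using lip x y by blast
      also have "\<dots> \<le> (\<bar>c k\<bar> + 1) * \<bar>x - y\<bar>" by (intro mult_right_mono) auto
      also have "\<dots> < e"
      proof -
        have p: "0 < \<bar>c k\<bar> + 1" by linarith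
        have "\<bar>x - y\<bar> < e / (\<bar>c k\<bar> + 1)" using y by simp
        then show ?thesis by (simp only: pos_less_divide_eq[OF p] mult.commute)
      qed
      finally show "norm (A (s n) k x - A (s n) k y) < e" by simp
    qed
    obtain g r where "strict_mono (r :: nat \<Rightarrow> nat)"
      and u: "\<And>e. 0 < e \<Longrightarrow> \<exists>N. \<forall>n x. n \<ge> N \<and> x \<in> {0..T} \<longrightarrow> norm (A (s (r n)) k x - g x) < e"
      using Arzela_Ascoli[of "{0..T}" "\<lambda>n. A (s n) k" "b k"] b eq by (metis compact_Icc real_norm_def)
    moreover have "(\<lambda>n. A ((s \<circ> r) n) k t) \<longlonglongrightarrow> g t" if "t \<in> {0..T}" for t
      unfolding LIMSEQ_def dist_norm o_def using u that by blast
    ultimately show "\<exists>r'. strict_mono r' \<and> (\<exists>g. \<forall>t\<in>{0..T}. (\<lambda>n. A ((s \<circ> r') n) k t) \<longlonglongrightarrow> g t)"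
      by blast
  qed
  have "\<exists>g. \<forall>t\<in>{0..T}. (\<lambda>n. A (diagseq n) k t) \<longlonglongrightarrow> g t" for k
  proof -
    \<comment> \<open>Only the tail of the diagonal sequence is a subsequence of the selection made
      for \<open>k\<close>; the offset is removed afterwards.\<close>
    have "\<exists>g. \<forall>t\<in>{0..T}. (\<lambda>n. A ((diagseq \<circ> (+) (Suc k)) n) k t) \<longlonglongrightarrow> g t"
    proof (rule diagseq_holds)
      fix r s :: "nat \<Rightarrow> nat" and n
      assume r: "strict_mono r" and "\<exists>g. \<forall>t\<in>{0..T}. (\<lambda>i. A (s i) n t) \<longlonglongrightarrow> g t"
      then obtain g where "\<And>t. t \<in> {0..T} \<Longrightarrow> (\<lambda>i. A (s i) n t) \<longlonglongrightarrow> g t" by blast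
      then have "\<And>t. t \<in> {0..T} \<Longrightarrow> (\<lambda>i. A ((s \<circ> r) i) n t) \<longlonglongrightarrow> g t"
        using LIMSEQ_subseq_LIMSEQ[OF _ r] unfolding o_def by blast
      then show "\<exists>g. \<forall>t\<in>{0..T}. (\<lambda>i. A ((s \<circ> r) i) n t) \<longlonglongrightarrow> g t" by blast
    qed
    then obtain g where g: "\<And>t. t \<in> {0..T} \<Longrightarrow> (\<lambda>n. A (diagseq (Suc k + n)) k t) \<longlonglongrightarrow> g t"
      unfolding o_def by blast
    have "(\<lambda>n. A (diagseq n) k t) \<longlonglongrightarrow> g t" if "t \<in> {0..T}" for t
      by (rule LIMSEQ_offset[of _ "Suc k"]) (use g[OF that] in \<open>simp add: add.commute\<close>)
    then show ?thesis by blast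
  qed
  then have "\<exists>g. \<forall>k. \<forall>t\<in>{0..T}. (\<lambda>n. A (diagseq n) k t) \<longlonglongrightarrow> g k t"
    by (rule choice[OF allI])
  then show ?thesis using subseq_diagseq by blast
qed

context interval begin

text \<open>Coefficientwise limits of Galerkin solutions. Energy and dissipation bounds survive on
  partial sums, uniformly in \<open>K\<close>; the quadratic term converges at each positive time by
  the Gevrey majorant, and dominated convergence in time yields the integral equations.\<close>

theorem coefficients_exist:
  fixes T :: real and \<alpha> :: "nat \<Rightarrow> real"
  assumes T: "0 < T" and \<alpha>: "summable (\<lambda>k. (lam k)\<^sup>2 * (\<alpha> k)\<^sup>2)"
  shows "\<exists>(a :: nat \<Rightarrow> real \<Rightarrow> real) m. (\<forall>k. a k 0 = \<alpha> k \<and> continuous_on {0..T} (a k)) \<and>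
    (\<forall>t\<in>{0..T}. \<forall>K. (\<Sum>k\<in>{1..K}. (lam k)\<^sup>2 * (a k t)\<^sup>2) \<le> m) \<and>
    (\<forall>t\<in>{0<..T}. \<exists>\<delta>>0. \<exists>C. \<forall>k. \<bar>a k t\<bar> \<le> C * exp (- \<delta> * lam k)) \<and>
    (\<forall>K. (\<integral>s. (\<Sum>k\<in>{1..K}. lam k ^ 6 * (a k s)\<^sup>2) \<partial>lebesgue_on {0..T}) \<le> m) \<and>
    (\<forall>k. integrable (lebesgue_on {0..T}) (\<lambda>s. - mu k * a k s - 1 / 2 * Qc (\<lambda>j. a j s) k)) \<and>
    (\<forall>k. \<forall>t\<in>{0..T}. a k t = \<alpha> k + (\<integral>s. - mu k * a k s - 1 / 2 * Qc (\<lambda>j. a j s) k \<partial>lebesgue_on {0..t}))"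
proof -
  define m where "m = exp T * (\<Sum>k. (lam k)\<^sup>2 * (\<alpha> k)\<^sup>2)"
  have "\<forall>N. \<exists>B. \<forall>k\<in>{1..N}. B k 0 = \<alpha> k \<and> (\<forall>t\<in>{0..T}.
      (B k has_real_derivative - mu k * B k t - 1 / 2 * qN N (\<lambda>j. B j t) k) (at t within {0..T}))"
    using galerkin_solution_exists T by simp
  from choice[OF this] obtain B where B: "\<And>N k. k \<in> {1..N} \<Longrightarrow> B N k 0 = \<alpha> k"
    "\<And>N k t. k \<in> {1..N} \<Longrightarrow> t \<in> {0..T} \<Longrightarrow>
      (B N k has_real_derivative - mu k * B N k t - 1 / 2 * qN N (\<lambda>j. B N j t) k) (at t within {0..T})"
    by blast
  \<comment> \<open>Extended by 0 beyond the truncation and at \<open>k = 0\<close>, so that bounds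
    hold for all indices; the mean is restored in the limit.\<close>
  define A where "A N k t = (if k \<in> {1..N} then B N k t else 0)" for N k t
  have A0: "A N k t = 0" if "k \<notin> {1..N}" for N k t
    unfolding A_def using that by (rule if_not_P)
  have AB: "A N k t = B N k t" if "k \<in> {1..N}" for N k t
    unfolding A_def using that by (rule if_P)
  have Ai: "A N k 0 = \<alpha> k" if "k \<in> {1..N}" for N k
    by (simp only: AB[OF that] B(1)[OF that])
  have ode: "(A N k has_real_derivative - mu k * A N k t - 1 / 2 * qN N (\<lambda>j. A N j t) k) (at t within {0..T})"
    if "k \<in> {1..N}" "t \<in> {0..T}" for N k t
  proof -
    have "qN N (\<lambda>j. A N j t) k = qN N (\<lambda>j. B N j t) k" by (rule qN_cong) (rule AB)
    moreover have "A N k = B N k" by (rule ext) (rule AB[OF that(1)])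
    ultimately show ?thesis using B(2)[OF that] by simp
  qed
  have Ac: "continuous_on {0..T} (A N k)" for N k
  proof (cases "k \<in> {1..N}")
    case True
    show ?thesis using ode[OF True] by (rule DERIV_continuous_on)
  next
    case False
    then have "A N k = (\<lambda>t. 0)" using A0 by (simp add: fun_eq_iff)
    then show ?thesis by simp
  qed
  have init: "exp T * (\<Sum>k\<in>{1..N}. (lam k)\<^sup>2 * (A N k 0)\<^sup>2) \<le> m" for N
  proof -
    have "(\<Sum>k\<in>{1..N}. (lam k)\<^sup>2 * (A N k 0)\<^sup>2) = (\<Sum>k\<in>{1..N}. (lam k)\<^sup>2 * (\<alpha> k)\<^sup>2)"
      by (intro sum.cong refl) (simp add: Ai)
    also have "\<dots> \<le> (\<Sum>k. (lam k)\<^sup>2 * (\<alpha> k)\<^sup>2)" by (rule sum_le_suminf[OF \<alpha>]) auto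
    finally show ?thesis unfolding m_def by (rule mult_left_mono) simp
  qed
  have ext: "(\<Sum>k\<in>{1..K}. f k) \<le> (\<Sum>k\<in>{1..N}. f k)"
    if "\<And>k. 0 \<le> f k" "\<And>k. k \<notin> {1..N} \<Longrightarrow> f k = 0" for f :: "nat \<Rightarrow> real" and K N
  proof -
    have "(\<Sum>k\<in>{1..K}. f k) \<le> (\<Sum>k\<in>{1..max K N}. f k)" by (rule sum_mono2) (use that in auto)
    also have "\<dots> = (\<Sum>k\<in>{1..N}. f k)" by (rule sum.mono_neutral_right) (use that in auto)
    finally show ?thesis .
  qed
  have EN: "(\<Sum>k\<in>{1..N}. (lam k)\<^sup>2 * (A N k t)\<^sup>2) \<le> m" if "t \<in> {0..T}" for N t
    by (rule order_trans[OF galerkin_energy_bounds(1)[of N T "A N" "\<lambda>_. 1 / 2", OF ode that] init])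
  have EK: "(\<Sum>k\<in>{1..K}. (lam k)\<^sup>2 * (A N k t)\<^sup>2) \<le> m" if "t \<in> {0..T}" for K N t
    by (rule order_trans[OF ext EN[OF that]]) (auto simp: A0)
  have m0: "0 \<le> m" using EN[of 0 0] T by simp
  have bd: "lam k * \<bar>A N k t\<bar> \<le> sqrt m" if t: "t \<in> {0..T}" for N k t
  proof (cases "k = 0")
    case False
    have "(lam k * \<bar>A N k t\<bar>)\<^sup>2 = (lam k)\<^sup>2 * (A N k t)\<^sup>2" by (simp add: power_mult_distrib)
    also have "\<dots> \<le> (\<Sum>k\<in>{1..k}. (lam k)\<^sup>2 * (A N k t)\<^sup>2)" by (rule member_le_sum) (use False in auto)
    also have "\<dots> \<le> m" by (rule EK[OF t])
    finally show ?thesis by (rule real_le_rsqrt)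
  qed (use m0 in simp)
  define b where "b k = sqrt m / lam k" for k
  have Ab: "\<bar>A N k t\<bar> \<le> b k" if t: "t \<in> {0..T}" for N k t
  proof (cases "k = 0")
    case False
    then have "0 < lam k" by (intro lam_pos) simp
    then show ?thesis using bd[OF t, of k N] by (simp add: b_def pos_le_divide_eq mult.commute)
  qed (simp add: A0 b_def)
  have b0: "0 \<le> b k" for k using m0 by (simp add: b_def)
  \<comment> \<open>Bounds the right-hand side of the \<open>k\<close>-th equation and so is a
    Lipschitz constant independent of \<open>N\<close>; its growth in \<open>k\<close> does not
    disturb the diagonal argument.\<close>
  define c where "c k = \<bar>mu k\<bar> * b k + m / 2" for k
  have c0: "0 \<le> c k" for k using b0 m0 by (simp add: c_def)
  have rhs: "\<bar>- mu k * A N k t - 1 / 2 * qN N (\<lambda>j. A N j t) k\<bar> \<le> c k" if t: "t \<in> {0..T}" for N k t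
  proof -
    have "\<bar>- mu k * A N k t - 1 / 2 * qN N (\<lambda>j. A N j t) k\<bar> \<le> \<bar>mu k\<bar> * \<bar>A N k t\<bar> + 1 / 2 * \<bar>qN N (\<lambda>j. A N j t) k\<bar>"
      using abs_triangle_ineq4[of "- mu k * A N k t" "1 / 2 * qN N (\<lambda>j. A N j t) k"] by (simp add: abs_mult)
    also have "\<dots> \<le> \<bar>mu k\<bar> * b k + 1 / 2 * m"
      by (intro add_mono mult_left_mono Ab t order_trans[OF abs_qN_le EN[OF t]]) auto
    finally show ?thesis by (simp add: c_def)
  qed
  have lip: "\<bar>A N k s - A N k t\<bar> \<le> c k * \<bar>s - t\<bar>" if st: "s \<in> {0..T}" "t \<in> {0..T}" for N k s t
  proof (cases "k \<in> {1..N}")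
    case True
    have "norm (A N k s - A N k t) \<le> c k * norm (s - t)"
      by (rule field_differentiable_bound[of "{0..T}" "A N k" "\<lambda>t. - mu k * A N k t - 1 / 2 * qN N (\<lambda>j. A N j t) k"])
         (use ode[OF True] rhs st in auto)
    then show ?thesis by simp
  next
    case False
    then show ?thesis using c0[of k] by (simp add: A0)
  qed
  obtain r g where r: "strict_mono (r :: nat \<Rightarrow> nat)"
    and g: "\<And>k t. t \<in> {0..T} \<Longrightarrow> (\<lambda>n. A (r n) k t) \<longlonglongrightarrow> g k t"
    using pointwise_diagonal_subsequence[of T A b c, OF Ab lip] by blast
  have rN: "filterlim r at_top sequentially" by (rule filterlim_subseq[OF r])
  have rk: "\<forall>\<^sub>F n in sequentially. k \<le> r n" for k using rN by (simp add: filterlim_at_top)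
  have gl: "\<bar>g k s - g k t\<bar> \<le> c k * \<bar>s - t\<bar>" if st: "s \<in> {0..T}" "t \<in> {0..T}" for k s t
    by (rule tendsto_upperbound[OF tendsto_rabs[OF tendsto_diff[OF g[OF st(1)] g[OF st(2)]]]])
       (use lip[OF st] in auto)
  have gc: "continuous_on {0..T} (g k)" for k
    by (rule lipschitz_on_continuous_on[OF lipschitz_onI[of _ _ "c k"]])
       (use gl c0 in \<open>auto simp: dist_real_def\<close>)
  have gE: "(\<Sum>k\<in>{1..K}. (lam k)\<^sup>2 * (g k t)\<^sup>2) \<le> m" if t: "t \<in> {0..T}" for K t
    by (rule tendsto_upperbound[of "\<lambda>n. \<Sum>k\<in>{1..K}. (lam k)\<^sup>2 * (A (r n) k t)\<^sup>2"])
       (use EK[OF t] in \<open>auto intro!: tendsto_intros g t\<close>)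
  have gev: "\<exists>\<delta>>0. \<exists>C\<ge>0. \<forall>n k. lam k * \<bar>A (r n) k t\<bar> \<le> C * exp (- \<delta> * lam k)" if t: "t \<in> {0<..T}" for t
  proof -
    \<comment> \<open>The largest elapsed time to which \<open>galerkin_gevrey\<close> applies at
      time \<open>t\<close>; it is the same for all truncations.\<close>
    define \<delta> where "\<delta> = min t (1 / (2 * (4 + S0) * (1 + m)))"
    have p: "0 < 2 * (4 + S0) * (1 + m)" using S0_nonneg m0 by (intro mult_pos_pos) auto
    have \<delta>: "0 < \<delta>" "\<delta> \<le> t" using t p by (auto simp: \<delta>_def)
    have "\<delta> \<le> 1 / (2 * (4 + S0) * (1 + m))" by (simp add: \<delta>_def)
    then have "\<delta> * (2 * (4 + S0) * (1 + m)) \<le> 1" by (simp only: pos_le_divide_eq[OF p])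
    then have \<delta>1: "2 * (4 + S0) * (1 + m) * \<delta> \<le> 1" by (simp only: mult.commute)
    have "lam k * \<bar>A N k t\<bar> \<le> sqrt (2 * (1 + m)) * exp (- \<delta> * lam k)" for N k
    proof (cases "k \<in> {1..N}")
      case True
      have tt: "t \<in> {0..T}" using t by auto
      have "(exp (\<delta> * lam k) * (lam k * \<bar>A N k t\<bar>))\<^sup>2 = exp (2 * \<delta> * lam k) * (lam k)\<^sup>2 * (A N k t)\<^sup>2"
        by (simp add: power_mult_distrib power2_eq_square[of "exp _"] flip: exp_add)
      also have "\<dots> \<le> (\<Sum>k\<in>{1..N}. exp (2 * \<delta> * lam k) * (lam k)\<^sup>2 * (A N k t)\<^sup>2)"
        by (rule member_le_sum[of k _ "\<lambda>k. exp (2 * \<delta> * lam k) * (lam k)\<^sup>2 * (A N k t)\<^sup>2"]) (use True in auto)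
      also have "\<dots> \<le> 2 * (1 + m)"
        by (rule galerkin_gevrey[OF ode EN tt]) (use \<delta> \<delta>1 in auto)
      finally have "exp (\<delta> * lam k) * (lam k * \<bar>A N k t\<bar>) \<le> sqrt (2 * (1 + m))" by (rule real_le_rsqrt)
      then have "exp (- \<delta> * lam k) * (exp (\<delta> * lam k) * (lam k * \<bar>A N k t\<bar>)) \<le> exp (- \<delta> * lam k) * sqrt (2 * (1 + m))"
        by (rule mult_left_mono) simp
      then show ?thesis by (simp only: mult.assoc[symmetric] exp_add[symmetric]) (simp add: mult.commute)
    next
      case False
      then show ?thesis using m0 by (simp add: A0)
    qed
    then show ?thesis using \<delta> m0 by (intro exI[of _ \<delta>] conjI exI[of _ "sqrt (2 * (1 + m))"]) auto
  qed
  have gdecay: "\<exists>\<delta>>0. \<exists>C\<ge>0. \<forall>k. lam k * \<bar>g k t\<bar> \<le> C * exp (- \<delta> * lam k)"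
    and gQ: "(\<lambda>n. qN (r n) (\<lambda>j. A (r n) j t) k) \<longlonglongrightarrow> Qc (\<lambda>j. g j t) k"
    and gs: "summable (\<lambda>k. lam k * \<bar>g k t\<bar>)" if t: "t \<in> {0<..T}" for t k
  proof -
    have tt: "t \<in> {0..T}" using t by auto
    obtain \<delta> C where \<delta>: "0 < \<delta>" "0 \<le> C" "\<And>n k. lam k * \<bar>A (r n) k t\<bar> \<le> C * exp (- \<delta> * lam k)"
      using gev[OF t] by blast
    have s: "summable (\<lambda>k. C * exp (- \<delta> * lam k))" by (rule summable_mult[OF summable_exp_lam[OF \<delta>(1)]])
    have "lam k * \<bar>g k t\<bar> \<le> C * exp (- \<delta> * lam k)" for k
      by (rule tendsto_upperbound[OF tendsto_mult_left[OF tendsto_rabs[OF g[OF tt]]]]) (use \<delta>(3) in auto)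
    then show "\<exists>\<delta>>0. \<exists>C\<ge>0. \<forall>k. lam k * \<bar>g k t\<bar> \<le> C * exp (- \<delta> * lam k)" using \<delta> by blast
    show sg: "summable (\<lambda>k. lam k * \<bar>g k t\<bar>)"
      by (rule summable_limit[OF rN g[OF tt] \<delta>(3) s])
    show "(\<lambda>n. qN (r n) (\<lambda>j. A (r n) j t) k) \<longlonglongrightarrow> Qc (\<lambda>j. g j t) k"
      unfolding Qc_eq[OF sg] by (rule qN_tendsto[OF rN g[OF tt] \<delta>(3) s])
  qed
  have gm: "g k \<in> borel_measurable (lebesgue_on {0..T})" for k
    by (rule borel_measurable_integrable[OF continuous_imp_integrable_lebesgue_on[OF gc]])
  have fin: "finite_measure (lebesgue_on {0..T})" by (rule finite_measure_lebesgue_on) simp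
  have Qi: "integrable (lebesgue_on {0..T}) (\<lambda>s. Qc (\<lambda>j. g j s) k)" for k
  proof (rule finite_measure.integrable_const_bound[OF fin, where B = m])
    show "(\<lambda>s. Qc (\<lambda>j. g j s) k) \<in> borel_measurable (lebesgue_on {0..T})"
      by (rule borel_measurable_Qc) (rule gm)
    have z: "AE s in lebesgue_on {0..T}. s \<noteq> 0" by (rule AE_lebesgue_on_neq) simp
    show "AE s in lebesgue_on {0..T}. norm (Qc (\<lambda>j. g j s) k) \<le> m"
      using z AE_space
    proof eventually_elim
      case (elim s)
      then have "s \<in> {0<..T}" "s \<in> {0..T}" by auto
      then show ?case using abs_Qc_le[OF gs gE] by simp
    qed
  qed
  \<comment> \<open>The mean equation has \<open>mu 0 = 0\<close> and a right-hand side independent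
    of the mean, so the missing coefficient is a plain integral.\<close>
  define a where "a k t = (if k = 0 then \<alpha> 0 + (\<integral>s. - 1 / 2 * Qc (\<lambda>j. g j s) 0 \<partial>lebesgue_on {0..t}) else g k t)" for k t
  have Qa: "Qc (\<lambda>j. a j s) = Qc (\<lambda>j. g j s)" for s
  proof -
    have "qN N (\<lambda>j. a j s) k = qN N (\<lambda>j. g j s) k" for N k
      by (rule qN_cong) (simp add: a_def)
    then show ?thesis by (simp add: Qc_def fun_eq_iff)
  qed
  have ac: "continuous_on {0..T} (a k)" for k
  proof (cases "k = 0")
    case True
    have "continuous_on {0..T} (\<lambda>t. \<integral>s. - 1 / 2 * Qc (\<lambda>j. g j s) 0 \<partial>lebesgue_on {0..t})"
      by (rule indefinite_integral_continuous_lebesgue(1)) (intro Bochner_Integration.integrable_mult_right Qi)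
    moreover have "a k = (\<lambda>t. \<alpha> 0 + (\<integral>s. - 1 / 2 * Qc (\<lambda>j. g j s) 0 \<partial>lebesgue_on {0..t}))"
      unfolding a_def[abs_def] using True by simp
    ultimately show ?thesis by (simp only: continuous_on_add continuous_on_const)
  next
    case False
    then show ?thesis unfolding a_def[abs_def] using gc by simp
  qed
  have ai: "integrable (lebesgue_on {0..T}) (\<lambda>s. - mu k * a k s - 1 / 2 * Qc (\<lambda>j. a j s) k)" for k
    unfolding Qa by (intro Bochner_Integration.integrable_diff Bochner_Integration.integrable_mult_right Qi
        continuous_imp_integrable_lebesgue_on ac)
  have eq: "a k t = \<alpha> k + (\<integral>s. - mu k * a k s - 1 / 2 * Qc (\<lambda>j. a j s) k \<partial>lebesgue_on {0..t})"
    if t: "t \<in> {0..T}" for k t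
  proof (cases "k = 0")
    case True
    then show ?thesis unfolding Qa by (simp add: a_def mu_def)
  next
    case False
    have sub: "{0..t} \<subseteq> {0..T}" using t by auto
    have qc: "continuous_on {0..t} (\<lambda>s. - mu k * A N k s - 1 / 2 * qN N (\<lambda>j. A N j s) k)" for N
      unfolding qN_poly by (intro continuous_intros continuous_on_subset[OF Ac sub])
    have ftc: "A N k t = \<alpha> k + (\<integral>s. - mu k * A N k s - 1 / 2 * qN N (\<lambda>j. A N j s) k \<partial>lebesgue_on {0..t})"
      if N: "k \<le> N" for N
    proof -
      have kN: "k \<in> {1..N}" using N False by simp
      have "((\<lambda>s. - mu k * A N k s - 1 / 2 * qN N (\<lambda>j. A N j s) k) has_integral A N k t - A N k 0) {0..t}"
      proof (rule fundamental_theorem_of_calculus)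
        fix s assume s: "s \<in> {0..t}"
        show "(A N k has_vector_derivative - mu k * A N k s - 1 / 2 * qN N (\<lambda>j. A N j s) k) (at s within {0..t})"
          unfolding has_real_derivative_iff_has_vector_derivative[symmetric]
          by (rule DERIV_subset[OF ode[OF kN] sub]) (use s sub in auto)
      qed (use t in auto)
      then have "A N k t - A N k 0 = integral {0..t} (\<lambda>s. - mu k * A N k s - 1 / 2 * qN N (\<lambda>j. A N j s) k)"
        by (simp add: integral_unique)
      also have "\<dots> = (\<integral>s. - mu k * A N k s - 1 / 2 * qN N (\<lambda>j. A N j s) k \<partial>lebesgue_on {0..t})"
        by (rule lebesgue_integral_eq_integral[symmetric, OF continuous_imp_integrable_lebesgue_on[OF qc]]) simp
      finally show ?thesis using Ai[OF kN] by simp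
    qed
    have "(\<lambda>n. \<integral>s. - mu k * A (r n) k s - 1 / 2 * qN (r n) (\<lambda>j. A (r n) j s) k \<partial>lebesgue_on {0..t})
        \<longlonglongrightarrow> (\<integral>s. - mu k * g k s - 1 / 2 * Qc (\<lambda>j. g j s) k \<partial>lebesgue_on {0..t})"
    proof (rule integral_dominated_convergence)
      have "integrable (lebesgue_on {0..T}) (\<lambda>s. - mu k * g k s - 1 / 2 * Qc (\<lambda>j. g j s) k)"
        by (intro Bochner_Integration.integrable_diff Bochner_Integration.integrable_mult_right Qi
            continuous_imp_integrable_lebesgue_on gc)
      from indefinite_integral_continuous_lebesgue(2)[OF this t]
      show "(\<lambda>s. - mu k * g k s - 1 / 2 * Qc (\<lambda>j. g j s) k) \<in> borel_measurable (lebesgue_on {0..t})"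
        by (rule borel_measurable_integrable)
      show "(\<lambda>s. - mu k * A (r n) k s - 1 / 2 * qN (r n) (\<lambda>j. A (r n) j s) k) \<in> borel_measurable (lebesgue_on {0..t})" for n
        by (rule borel_measurable_integrable[OF continuous_imp_integrable_lebesgue_on[OF qc]])
      show "integrable (lebesgue_on {0..t}) (\<lambda>s. c k)"
        by (rule continuous_imp_integrable_lebesgue_on) simp
      have z: "AE s in lebesgue_on {0..t}. s \<noteq> 0" by (rule AE_lebesgue_on_neq) simp
      show "AE s in lebesgue_on {0..t}. (\<lambda>n. - mu k * A (r n) k s - 1 / 2 * qN (r n) (\<lambda>j. A (r n) j s) k)
          \<longlonglongrightarrow> - mu k * g k s - 1 / 2 * Qc (\<lambda>j. g j s) k"
        using z AE_space
      proof eventually_elim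
        case (elim s)
        then have "s \<in> {0<..T}" "s \<in> {0..T}" using t by auto
        then show ?case by (intro tendsto_diff tendsto_mult_left g gQ)
      qed
      show "AE s in lebesgue_on {0..t}. norm (- mu k * A (r n) k s - 1 / 2 * qN (r n) (\<lambda>j. A (r n) j s) k) \<le> c k" for n
        using rhs t by (intro AE_I2) auto
    qed
    then have "(\<lambda>n. \<alpha> k + (\<integral>s. - mu k * A (r n) k s - 1 / 2 * qN (r n) (\<lambda>j. A (r n) j s) k \<partial>lebesgue_on {0..t}))
        \<longlonglongrightarrow> \<alpha> k + (\<integral>s. - mu k * g k s - 1 / 2 * Qc (\<lambda>j. g j s) k \<partial>lebesgue_on {0..t})"
      by (rule tendsto_add[OF tendsto_const])
    moreover have "\<forall>\<^sub>F n in sequentially. \<alpha> k + (\<integral>s. - mu k * A (r n) k s - 1 / 2 * qN (r n) (\<lambda>j. A (r n) j s) k \<partial>lebesgue_on {0..t}) = A (r n) k t"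
      using rk[of k] by eventually_elim (simp only: ftc)
    ultimately have "(\<lambda>n. A (r n) k t) \<longlonglongrightarrow> \<alpha> k + (\<integral>s. - mu k * g k s - 1 / 2 * Qc (\<lambda>j. g j s) k \<partial>lebesgue_on {0..t})"
      by (rule Lim_transform_eventually)
    then have "g k t = \<alpha> k + (\<integral>s. - mu k * g k s - 1 / 2 * Qc (\<lambda>j. g j s) k \<partial>lebesgue_on {0..t})"
      by (rule LIMSEQ_unique[OF g[OF t]])
    then show ?thesis unfolding Qa using False by (simp add: a_def)
  qed
  have a_init: "a k 0 = \<alpha> k" for k
  proof -
    have "integrable (lebesgue_on {0..0}) (\<lambda>s. - mu k * a k s - 1 / 2 * Qc (\<lambda>j. a j s) k)"
      by (rule indefinite_integral_continuous_lebesgue(2)[OF ai]) (use T in simp)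
    from lebesgue_integral_eq_integral[OF this] show ?thesis using eq[of 0 k] T by simp
  qed
  have a_E: "(\<Sum>k\<in>{1..K}. (lam k)\<^sup>2 * (a k t)\<^sup>2) \<le> m" if t: "t \<in> {0..T}" for K t
    using gE[OF t, of K] by (simp add: a_def)
  have a_decay: "\<exists>\<delta>>0. \<exists>C. \<forall>k. \<bar>a k t\<bar> \<le> C * exp (- \<delta> * lam k)" if t: "t \<in> {0<..T}" for t
  proof -
    obtain \<delta> C where \<delta>: "0 < \<delta>" "0 \<le> C" "\<And>k. lam k * \<bar>g k t\<bar> \<le> C * exp (- \<delta> * lam k)"
      using gdecay[OF t] by blast
    have l1: "0 < lam 1" by (rule lam_pos) simp
    \<comment> \<open>\<open>|a 0 t|\<close> covers index 0, where the exponential is 1; for the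
      other indices, dividing by \<open>lam 1\<close> removes the factor
      \<open>lam k\<close>.\<close>
    have "\<bar>a k t\<bar> \<le> (C / lam 1 + \<bar>a 0 t\<bar>) * exp (- \<delta> * lam k)" for k
    proof (cases "k = 0")
      case True
      then show ?thesis using \<delta>(2) by simp
    next
      case False
      then have "lam 1 * \<bar>g k t\<bar> \<le> lam k * \<bar>g k t\<bar>" by (intro mult_right_mono lam_mono) auto
      also note \<delta>(3)[of k]
      finally have "\<bar>g k t\<bar> \<le> C / lam 1 * exp (- \<delta> * lam k)"
        using l1 by (simp add: pos_le_divide_eq mult.commute)
      also have "\<dots> \<le> (C / lam 1 + \<bar>a 0 t\<bar>) * exp (- \<delta> * lam k)" by (intro mult_right_mono) auto
      finally show ?thesis using False by (simp add: a_def)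
    qed
    then show ?thesis using \<delta>(1) by blast
  qed
  have a_D: "(\<integral>s. (\<Sum>k\<in>{1..K}. lam k ^ 6 * (a k s)\<^sup>2) \<partial>lebesgue_on {0..T}) \<le> m" for K
  proof (rule tendsto_upperbound)
    have Dc: "continuous_on {0..T} (\<lambda>s. \<Sum>k\<in>{1..K}. lam k ^ 6 * (A N k s)\<^sup>2)" for N K
      by (intro continuous_intros Ac)
    show "(\<lambda>n. \<integral>s. (\<Sum>k\<in>{1..K}. lam k ^ 6 * (A (r n) k s)\<^sup>2) \<partial>lebesgue_on {0..T})
        \<longlonglongrightarrow> (\<integral>s. (\<Sum>k\<in>{1..K}. lam k ^ 6 * (a k s)\<^sup>2) \<partial>lebesgue_on {0..T})"
    proof (rule integral_dominated_convergence)
      have "continuous_on {0..T} (\<lambda>s. \<Sum>k\<in>{1..K}. lam k ^ 6 * (a k s)\<^sup>2)" by (intro continuous_intros ac)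
      then show "(\<lambda>s. \<Sum>k\<in>{1..K}. lam k ^ 6 * (a k s)\<^sup>2) \<in> borel_measurable (lebesgue_on {0..T})"
        by (rule borel_measurable_integrable[OF continuous_imp_integrable_lebesgue_on])
      show "(\<lambda>s. \<Sum>k\<in>{1..K}. lam k ^ 6 * (A (r n) k s)\<^sup>2) \<in> borel_measurable (lebesgue_on {0..T})" for n
        by (rule borel_measurable_integrable[OF continuous_imp_integrable_lebesgue_on[OF Dc]])
      show "integrable (lebesgue_on {0..T}) (\<lambda>s. \<Sum>k\<in>{1..K}. lam k ^ 6 * (b k)\<^sup>2)"
        by (rule continuous_imp_integrable_lebesgue_on) simp
      show "AE s in lebesgue_on {0..T}. (\<lambda>n. \<Sum>k\<in>{1..K}. lam k ^ 6 * (A (r n) k s)\<^sup>2) \<longlonglongrightarrow> (\<Sum>k\<in>{1..K}. lam k ^ 6 * (a k s)\<^sup>2)"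
      proof (intro AE_I2 tendsto_sum tendsto_mult_left tendsto_power)
        fix s k assume "s \<in> space (lebesgue_on {0..T})" "k \<in> {1..K}"
        then show "(\<lambda>n. A (r n) k s) \<longlonglongrightarrow> a k s" using g[of s k] by (simp add: a_def)
      qed
      show "AE s in lebesgue_on {0..T}. norm (\<Sum>k\<in>{1..K}. lam k ^ 6 * (A (r n) k s)\<^sup>2) \<le> (\<Sum>k\<in>{1..K}. lam k ^ 6 * (b k)\<^sup>2)" for n
      proof (rule AE_I2)
        fix s assume s: "s \<in> space (lebesgue_on {0..T})"
        have "(A (r n) k s)\<^sup>2 \<le> (b k)\<^sup>2" for k
          using power_mono[OF Ab[of s "r n" k], of 2] s by simp
        then have "(\<Sum>k\<in>{1..K}. lam k ^ 6 * (A (r n) k s)\<^sup>2) \<le> (\<Sum>k\<in>{1..K}. lam k ^ 6 * (b k)\<^sup>2)"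
          by (intro sum_mono mult_left_mono) auto
        moreover have "0 \<le> (\<Sum>k\<in>{1..K}. lam k ^ 6 * (A (r n) k s)\<^sup>2)" by (intro sum_nonneg) simp
        ultimately show "norm (\<Sum>k\<in>{1..K}. lam k ^ 6 * (A (r n) k s)\<^sup>2) \<le> (\<Sum>k\<in>{1..K}. lam k ^ 6 * (b k)\<^sup>2)" by simp
      qed
    qed
    have "(\<integral>s. (\<Sum>k\<in>{1..K}. lam k ^ 6 * (A N k s)\<^sup>2) \<partial>lebesgue_on {0..T}) \<le> m" for N
    proof -
      have "(\<integral>s. (\<Sum>k\<in>{1..K}. lam k ^ 6 * (A N k s)\<^sup>2) \<partial>lebesgue_on {0..T}) \<le>
          (\<integral>s. (\<Sum>k\<in>{1..N}. lam k ^ 6 * (A N k s)\<^sup>2) \<partial>lebesgue_on {0..T})"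
        by (intro integral_mono continuous_imp_integrable_lebesgue_on Dc ext) (auto simp: A0)
      also have "\<dots> = integral {0..T} (\<lambda>s. \<Sum>k\<in>{1..N}. lam k ^ 6 * (A N k s)\<^sup>2)"
        by (rule lebesgue_integral_eq_integral[OF continuous_imp_integrable_lebesgue_on[OF Dc]]) simp
      also have "\<dots> \<le> m"
        by (rule order_trans[OF galerkin_energy_bounds(2)[of N T "A N" "\<lambda>_. 1 / 2" T, OF ode] init]) (use T in auto)
      finally show ?thesis .
    qed
    then show "\<forall>\<^sub>F n in sequentially. (\<integral>s. (\<Sum>k\<in>{1..K}. lam k ^ 6 * (A (r n) k s)\<^sup>2) \<partial>lebesgue_on {0..T}) \<le> m"
      by simp
  qed simp
  show ?thesis
    using a_init ac a_E a_decay a_D ai eq by (intro exI[of _ a] exI[of _ m]) blast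
qed

end

section \<open>Uniqueness of the coefficients\<close>

lemma integral_lebesgue_on_restrict:
  fixes f :: "real \<Rightarrow> real"
  assumes "s \<in> {0..t}"
  shows "(\<integral>r. f r * (if r \<le> s then 1 else 0) \<partial>lebesgue_on {0..t}) = (\<integral>r. f r \<partial>lebesgue_on {0..s})"
proof -
  have "(\<integral>r. f r * (if r \<le> s then 1 else 0) \<partial>lebesgue_on {0..t}) =
      (\<integral>r. indicator {0..t} r *\<^sub>R (f r * (if r \<le> s then 1 else 0)) \<partial>lebesgue)"
    by (rule integral_restrict_space) simp
  also have "\<dots> = (\<integral>r. indicator {0..s} r *\<^sub>R f r \<partial>lebesgue)"
    by (rule Bochner_Integration.integral_cong) (use assms in \<open>auto simp: indicator_def\<close>)
  also have "\<dots> = (\<integral>r. f r \<partial>lebesgue_on {0..s})"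
    by (rule integral_restrict_space[symmetric]) simp
  finally show ?thesis .
qed

text \<open>Chain rule for the square of an absolutely continuous function, by Fubini on the two triangles.\<close>

lemma square_of_integral:
  fixes f :: "real \<Rightarrow> real"
  assumes f: "integrable (lebesgue_on {0..t}) f"
  shows "(\<integral>s. f s \<partial>lebesgue_on {0..t})\<^sup>2 = (\<integral>s. 2 * (\<integral>r. f r \<partial>lebesgue_on {0..s}) * f s \<partial>lebesgue_on {0..t})"
    and "integrable (lebesgue_on {0..t}) (\<lambda>s. 2 * (\<integral>r. f r \<partial>lebesgue_on {0..s}) * f s)"
proof -
  define N where "N = lebesgue_on {0..t}"
  have fm: "f \<in> borel_measurable N" and fi: "integrable N f" using f by (auto simp: N_def)
  have fin: "finite_measure N" unfolding N_def by (rule finite_measure_lebesgue_on) simp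
  interpret N: finite_measure N by (rule fin)
  interpret NN: pair_sigma_finite N N ..
  have sp: "space N = {0..t}" by (simp add: N_def)
  have idm: "(\<lambda>x. x) \<in> borel_measurable N"
    unfolding N_def using id_borel_measurable_lebesgue_on by (simp add: id_def)
  have m1: "(\<lambda>z. f (fst z)) \<in> borel_measurable (N \<Otimes>\<^sub>M N)" "(\<lambda>z. f (snd z)) \<in> borel_measurable (N \<Otimes>\<^sub>M N)"
    using measurable_compose[OF measurable_fst fm] measurable_compose[OF measurable_snd fm] by auto
  have m2: "(\<lambda>z. fst z) \<in> borel_measurable (N \<Otimes>\<^sub>M N)" "(\<lambda>z. snd z) \<in> borel_measurable (N \<Otimes>\<^sub>M N)"
    using measurable_compose[OF measurable_fst idm] measurable_compose[OF measurable_snd idm] by auto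
  define h where "h r s = f s * (f r * (if r \<le> s then 1 else 0))" for r s
  have hm: "(\<lambda>z. h (fst z) (snd z)) \<in> borel_measurable (N \<Otimes>\<^sub>M N)"
    unfolding h_def
    by (intro borel_measurable_times m1 measurable_If borel_measurable_const borel_measurable_le m2)
  have prod: "integrable (N \<Otimes>\<^sub>M N) (\<lambda>z. f (fst z) * f (snd z))"
  proof (rule NN.Fubini_integrable)
    show "(\<lambda>z. f (fst z) * f (snd z)) \<in> borel_measurable (N \<Otimes>\<^sub>M N)" by (intro borel_measurable_times m1)
    show "integrable N (\<lambda>x. \<integral>y. norm (f (fst (x, y)) * f (snd (x, y))) \<partial>N)"
      using fi by (simp add: abs_mult)
    show "AE x in N. integrable N (\<lambda>y. f (fst (x, y)) * f (snd (x, y)))" using fi by simp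
  qed
  have hi: "integrable (N \<Otimes>\<^sub>M N) (\<lambda>z. h (fst z) (snd z))"
    by (rule Bochner_Integration.integrable_bound[OF prod hm]) (auto simp: h_def abs_mult)
  have hi': "integrable (N \<Otimes>\<^sub>M N) (case_prod h)" using hi by (simp add: case_prod_beta')
  define F where "F s = (\<integral>r. f r \<partial>lebesgue_on {0..s})" for s
  have inner: "(\<integral>r. h r s \<partial>N) = f s * F s" if "s \<in> {0..t}" for s
    using integral_lebesgue_on_restrict[OF that, of f] by (simp add: h_def F_def N_def)
  have inner': "(\<integral>s. h r s \<partial>N) = f r * (integral\<^sup>L N f) - f r * F r" if r: "r \<in> {0..t}" for r
  proof -
    have i1: "integrable N (\<lambda>s. f s * (if s \<le> r then 1 else 0))"
      by (rule Bochner_Integration.integrable_bound[OF fi])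
         (auto intro!: borel_measurable_times fm measurable_If borel_measurable_const borel_measurable_le idm)
    \<comment> \<open>The diagonal \<open>s = r\<close> belongs to both closed triangles; it is
      negligible.\<close>
    have ne: "AE s in N. s \<noteq> r" unfolding N_def by (rule AE_lebesgue_on_neq) simp
    have "(\<integral>s. h r s \<partial>N) = (\<integral>s. f r * (f s - f s * (if s \<le> r then 1 else 0)) \<partial>N)"
    proof (rule integral_cong_AE)
      show "h r \<in> borel_measurable N"
        unfolding h_def[abs_def]
        by (intro borel_measurable_times fm measurable_If borel_measurable_const borel_measurable_le idm)
      show "(\<lambda>s. f r * (f s - f s * (if s \<le> r then 1 else 0))) \<in> borel_measurable N"
        by (rule borel_measurable_times[OF borel_measurable_const borel_measurable_diff[OF fm borel_measurable_integrable[OF i1]]])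
      show "AE s in N. h r s = f r * (f s - f s * (if s \<le> r then 1 else 0))"
        using ne by eventually_elim (auto simp: h_def)
    qed
    also have "\<dots> = f r * ((\<integral>s. f s \<partial>N) - (\<integral>s. f s * (if s \<le> r then 1 else 0) \<partial>N))"
      using i1 fi by simp
    also have "(\<integral>s. f s * (if s \<le> r then 1 else 0) \<partial>N) = F r"
      using integral_lebesgue_on_restrict[OF r, of f] by (simp add: N_def F_def)
    finally show ?thesis by (simp add: right_diff_distrib)
  qed
  have "integrable N (\<lambda>s. \<integral>r. h r s \<partial>N)" by (rule NN.integrable_snd[OF hi'])
  moreover have c: "integrable N (\<lambda>s. \<integral>r. h r s \<partial>N) = integrable N (\<lambda>s. f s * F s)"
    by (rule Bochner_Integration.integrable_cong) (use inner sp in auto)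
  ultimately have FI: "integrable N (\<lambda>s. f s * F s)" by simp
  have e: "2 * (\<integral>r. f r \<partial>lebesgue_on {0..s}) * f s = 2 * (f s * F s)" for s by (simp add: F_def)
  show "integrable (lebesgue_on {0..t}) (\<lambda>s. 2 * (\<integral>r. f r \<partial>lebesgue_on {0..s}) * f s)"
    unfolding e N_def[symmetric] by (rule Bochner_Integration.integrable_mult_right[OF FI])
  have "(\<integral>s. f s * F s \<partial>N) = (\<integral>s. (\<integral>r. h r s \<partial>N) \<partial>N)"
    by (rule Bochner_Integration.integral_cong) (use inner sp in auto)
  also have "\<dots> = (\<integral>r. (\<integral>s. h r s \<partial>N) \<partial>N)"
    by (rule NN.Fubini_integral[OF hi'])
  also have "\<dots> = (\<integral>r. f r * (integral\<^sup>L N f) - f r * F r \<partial>N)"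
    by (rule Bochner_Integration.integral_cong) (use inner' sp in auto)
  also have "\<dots> = (integral\<^sup>L N f) * (integral\<^sup>L N f) - (\<integral>s. f s * F s \<partial>N)"
    using FI fi by simp
  finally have "(integral\<^sup>L N f)\<^sup>2 = 2 * (\<integral>s. f s * F s \<partial>N)" by (simp add: power2_eq_square)
  then show "(\<integral>s. f s \<partial>lebesgue_on {0..t})\<^sup>2 = (\<integral>s. 2 * (\<integral>r. f r \<partial>lebesgue_on {0..s}) * f s \<partial>lebesgue_on {0..t})"
    unfolding e N_def[symmetric] by simp
qed

text \<open>Since \<open>H\<close> is only integrable, time is cut into steps of length
  \<open>e\<close> over which its integral is below 1/2, by uniform continuity of its primitive. On
  each step the inequality halves the current bound of \<open>y\<close> indefinitely.\<close>

lemma gronwall_integrable_kernel: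
  fixes y H :: "real \<Rightarrow> real"
  assumes H: "integrable (lebesgue_on {0..T}) H" "\<And>s. 0 \<le> H s"
    and ym: "y \<in> borel_measurable (lebesgue_on {0..T})"
    and yb: "\<And>t. t \<in> {0..T} \<Longrightarrow> 0 \<le> y t \<and> y t \<le> C"
    and ineq: "\<And>t. t \<in> {0..T} \<Longrightarrow> y t \<le> (\<integral>s. H s * y s \<partial>lebesgue_on {0..t})"
    and t: "t \<in> {0..T}"
  shows "y t = 0"
proof -
  define m where "m t = (\<integral>s. H s \<partial>lebesgue_on {0..t})" for t
  have mc: "continuous_on {0..T} m"
    unfolding m_def by (rule indefinite_integral_continuous_lebesgue(1)[OF H(1)])
  have Hi: "integrable (lebesgue_on {0..s}) H" if "s \<in> {0..T}" for s
    by (rule indefinite_integral_continuous_lebesgue(2)[OF H(1) that])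
  have HyT: "integrable (lebesgue_on {0..T}) (\<lambda>s. H s * y s)"
  proof (rule Bochner_Integration.integrable_bound)
    show "integrable (lebesgue_on {0..T}) (\<lambda>s. C * H s)" using H(1) by simp
    show "(\<lambda>s. H s * y s) \<in> borel_measurable (lebesgue_on {0..T})"
      using H(1) by (intro borel_measurable_times ym) auto
    show "AE s in lebesgue_on {0..T}. norm (H s * y s) \<le> norm (C * H s)"
    proof (rule AE_I2)
      fix s assume "s \<in> space (lebesgue_on {0..T})"
      then have "0 \<le> y s" "y s \<le> C" using yb[of s] by auto
      then have "H s * y s \<le> H s * C" by (intro mult_left_mono H(2)) auto
      then show "norm (H s * y s) \<le> norm (C * H s)"
        using H(2)[of s] \<open>0 \<le> y s\<close> \<open>y s \<le> C\<close> by (simp add: abs_mult mult.commute)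
    qed
  qed
  have Hyi: "integrable (lebesgue_on {0..s}) (\<lambda>s. H s * y s)" if "s \<in> {0..T}" for s
    by (rule indefinite_integral_continuous_lebesgue(2)[OF HyT that])
  have "uniformly_continuous_on {0..T} m"
    by (rule compact_uniformly_continuous[OF mc compact_Icc])
  then obtain d where d: "d > 0" "\<And>s t. s \<in> {0..T} \<Longrightarrow> t \<in> {0..T} \<Longrightarrow> dist t s < d \<Longrightarrow> dist (m t) (m s) < 1 / 2"
    unfolding uniformly_continuous_on_def by (metis half_gt_zero_iff zero_less_one)
  define e where "e = d / 2"
  have e: "0 < e" "e < d" using d by (auto simp: e_def)
  have step: "\<forall>t\<in>{0..T}. t \<le> real n * e \<longrightarrow> y t = 0" for n
  proof (induction n)
    case 0
    show ?case
    proof (intro ballI impI)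
      fix t assume t: "t \<in> {0..T}" "t \<le> real 0 * e"
      then have t0: "t = 0" by simp
      have "y 0 \<le> (\<integral>s. H s * y s \<partial>lebesgue_on {0..0})" using ineq[of 0] t t0 by simp
      also have "\<dots> = integral {0..0} (\<lambda>s. H s * y s)"
        by (rule lebesgue_integral_eq_integral[OF Hyi]) (use t t0 in auto)
      finally show "y t = 0" using yb[of t] t t0 by simp
    qed
  next
    case (Suc n)
    show ?case
    proof (intro ballI impI)
      fix t1 assume t1: "t1 \<in> {0..T}" "t1 \<le> real (Suc n) * e"
      \<comment> \<open>Given \<open>y = 0\<close> up to \<open>n e\<close> and
        \<open>y \<le> C / 2 ^ j\<close> on the next step, only the integral of \<open>H\<close>
        over that step contributes, and it supplies another factor 1/2.\<close>
      have half: "y t \<le> C / 2 ^ j" if "t \<in> {0..T}" "t \<le> real (Suc n) * e" for j t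
        using that
      proof (induction j arbitrary: t)
        case 0
        then show ?case using yb[of t] by simp
      next
        case (Suc j)
        have C: "0 \<le> C" using yb[OF Suc.prems(1)] by linarith
        define t0 where "t0 = min t (real n * e)"
        have t0: "t0 \<in> {0..T}" "t0 \<in> {0..t}" "t0 \<le> real n * e" "t - t0 \<le> e"
          using Suc.prems e by (auto simp: t0_def min_def algebra_simps)
        have i0: "integrable (lebesgue_on {0..t}) (\<lambda>s. H s * (if s \<le> t0 then 1 else 0))"
        proof (rule Bochner_Integration.integrable_bound[OF Hi[OF Suc.prems(1)]])
          have "(\<lambda>x. x) \<in> borel_measurable (lebesgue_on {0..t})"
            using id_borel_measurable_lebesgue_on by (simp add: id_def)
          then show "(\<lambda>s. H s * (if s \<le> t0 then 1 else 0)) \<in> borel_measurable (lebesgue_on {0..t})"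
            using Hi[OF Suc.prems(1)]
            by (intro borel_measurable_times measurable_If borel_measurable_const borel_measurable_le) auto
        qed auto
        have "y t \<le> (\<integral>s. H s * y s \<partial>lebesgue_on {0..t})" by (rule ineq[OF Suc.prems(1)])
        also have "\<dots> \<le> (\<integral>s. C / 2 ^ j * (H s - H s * (if s \<le> t0 then 1 else 0)) \<partial>lebesgue_on {0..t})"
        proof (rule integral_mono)
          show "integrable (lebesgue_on {0..t}) (\<lambda>s. H s * y s)" by (rule Hyi[OF Suc.prems(1)])
          show "integrable (lebesgue_on {0..t}) (\<lambda>s. C / 2 ^ j * (H s - H s * (if s \<le> t0 then 1 else 0)))"
            by (intro Bochner_Integration.integrable_mult_right Bochner_Integration.integrable_diff i0 Hi Suc.prems(1))
          fix s assume "s \<in> space (lebesgue_on {0..t})"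
          then have s: "s \<in> {0..T}" "s \<le> real (Suc n) * e" using Suc.prems by auto
          show "H s * y s \<le> C / 2 ^ j * (H s - H s * (if s \<le> t0 then 1 else 0))"
          proof (cases "s \<le> t0")
            case True
            then have "y s = 0" using \<open>\<forall>t\<in>{0..T}. t \<le> real n * e \<longrightarrow> y t = 0\<close> s t0(3) by auto
            then show ?thesis using True by simp
          next
            case False
            have "H s * y s \<le> H s * (C / 2 ^ j)" by (intro mult_left_mono Suc.IH s H(2))
            then show ?thesis using False by (simp add: mult.commute)
          qed
        qed
        also have "\<dots> = C / 2 ^ j * (m t - m t0)"
          using integral_lebesgue_on_restrict[OF t0(2), of H] i0 Hi[OF Suc.prems(1)] by (simp add: m_def)
        also have "\<dots> \<le> C / 2 ^ j * (1 / 2)"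
        proof (rule mult_left_mono)
          have "dist (m t) (m t0) < 1 / 2"
            using d(2)[OF t0(1) Suc.prems(1)] t0 e by (simp add: dist_real_def)
          then show "m t - m t0 \<le> 1 / 2" unfolding dist_real_def by linarith
        qed (use C in simp)
        finally show ?case by simp
      qed
      have "(\<lambda>j. C * (1 / 2) ^ j) \<longlonglongrightarrow> C * 0"
        by (intro tendsto_mult_left LIMSEQ_power_zero) simp
      then have "(\<lambda>j. C / 2 ^ j) \<longlonglongrightarrow> 0" by (simp add: power_divide)
      then have "y t1 \<le> 0" by (rule LIMSEQ_le_const) (use half[OF t1] in auto)
      then show "y t1 = 0" using yb[OF t1(1)] by simp
    qed
  qed
  obtain n where "T / e \<le> real n" using real_arch_simple by blast
  then have "t \<le> real n * e" using t e by (simp add: pos_divide_le_eq)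
  then show ?thesis using step t by blast
qed

section \<open>The coefficient system and the uniqueness of its solution\<close>

context interval begin

definition rate :: "(nat \<Rightarrow> real) \<Rightarrow> nat \<Rightarrow> real" where
  "rate a k = - mu k * a k - 1 / 2 * Qc a k"

text \<open>The cosine coefficients of a solution solve this infinite system of integral equations.\<close>

definition coef_sol :: "real \<Rightarrow> (nat \<Rightarrow> real) \<Rightarrow> (nat \<Rightarrow> real \<Rightarrow> real) \<Rightarrow> bool" where
  "coef_sol T \<alpha> p \<longleftrightarrow>
    (\<forall>k. integrable (lebesgue_on {0..T}) (\<lambda>s. rate (\<lambda>j. p j s) k)) \<and>
    (\<forall>k. \<forall>t\<in>{0..T}. p k t = \<alpha> k + (\<integral>s. rate (\<lambda>j. p j s) k \<partial>lebesgue_on {0..t})) \<and>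
    (AE s in lebesgue_on {0..T}. summable (\<lambda>k. lam k ^ 6 * (p k s)\<^sup>2)) \<and>
    integrable (lebesgue_on {0..T}) (\<lambda>s. \<Sum>k. lam k ^ 6 * (p k s)\<^sup>2) \<and>
    (\<exists>C. \<forall>t\<in>{0..T}. \<forall>K. (\<Sum>k\<le>K. (p k t)\<^sup>2) \<le> C)"

lemma coef_sol_continuous:
  assumes "coef_sol T \<alpha> p"
  shows "continuous_on {0..T} (p k)"
proof -
  have "continuous_on {0..T} (\<lambda>t. \<alpha> k + (\<integral>s. rate (\<lambda>j. p j s) k \<partial>lebesgue_on {0..t}))"
    using assms unfolding coef_sol_def
    by (intro continuous_on_add continuous_on_const indefinite_integral_continuous_lebesgue(1)) auto
  then show ?thesis
    by (rule continuous_on_eq) (use assms in \<open>auto simp: coef_sol_def\<close>)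
qed

lemma summable_lam_from_6:
  assumes "summable (\<lambda>k. lam k ^ 6 * (a k)\<^sup>2)"
  shows "summable (\<lambda>k. (lam k)\<^sup>2 * \<bar>a k\<bar>)" "summable (\<lambda>k. lam k * \<bar>a k\<bar>)" "summable (\<lambda>k. \<bar>a k\<bar>)"
    "summable (\<lambda>k. lam k ^ 4 * (a k)\<^sup>2)"
    "(\<Sum>k. lam k ^ 4 * (a k)\<^sup>2) \<le> 1 / (lam 1)\<^sup>2 * (\<Sum>k. lam k ^ 6 * (a k)\<^sup>2)"
    "(\<Sum>k. lam k * \<bar>a k\<bar>)\<^sup>2 \<le> S0 / (lam 1)\<^sup>2 * (\<Sum>k. lam k ^ 6 * (a k)\<^sup>2)"
proof -
  show s2: "summable (\<lambda>k. (lam k)\<^sup>2 * \<bar>a k\<bar>)" using summable_lam_power[of 2 a] assms by simp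
  show "summable (\<lambda>k. lam k * \<bar>a k\<bar>)" using summable_lam_mono[OF s2, of 1] by simp
  show "summable (\<lambda>k. \<bar>a k\<bar>)" using summable_lam_mono[OF s2, of 0] by simp
  have l1: "0 < lam 1" by (rule lam_pos) simp
  have le: "lam k ^ 4 * (a k)\<^sup>2 \<le> 1 / (lam 1)\<^sup>2 * (lam k ^ 6 * (a k)\<^sup>2)" for k
  proof (cases "k = 0")
    case False
    have "(lam 1)\<^sup>2 * (lam k ^ 4 * (a k)\<^sup>2) \<le> (lam k)\<^sup>2 * (lam k ^ 4 * (a k)\<^sup>2)"
      using False by (intro mult_right_mono power_mono lam_mono) auto
    also have "\<dots> = lam k ^ 6 * (a k)\<^sup>2" by (simp add: mult.assoc[symmetric] flip: power_add)
    finally show ?thesis using l1 by (simp add: pos_le_divide_eq mult.commute)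
  qed simp
  have s6: "summable (\<lambda>k. 1 / (lam 1)\<^sup>2 * (lam k ^ 6 * (a k)\<^sup>2))" by (rule summable_mult[OF assms])
  show s4: "summable (\<lambda>k. lam k ^ 4 * (a k)\<^sup>2)"
    by (rule summable_comparison_test'[OF s6, of 0]) (use le in simp)
  show le4: "(\<Sum>k. lam k ^ 4 * (a k)\<^sup>2) \<le> 1 / (lam 1)\<^sup>2 * (\<Sum>k. lam k ^ 6 * (a k)\<^sup>2)"
    unfolding suminf_mult[OF assms, symmetric] by (rule suminf_le[OF le s4 s6])
  have "(\<Sum>k. lam k * \<bar>a k\<bar>)\<^sup>2 \<le> S0 * (\<Sum>k. lam k ^ 4 * (a k)\<^sup>2)"
    using suminf_lam_power_le[of 1 a] s4 by simp
  also have "\<dots> \<le> S0 * (1 / (lam 1)\<^sup>2 * (\<Sum>k. lam k ^ 6 * (a k)\<^sup>2))"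
    by (intro mult_left_mono le4 S0_nonneg)
  finally show "(\<Sum>k. lam k * \<bar>a k\<bar>)\<^sup>2 \<le> S0 / (lam 1)\<^sup>2 * (\<Sum>k. lam k ^ 6 * (a k)\<^sup>2)" by simp
qed

text \<open>Bessel applied to \<open>u\<^sub>x\<^sup>2 - w\<^sub>x\<^sup>2 = (u\<^sub>x - w\<^sub>x) (u\<^sub>x + w\<^sub>x)\<close>.\<close>

lemma Qc_difference_bound:
  assumes p: "summable (\<lambda>k. lam k ^ 6 * (p k)\<^sup>2)" and q: "summable (\<lambda>k. lam k ^ 6 * (q k)\<^sup>2)"
  shows "(\<Sum>k\<le>K. (Qc p k - Qc q k)\<^sup>2) \<le> 4 * (S0 / lam 1)\<^sup>2 *
      ((\<Sum>k. lam k ^ 6 * (p k)\<^sup>2) + (\<Sum>k. lam k ^ 6 * (q k)\<^sup>2)) * (\<Sum>k. lam k ^ 4 * (p k - q k)\<^sup>2)"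
    and "summable (\<lambda>k. lam k ^ 4 * (p k - q k)\<^sup>2)"
    and "(\<Sum>k. lam k ^ 4 * (p k - q k)\<^sup>2) \<le> 2 / (lam 1)\<^sup>2 * ((\<Sum>k. lam k ^ 6 * (p k)\<^sup>2) + (\<Sum>k. lam k ^ 6 * (q k)\<^sup>2))"
proof -
  note P = summable_lam_from_6[OF p] and Q = summable_lam_from_6[OF q]
  define SP SQ where "SP = (\<Sum>k. lam k ^ 6 * (p k)\<^sup>2)" and "SQ = (\<Sum>k. lam k ^ 6 * (q k)\<^sup>2)"
  have d2: "lam k ^ 4 * (p k - q k)\<^sup>2 \<le> 2 * (lam k ^ 4 * (p k)\<^sup>2) + 2 * (lam k ^ 4 * (q k)\<^sup>2)" for k
  proof -
    have "0 \<le> (p k + q k)\<^sup>2" by simp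
    then have "(p k - q k)\<^sup>2 \<le> 2 * (p k)\<^sup>2 + 2 * (q k)\<^sup>2" by (simp add: power2_sum power2_diff)
    then have "lam k ^ 4 * (p k - q k)\<^sup>2 \<le> lam k ^ 4 * (2 * (p k)\<^sup>2 + 2 * (q k)\<^sup>2)" by (rule mult_left_mono) simp
    then show ?thesis by (simp add: algebra_simps)
  qed
  have s2: "summable (\<lambda>k. 2 * (lam k ^ 4 * (p k)\<^sup>2) + 2 * (lam k ^ 4 * (q k)\<^sup>2))"
    by (intro summable_add summable_mult[OF P(4)] summable_mult[OF Q(4)])
  show sd: "summable (\<lambda>k. lam k ^ 4 * (p k - q k)\<^sup>2)"
    by (rule summable_comparison_test'[OF s2, of 0]) (use d2 in simp)
  have "(\<Sum>k. lam k ^ 4 * (p k - q k)\<^sup>2) \<le> (\<Sum>k. 2 * (lam k ^ 4 * (p k)\<^sup>2) + 2 * (lam k ^ 4 * (q k)\<^sup>2))"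
    by (rule suminf_le[OF d2 sd s2])
  also have "\<dots> = 2 * (\<Sum>k. lam k ^ 4 * (p k)\<^sup>2) + 2 * (\<Sum>k. lam k ^ 4 * (q k)\<^sup>2)"
    using suminf_add[OF summable_mult[OF P(4)] summable_mult[OF Q(4)], of 2 2]
    by (simp add: suminf_mult[OF P(4)] suminf_mult[OF Q(4)])
  also have "\<dots> \<le> 2 * (1 / (lam 1)\<^sup>2 * SP) + 2 * (1 / (lam 1)\<^sup>2 * SQ)"
    unfolding SP_def SQ_def by (intro add_mono mult_left_mono P(5) Q(5)) auto
  finally show "(\<Sum>k. lam k ^ 4 * (p k - q k)\<^sup>2) \<le> 2 / (lam 1)\<^sup>2 * ((\<Sum>k. lam k ^ 6 * (p k)\<^sup>2) + (\<Sum>k. lam k ^ 6 * (q k)\<^sup>2))"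
    unfolding SP_def[symmetric] SQ_def[symmetric] by (simp add: algebra_simps add_divide_distrib)
  define X where "X = (\<Sum>k. lam k ^ 4 * (p k - q k)\<^sup>2)"
  have X0: "0 \<le> X" unfolding X_def by (rule suminf_nonneg[OF sd]) simp
  \<comment> \<open>\<open>A\<close> bounds the difference of the two derivatives in the sup norm
    and \<open>B\<close> their sum. \<open>A\<^sup>2\<close> is controlled by the dissipation
    \<open>X\<close> of the difference, \<open>B\<^sup>2\<close> by the sums weighted with
    \<open>lam k ^ 6\<close>.\<close>
  define A B where "A = (\<Sum>k. lam k * \<bar>p k - q k\<bar>)" and "B = (\<Sum>k. lam k * \<bar>p k\<bar>) + (\<Sum>k. lam k * \<bar>q k\<bar>)"
  have sA: "summable (\<lambda>k. lam k * \<bar>p k - q k\<bar>)" using summable_lam_power[of 1 "\<lambda>k. p k - q k"] sd by simp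
  have A2: "A\<^sup>2 \<le> S0 * X" unfolding A_def X_def using suminf_lam_power_le[of 1 "\<lambda>k. p k - q k"] sd by simp
  have B2: "B\<^sup>2 \<le> 2 * (S0 / (lam 1)\<^sup>2) * (SP + SQ)"
  proof -
    have "0 \<le> ((\<Sum>k. lam k * \<bar>p k\<bar>) - (\<Sum>k. lam k * \<bar>q k\<bar>))\<^sup>2" by simp
    then have "B\<^sup>2 \<le> 2 * (\<Sum>k. lam k * \<bar>p k\<bar>)\<^sup>2 + 2 * (\<Sum>k. lam k * \<bar>q k\<bar>)\<^sup>2"
      by (simp add: B_def power2_sum power2_diff)
    also have "\<dots> \<le> 2 * (S0 / (lam 1)\<^sup>2 * SP) + 2 * (S0 / (lam 1)\<^sup>2 * SQ)"
      unfolding SP_def SQ_def by (intro add_mono mult_left_mono P(6) Q(6)) auto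
    finally show ?thesis by (simp add: algebra_simps add_divide_distrib)
  qed
  define F where "F x = (ux p x)\<^sup>2 - (ux q x)\<^sup>2" for x
  have Fc: "continuous_on {0..L} F" unfolding F_def by (intro continuous_intros continuous_ux P(2) Q(2))
  have uxd: "ux p x - ux q x = ux (\<lambda>k. p k - q k) x" for x
  proof -
    have sp: "summable (\<lambda>k. lam k * p k * sn k x)" "summable (\<lambda>k. lam k * q k * sn k x)"
      using P(2) Q(2) by (auto intro!: summable_trig(2) simp: abs_mult)
    show ?thesis unfolding ux_eq suminf_diff[OF sp] by (simp add: algebra_simps)
  qed
  have Fb: "(F x)\<^sup>2 \<le> A\<^sup>2 * B\<^sup>2" for x
  proof -
    have "\<bar>F x\<bar> = \<bar>ux p x - ux q x\<bar> * \<bar>ux p x + ux q x\<bar>"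
      by (simp add: F_def power2_eq_square abs_mult[symmetric] algebra_simps)
    also have "\<dots> \<le> A * B"
    proof (rule mult_mono)
      show "\<bar>ux p x - ux q x\<bar> \<le> A" unfolding uxd A_def by (rule abs_ux_le[OF sA])
      show "\<bar>ux p x + ux q x\<bar> \<le> B"
        using abs_ux_le[OF P(2), of x] abs_ux_le[OF Q(2), of x] unfolding B_def by linarith
      show "0 \<le> A" unfolding A_def by (rule suminf_nonneg[OF sA]) simp
    qed simp
    finally have "\<bar>F x\<bar>\<^sup>2 \<le> (A * B)\<^sup>2" by (rule power_mono) simp
    then show ?thesis by (simp add: power_mult_distrib)
  qed
  have ftF: "ft F k = Qc p k - Qc q k" for k
  proof -
    have "integrable M (\<lambda>x. (ux p x)\<^sup>2 * cs k x)" "integrable M (\<lambda>x. (ux q x)\<^sup>2 * cs k x)"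
      by (intro continuous_integrable_M continuous_intros continuous_ux P(2) Q(2))+
    then show ?thesis
      unfolding Qc_eq[OF P(2)] Qc_eq[OF Q(2)] F_def ft_def by (simp add: left_diff_distrib diff_divide_distrib)
  qed
  have "L / 2 * (\<Sum>k\<le>K. (Qc p k - Qc q k)\<^sup>2) = (\<Sum>k\<le>K. L / 2 * (ft F k)\<^sup>2)"
    by (simp add: ftF sum_distrib_left)
  also have "\<dots> \<le> (\<Sum>k\<le>K. nrm k * (ft F k)\<^sup>2)"
    by (intro sum_mono mult_right_mono nrm_ge) auto
  also have "\<dots> \<le> (\<integral>x. (F x)\<^sup>2 \<partial>M)" by (rule bessel_cs[OF L2_continuous[OF Fc]])
  also have "\<dots> \<le> (\<integral>x. A\<^sup>2 * B\<^sup>2 \<partial>M)"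
    by (intro integral_mono continuous_integrable_M continuous_intros Fc Fb)
  also have "\<dots> = L / 2 * (2 * (A\<^sup>2 * B\<^sup>2))" by simp
  finally have "(\<Sum>k\<le>K. (Qc p k - Qc q k)\<^sup>2) \<le> 2 * (A\<^sup>2 * B\<^sup>2)"
    using L_pos by (simp only: mult_le_cancel_left_pos[OF half_gt_zero[OF L_pos]])
  also have "\<dots> \<le> 2 * ((S0 * X) * (2 * (S0 / (lam 1)\<^sup>2) * (SP + SQ)))"
    by (intro mult_left_mono mult_mono A2 B2 mult_nonneg_nonneg S0_nonneg X0) auto
  also have "\<dots> = 4 * (S0 / lam 1)\<^sup>2 * (SP + SQ) * X"
    by (simp add: power_divide power2_eq_square)
  finally show "(\<Sum>k\<le>K. (Qc p k - Qc q k)\<^sup>2) \<le> 4 * (S0 / lam 1)\<^sup>2 *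
      ((\<Sum>k. lam k ^ 6 * (p k)\<^sup>2) + (\<Sum>k. lam k ^ 6 * (q k)\<^sup>2)) * (\<Sum>k. lam k ^ 4 * (p k - q k)\<^sup>2)"
    unfolding SP_def SQ_def X_def .
qed

text \<open>The squared \<open>L\<^sup>2\<close> difference has the dissipation \<open>X\<close>.
  The chain rule is available for finitely many modes, whereas the nonlinearity is bounded by the
  dissipation of all of them; the mismatch is the tail \<open>\<tau> K\<close>, which tends to 0 in
  \<open>L\<^sup>1\<close> in time.\<close>

theorem coef_sol_unique:
  assumes p: "coef_sol T \<alpha> p" and q: "coef_sol T \<alpha> q" and t: "t \<in> {0..T}"
  shows "p k t = q k t"
proof -
  define D where "D k s = p k s - q k s" for k s
  define R where "R k s = rate (\<lambda>j. p j s) k - rate (\<lambda>j. q j s) k" for k s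
  define SP SQ where "SP s = (\<Sum>k. lam k ^ 6 * (p k s)\<^sup>2)" and "SQ s = (\<Sum>k. lam k ^ 6 * (q k s)\<^sup>2)" for s
  define X where "X s = (\<Sum>k. lam k ^ 4 * (D k s)\<^sup>2)" for s
  define \<tau> where "\<tau> K s = X s - (\<Sum>k\<le>K. lam k ^ 4 * (D k s)\<^sup>2)" for K s
  define c where "c = 4 * (S0 / lam 1)\<^sup>2 + 1"
  \<comment> \<open>The leading 1 keeps \<open>c * h s\<close> positive at every time, so that it
    can be the weight in Young's inequality.\<close>
  define h where "h s = 1 + \<bar>SP s\<bar> + \<bar>SQ s\<bar>" for s
  define H where "H s = 1 + c / 2 * h s" for s
  define y where "y s = (\<Sum>k. (D k s)\<^sup>2)" for s
  let ?T = "lebesgue_on {0..T}"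
  have c0: "0 < c" by (simp add: c_def add_nonneg_pos)
  have h1: "1 \<le> h s" for s by (simp add: h_def)
  have pi: "\<And>k. integrable ?T (\<lambda>s. rate (\<lambda>j. p j s) k)" "\<And>k. integrable ?T (\<lambda>s. rate (\<lambda>j. q j s) k)"
    using p q by (auto simp: coef_sol_def)
  have peq: "\<And>k t. t \<in> {0..T} \<Longrightarrow> p k t = \<alpha> k + (\<integral>s. rate (\<lambda>j. p j s) k \<partial>lebesgue_on {0..t})"
    "\<And>k t. t \<in> {0..T} \<Longrightarrow> q k t = \<alpha> k + (\<integral>s. rate (\<lambda>j. q j s) k \<partial>lebesgue_on {0..t})"
    using p q unfolding coef_sol_def by blast+
  have sae: "AE s in ?T. summable (\<lambda>k. lam k ^ 6 * (p k s)\<^sup>2)" "AE s in ?T. summable (\<lambda>k. lam k ^ 6 * (q k s)\<^sup>2)"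
    and SPi: "integrable ?T SP" "integrable ?T SQ"
    using p q unfolding coef_sol_def SP_def SQ_def by blast+
  have Dm: "(\<lambda>s. D k s) \<in> borel_measurable ?T" for k
    unfolding D_def
    by (intro borel_measurable_diff borel_measurable_integrable continuous_imp_integrable_lebesgue_on
        coef_sol_continuous[OF p] coef_sol_continuous[OF q])
  have Ri: "integrable ?T (R k)" for k unfolding R_def[abs_def] by (intro Bochner_Integration.integrable_diff pi)
  have Rit: "integrable (lebesgue_on {0..t}) (R k)" if "t \<in> {0..T}" for k t
    by (rule indefinite_integral_continuous_lebesgue(2)[OF Ri that])
  have DR: "D k t = (\<integral>s. R k s \<partial>lebesgue_on {0..t})" if t: "t \<in> {0..T}" for k t
    unfolding D_def R_def peq(1)[OF t, of k] peq(2)[OF t, of k]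
    using indefinite_integral_continuous_lebesgue(2)[OF pi(1)[of k] t]
      indefinite_integral_continuous_lebesgue(2)[OF pi(2)[of k] t] by simp
  have Dsq: "(D k t)\<^sup>2 = (\<integral>s. 2 * D k s * R k s \<partial>lebesgue_on {0..t})"
    and DRi: "integrable (lebesgue_on {0..t}) (\<lambda>s. 2 * D k s * R k s)" if t: "t \<in> {0..T}" for k t
  proof -
    have e: "2 * (\<integral>r. R k r \<partial>lebesgue_on {0..s}) * R k s = 2 * D k s * R k s"
      if "s \<in> space (lebesgue_on {0..t})" for s
    proof -
      have "s \<in> {0..T}" using that t by auto
      then show ?thesis using DR by simp
    qed
    show "(D k t)\<^sup>2 = (\<integral>s. 2 * D k s * R k s \<partial>lebesgue_on {0..t})"
      unfolding DR[OF t] square_of_integral(1)[OF Rit[OF t]]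
      by (rule Bochner_Integration.integral_cong[OF refl]) (rule e)
    show "integrable (lebesgue_on {0..t}) (\<lambda>s. 2 * D k s * R k s)"
      using square_of_integral(2)[OF Rit[OF t], of k]
        Bochner_Integration.integrable_cong[OF refl e, of "lebesgue_on {0..t}"] by simp
  qed
  obtain C1 C2 where C: "\<And>t K. t \<in> {0..T} \<Longrightarrow> (\<Sum>k\<le>K. (p k t)\<^sup>2) \<le> C1" "\<And>t K. t \<in> {0..T} \<Longrightarrow> (\<Sum>k\<le>K. (q k t)\<^sup>2) \<le> C2"
    using p q unfolding coef_sol_def by blast
  define C where "C = 2 * C1 + 2 * C2"
  have yK: "(\<Sum>k\<le>K. (D k t)\<^sup>2) \<le> C" if t: "t \<in> {0..T}" for K t
  proof -
    have "(D k t)\<^sup>2 \<le> 2 * (p k t)\<^sup>2 + 2 * (q k t)\<^sup>2" for k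
    proof -
      have "0 \<le> (p k t + q k t)\<^sup>2" by simp
      then show ?thesis by (simp add: D_def power2_sum power2_diff)
    qed
    then have "(\<Sum>k\<le>K. (D k t)\<^sup>2) \<le> (\<Sum>k\<le>K. 2 * (p k t)\<^sup>2 + 2 * (q k t)\<^sup>2)" by (intro sum_mono)
    also have "\<dots> = 2 * (\<Sum>k\<le>K. (p k t)\<^sup>2) + 2 * (\<Sum>k\<le>K. (q k t)\<^sup>2)" by (simp add: sum.distrib sum_distrib_left)
    also have "\<dots> \<le> C" using C(1)[OF t, of K] C(2)[OF t, of K] unfolding C_def by linarith
    finally show ?thesis .
  qed
  have ys: "summable (\<lambda>k. (D k t)\<^sup>2)" if t: "t \<in> {0..T}" for t
    by (rule bounded_imp_summable[of _ C]) (use yK[OF t] in auto)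
  have ylim: "(\<lambda>K. \<Sum>k\<le>K. (D k t)\<^sup>2) \<longlonglongrightarrow> y t" if t: "t \<in> {0..T}" for t
    unfolding y_def by (rule summable_LIMSEQ'[OF ys[OF t]])
  have yb: "0 \<le> y t \<and> y t \<le> C" if t: "t \<in> {0..T}" for t
  proof
    show "0 \<le> y t" unfolding y_def by (rule suminf_nonneg[OF ys[OF t]]) simp
    show "y t \<le> C" by (rule LIMSEQ_le_const2[OF ylim[OF t]]) (use yK[OF t] in auto)
  qed
  have yge: "(\<Sum>k\<le>K. (D k t)\<^sup>2) \<le> y t" if t: "t \<in> {0..T}" for K t
    unfolding y_def by (rule sum_le_suminf[OF ys[OF t]]) auto
  have ym: "y \<in> borel_measurable ?T"
    unfolding y_def[abs_def] by (intro borel_measurable_suminf borel_measurable_power Dm)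
  have Xm: "X \<in> borel_measurable ?T"
    unfolding X_def[abs_def] by (intro borel_measurable_suminf borel_measurable_times borel_measurable_const borel_measurable_power Dm)
  have Hi: "integrable ?T H"
    unfolding H_def[abs_def] h_def
    by (intro Bochner_Integration.integrable_add Bochner_Integration.integrable_mult_right integrable_abs SPi
        continuous_imp_integrable_lebesgue_on continuous_on_const)
  have H0: "0 \<le> H s" for s using c0 h1[of s] by (simp add: H_def)
  have good: "AE s in ?T. s \<in> {0..T} \<and> 0 \<le> SP s \<and> 0 \<le> SQ s \<and> summable (\<lambda>k. lam k ^ 4 * (D k s)\<^sup>2) \<and>
      X s \<le> 2 / (lam 1)\<^sup>2 * (SP s + SQ s) \<and>
      (\<forall>K. (\<Sum>k\<le>K. (Qc (\<lambda>j. p j s) k - Qc (\<lambda>j. q j s) k)\<^sup>2) \<le> c * h s * X s)"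
    using sae(1) sae(2) AE_space
  proof eventually_elim
    case (elim s)
    note b = Qc_difference_bound[OF elim(1,2)]
    have nn: "0 \<le> SP s" "0 \<le> SQ s"
      unfolding SP_def SQ_def by (intro suminf_nonneg elim(1,2); simp)+
    have sX: "summable (\<lambda>k. lam k ^ 4 * (D k s)\<^sup>2)" unfolding D_def by (rule b(2))
    have X0: "0 \<le> X s" unfolding X_def by (rule suminf_nonneg[OF sX]) simp
    have "(\<Sum>k\<le>K. (Qc (\<lambda>j. p j s) k - Qc (\<lambda>j. q j s) k)\<^sup>2) \<le> c * h s * X s" for K
    proof -
      have "(\<Sum>k\<le>K. (Qc (\<lambda>j. p j s) k - Qc (\<lambda>j. q j s) k)\<^sup>2) \<le> 4 * (S0 / lam 1)\<^sup>2 * (SP s + SQ s) * X s"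
        using b(1)[of K] unfolding SP_def SQ_def X_def D_def .
      also have "\<dots> \<le> c * h s * X s"
        using nn X0 by (intro mult_right_mono mult_mono) (auto simp: c_def h_def)
      finally show ?thesis .
    qed
    moreover have "X s \<le> 2 / (lam 1)\<^sup>2 * (SP s + SQ s)"
      using b(3) unfolding SP_def SQ_def X_def D_def .
    ultimately show ?case using nn sX elim(3) by auto
  qed
  have Xi: "integrable ?T X"
  proof (rule Bochner_Integration.integrable_bound)
    show "integrable ?T (\<lambda>s. 2 / (lam 1)\<^sup>2 * (SP s + SQ s))"
      by (intro Bochner_Integration.integrable_add Bochner_Integration.integrable_mult_right SPi)
    show "AE s in ?T. norm (X s) \<le> norm (2 / (lam 1)\<^sup>2 * (SP s + SQ s))"
      using good
    proof eventually_elim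
      case (elim s)
      then have "0 \<le> X s" unfolding X_def by (intro suminf_nonneg) auto
      then show ?case using elim by simp
    qed
  qed (rule Xm)
  have \<tau>m: "\<tau> K \<in> borel_measurable ?T" for K
    unfolding \<tau>_def[abs_def]
    by (intro borel_measurable_diff Xm borel_measurable_sum borel_measurable_times borel_measurable_const borel_measurable_power Dm)
  have \<tau>b: "AE s in ?T. 0 \<le> \<tau> K s \<and> \<tau> K s \<le> X s" for K
    using good
  proof eventually_elim
    case (elim s)
    then have "(\<Sum>k\<le>K. lam k ^ 4 * (D k s)\<^sup>2) \<le> X s" unfolding X_def by (intro sum_le_suminf) auto
    moreover have "0 \<le> (\<Sum>k\<le>K. lam k ^ 4 * (D k s)\<^sup>2)" by (intro sum_nonneg) simp
    ultimately show ?case by (simp add: \<tau>_def)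
  qed
  have \<tau>n: "AE s in ?T. norm (\<tau> K s) \<le> X s" for K
    using \<tau>b[of K] by eventually_elim simp
  have \<tau>i: "integrable ?T (\<tau> K)" for K
  proof (rule Bochner_Integration.integrable_bound[OF Xi \<tau>m])
    show "AE s in ?T. norm (\<tau> K s) \<le> norm (X s)" using \<tau>n[of K] by eventually_elim simp
  qed
  have \<tau>lim: "(\<lambda>K. \<integral>s. \<tau> K s \<partial>?T) \<longlonglongrightarrow> 0"
  proof -
    have "(\<lambda>K. \<integral>s. \<tau> K s \<partial>?T) \<longlonglongrightarrow> (\<integral>s. 0 \<partial>?T)"
    proof (rule integral_dominated_convergence[OF _ \<tau>m Xi])
      show "AE s in ?T. (\<lambda>K. \<tau> K s) \<longlonglongrightarrow> 0"
        using good
      proof eventually_elim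
        case (elim s)
        then have "(\<lambda>K. X s - (\<Sum>k\<le>K. lam k ^ 4 * (D k s)\<^sup>2)) \<longlonglongrightarrow> X s - X s"
          unfolding X_def by (intro tendsto_diff tendsto_const summable_LIMSEQ') auto
        then show ?case by (simp add: \<tau>_def)
      qed
    qed (use \<tau>n in auto)
    then show ?thesis by simp
  qed
  have Hyi: "integrable ?T (\<lambda>s. H s * y s)"
  proof (rule Bochner_Integration.integrable_bound)
    show "integrable ?T (\<lambda>s. C * H s)" using Hi by simp
    show "(\<lambda>s. H s * y s) \<in> borel_measurable ?T" using Hi by (intro borel_measurable_times ym) auto
    show "AE s in ?T. norm (H s * y s) \<le> norm (C * H s)"
    proof (rule AE_I2)
      fix s assume "s \<in> space ?T"
      then have ys: "0 \<le> y s" "y s \<le> C" using yb[of s] by auto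
      then have "H s * y s \<le> H s * C" by (intro mult_left_mono H0) auto
      then show "norm (H s * y s) \<le> norm (C * H s)"
        using H0[of s] ys by (simp add: abs_mult mult.commute)
    qed
  qed
  have key: "AE s in ?T. (\<Sum>k\<le>K. 2 * D k s * R k s) \<le> \<tau> K s + H s * y s" for K
    using good
  proof eventually_elim
    case (elim s)
    define \<Delta> where "\<Delta> k = Qc (\<lambda>j. p j s) k - Qc (\<lambda>j. q j s) k" for k
    have hs: "0 < c * h s" using c0 h1[of s] by (intro mult_pos_pos) auto
    have X0: "0 \<le> X s" unfolding X_def by (rule suminf_nonneg) (use elim in auto)
    have pt: "2 * D k s * R k s \<le> - (lam k ^ 4 * (D k s)\<^sup>2) + (D k s)\<^sup>2 + ((\<Delta> k)\<^sup>2 / (c * h s) + c * h s * (D k s)\<^sup>2) / 2" for k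
    proof -
      have arith: "A \<le> - (l * d) + d + E" if "A = B - C" "B \<le> (1 - l) * d" "- C \<le> E" for A B C E l d :: real
        using that by (simp add: algebra_simps)
      have "2 * D k s * R k s = - 2 * mu k * (D k s)\<^sup>2 - D k s * \<Delta> k"
        by (simp add: R_def rate_def D_def \<Delta>_def algebra_simps power2_eq_square)
      \<comment> \<open>From \<open>((lam k)\<^sup>2 - 1)\<^sup>2 \<ge> 0\<close>: the unstable
        modes cost the zero-order term, and one multiple of \<open>lam k ^ 4\<close> remains as
        dissipation.\<close>
      moreover have "- 2 * mu k * (D k s)\<^sup>2 \<le> (1 - lam k ^ 4) * (D k s)\<^sup>2"
      proof (rule mult_right_mono)
        have "0 \<le> ((lam k)\<^sup>2 - 1)\<^sup>2" by simp
        then show "- 2 * mu k \<le> 1 - lam k ^ 4" by (simp add: mu_def power2_diff flip: power_mult)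
      qed simp
      moreover have "- (D k s * \<Delta> k) \<le> ((\<Delta> k)\<^sup>2 / (c * h s) + c * h s * (D k s)\<^sup>2) / 2"
      proof -
        \<comment> \<open>Young's inequality weighted with \<open>c * h s\<close>: dividing the
          squared differences of the \<open>Qc\<close> by this weight leaves a sum of at most
          \<open>X s\<close>.\<close>
        define z where "z = sqrt (c * h s)"
        have z: "0 < z" "z\<^sup>2 = c * h s" using hs by (auto simp: z_def)
        have "0 \<le> (\<Delta> k / z + z * D k s)\<^sup>2" by simp
        also have "\<dots> = (\<Delta> k)\<^sup>2 / z\<^sup>2 + z\<^sup>2 * (D k s)\<^sup>2 + 2 * (D k s * \<Delta> k)"
          using z(1) by (simp add: power2_sum power_divide power_mult_distrib)
        finally show ?thesis unfolding z(2) by simp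
      qed
      ultimately show ?thesis by (rule arith)
    qed
    have "(\<Sum>k\<le>K. 2 * D k s * R k s) \<le> (\<Sum>k\<le>K. - (lam k ^ 4 * (D k s)\<^sup>2) + (D k s)\<^sup>2 + ((\<Delta> k)\<^sup>2 / (c * h s) + c * h s * (D k s)\<^sup>2) / 2)"
      by (rule sum_mono[OF pt])
    also have "\<dots> = - (\<Sum>k\<le>K. lam k ^ 4 * (D k s)\<^sup>2) + H s * (\<Sum>k\<le>K. (D k s)\<^sup>2) + (\<Sum>k\<le>K. (\<Delta> k)\<^sup>2) / (c * h s) / 2"
    proof -
      have "- (lam k ^ 4 * (D k s)\<^sup>2) + (D k s)\<^sup>2 + ((\<Delta> k)\<^sup>2 / (c * h s) + c * h s * (D k s)\<^sup>2) / 2 =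
          - (lam k ^ 4 * (D k s)\<^sup>2) + H s * (D k s)\<^sup>2 + (\<Delta> k)\<^sup>2 / (c * h s) / 2" for k
        by (simp add: H_def algebra_simps add_divide_distrib)
      then show ?thesis
        by (simp only: sum.distrib sum_negf sum_distrib_left[symmetric] sum_divide_distrib[symmetric])
    qed
    \<comment> \<open>\<open>X s\<close> minus the partial sum of the dissipation is exactly the
      tail \<open>\<tau> K s\<close>.\<close>
    also have "\<dots> \<le> - (\<Sum>k\<le>K. lam k ^ 4 * (D k s)\<^sup>2) + H s * y s + X s"
    proof (intro add_mono order_refl mult_left_mono yge H0)
      show "s \<in> {0..T}" using elim by blast
      have "(\<Sum>k\<le>K. (\<Delta> k)\<^sup>2) \<le> X s * (c * h s)"
        using elim unfolding \<Delta>_def by (simp add: mult.commute)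
      then have "(\<Sum>k\<le>K. (\<Delta> k)\<^sup>2) / (c * h s) \<le> X s" by (simp only: pos_divide_le_eq[OF hs])
      moreover have half: "a / 2 \<le> x" if "a \<le> x" "0 \<le> x" for a x :: real using that by linarith
      ultimately show "(\<Sum>k\<le>K. (\<Delta> k)\<^sup>2) / (c * h s) / 2 \<le> X s" using X0 by (intro half)
    qed
    finally show ?case by (simp add: \<tau>_def)
  qed
  have ineq: "y t \<le> (\<integral>s. H s * y s \<partial>lebesgue_on {0..t})" if t: "t \<in> {0..T}" for t
  proof (rule LIMSEQ_le[OF ylim[OF t]])
    show "(\<lambda>K. (\<integral>s. \<tau> K s \<partial>?T) + (\<integral>s. H s * y s \<partial>lebesgue_on {0..t})) \<longlonglongrightarrow> (\<integral>s. H s * y s \<partial>lebesgue_on {0..t})"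
      using tendsto_add[OF \<tau>lim tendsto_const[of "\<integral>s. H s * y s \<partial>lebesgue_on {0..t}"]] by simp
    have sub: "AE s in lebesgue_on {0..t}. P s" if "AE s in ?T. P s" for P
      using that t by (auto simp: AE_restrict_space_iff elim: eventually_mono)
    have "(\<Sum>k\<le>K. (D k t)\<^sup>2) \<le> (\<integral>s. \<tau> K s \<partial>?T) + (\<integral>s. H s * y s \<partial>lebesgue_on {0..t})" for K
    proof -
      have \<tau>t: "integrable (lebesgue_on {0..t}) (\<tau> K)" by (rule indefinite_integral_continuous_lebesgue(2)[OF \<tau>i t])
      have Ht: "integrable (lebesgue_on {0..t}) (\<lambda>s. H s * y s)" by (rule indefinite_integral_continuous_lebesgue(2)[OF Hyi t])
      have "(\<Sum>k\<le>K. (D k t)\<^sup>2) = (\<integral>s. (\<Sum>k\<le>K. 2 * D k s * R k s) \<partial>lebesgue_on {0..t})"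
        unfolding Dsq[OF t] by (rule Bochner_Integration.integral_sum[symmetric, OF DRi[OF t]])
      also have "\<dots> \<le> (\<integral>s. \<tau> K s + H s * y s \<partial>lebesgue_on {0..t})"
        by (rule integral_mono_AE) (intro Bochner_Integration.integrable_sum Bochner_Integration.integrable_add DRi[OF t] \<tau>t Ht sub[OF key])+
      also have "\<dots> = (\<integral>s. \<tau> K s \<partial>lebesgue_on {0..t}) + (\<integral>s. H s * y s \<partial>lebesgue_on {0..t})"
        using \<tau>t Ht by simp
      also have "(\<integral>s. \<tau> K s \<partial>lebesgue_on {0..t}) \<le> (\<integral>s. \<tau> K s \<partial>?T)"
      proof -
        have "(\<lambda>x. x) \<in> borel_measurable ?T" using id_borel_measurable_lebesgue_on by (simp add: id_def)
        then have i: "integrable ?T (\<lambda>r. \<tau> K r * (if r \<le> t then 1 else 0))"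
          by (intro Bochner_Integration.integrable_bound[OF \<tau>i[of K]] borel_measurable_times \<tau>m measurable_If borel_measurable_const borel_measurable_le) auto
        have "(\<integral>r. \<tau> K r * (if r \<le> t then 1 else 0) \<partial>?T) \<le> (\<integral>s. \<tau> K s \<partial>?T)"
        proof (rule integral_mono_AE[OF i \<tau>i])
          show "AE r in ?T. \<tau> K r * (if r \<le> t then 1 else 0) \<le> \<tau> K r"
            using \<tau>b[of K] by eventually_elim auto
        qed
        then show ?thesis unfolding integral_lebesgue_on_restrict[OF t] .
      qed
      finally show ?thesis by simp
    qed
    then show "\<exists>N. \<forall>n\<ge>N. (\<Sum>k\<le>n. (D k t)\<^sup>2) \<le> (\<integral>s. \<tau> n s \<partial>?T) + (\<integral>s. H s * y s \<partial>lebesgue_on {0..t})"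
      by blast
  qed
  have "y t = 0" by (rule gronwall_integrable_kernel[OF Hi H0 ym yb ineq t])
  moreover have "(D k t)\<^sup>2 \<le> (\<Sum>k\<le>k. (D k t)\<^sup>2)" by (rule member_le_sum) auto
  ultimately have "(D k t)\<^sup>2 \<le> 0" using yge[OF t, of k] by linarith
  then show ?thesis by (simp add: D_def)
qed

end

section \<open>Coefficients of weak solutions\<close>

text \<open>Lebesgue measure is complete. This matters for expressions built from
  \<open>weak_deriv\<close>, whose arbitrary representatives carry no measurability in time of their
  own.\<close>

lemma borel_measurable_lebesgue_on_AE:
  fixes f g :: "real \<Rightarrow> real"
  assumes f: "f \<in> borel_measurable (lebesgue_on S)" and S: "S \<in> sets lebesgue"
    and ae: "AE x in lebesgue_on S. f x = g x"
  shows "g \<in> borel_measurable (lebesgue_on S)"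
proof -
  have "(\<lambda>x. if x \<in> S then f x else 0) \<in> borel_measurable lebesgue"
    using f S by (subst borel_measurable_if) auto
  moreover have "AE x in lebesgue. (if x \<in> S then f x else 0) = (if x \<in> S then g x else 0)"
    using ae S by (auto simp: AE_restrict_space_iff elim: eventually_mono)
  ultimately have "(\<lambda>x. if x \<in> S then g x else 0) \<in> borel_measurable lebesgue"
    by (rule borel_measurable_AE)
  then show ?thesis using S by (subst (asm) borel_measurable_if) auto
qed

lemma integral_lebesgue_on_cong_AE:
  fixes f g :: "real \<Rightarrow> real"
  assumes "f \<in> borel_measurable (lebesgue_on S)" "S \<in> sets lebesgue" "AE x in lebesgue_on S. g x = f x"
  shows "(\<integral>x. g x \<partial>lebesgue_on S) = (\<integral>x. f x \<partial>lebesgue_on S)"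
proof (rule integral_cong_AE)
  show "g \<in> borel_measurable (lebesgue_on S)"
    by (rule borel_measurable_lebesgue_on_AE[OF assms(1,2)]) (use assms(3) in \<open>eventually_elim, simp\<close>)
qed (use assms in auto)

lemma continuous_AE_zero_imp_zero:
  fixes f :: "real \<Rightarrow> real"
  assumes f: "continuous_on {a..b} f" and ab: "a < b"
    and ae: "AE x in lebesgue_on {a<..<b}. f x = 0" and x: "x \<in> {a..b}"
  shows "f x = 0"
proof -
  have c: "continuous_on {a..b} (\<lambda>x. \<bar>f x\<bar>)" by (intro continuous_intros f)
  have i: "integrable (lebesgue_on {a..b}) (\<lambda>x. \<bar>f x\<bar>)" by (rule continuous_imp_integrable_lebesgue_on[OF c])
  have "AE x in lebesgue_on {a..b}. x \<noteq> a" "AE x in lebesgue_on {a..b}. x \<noteq> b"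
    by (rule AE_lebesgue_on_neq; simp)+
  moreover have "AE x in lebesgue_on {a..b}. x \<in> {a<..<b} \<longrightarrow> f x = 0"
    using ae by (auto simp: AE_restrict_space_iff elim: eventually_mono)
  moreover have "AE x in lebesgue_on {a..b}. x \<in> {a..b}" by (rule AE_I2) simp
  ultimately have "AE x in lebesgue_on {a..b}. \<bar>f x\<bar> = 0"
    by eventually_elim auto
  then have "(\<integral>x. \<bar>f x\<bar> \<partial>lebesgue_on {a..b}) = 0" by (rule integral_eq_zero_AE)
  then have "((\<lambda>x. \<bar>f x\<bar>) has_integral 0) (cbox a b)"
    using has_integral_integral_lebesgue_on[OF i] by simp
  then have "\<bar>f x\<bar> = 0"
    using has_integral_0_cbox_imp_0[of a b "\<lambda>x. \<bar>f x\<bar>" x] c ab x by (auto simp: box_real)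
  then show ?thesis by simp
qed

lemma continuous_AE_le_imp_le:
  fixes f :: "real \<Rightarrow> real"
  assumes f: "continuous_on {a..b} f" and ab: "a < b"
    and ae: "AE x in lebesgue_on {a..b}. f x \<le> C" and x: "x \<in> {a..b}"
  shows "f x \<le> C"
proof -
  have c: "continuous_on {a..b} (\<lambda>x. max 0 (f x - C))" by (intro continuous_intros f)
  have "AE x in lebesgue_on {a<..<b}. max 0 (f x - C) = 0"
    using ae by (auto simp: AE_restrict_space_iff max_def elim: eventually_mono)
  then have "max 0 (f x - C) = 0" by (rule continuous_AE_zero_imp_zero[OF c ab _ x])
  then show ?thesis by (simp add: max_def split: if_splits)
qed

context interval begin

lemma has_weak_deriv_AE_cong:
  assumes f: "integrable M f" and f': "integrable M f'" and ae: "AE x in M. f x = f' x"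
    and w: "has_weak_deriv L k f g"
  shows "has_weak_deriv L k f' g"
  unfolding has_weak_deriv_def
proof (intro allI impI)
  fix \<phi> assume t: "test_fun L \<phi>"
  have t': "smooth_fun ((deriv ^^ n) \<phi>)" for n
    by (induction n) (use test_fun_smooth[OF t] smooth_fun_deriv in auto)
  have "(\<integral>x. f' x * (deriv ^^ k) \<phi> x \<partial>M) = (\<integral>x. f x * (deriv ^^ k) \<phi> x \<partial>M)"
    by (rule integral_cong_AE)
       (use ae in \<open>auto intro!: borel_measurable_integrable integrable_mult_continuous f f' smooth_fun_continuous t' elim: eventually_mono\<close>)
  then show "(\<integral>x. f' x * (deriv ^^ k) \<phi> x \<partial>M) = (- 1) ^ k * (\<integral>x. g x * \<phi> x \<partial>M)"
    using w t unfolding has_weak_deriv_def by simp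
qed

text \<open>\<open>e\<close> is the sign left by the integrations by parts. With
  \<open>n \<noteq> 0\<close> the term of index 0, about which sines say nothing, drops out.\<close>

lemma sine_bessel_suminf:
  assumes g: "L2_fun L g" and c: "\<And>k. (\<integral>x. g x * sn k x \<partial>M) = e * (lam k ^ n * (L / 2) * a k)" and e: "e\<^sup>2 = 1" and n: "n \<noteq> 0"
  shows "summable (\<lambda>k. lam k ^ (2 * n) * (a k)\<^sup>2)"
    and "(\<Sum>k. lam k ^ (2 * n) * (a k)\<^sup>2) \<le> 2 / L * (\<integral>x. (g x)\<^sup>2 \<partial>M)"
proof -
  have b: "(\<Sum>k<K. lam k ^ (2 * n) * (a k)\<^sup>2) \<le> 2 / L * (\<integral>x. (g x)\<^sup>2 \<partial>M)" for K
  proof -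
    have "(\<Sum>k<K. lam k ^ (2 * n) * (a k)\<^sup>2) \<le> (\<Sum>k\<in>{1..K}. lam k ^ (2 * n) * (a k)\<^sup>2)"
    proof -
      have "(\<Sum>k<K. lam k ^ (2 * n) * (a k)\<^sup>2) \<le> (\<Sum>k\<in>insert 0 {1..K}. lam k ^ (2 * n) * (a k)\<^sup>2)"
        by (rule sum_mono2) auto
      also have "\<dots> = (\<Sum>k\<in>{1..K}. lam k ^ (2 * n) * (a k)\<^sup>2)" using n by simp
      finally show ?thesis .
    qed
    also have "\<dots> = (\<Sum>k\<in>{1..K}. (\<integral>x. g x * sn k x \<partial>M)\<^sup>2) * (4 / L\<^sup>2)"
      unfolding c sum_distrib_right
      using L_pos by (intro sum.cong refl) (simp add: power_mult_distrib e power_divide power_mult[symmetric] mult.commute[of 2 n])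
    also have "\<dots> \<le> (L / 2 * (\<integral>x. (g x)\<^sup>2 \<partial>M)) * (4 / L\<^sup>2)"
      by (rule mult_right_mono[OF bessel_sn[OF g]]) simp
    also have "\<dots> = 2 / L * (\<integral>x. (g x)\<^sup>2 \<partial>M)" using L_pos by (simp add: power2_eq_square)
    finally show ?thesis .
  qed
  show s: "summable (\<lambda>k. lam k ^ (2 * n) * (a k)\<^sup>2)"
    by (rule summableI_nonneg_bounded[OF _ b]) simp
  show "(\<Sum>k. lam k ^ (2 * n) * (a k)\<^sup>2) \<le> 2 / L * (\<integral>x. (g x)\<^sup>2 \<partial>M)"
    by (rule suminf_le_const[OF s b])
qed

lemma nrm_half: "k \<noteq> 0 \<Longrightarrow> nrm k = L / 2" by (simp add: nrm_def)

text \<open>Up to sign, the sine integrals of the weak derivative are \<open>lam k\<close> times the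
  cosine integrals of \<open>f\<close>; Bessel's inequality for the sines concludes.\<close>

lemma H1_coefficients:
  assumes "sobolev L 1 f"
  shows "summable (\<lambda>k. (lam k)\<^sup>2 * (ft f k)\<^sup>2)"
proof -
  note w = sobolev_weak_deriv[OF assms order_refl]
  have f: "L2_fun L f" using assms by (simp add: sobolev_def)
  have c: "(\<integral>x. weak_deriv L 1 f x * sn k x \<partial>M) = - 1 * (lam k ^ 1 * (L / 2) * ft f k)" for k
    using weak_deriv_sine_coeff[OF f w, of k] by (cases "k = 0") (simp_all add: integral_cs_ft nrm_half)
  show ?thesis using sine_bessel_suminf(1)[OF w(1) c] by simp
qed

text \<open>Three integrations by parts alternate between sines and cosines. The sine steps produce
  no boundary term; the cosine step, from \<open>u\<^sub>x\<close> to
  \<open>u\<^sub>x\<^sub>x\<close>, uses the zero traces. The resulting decay makes the series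
  converge, which identifies \<open>u\<^sub>x\<close> with \<open>- ux\<close> and the quadratic
  term with \<open>Qc\<close>.\<close>

lemma H3_coefficients:
  assumes f: "sobolev L 3 f" and tr: "has_trace L (weak_deriv L 1 f) 0 0" "has_trace L (weak_deriv L 1 f) L 0"
  shows "(\<integral>x. weak_deriv L 3 f x * sn k x \<partial>M) = lam k ^ 3 * (nrm k * ft f k)"
    and "(\<integral>x. weak_deriv L 2 f x * cs k x \<partial>M) = - (lam k)\<^sup>2 * (nrm k * ft f k)"
    and "(\<integral>x. (weak_deriv L 1 f x)\<^sup>2 * cs k x \<partial>M) = nrm k * Qc (ft f) k"
    and "summable (\<lambda>k. lam k ^ 6 * (ft f k)\<^sup>2)"
    and "(\<Sum>k. lam k ^ 6 * (ft f k)\<^sup>2) \<le> 2 / L * (\<integral>x. (weak_deriv L 3 f x)\<^sup>2 \<partial>M)"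
proof -
  have f2: "L2_fun L f" using f by (simp add: sobolev_def)
  let ?g1 = "weak_deriv L 1 f" and ?g2 = "weak_deriv L 2 f" and ?g3 = "weak_deriv L 3 f"
  have w1: "L2_fun L ?g1" "has_weak_deriv L 1 f ?g1" by (rule sobolev_weak_deriv[OF f]; simp)+
  have w2: "L2_fun L ?g2" "has_weak_deriv L (Suc 1) f ?g2"
    using sobolev_weak_deriv[OF f, of 2] by (simp_all add: numeral_2_eq_2)
  have w3: "L2_fun L ?g3" "has_weak_deriv L (Suc 2) f ?g3"
    using sobolev_weak_deriv[OF f, of 3] by (simp_all add: numeral_3_eq_3 numeral_2_eq_2)
  have w12: "has_weak_deriv L 1 ?g1 ?g2" by (rule has_weak_deriv_step[OF w1(2) w2(2)])
  have w2': "has_weak_deriv L 2 f ?g2" using w2(2) by (simp add: numeral_2_eq_2)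
  have w23: "has_weak_deriv L 1 ?g2 ?g3" by (rule has_weak_deriv_step[OF w2' w3(2)])
  obtain F where F: "continuous_on {0..L} F" "AE x in M. ?g1 x = F x" "F 0 = 0"
    using tr(1) unfolding has_trace_def by blast
  obtain F' where F': "continuous_on {0..L} F'" "AE x in M. ?g1 x = F' x" "F' L = 0"
    using tr(2) unfolding has_trace_def by blast
  \<comment> \<open>The two traces may be witnessed by different continuous representatives; these
    agree almost everywhere, hence also at the endpoint.\<close>
  have "AE x in M. F x - F' x = 0" using F(2) F'(2) by eventually_elim simp
  then have "F L - F' L = 0"
    by (rule continuous_AE_zero_imp_zero[OF continuous_on_diff[OF F(1) F'(1)] L_pos]) (use L_pos in simp)
  then have FL: "F L = 0" using F'(3) by simp
  have i1: "(\<integral>x. ?g1 x * sn k x \<partial>M) = - lam k * (nrm k * ft f k)" for k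
    using weak_deriv_sine_coeff[OF f2 w1, of k] by (simp add: integral_cs_ft)
  have i2: "(\<integral>x. ?g2 x * cs k x \<partial>M) = - (lam k)\<^sup>2 * (nrm k * ft f k)" for k
  proof -
    have "(\<integral>x. ?g1 x * deriv (cs k) x \<partial>M) = - (\<integral>x. ?g2 x * cs k x \<partial>M)"
      by (rule weak_deriv_zero_trace[OF w1(1) w2(1) w12 F(1,3) FL F(2) smooth_cs])
    moreover have "(\<integral>x. ?g1 x * deriv (cs k) x \<partial>M) = - lam k * (\<integral>x. ?g1 x * sn k x \<partial>M)"
      unfolding deriv_cs mult.left_commute[of _ "- lam k"] by simp
    ultimately show ?thesis unfolding i1 by (simp add: power2_eq_square)
  qed
  then show "(\<integral>x. ?g2 x * cs k x \<partial>M) = - (lam k)\<^sup>2 * (nrm k * ft f k)" .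
  have i3: "(\<integral>x. ?g3 x * sn k x \<partial>M) = lam k ^ 3 * (nrm k * ft f k)" for k
    unfolding weak_deriv_sine_coeff[OF w2(1) w3(1) w23] i2 by (simp add: power2_eq_square power3_eq_cube)
  then show "(\<integral>x. ?g3 x * sn k x \<partial>M) = lam k ^ 3 * (nrm k * ft f k)" .
  have c3: "(\<integral>x. ?g3 x * sn k x \<partial>M) = 1 * (lam k ^ 3 * (L / 2) * ft f k)" for k
    unfolding i3 by (cases "k = 0") (simp_all add: nrm_half)
  show s6: "summable (\<lambda>k. lam k ^ 6 * (ft f k)\<^sup>2)"
    using sine_bessel_suminf(1)[OF w3(1) c3] by simp
  show "(\<Sum>k. lam k ^ 6 * (ft f k)\<^sup>2) \<le> 2 / L * (\<integral>x. (?g3 x)\<^sup>2 \<partial>M)"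
    using sine_bessel_suminf(2)[OF w3(1) c3] by simp
  note s = summable_lam_from_6[OF s6]
  have fc: "AE x in M. f x = cser (ft f) x" by (rule AE_eq_cser_ft[OF L2_integrable[OF f2] s(3)])
  have uc: "continuous_on {0..L} (ux (ft f))" by (rule continuous_ux[OF s(2)])
  have "has_weak_deriv L (Suc 0) (cser (ft f)) (\<lambda>x. - ux (ft f) x)"
    by (rule has_weak_deriv_classical[OF has_weak_deriv_0])
       (auto intro!: continuous_intros uc has_derivative_trig_series(1)[OF s(2), folded ux_def])
  then have "has_weak_deriv L 1 f (\<lambda>x. - ux (ft f) x)"
    using has_weak_deriv_AE_cong[of "cser (ft f)" f 1] fc L2_integrable[OF f2]
      continuous_integrable_M[OF continuous_trig_series(1)[OF s(3)]] by (simp add: eventually_mono)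
  then have g1: "AE x in M. ?g1 x = - ux (ft f) x"
    by (rule has_weak_deriv_unique[OF w1(1) L2_continuous[OF continuous_on_minus[OF uc]] w1(2)])
  have "(\<integral>x. (?g1 x)\<^sup>2 * cs k x \<partial>M) = (\<integral>x. (ux (ft f) x)\<^sup>2 * cs k x \<partial>M)"
  proof (rule integral_cong_AE)
    show "(\<lambda>x. (?g1 x)\<^sup>2 * cs k x) \<in> borel_measurable M"
      by (rule borel_measurable_integrable[OF integrable_mult_continuous[OF L2_square_integrable[OF w1(1)] cont_trig(1)]])
    show "(\<lambda>x. (ux (ft f) x)\<^sup>2 * cs k x) \<in> borel_measurable M"
      by (intro continuous_measurable_M continuous_intros uc)
    show "AE x in M. (?g1 x)\<^sup>2 * cs k x = (ux (ft f) x)\<^sup>2 * cs k x"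
      using g1 by eventually_elim simp
  qed
  then show "(\<integral>x. (?g1 x)\<^sup>2 * cs k x \<partial>M) = nrm k * Qc (ft f) k"
    unfolding Qc_eq[OF s(2)] integral_cs_ft .
qed

text \<open>Lebesgue measurability in the plane does not make every section measurable, so
  \<open>W\<close> is replaced by a Borel function \<open>b\<close> equal to it almost everywhere.
  For almost every \<open>s\<close> the sections agree, and completeness carries measurability
  back.\<close>

lemma ft_measurable_in_time:
  assumes "jointly_measurable L T w"
  shows "(\<lambda>s. ft (w s) k) \<in> borel_measurable (lebesgue_on {0..T})"
proof -
  let ?S = "{0..T} \<times> {0<..<L}"
  have S: "?S \<in> sets lebesgue" by (intro sets_completionI_sets) (auto intro!: borel_Times simp: sets_lborel)
  define W where "W z = (if z \<in> ?S then w (fst z) (snd z) else 0) * cs k (snd z)" for z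
  have "(\<lambda>z. if z \<in> ?S then w (fst z) (snd z) else 0) \<in> borel_measurable lebesgue"
    using assms S by (subst borel_measurable_if) (auto simp: jointly_measurable_def case_prod_beta')
  moreover have "(\<lambda>z :: real \<times> real. cs k (snd z)) \<in> borel_measurable lebesgue"
    by (intro measurable_completion) (simp add: borel_measurable_continuous_onI continuous_intros)
  ultimately have "W \<in> borel_measurable lebesgue" unfolding W_def by (rule borel_measurable_times)
  then obtain b where b: "b \<in> borel_measurable lborel" "AE z in lborel. W z = b z"
    using completion_ex_borel_measurable_real by blast
  have bm: "b \<in> borel_measurable (lborel \<Otimes>\<^sub>M lborel)" using b(1) unfolding lborel_prod .
  have "AE z in lborel \<Otimes>\<^sub>M lborel. W z = b z" using b(2) unfolding lborel_prod .
  then have "AE s in lborel. AE x in lborel. W (s, x) = b (s, x)"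
    by (rule lborel_pair.AE_pair)
  then have "AE s in lebesgue. AE x in lborel. W (s, x) = b (s, x)"
    by (rule AE_completion)
  then have ae: "AE s in lebesgue_on {0..T}. AE x in lborel. W (s, x) = b (s, x)"
    by (auto simp: AE_restrict_space_iff elim: eventually_mono)
  have "(\<lambda>s. \<integral>x. b (s, x) \<partial>lborel) \<in> borel_measurable lborel"
    using bm by (intro lborel.borel_measurable_lebesgue_integral) (simp add: case_prod_beta')
  then have "(\<lambda>s. (\<integral>x. b (s, x) \<partial>lborel) / nrm k) \<in> borel_measurable (lebesgue_on {0..T})"
    by (intro borel_measurable_divide borel_measurable_const measurable_restrict_space1 measurable_completion)
  then show ?thesis
  proof (rule borel_measurable_lebesgue_on_AE)
    show "AE s in lebesgue_on {0..T}. (\<integral>x. b (s, x) \<partial>lborel) / nrm k = ft (w s) k"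
      using ae AE_space
    proof eventually_elim
      case (elim s)
      have bs: "(\<lambda>x. b (s, x)) \<in> borel_measurable lborel"
        using measurable_compose[OF _ bm, of "\<lambda>x. (s, x)" lborel] by simp
      then have bs': "(\<lambda>x. b (s, x)) \<in> borel_measurable lebesgue" by (rule measurable_completion)
      have ae2: "AE x in lebesgue. b (s, x) = W (s, x)"
        using AE_completion[OF elim(1)] by (rule eventually_mono) simp
      have "(\<integral>x. w s x * cs k x \<partial>M) = (\<integral>x. indicator {0<..<L} x *\<^sub>R (w s x * cs k x) \<partial>lebesgue)"
        by (rule integral_restrict_space) simp
      also have "\<dots> = (\<integral>x. W (s, x) \<partial>lebesgue)"
        by (rule Bochner_Integration.integral_cong) (use elim(2) in \<open>auto simp: W_def indicator_def\<close>)
      also have "\<dots> = (\<integral>x. b (s, x) \<partial>lebesgue)"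
      proof (rule integral_cong_AE[OF _ bs'])
        show "(\<lambda>x. W (s, x)) \<in> borel_measurable lebesgue" by (rule borel_measurable_AE[OF bs' ae2])
        show "AE x in lebesgue. W (s, x) = b (s, x)" using ae2 by (rule eventually_mono) simp
      qed
      also have "\<dots> = (\<integral>x. b (s, x) \<partial>lborel)" by (rule integral_completion[OF bs])
      finally show ?case by (simp add: ft_def)
    qed
  qed simp
qed

text \<open>Testing with \<open>cs k\<close> turns the weak equation into the \<open>k\<close>-th
  integral equation, but only for almost every time. The right-hand side is continuous in time and
  is taken as \<open>p\<close>; the countably many exceptional null sets form one null set.\<close>

lemma KS_solution_coef_sol:
  assumes T: "0 < T" and u0: "L2_fun L u0" and KS: "KS_solution L T u0 w"
  shows "\<exists>p. coef_sol T (ft u0) p \<and> (AE t in lebesgue_on {0..T}. L2_fun L (w t) \<and> (\<forall>k. ft (w t) k = p k t))"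
proof -
  let ?T = "lebesgue_on {0..T}"
  define \<omega> where "\<omega> k s = ft (w s) k" for k s
  obtain C where jm: "jointly_measurable L T w" and C: "AE t in ?T. L2_fun L (w t) \<and> L2_norm L (w t) \<le> C"
    using KS unfolding KS_solution_def Linf_L2_def by blast
  have s3: "AE t in ?T. sobolev L 3 (w t)" and Si: "integrable ?T (\<lambda>t. (sobolev_norm L 3 (w t))\<^sup>2)"
    using KS unfolding KS_solution_def L2_sobolev_def by blast+
  have tr: "AE t in ?T. has_trace L (weak_deriv L 1 (w t)) 0 0 \<and> has_trace L (weak_deriv L 1 (w t)) L 0"
    using KS unfolding KS_solution_def by blast
  have snn: "0 \<le> (\<Sum>j\<le>3. (L2_norm L (weak_deriv L j (w t)))\<^sup>2)" for t by (intro sum_nonneg) simp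
  have S2: "(\<integral>x. (weak_deriv L j (w t) x)\<^sup>2 \<partial>M) \<le> (sobolev_norm L 3 (w t))\<^sup>2" if "j \<le> 3" for j t
  proof -
    have "(\<integral>x. (weak_deriv L j (w t) x)\<^sup>2 \<partial>M) = (L2_norm L (weak_deriv L j (w t)))\<^sup>2"
      by (simp add: L2_norm_def)
    also have "\<dots> \<le> (\<Sum>j\<le>3. (L2_norm L (weak_deriv L j (w t)))\<^sup>2)"
      by (rule member_le_sum) (use that in auto)
    finally show ?thesis using snn by (simp add: sobolev_norm_def)
  qed
  have \<omega>m: "\<omega> k \<in> borel_measurable ?T" for k
    unfolding \<omega>_def[abs_def] by (rule ft_measurable_in_time[OF jm])
  have Qm: "(\<lambda>s. Qc (\<lambda>j. \<omega> j s) k) \<in> borel_measurable ?T" for k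
    by (rule borel_measurable_Qc) (rule \<omega>m)
  define C2 where "C2 = 2 / L * C\<^sup>2"
  have good: "AE s in ?T. s \<in> {0..T} \<and> L2_fun L (w s) \<and> (\<forall>K. (\<Sum>k\<le>K. (\<omega> k s)\<^sup>2) \<le> C2) \<and>
      summable (\<lambda>k. lam k ^ 6 * (\<omega> k s)\<^sup>2) \<and>
      (\<Sum>k. lam k ^ 6 * (\<omega> k s)\<^sup>2) \<le> 2 / L * (sobolev_norm L 3 (w s))\<^sup>2 \<and>
      (\<forall>k. \<bar>Qc (\<lambda>j. \<omega> j s) k\<bar> \<le> 2 / L * (sobolev_norm L 3 (w s))\<^sup>2) \<and>
      (\<forall>k. (\<integral>x. weak_deriv L 3 (w s) x * deriv (cs k) x - weak_deriv L 2 (w s) x * cs k x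
              - 1 / 2 * (weak_deriv L 1 (w s) x)\<^sup>2 * cs k x \<partial>M) = nrm k * rate (\<lambda>j. \<omega> j s) k)"
    using C s3 tr AE_space
  proof eventually_elim
    case (elim s)
    have sob: "sobolev L 3 (w s)" and l2: "L2_fun L (w s)" and n: "L2_norm L (w s) \<le> C" and ss: "s \<in> {0..T}"
      using elim by auto
    have om: "(\<lambda>j. \<omega> j s) = ft (w s)" by (simp add: \<omega>_def fun_eq_iff)
    note h = H3_coefficients[OF sob]
    have h': "has_trace L (weak_deriv L 1 (w s)) 0 0" "has_trace L (weak_deriv L 1 (w s)) L 0" using elim by auto
    note h1 = h(1)[OF h'] and h2 = h(2)[OF h'] and h3 = h(3)[OF h'] and h4 = h(4)[OF h'] and h5 = h(5)[OF h']
    have b2: "(\<Sum>k\<le>K. (\<omega> k s)\<^sup>2) \<le> C2" for K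
    proof -
      have "L / 2 * (\<Sum>k\<le>K. (\<omega> k s)\<^sup>2) = (\<Sum>k\<le>K. L / 2 * (ft (w s) k)\<^sup>2)"
        by (simp add: \<omega>_def sum_distrib_left)
      also have "\<dots> \<le> (\<Sum>k\<le>K. nrm k * (ft (w s) k)\<^sup>2)" by (intro sum_mono mult_right_mono nrm_ge) auto
      also have "\<dots> \<le> (\<integral>x. (w s x)\<^sup>2 \<partial>M)" by (rule bessel_cs[OF l2])
      also have "\<dots> = (L2_norm L (w s))\<^sup>2" by (simp add: L2_norm_def)
      also have "\<dots> \<le> C\<^sup>2" by (rule power_mono[OF n]) (simp add: L2_norm_def)
      finally show ?thesis using L_pos by (simp add: C2_def field_simps)
    qed
    have l2w: "L2_fun L (weak_deriv L 1 (w s))" "L2_fun L (weak_deriv L 2 (w s))" "L2_fun L (weak_deriv L 3 (w s))"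
      using sobolev_weak_deriv(1)[OF sob] by auto
    have b6: "(\<Sum>k. lam k ^ 6 * (\<omega> k s)\<^sup>2) \<le> 2 / L * (sobolev_norm L 3 (w s))\<^sup>2"
      unfolding \<omega>_def by (rule order_trans[OF h5 mult_left_mono[OF S2]]) (use L_pos in auto)
    have bQ: "\<bar>Qc (\<lambda>j. \<omega> j s) k\<bar> \<le> 2 / L * (sobolev_norm L 3 (w s))\<^sup>2" for k
    proof -
      have i: "integrable M (\<lambda>x. (weak_deriv L 1 (w s) x)\<^sup>2)" by (rule L2_square_integrable[OF l2w(1)])
      have "L / 2 * \<bar>Qc (ft (w s)) k\<bar> \<le> nrm k * \<bar>Qc (ft (w s)) k\<bar>" by (intro mult_right_mono nrm_ge) simp
      also have "\<dots> = \<bar>\<integral>x. (weak_deriv L 1 (w s) x)\<^sup>2 * cs k x \<partial>M\<bar>" unfolding h3 by (simp add: abs_mult)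
      also have "\<dots> \<le> (\<integral>x. \<bar>(weak_deriv L 1 (w s) x)\<^sup>2 * cs k x\<bar> \<partial>M)" by (rule integral_abs_bound)
      also have "\<dots> \<le> (\<integral>x. (weak_deriv L 1 (w s) x)\<^sup>2 \<partial>M)"
      proof (rule integral_mono[OF integrable_abs[OF integrable_mult_continuous[OF i cont_trig(1)]] i])
        show "\<bar>(weak_deriv L 1 (w s) x)\<^sup>2 * cs k x\<bar> \<le> (weak_deriv L 1 (w s) x)\<^sup>2" for x
          using abs_trig_le(1)[of "(weak_deriv L 1 (w s) x)\<^sup>2" k x] by simp
      qed
      also have "\<dots> \<le> (sobolev_norm L 3 (w s))\<^sup>2" by (rule S2) simp
      finally have "L / 2 * \<bar>Qc (ft (w s)) k\<bar> \<le> (sobolev_norm L 3 (w s))\<^sup>2" .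
      then show ?thesis unfolding om using L_pos by (simp add: field_simps)
    qed
    have eq: "(\<integral>x. weak_deriv L 3 (w s) x * deriv (cs k) x - weak_deriv L 2 (w s) x * cs k x
              - 1 / 2 * (weak_deriv L 1 (w s) x)\<^sup>2 * cs k x \<partial>M) = nrm k * rate (\<lambda>j. \<omega> j s) k" for k
    proof -
      have i: "integrable M (\<lambda>x. weak_deriv L 3 (w s) x * sn k x)" "integrable M (\<lambda>x. weak_deriv L 2 (w s) x * cs k x)"
        "integrable M (\<lambda>x. (weak_deriv L 1 (w s) x)\<^sup>2 * cs k x)"
        by (intro integrable_mult_continuous L2_integrable L2_square_integrable l2w cont_trig)+
      have "(\<integral>x. weak_deriv L 3 (w s) x * deriv (cs k) x - weak_deriv L 2 (w s) x * cs k x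
              - 1 / 2 * (weak_deriv L 1 (w s) x)\<^sup>2 * cs k x \<partial>M) =
          (\<integral>x. - lam k * (weak_deriv L 3 (w s) x * sn k x) - weak_deriv L 2 (w s) x * cs k x
              - 1 / 2 * ((weak_deriv L 1 (w s) x)\<^sup>2 * cs k x) \<partial>M)"
        unfolding deriv_cs by (simp only: mult_ac)
      also have "\<dots> = - lam k * (\<integral>x. weak_deriv L 3 (w s) x * sn k x \<partial>M) - (\<integral>x. weak_deriv L 2 (w s) x * cs k x \<partial>M)
          - 1 / 2 * (\<integral>x. (weak_deriv L 1 (w s) x)\<^sup>2 * cs k x \<partial>M)"
        by (simp only: Bochner_Integration.integral_diff[OF Bochner_Integration.integrable_diff[OF
              Bochner_Integration.integrable_mult_right[OF i(1)] i(2)] Bochner_Integration.integrable_mult_right[OF i(3)]]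
            Bochner_Integration.integral_diff[OF Bochner_Integration.integrable_mult_right[OF i(1)] i(2)]
            Bochner_Integration.integral_mult_right_zero)
      also have "\<dots> = nrm k * rate (ft (w s)) k"
        unfolding h1 h2 h3 rate_def mu_def by (simp add: algebra_simps power2_eq_square power3_eq_cube power4_eq_xxxx)
      finally show ?thesis unfolding om .
    qed
    show ?case using ss l2 b2 h4 b6 bQ eq unfolding \<omega>_def by blast
  qed
  have ri: "integrable ?T (\<lambda>s. rate (\<lambda>j. \<omega> j s) k)" for k
  proof -
    have fin: "finite_measure ?T" by (rule finite_measure_lebesgue_on) simp
    have "integrable ?T (\<omega> k)"
    proof (rule finite_measure.integrable_const_bound[OF fin, where B = "sqrt C2"])
      show "AE s in ?T. norm (\<omega> k s) \<le> sqrt C2"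
        using good
      proof eventually_elim
        case (elim s)
        have "\<bar>\<omega> k s\<bar>\<^sup>2 \<le> (\<Sum>k\<le>k. (\<omega> k s)\<^sup>2)" unfolding power2_abs by (rule member_le_sum) auto
        also have "\<dots> \<le> C2" using elim by blast
        finally show ?case by (simp add: real_le_rsqrt)
      qed
    qed (rule \<omega>m)
    moreover have "integrable ?T (\<lambda>s. Qc (\<lambda>j. \<omega> j s) k)"
    proof (rule Bochner_Integration.integrable_bound[OF Bochner_Integration.integrable_mult_right[OF Si, of "2 / L"] Qm])
      show "AE s in ?T. norm (Qc (\<lambda>j. \<omega> j s) k) \<le> norm (2 / L * (sobolev_norm L 3 (w s))\<^sup>2)"
        using good
      proof eventually_elim
        case (elim s)
        then have "\<bar>Qc (\<lambda>j. \<omega> j s) k\<bar> \<le> 2 / L * (sobolev_norm L 3 (w s))\<^sup>2" by blast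
        then show ?case unfolding real_norm_def by (rule order_trans[OF _ abs_ge_self])
      qed
    qed
    ultimately show ?thesis unfolding rate_def
      by (intro Bochner_Integration.integrable_diff Bochner_Integration.integrable_mult_right)
  qed
  define p where "p k t = ft u0 k + (\<integral>s. rate (\<lambda>j. \<omega> j s) k \<partial>lebesgue_on {0..t})" for k t
  have pc: "continuous_on {0..T} (p k)" for k
    unfolding p_def by (intro continuous_on_add continuous_on_const indefinite_integral_continuous_lebesgue(1)[OF ri])
  have "AE t in ?T. \<omega> k t = p k t" for k
  proof -
    have "AE t in ?T. (\<integral>x. w t x * cs k x \<partial>M) - (\<integral>x. u0 x * cs k x \<partial>M)
           = (\<integral>s. (\<integral>x. weak_deriv L 3 (w s) x * deriv (cs k) x - weak_deriv L 2 (w s) x * cs k x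
                        - 1 / 2 * (weak_deriv L 1 (w s) x)\<^sup>2 * cs k x \<partial>M) \<partial>lebesgue_on {0..t})"
      using KS smooth_cs[of k] unfolding KS_solution_def by blast
    then show ?thesis
      using AE_space
    proof eventually_elim
      case (elim t)
      then have t: "t \<in> {0..T}" by simp
      have sub: "AE s in lebesgue_on {0..t}. P s" if "AE s in ?T. P s" for P
        using that t by (auto simp: AE_restrict_space_iff elim: eventually_mono)
      have rt: "integrable (lebesgue_on {0..t}) (\<lambda>s. rate (\<lambda>j. \<omega> j s) k)"
        by (rule indefinite_integral_continuous_lebesgue(2)[OF ri t])
      have "(\<integral>x. w t x * cs k x \<partial>M) - (\<integral>x. u0 x * cs k x \<partial>M) = (\<integral>s. nrm k * rate (\<lambda>j. \<omega> j s) k \<partial>lebesgue_on {0..t})"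
        unfolding elim(1)
      proof (rule integral_lebesgue_on_cong_AE)
        show "(\<lambda>s. nrm k * rate (\<lambda>j. \<omega> j s) k) \<in> borel_measurable (lebesgue_on {0..t})"
          by (rule borel_measurable_integrable[OF Bochner_Integration.integrable_mult_right[OF rt]])
        show "AE s in lebesgue_on {0..t}. (\<integral>x. weak_deriv L 3 (w s) x * deriv (cs k) x - weak_deriv L 2 (w s) x * cs k x
                        - 1 / 2 * (weak_deriv L 1 (w s) x)\<^sup>2 * cs k x \<partial>M) = nrm k * rate (\<lambda>j. \<omega> j s) k"
          using sub[OF good] by eventually_elim blast
      qed simp
      then have "nrm k * \<omega> k t = nrm k * p k t"
        unfolding integral_cs_ft by (simp add: p_def \<omega>_def algebra_simps)
      then show ?case by simp
    qed
  qed
  then have ae: "AE t in ?T. \<forall>k. \<omega> k t = p k t" by (simp add: AE_all_countable)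
  have aer: "AE s in ?T. (\<lambda>j. \<omega> j s) = (\<lambda>j. p j s)" using ae by eventually_elim auto
  have sub: "AE s in lebesgue_on {0..t}. P s" if "AE s in ?T. P s" "t \<in> {0..T}" for P t
    using that by (auto simp: AE_restrict_space_iff elim: eventually_mono)
  have pm: "p k \<in> borel_measurable ?T" for k
    by (rule borel_measurable_integrable[OF continuous_imp_integrable_lebesgue_on[OF pc]])
  have rpm: "(\<lambda>s. rate (\<lambda>j. p j s) k) \<in> borel_measurable ?T" for k
    unfolding rate_def by (intro borel_measurable_diff borel_measurable_times borel_measurable_const borel_measurable_Qc pm)
  have raeq: "AE s in ?T. rate (\<lambda>j. p j s) k = rate (\<lambda>j. \<omega> j s) k" for k
    using aer by eventually_elim simp
  have "coef_sol T (ft u0) p"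
    unfolding coef_sol_def
  proof (intro conjI allI ballI)
    show "integrable ?T (\<lambda>s. rate (\<lambda>j. p j s) k)" for k
      using integrable_cong_AE[OF rpm borel_measurable_integrable[OF ri] raeq] ri by blast
    show "p k t = ft u0 k + (\<integral>s. rate (\<lambda>j. p j s) k \<partial>lebesgue_on {0..t})" if t: "t \<in> {0..T}" for k t
    proof -
      have "(\<integral>s. rate (\<lambda>j. p j s) k \<partial>lebesgue_on {0..t}) = (\<integral>s. rate (\<lambda>j. \<omega> j s) k \<partial>lebesgue_on {0..t})"
        by (rule integral_lebesgue_on_cong_AE[OF borel_measurable_integrable[OF indefinite_integral_continuous_lebesgue(2)[OF ri t]] _ sub[OF raeq t]]) simp
      then show ?thesis by (simp add: p_def)
    qed
    show "AE s in ?T. summable (\<lambda>k. lam k ^ 6 * (p k s)\<^sup>2)"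
      using good ae by eventually_elim simp
    show "integrable ?T (\<lambda>s. \<Sum>k. lam k ^ 6 * (p k s)\<^sup>2)"
    proof (rule Bochner_Integration.integrable_bound[OF Bochner_Integration.integrable_mult_right[OF Si, of "2 / L"]])
      show "(\<lambda>s. \<Sum>k. lam k ^ 6 * (p k s)\<^sup>2) \<in> borel_measurable ?T"
        by (intro borel_measurable_suminf borel_measurable_times borel_measurable_const borel_measurable_power pm)
      show "AE s in ?T. norm (\<Sum>k. lam k ^ 6 * (p k s)\<^sup>2) \<le> norm (2 / L * (sobolev_norm L 3 (w s))\<^sup>2)"
        using good ae
      proof eventually_elim
        case (elim s)
        have nn: "0 \<le> (\<Sum>k. lam k ^ 6 * (\<omega> k s)\<^sup>2)"
          by (rule suminf_nonneg) (use elim(1) in \<open>blast, simp add: zero_le_mult_iff lam_nonneg\<close>)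
        have "(\<Sum>k. lam k ^ 6 * (\<omega> k s)\<^sup>2) \<le> 2 / L * (sobolev_norm L 3 (w s))\<^sup>2" using elim(1) by blast
        then have "norm (\<Sum>k. lam k ^ 6 * (\<omega> k s)\<^sup>2) \<le> norm (2 / L * (sobolev_norm L 3 (w s))\<^sup>2)"
          unfolding real_norm_def abs_of_nonneg[OF nn] by (rule order_trans[OF _ abs_ge_self])
        then show ?case using elim(2) by simp
      qed
    qed
    show "\<exists>C. \<forall>t\<in>{0..T}. \<forall>K. (\<Sum>k\<le>K. (p k t)\<^sup>2) \<le> C"
    proof (intro exI[of _ C2] ballI allI)
      fix t K assume t: "t \<in> {0..T}"
      show "(\<Sum>k\<le>K. (p k t)\<^sup>2) \<le> C2"
      \<comment> \<open>A bound valid for almost every time extends to every time by continuity of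
        the finite sum.\<close>
      proof (rule continuous_AE_le_imp_le[OF _ T _ t])
        show "continuous_on {0..T} (\<lambda>t. \<Sum>k\<le>K. (p k t)\<^sup>2)" by (intro continuous_intros pc)
        show "AE t in ?T. (\<Sum>k\<le>K. (p k t)\<^sup>2) \<le> C2"
          using good ae by eventually_elim auto
      qed
    qed
  qed
  moreover have "AE t in ?T. L2_fun L (w t) \<and> (\<forall>k. ft (w t) k = p k t)"
    using good ae by eventually_elim (auto simp: \<omega>_def)
  ultimately show ?thesis by blast
qed

section \<open>Cosine series as weak solutions\<close>

text \<open>The \<open>j\<close>-th derivative of \<open>cser a\<close>: cosine and sine series
  alternate, and the exponent \<open>(j + 1) div 2\<close> produces the sign pattern
  \<open>+ - - +\<close>.\<close>

definition sder :: "nat \<Rightarrow> (nat \<Rightarrow> real) \<Rightarrow> real \<Rightarrow> real" where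
  "sder j a x = (- 1) ^ ((j + 1) div 2) *
     (if even j then cser (\<lambda>k. lam k ^ j * a k) x else sser (\<lambda>k. lam k ^ j * a k) x)"

lemma sder_low:
  "sder 0 a = cser a" "sder 1 a x = - ux a x" "sder 2 a x = - cser (\<lambda>k. (lam k)\<^sup>2 * a k) x"
  "sder 3 a x = sser (\<lambda>k. lam k ^ 3 * a k) x"
  by (simp_all add: sder_def fun_eq_iff ux_def)

lemma abs_lam_power_mult: "\<bar>lam k ^ j * a\<bar> = lam k ^ j * \<bar>a\<bar>"
  by (simp add: abs_mult)

lemma continuous_sder:
  assumes "summable (\<lambda>k. lam k ^ j * \<bar>a k\<bar>)"
  shows "continuous_on S (sder j a)"
proof -
  have "summable (\<lambda>k. \<bar>lam k ^ j * a k\<bar>)" using assms by (simp only: abs_lam_power_mult)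
  from continuous_trig_series[OF this, of S] show ?thesis
    unfolding sder_def[abs_def] by (intro continuous_on_mult_left) (cases "even j"; simp)
qed

lemma sder_has_derivative:
  assumes "summable (\<lambda>k. lam k ^ Suc j * \<bar>a k\<bar>)"
  shows "(sder j a has_real_derivative sder (Suc j) a x) (at x)"
proof -
  define b where "b k = lam k ^ j * a k" for k
  have e: "lam k * \<bar>b k\<bar> = lam k ^ Suc j * \<bar>a k\<bar>" for k
    unfolding b_def by (simp add: abs_lam_power_mult)
  have b: "summable (\<lambda>k. lam k * \<bar>b k\<bar>)" unfolding e by (rule assms)
  have l: "(\<lambda>k. lam k * b k) = (\<lambda>k. lam k ^ Suc j * a k)" by (simp add: b_def mult.assoc)
  note d = has_derivative_trig_series[OF b, unfolded l]
  show ?thesis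
  proof (cases "even j")
    case True
    then obtain i where i: "j = 2 * i" by blast
    show ?thesis
      using DERIV_cmult[OF d(1), of "(- 1) ^ i" x] unfolding sder_def[abs_def] b_def by (simp add: i)
  next
    case False
    then obtain i where i: "j = 2 * i + 1" by (elim oddE)
    show ?thesis
      using DERIV_cmult[OF d(2), of "(- 1) ^ (i + 1)" x] unfolding sder_def[abs_def] b_def by (simp add: i)
  qed
qed

lemma has_weak_deriv_sder:
  assumes "summable (\<lambda>k. lam k ^ n * \<bar>a k\<bar>)" "j \<le> n"
  shows "has_weak_deriv L j (cser a) (sder j a)"
  using assms(2)
proof (induction j)
  case 0
  show ?case unfolding sder_low by (rule has_weak_deriv_0)
next
  case (Suc j)
  have s: "summable (\<lambda>k. lam k ^ Suc j * \<bar>a k\<bar>)" by (rule summable_lam_mono[OF assms(1) Suc.prems])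
  show ?case
    by (rule has_weak_deriv_classical[OF Suc.IH sder_has_derivative[OF s] continuous_sder[OF s]])
      (use Suc.prems in simp)
qed

lemma parseval_cser:
  assumes "summable (\<lambda>k. \<bar>a k\<bar>)"
  shows "(\<lambda>k. nrm k * (a k)\<^sup>2) sums (\<integral>x. (cser a x)\<^sup>2 \<partial>M)"
proof -
  have "(\<lambda>k. a k * (\<integral>x. cser a x * cs k x \<partial>M)) sums (\<integral>x. cser a x * cser a x \<partial>M)"
    by (rule integral_mult_cser[OF continuous_integrable_M[OF continuous_trig_series(1)[OF assms]] assms])
  then show ?thesis
    unfolding integral_cs_ft ft_cser[OF assms] by (simp only: power2_eq_square mult_ac)
qed

text \<open>\<open>nrm 0 = L\<close> while \<open>sn 0\<close> is the zero function, so index 0 is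
  excluded through \<open>a 0 = 0\<close>.\<close>

lemma parseval_sser:
  assumes s: "summable (\<lambda>k. \<bar>a k\<bar>)" and a0: "a 0 = 0"
  shows "(\<lambda>k. nrm k * (a k)\<^sup>2) sums (\<integral>x. (sser a x)\<^sup>2 \<partial>M)"
proof -
  have c: "(\<integral>x. sser a x * sn k x \<partial>M) = nrm k * a k" if k: "k \<noteq> 0" for k
  proof -
    have "(\<lambda>j. a j * (\<integral>x. sn k x * sn j x \<partial>M)) sums (\<integral>x. sn k x * sser a x \<partial>M)"
      by (rule integral_mult_sser[OF continuous_integrable_M[OF cont_trig(2)] s])
    moreover have "(\<lambda>j. a j * (\<integral>x. sn k x * sn j x \<partial>M)) = (\<lambda>j. if j = k then nrm k * a k else 0)"
    proof
      fix j
      show "a j * (\<integral>x. sn k x * sn j x \<partial>M) = (if j = k then nrm k * a k else 0)"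
        using k orthogonal_sn[OF k, of j] nrm_half[OF k] a0 by (cases "j = 0") auto
    qed
    moreover have "(\<lambda>j. if j = k then nrm k * a k else 0) sums (nrm k * a k)"
      by (rule sums_single)
    ultimately have "(\<integral>x. sn k x * sser a x \<partial>M) = nrm k * a k" using sums_unique2 by metis
    then show ?thesis by (simp add: mult.commute)
  qed
  have "(\<lambda>k. a k * (\<integral>x. sser a x * sn k x \<partial>M)) sums (\<integral>x. sser a x * sser a x \<partial>M)"
    by (rule integral_mult_sser[OF continuous_integrable_M[OF continuous_trig_series(2)[OF s]] s])
  moreover have "a k * (\<integral>x. sser a x * sn k x \<partial>M) = nrm k * (a k)\<^sup>2" for k
    using c[of k] a0 by (cases "k = 0") (simp_all add: power2_eq_square)
  ultimately show ?thesis by (simp add: power2_eq_square)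
qed

lemma parseval_sder:
  assumes "summable (\<lambda>k. lam k ^ j * \<bar>a k\<bar>)"
  shows "(\<lambda>k. nrm k * (lam k ^ j * a k)\<^sup>2) sums (\<integral>x. (sder j a x)\<^sup>2 \<partial>M)"
proof -
  have s: "summable (\<lambda>k. \<bar>lam k ^ j * a k\<bar>)" using assms by (simp only: abs_lam_power_mult)
  show ?thesis
  proof (cases "even j")
    case True
    then have "(sder j a x)\<^sup>2 = (cser (\<lambda>k. lam k ^ j * a k) x)\<^sup>2" for x
      by (simp add: sder_def power_mult_distrib flip: power_mult)
    then show ?thesis using parseval_cser[OF s] by simp
  next
    case False
    then have "(sder j a x)\<^sup>2 = (sser (\<lambda>k. lam k ^ j * a k) x)\<^sup>2" for x
      by (simp add: sder_def power_mult_distrib flip: power_mult)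
    moreover have "lam 0 ^ j * a 0 = 0" using False by (cases j) auto
    ultimately show ?thesis using parseval_sser[OF s] by simp
  qed
qed

lemma sobolev_cser:
  assumes s: "summable (\<lambda>k. lam k ^ n * \<bar>a k\<bar>)"
  shows "sobolev L n (cser a)"
    and "j \<le> n \<Longrightarrow> AE x in M. weak_deriv L j (cser a) x = sder j a x"
    and "(sobolev_norm L n (cser a))\<^sup>2 = (\<Sum>j\<le>n. \<Sum>k. nrm k * (lam k ^ j * a k)\<^sup>2)"
proof -
  have sj: "summable (\<lambda>k. lam k ^ j * \<bar>a k\<bar>)" if "j \<le> n" for j by (rule summable_lam_mono[OF s that])
  have L2: "L2_fun L (sder j a)" if "j \<le> n" for j by (rule L2_continuous[OF continuous_sder[OF sj[OF that]]])
  note wd = weak_deriv_AE_eq[OF L2 has_weak_deriv_sder[OF s]]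
  show "AE x in M. weak_deriv L j (cser a) x = sder j a x" if "j \<le> n" for j by (rule wd(3)[OF that that])
  show "sobolev L n (cser a)"
    unfolding sobolev_def
  proof (intro conjI allI impI)
    show "L2_fun L (cser a)" using L2[of 0] unfolding sder_low by simp
    show "\<exists>g. L2_fun L g \<and> has_weak_deriv L j (cser a) g" if "j \<le> n" for j
      using L2[OF that] has_weak_deriv_sder[OF s that] by blast
  qed
  have "(L2_norm L (weak_deriv L j (cser a)))\<^sup>2 = (\<Sum>k. nrm k * (lam k ^ j * a k)\<^sup>2)" if j: "j \<le> n" for j
  proof -
    have "(\<integral>x. (weak_deriv L j (cser a) x)\<^sup>2 \<partial>M) = (\<integral>x. (sder j a x)\<^sup>2 \<partial>M)"
    proof (rule integral_lebesgue_on_cong_AE)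
      show "(\<lambda>x. (sder j a x)\<^sup>2) \<in> borel_measurable M"
        using L2_measurable[OF L2[OF j]] by (rule borel_measurable_power)
      show "AE x in M. (weak_deriv L j (cser a) x)\<^sup>2 = (sder j a x)\<^sup>2"
        using wd(3)[OF j j] by eventually_elim simp
    qed simp
    also have "\<dots> = (\<Sum>k. nrm k * (lam k ^ j * a k)\<^sup>2)" by (rule sums_unique[OF parseval_sder[OF sj[OF j]]])
    finally have "(\<integral>x. (weak_deriv L j (cser a) x)\<^sup>2 \<partial>M) = (\<Sum>k. nrm k * (lam k ^ j * a k)\<^sup>2)" .
    moreover have "(L2_norm L (weak_deriv L j (cser a)))\<^sup>2 = (\<integral>x. (weak_deriv L j (cser a) x)\<^sup>2 \<partial>M)"
      unfolding L2_norm_def by (rule real_sqrt_pow2) (simp add: Bochner_Integration.integral_nonneg)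
    ultimately show ?thesis by simp
  qed
  then have "(\<Sum>j\<le>n. (L2_norm L (weak_deriv L j (cser a)))\<^sup>2) = (\<Sum>j\<le>n. \<Sum>k. nrm k * (lam k ^ j * a k)\<^sup>2)"
    by (intro sum.cong) simp_all
  moreover have "(sobolev_norm L n (cser a))\<^sup>2 = (\<Sum>j\<le>n. (L2_norm L (weak_deriv L j (cser a)))\<^sup>2)"
    unfolding sobolev_norm_def by (rule real_sqrt_pow2) (simp add: sum_nonneg)
  ultimately show "(sobolev_norm L n (cser a))\<^sup>2 = (\<Sum>j\<le>n. \<Sum>k. nrm k * (lam k ^ j * a k)\<^sup>2)"
    by (rule trans[rotated])
qed

section \<open>Smooth test functions and the weak form of a cosine series\<close>

lemma integral_deriv_sn:
  assumes "smooth_fun v"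
  shows "(\<integral>x. deriv v x * sn k x \<partial>M) = - lam k * (\<integral>x. v x * cs k x \<partial>M)"
proof -
  note vc = smooth_fun_continuous[OF assms] and vc' = smooth_fun_continuous[OF smooth_fun_deriv[OF assms]]
  have c: "continuous_on {0..L} (\<lambda>x. deriv v x * sn k x)" "continuous_on {0..L} (\<lambda>x. lam k * (v x * cs k x))"
    by (intro continuous_intros vc vc')+
  have "(\<integral>x. deriv v x * sn k x + lam k * (v x * cs k x) \<partial>M) = v L * sn k L - v 0 * sn k 0"
  proof (rule FTC_M)
    show "((\<lambda>x. v x * sn k x) has_real_derivative deriv v x * sn k x + lam k * (v x * cs k x)) (at x within {0..L})" for x
      by (rule has_field_derivative_at_within)
        (auto intro!: derivative_eq_intros smooth_fun_has_derivative[OF assms])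
  qed (intro continuous_on_add c)
  moreover have "(\<integral>x. deriv v x * sn k x + lam k * (v x * cs k x) \<partial>M)
      = (\<integral>x. deriv v x * sn k x \<partial>M) + lam k * (\<integral>x. v x * cs k x \<partial>M)"
    using Bochner_Integration.integral_add[OF continuous_integrable_M[OF c(1)] continuous_integrable_M[OF c(2)]] by simp
  ultimately show ?thesis by simp
qed

text \<open>Two integrations by parts: the one against a sine has no boundary term, the other leaves
  \<open>deriv v\<close> at the ends. As these values are unrestricted, no rate beyond
  \<open>1 / (lam k)\<^sup>2\<close> can be expected.\<close>

lemma smooth_coefficient_decay:
  assumes v: "smooth_fun v"
  shows "\<exists>C. \<forall>k. (lam k)\<^sup>2 * \<bar>\<integral>x. v x * cs k x \<partial>M\<bar> \<le> C"
proof -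
  define w where "w = deriv v"
  have w: "smooth_fun w" unfolding w_def by (rule smooth_fun_deriv[OF v])
  note wc = smooth_fun_continuous[OF w] and wc' = smooth_fun_continuous[OF smooth_fun_deriv[OF w]]
  have "(lam k)\<^sup>2 * \<bar>\<integral>x. v x * cs k x \<partial>M\<bar> \<le> \<bar>w L\<bar> + \<bar>w 0\<bar> + (\<integral>x. \<bar>deriv w x\<bar> \<partial>M)" for k
  proof -
    have c: "continuous_on {0..L} (\<lambda>x. deriv w x * cs k x)" "continuous_on {0..L} (\<lambda>x. lam k * (w x * sn k x))"
      by (intro continuous_intros wc wc')+
    have "(\<integral>x. deriv w x * cs k x - lam k * (w x * sn k x) \<partial>M) = w L * cs k L - w 0 * cs k 0"
    proof (rule FTC_M)
      show "((\<lambda>x. w x * cs k x) has_real_derivative deriv w x * cs k x - lam k * (w x * sn k x)) (at x within {0..L})" for x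
        by (rule has_field_derivative_at_within)
          (auto intro!: derivative_eq_intros smooth_fun_has_derivative[OF w])
    qed (intro continuous_on_diff c)
    moreover have "(\<integral>x. deriv w x * cs k x - lam k * (w x * sn k x) \<partial>M)
      = (\<integral>x. deriv w x * cs k x \<partial>M) - lam k * (\<integral>x. w x * sn k x \<partial>M)"
      using Bochner_Integration.integral_diff[OF continuous_integrable_M[OF c(1)] continuous_integrable_M[OF c(2)]] by simp
    moreover have "(\<integral>x. w x * sn k x \<partial>M) = - lam k * (\<integral>x. v x * cs k x \<partial>M)"
      unfolding w_def by (rule integral_deriv_sn[OF v])
    ultimately have "(lam k)\<^sup>2 * (\<integral>x. v x * cs k x \<partial>M) = w L * cs k L - w 0 * cs k 0 - (\<integral>x. deriv w x * cs k x \<partial>M)"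
      by (simp add: power2_eq_square)
    then have eq: "(lam k)\<^sup>2 * \<bar>\<integral>x. v x * cs k x \<partial>M\<bar> = \<bar>w L * cs k L - w 0 * cs k 0 - (\<integral>x. deriv w x * cs k x \<partial>M)\<bar>"
      using abs_lam_power_mult[of k 2 "\<integral>x. v x * cs k x \<partial>M"] by simp
    have "\<bar>\<integral>x. deriv w x * cs k x \<partial>M\<bar> \<le> (\<integral>x. \<bar>deriv w x\<bar> \<partial>M)"
    proof (rule order_trans[OF integral_abs_bound integral_mono])
      show "integrable M (\<lambda>x. \<bar>deriv w x * cs k x\<bar>)" "integrable M (\<lambda>x. \<bar>deriv w x\<bar>)"
        by (intro Bochner_Integration.integrable_abs continuous_integrable_M c wc')+
    qed (rule abs_trig_le)
    moreover have "\<bar>w L * cs k L\<bar> \<le> \<bar>w L\<bar>" "\<bar>w 0 * cs k 0\<bar> \<le> \<bar>w 0\<bar>" by (rule abs_trig_le)+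
    ultimately show ?thesis unfolding eq by linarith
  qed
  then show ?thesis by blast
qed

lemma summable_smooth_coefficients:
  assumes v: "smooth_fun v"
  shows "summable (\<lambda>k. \<bar>\<integral>x. v x * cs k x \<partial>M\<bar>)" and "summable (\<lambda>k. \<bar>ft v k\<bar>)"
proof -
  obtain C where C: "(lam k)\<^sup>2 * \<bar>\<integral>x. v x * cs k x \<partial>M\<bar> \<le> C" for k
    using smooth_coefficient_decay[OF v] by blast
  show s: "summable (\<lambda>k. \<bar>\<integral>x. v x * cs k x \<partial>M\<bar>)"
  proof (rule summable_comparison_test'[OF summable_mult[OF summable_inverse_lam2, of C], of 1])
    fix k :: nat assume "1 \<le> k"
    then have "0 < (lam k)\<^sup>2" using lam_pos[of k] by simp
    then show "norm \<bar>\<integral>x. v x * cs k x \<partial>M\<bar> \<le> C * (1 / (lam k)\<^sup>2)"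
      using C[of k] by (simp add: pos_le_divide_eq mult.commute)
  qed
  show "summable (\<lambda>k. \<bar>ft v k\<bar>)"
  proof (rule summable_comparison_test'[OF summable_mult[OF s, of "2 / L"], of 0])
    fix k
    have "1 / nrm k \<le> 2 / L" using nrm_ge[of k] L_pos by (simp add: field_simps)
    then have "\<bar>\<integral>x. v x * cs k x \<partial>M\<bar> * (1 / nrm k) \<le> \<bar>\<integral>x. v x * cs k x \<partial>M\<bar> * (2 / L)"
      by (rule mult_left_mono) simp
    then show "norm \<bar>ft v k\<bar> \<le> 2 / L * \<bar>\<integral>x. v x * cs k x \<partial>M\<bar>"
      by (simp add: ft_def mult.commute)
  qed
qed

text \<open>The smooth factor is the one that is expanded: its series converges absolutely, so for
  \<open>g\<close> integrability suffices.\<close>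

lemma integral_mult_smooth:
  assumes g: "integrable M g" and v: "smooth_fun v"
  shows "(\<lambda>k. ft g k * (\<integral>x. v x * cs k x \<partial>M)) sums (\<integral>x. g x * v x \<partial>M)"
proof -
  have vc: "continuous_on {0..L} v" by (rule smooth_fun_continuous[OF v])
  note sv = summable_smooth_coefficients(2)[OF v]
  have "(\<integral>x. g x * v x \<partial>M) = (\<integral>x. g x * cser (ft v) x \<partial>M)"
  proof (rule integral_lebesgue_on_cong_AE)
    show "(\<lambda>x. g x * cser (ft v) x) \<in> borel_measurable M"
      by (rule borel_measurable_integrable[OF integrable_mult_continuous[OF g continuous_trig_series(1)[OF sv]]])
    show "AE x in M. g x * v x = g x * cser (ft v) x"
      using AE_eq_cser_ft[OF continuous_integrable_M[OF vc] sv] by eventually_elim simp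
  qed simp
  moreover have "(\<lambda>k. ft v k * (\<integral>x. g x * cs k x \<partial>M)) sums (\<integral>x. g x * cser (ft v) x \<partial>M)"
    by (rule integral_mult_cser[OF g sv])
  moreover have "ft v k * (\<integral>x. g x * cs k x \<partial>M) = ft g k * (\<integral>x. v x * cs k x \<partial>M)" for k
    by (simp add: integral_cs_ft)
  ultimately show ?thesis by simp
qed

text \<open>Each of the three terms is paired termwise with the cosine integrals of
  \<open>v\<close>; for the highest one this passes through the sine integrals of
  \<open>deriv v\<close>, which are \<open>- lam k\<close> times those of \<open>v\<close>.\<close>

lemma weak_form_cser:
  assumes a: "summable (\<lambda>k. lam k ^ 3 * \<bar>a k\<bar>)" and v: "smooth_fun v"
  shows "(\<lambda>k. rate a k * (\<integral>x. v x * cs k x \<partial>M)) sums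
    (\<integral>x. weak_deriv L 3 (cser a) x * deriv v x - weak_deriv L 2 (cser a) x * v x
         - 1 / 2 * (weak_deriv L 1 (cser a) x)\<^sup>2 * v x \<partial>M)"
proof -
  define V where "V k = (\<integral>x. v x * cs k x \<partial>M)" for k
  note vc = smooth_fun_continuous[OF v] and vc' = smooth_fun_continuous[OF smooth_fun_deriv[OF v]]
  have a1: "summable (\<lambda>k. lam k * \<bar>a k\<bar>)" using summable_lam_mono[OF a, of 1] by simp
  have a2: "summable (\<lambda>k. \<bar>(lam k)\<^sup>2 * a k\<bar>)"
    using summable_lam_mono[OF a, of 2] by (simp only: abs_lam_power_mult)
  have a3: "summable (\<lambda>k. \<bar>lam k ^ 3 * a k\<bar>)" using a by (simp only: abs_lam_power_mult)
  note uxc = continuous_ux[OF a1, of "{0..L}"]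
  have c: "continuous_on {0..L} (\<lambda>x. deriv v x * sser (\<lambda>k. lam k ^ 3 * a k) x)"
    "continuous_on {0..L} (\<lambda>x. v x * cser (\<lambda>k. (lam k)\<^sup>2 * a k) x)"
    "continuous_on {0..L} (\<lambda>x. (ux a x)\<^sup>2)" "continuous_on {0..L} (\<lambda>x. 1 / 2 * ((ux a x)\<^sup>2 * v x))"
    by (intro continuous_intros vc vc' uxc continuous_trig_series a2 a3)+
  note i = c[THEN continuous_integrable_M]
  have "(\<integral>x. weak_deriv L 3 (cser a) x * deriv v x - weak_deriv L 2 (cser a) x * v x
         - 1 / 2 * (weak_deriv L 1 (cser a) x)\<^sup>2 * v x \<partial>M)
      = (\<integral>x. deriv v x * sser (\<lambda>k. lam k ^ 3 * a k) x + v x * cser (\<lambda>k. (lam k)\<^sup>2 * a k) x - 1 / 2 * ((ux a x)\<^sup>2 * v x) \<partial>M)"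
  proof (rule integral_lebesgue_on_cong_AE)
    show "(\<lambda>x. deriv v x * sser (\<lambda>k. lam k ^ 3 * a k) x + v x * cser (\<lambda>k. (lam k)\<^sup>2 * a k) x - 1 / 2 * ((ux a x)\<^sup>2 * v x)) \<in> borel_measurable M"
      by (intro borel_measurable_diff borel_measurable_add borel_measurable_integrable i)
    have "AE x in M. weak_deriv L 3 (cser a) x = sder 3 a x" "AE x in M. weak_deriv L 2 (cser a) x = sder 2 a x"
      "AE x in M. weak_deriv L 1 (cser a) x = sder 1 a x"
      by (rule sobolev_cser(2)[OF a]; simp)+
    then show "AE x in M. weak_deriv L 3 (cser a) x * deriv v x - weak_deriv L 2 (cser a) x * v x
         - 1 / 2 * (weak_deriv L 1 (cser a) x)\<^sup>2 * v x
        = deriv v x * sser (\<lambda>k. lam k ^ 3 * a k) x + v x * cser (\<lambda>k. (lam k)\<^sup>2 * a k) x - 1 / 2 * ((ux a x)\<^sup>2 * v x)"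
    proof eventually_elim
      case (elim x)
      then show ?case unfolding elim sder_low by (simp add: mult_ac)
    qed
  qed simp
  also have "\<dots> = (\<integral>x. deriv v x * sser (\<lambda>k. lam k ^ 3 * a k) x \<partial>M)
      + (\<integral>x. v x * cser (\<lambda>k. (lam k)\<^sup>2 * a k) x \<partial>M) - 1 / 2 * (\<integral>x. (ux a x)\<^sup>2 * v x \<partial>M)"
    by (subst Bochner_Integration.integral_diff[OF Bochner_Integration.integrable_add[OF i(1,2)] i(4)],
        subst Bochner_Integration.integral_add[OF i(1,2)], subst integral_mult_right_zero) (rule refl)
  finally have eq: "(\<integral>x. weak_deriv L 3 (cser a) x * deriv v x - weak_deriv L 2 (cser a) x * v x
         - 1 / 2 * (weak_deriv L 1 (cser a) x)\<^sup>2 * v x \<partial>M)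
    = (\<integral>x. deriv v x * sser (\<lambda>k. lam k ^ 3 * a k) x \<partial>M)
      + (\<integral>x. v x * cser (\<lambda>k. (lam k)\<^sup>2 * a k) x \<partial>M) - 1 / 2 * (\<integral>x. (ux a x)\<^sup>2 * v x \<partial>M)" .
  have s1: "(\<lambda>k. lam k ^ 3 * a k * (- lam k * V k)) sums (\<integral>x. deriv v x * sser (\<lambda>k. lam k ^ 3 * a k) x \<partial>M)"
    using integral_mult_sser[OF continuous_integrable_M[OF vc'] a3] unfolding integral_deriv_sn[OF v] V_def .
  have s2: "(\<lambda>k. (lam k)\<^sup>2 * a k * V k) sums (\<integral>x. v x * cser (\<lambda>k. (lam k)\<^sup>2 * a k) x \<partial>M)"
    using integral_mult_cser[OF continuous_integrable_M[OF vc] a2] unfolding V_def .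
  have s3: "(\<lambda>k. Qc a k * V k) sums (\<integral>x. (ux a x)\<^sup>2 * v x \<partial>M)"
    using integral_mult_smooth[OF i(3) v] unfolding V_def Qc_eq[OF a1] .
  have "(\<lambda>k. lam k ^ 3 * a k * (- lam k * V k) + (lam k)\<^sup>2 * a k * V k - 1 / 2 * (Qc a k * V k)) sums
    ((\<integral>x. deriv v x * sser (\<lambda>k. lam k ^ 3 * a k) x \<partial>M)
      + (\<integral>x. v x * cser (\<lambda>k. (lam k)\<^sup>2 * a k) x \<partial>M) - 1 / 2 * (\<integral>x. (ux a x)\<^sup>2 * v x \<partial>M))"
    by (intro sums_diff sums_add sums_mult s1 s2 s3)
  moreover have "lam k ^ 3 * a k * (- lam k * V k) + (lam k)\<^sup>2 * a k * V k - 1 / 2 * (Qc a k * V k) = rate a k * V k" for k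
    unfolding rate_def mu_def by (simp add: algebra_simps power2_eq_square power3_eq_cube power4_eq_xxxx)
  ultimately show ?thesis unfolding eq V_def by simp
qed

text \<open>The odd derivatives are sine series, which vanish termwise at both ends.\<close>

lemma classical_bc_cser:
  assumes a: "summable (\<lambda>k. lam k ^ 3 * \<bar>a k\<bar>)"
  shows "classical_bc L (cser a)"
  unfolding classical_bc_def
proof (rule exI[of _ "sder 1 a"], rule exI[of _ "sder 2 a"], rule exI[of _ "sder 3 a"], intro conjI ballI)
  have d: "(sder j a has_real_derivative sder (Suc j) a x) (at x within {0..L})" if "Suc j \<le> 3" for j x
    by (rule has_field_derivative_at_within[OF sder_has_derivative[OF summable_lam_mono[OF a that]]])
  show "(cser a has_real_derivative sder 1 a x) (at x within {0..L})" for x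
    using d[of 0 x] by (simp only: One_nat_def sder_low(1))
  show "(sder 1 a has_real_derivative sder 2 a x) (at x within {0..L})" for x
    using d[of 1 x] by (simp add: numeral_2_eq_2)
  show "(sder 2 a has_real_derivative sder 3 a x) (at x within {0..L})" for x
    using d[of 2 x] by (simp add: numeral_2_eq_2 numeral_3_eq_3)
  show "continuous_on {0..L} (sder 3 a)" by (rule continuous_sder[OF a])
qed (unfold sder_low, simp_all add: ux_def sser_def)

lemma has_trace_cser:
  assumes a: "summable (\<lambda>k. lam k ^ 3 * \<bar>a k\<bar>)"
  shows "has_trace L (weak_deriv L 1 (cser a)) 0 0" "has_trace L (weak_deriv L 1 (cser a)) L 0"
proof -
  have "continuous_on {0..L} (sder 1 a)" by (rule continuous_sder[OF summable_lam_mono[OF a]]) simp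
  moreover have "AE x in M. weak_deriv L 1 (cser a) x = sder 1 a x" by (rule sobolev_cser(2)[OF a]) simp
  moreover have "sder 1 a 0 = 0" "sder 1 a L = 0" unfolding sder_low by (simp_all add: ux_def sser_def)
  ultimately show "has_trace L (weak_deriv L 1 (cser a)) 0 0" "has_trace L (weak_deriv L 1 (cser a)) L 0"
    unfolding has_trace_def by blast+
qed

lemma integrable_suminf_bounded:
  fixes f :: "nat \<Rightarrow> 'a \<Rightarrow> real"
  assumes f: "\<And>k. integrable \<M> (f k)" "\<And>k x. 0 \<le> f k x" and s: "AE x in \<M>. summable (\<lambda>k. f k x)"
    and m: "\<And>K. (\<integral>x. (\<Sum>k\<le>K. f k x) \<partial>\<M>) \<le> m"
  shows "integrable \<M> (\<lambda>x. \<Sum>k. f k x)" and "summable (\<lambda>k. \<integral>x. f k x \<partial>\<M>)"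
proof -
  show sI: "summable (\<lambda>k. \<integral>x. f k x \<partial>\<M>)"
  proof (rule bounded_imp_summable)
    show "0 \<le> (\<integral>x. f k x \<partial>\<M>)" for k using f(2) by simp
    show "(\<Sum>k\<le>K. \<integral>x. f k x \<partial>\<M>) \<le> m" for K using m[of K] f(1) by simp
  qed
  show "integrable \<M> (\<lambda>x. \<Sum>k. f k x)"
    by (rule integrable_suminf[OF f(1)]) (use s sI f(2) in simp_all)
qed

lemma jointly_measurable_cser:
  assumes "\<And>k. continuous_on {0..T} (a k)"
  shows "jointly_measurable L T (\<lambda>t. cser (\<lambda>k. a k t))"
proof -
  have "(\<lambda>p. a k (fst p) * cs k (snd p)) \<in> borel_measurable (lebesgue_on ({0..T} \<times> {0<..<L}))" for k
  proof (rule continuous_imp_measurable_on_sets_lebesgue)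
    have "continuous_on ({0..T} \<times> {0<..<L}) (\<lambda>p. a k (fst p))"
      by (rule continuous_on_compose2[OF assms]) (auto intro: continuous_intros)
    then show "continuous_on ({0..T} \<times> {0<..<L}) (\<lambda>p. a k (fst p) * cs k (snd p))"
      by (intro continuous_intros)
    have "{0..T} \<times> {0<..<L} \<in> sets (borel :: (real \<times> real) measure)"
      unfolding borel_prod[symmetric] by (rule pair_measureI) simp_all
    then show "{0..T} \<times> {0<..<L} \<in> sets lebesgue" by (intro sets_completionI_sets) simp
  qed
  then have "(\<lambda>p. \<Sum>k. a k (fst p) * cs k (snd p)) \<in> borel_measurable (lebesgue_on ({0..T} \<times> {0<..<L}))"
    by (rule borel_measurable_suminf)
  then show ?thesis unfolding jointly_measurable_def cser_def by (simp add: case_prod_beta)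
qed

text \<open>\<open>lam k / lam 1\<close> is at least 1, so the missing even powers can be inserted;
  the \<open>1 +\<close> in the base lets the exponent 3 serve all \<open>j\<close> at once.\<close>

lemma lam_power_le_6:
  assumes "1 \<le> k" "j \<le> 3"
  shows "(lam k ^ j)\<^sup>2 \<le> (1 + 1 / (lam 1)\<^sup>2) ^ 3 * lam k ^ 6"
proof -
  have l: "0 < lam 1" "lam 1 \<le> lam k" using assms(1) lam_pos[of 1] lam_mono[of 1 k] by auto
  have "1 \<le> 1 / (lam 1)\<^sup>2 * (lam k)\<^sup>2" using power_mono[OF l(2), of 2] l(1) by simp
  also have "\<dots> \<le> (1 + 1 / (lam 1)\<^sup>2) * (lam k)\<^sup>2" by (rule mult_right_mono) simp_all
  finally have 1: "1 \<le> ((1 + 1 / (lam 1)\<^sup>2) * (lam k)\<^sup>2) ^ (3 - j)" by (rule one_le_power)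
  have "(lam k ^ j)\<^sup>2 * 1 \<le> (lam k ^ j)\<^sup>2 * ((1 + 1 / (lam 1)\<^sup>2) * (lam k)\<^sup>2) ^ (3 - j)"
    by (rule mult_left_mono[OF 1]) simp
  also have "\<dots> = (1 + 1 / (lam 1)\<^sup>2) ^ (3 - j) * (((lam k)\<^sup>2) ^ j * ((lam k)\<^sup>2) ^ (3 - j))"
    by (simp add: power_mult_distrib power_mult[symmetric] mult_ac)
  also have "((lam k)\<^sup>2) ^ j * ((lam k)\<^sup>2) ^ (3 - j) = lam k ^ 6"
    unfolding power_mult[symmetric] power_add[symmetric] using assms(2) by (intro arg_cong[where f = "power _"]) simp
  also have "(1 + 1 / (lam 1)\<^sup>2) ^ (3 - j) * lam k ^ 6 \<le> (1 + 1 / (lam 1)\<^sup>2) ^ 3 * lam k ^ 6"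
    by (intro mult_right_mono power_increasing) simp_all
  finally show ?thesis by simp
qed

lemma sobolev_norm_cser_le:
  assumes s: "summable (\<lambda>k. lam k ^ 3 * \<bar>a k\<bar>)" and s6: "summable (\<lambda>k. lam k ^ 6 * (a k)\<^sup>2)"
  shows "(sobolev_norm L 3 (cser a))\<^sup>2
    \<le> 4 * (L * (a 0)\<^sup>2 + L * (1 + 1 / (lam 1)\<^sup>2) ^ 3 * (\<Sum>k. lam k ^ 6 * (a k)\<^sup>2))"
proof -
  let ?c = "(1 + 1 / (lam 1)\<^sup>2) ^ 3"
  define f where "f k = (if k = (0::nat) then L * (a 0)\<^sup>2 else 0)" for k
  have f: "f sums (L * (a 0)\<^sup>2)" unfolding f_def by (rule sums_single)
  have "(\<Sum>k. nrm k * (lam k ^ j * a k)\<^sup>2) \<le> L * (a 0)\<^sup>2 + L * ?c * (\<Sum>k. lam k ^ 6 * (a k)\<^sup>2)" if j: "j \<le> 3" for j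
  proof (rule sums_le[OF _ summable_sums[OF sums_summable[OF parseval_sder[OF summable_lam_mono[OF s j]]]]
          sums_add[OF f sums_mult[OF summable_sums[OF s6]]]])
    fix k
    show "nrm k * (lam k ^ j * a k)\<^sup>2 \<le> f k + L * ?c * (lam k ^ 6 * (a k)\<^sup>2)"
    proof (cases "k = 0")
      case True
      have "(lam 0 ^ j * a 0)\<^sup>2 \<le> (a 0)\<^sup>2" by (cases j) simp_all
      then show ?thesis using True L_pos by (simp add: f_def nrm_def)
    next
      case False
      have "nrm k * ((lam k ^ j)\<^sup>2 * (a k)\<^sup>2) \<le> L * (?c * lam k ^ 6 * (a k)\<^sup>2)"
        by (intro mult_mono nrm_le mult_right_mono lam_power_le_6 j) (use False L_pos in simp_all)
      then show ?thesis using False by (simp add: f_def power_mult_distrib mult_ac)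
    qed
  qed
  \<comment> \<open>Four orders of differentiation with the same bound give the factor 4.\<close>
  then have "(\<Sum>j\<le>3. \<Sum>k. nrm k * (lam k ^ j * a k)\<^sup>2) \<le> of_nat (card {..3::nat}) * (L * (a 0)\<^sup>2 + L * ?c * (\<Sum>k. lam k ^ 6 * (a k)\<^sup>2))"
    by (intro sum_bounded_above) simp
  then show ?thesis unfolding sobolev_cser(3)[OF s] by simp
qed

text \<open>At \<open>t = 0\<close> only the summability inherited from \<open>H\<^sup>1\<close> is
  available, so everything involving higher derivatives is proved for \<open>0 < t\<close>, which is
  almost every time.\<close>

theorem KS_solution_exists:
  assumes T: "0 < T" and u0: "sobolev L 1 u0"
  shows "\<exists>a. coef_sol T (ft u0) a \<and> (\<forall>k. a k 0 = ft u0 k) \<and> (\<forall>t\<in>{0..T}. summable (\<lambda>k. \<bar>a k t\<bar>)) \<and>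
    KS_solution L T u0 (\<lambda>t. cser (\<lambda>k. a k t)) \<and> C_L2 L T (\<lambda>t. cser (\<lambda>k. a k t)) \<and>
    (\<forall>t\<in>{0<..T}. \<exists>\<delta>>0. \<exists>C. \<forall>k. \<bar>a k t\<bar> \<le> C * exp (- \<delta> * lam k))"
proof -
  let ?T = "lebesgue_on {0..T}"
  have L2: "L2_fun L u0" using u0 unfolding sobolev_def by blast
  note u0i = L2_integrable[OF L2]
  obtain a m where a: "\<forall>k. a k 0 = ft u0 k \<and> continuous_on {0..T} (a k)"
      "\<forall>t\<in>{0..T}. \<forall>K. (\<Sum>k\<in>{1..K}. (lam k)\<^sup>2 * (a k t)\<^sup>2) \<le> m"
      "\<forall>t\<in>{0<..T}. \<exists>\<delta>>0. \<exists>C. \<forall>k. \<bar>a k t\<bar> \<le> C * exp (- \<delta> * lam k)"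
      "\<forall>K. (\<integral>s. (\<Sum>k\<in>{1..K}. lam k ^ 6 * (a k s)\<^sup>2) \<partial>?T) \<le> m"
      "\<forall>k. integrable ?T (\<lambda>s. - mu k * a k s - 1 / 2 * Qc (\<lambda>j. a j s) k)"
      "\<forall>k. \<forall>t\<in>{0..T}. a k t = ft u0 k + (\<integral>s. - mu k * a k s - 1 / 2 * Qc (\<lambda>j. a j s) k \<partial>lebesgue_on {0..t})"
    using coefficients_exist[OF T H1_coefficients[OF u0]] by (elim exE conjE) (rule that)
  have a0: "a k 0 = ft u0 k" and ac: "continuous_on {0..T} (a k)" for k using a(1) by simp_all
  have am: "(\<Sum>k\<in>{1..K}. (lam k)\<^sup>2 * (a k t)\<^sup>2) \<le> m" if "t \<in> {0..T}" for t K
    using bspec[OF a(2) that] by blast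
  have ag: "\<exists>\<delta>>0. \<exists>C. \<forall>k. \<bar>a k t\<bar> \<le> C * exp (- \<delta> * lam k)" if "t \<in> {0<..T}" for t
    using a(3) that by (rule bspec)
  note a6 = a(4)[rule_format]
  have ai: "integrable ?T (\<lambda>s. rate (\<lambda>j. a j s) k)" for k
    unfolding rate_def by (rule a(5)[rule_format])
  have ae: "a k t = ft u0 k + (\<integral>s. rate (\<lambda>j. a j s) k \<partial>lebesgue_on {0..t})" if "t \<in> {0..T}" for k t
    unfolding rate_def by (rule a(6)[rule_format, OF that])
  have am': "a k \<in> borel_measurable ?T" for k
    by (rule borel_measurable_integrable[OF continuous_imp_integrable_lebesgue_on[OF ac]])
  obtain C0 where C0: "\<And>t. t \<in> {0..T} \<Longrightarrow> \<bar>a 0 t\<bar> \<le> C0"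
  proof -
    obtain C where "\<forall>x\<in>a 0 ` {0..T}. norm x \<le> C"
      using compact_continuous_image[OF ac[of 0] compact_Icc, THEN compact_imp_bounded]
      unfolding bounded_iff by blast
    then show thesis by (intro that[of C]) simp
  qed
  \<comment> \<open>A summable majorant of \<open>(a k t)\<^sup>2\<close> uniform in
    \<open>t\<close>: the energy bound for \<open>k > 0\<close>, and \<open>C0\<close> for the mean,
    where the second summand is 0 by the convention for division.\<close>
  define G where "G k = (if k = 0 then C0\<^sup>2 else 0) + m * (1 / (lam k)\<^sup>2)" for k
  have Gs: "summable G"
    unfolding G_def by (intro summable_add summable_mult summable_inverse_lam2 sums_summable[OF sums_single])
  have aG: "(a k t)\<^sup>2 \<le> G k" if t: "t \<in> {0..T}" for k t
  proof (cases "k = 0")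
    case True
    have "\<bar>a 0 t\<bar>\<^sup>2 \<le> C0\<^sup>2" by (rule power_mono[OF C0[OF t]]) simp
    then show ?thesis using True by (simp add: G_def)
  next
    case False
    have "(lam k)\<^sup>2 * (a k t)\<^sup>2 \<le> (\<Sum>k\<in>{1..k}. (lam k)\<^sup>2 * (a k t)\<^sup>2)"
      by (rule member_le_sum) (use False in auto)
    also have "\<dots> \<le> m" by (rule am[OF t])
    finally have "(a k t)\<^sup>2 \<le> m / (lam k)\<^sup>2" using lam_pos[of k] False by (simp add: pos_le_divide_eq mult.commute)
    then show ?thesis using False by (simp add: G_def)
  qed
  have sa: "summable (\<lambda>k. \<bar>a k t\<bar>)" if t: "t \<in> {0..T}" for t
  proof -
    have "summable (\<lambda>k. lam k ^ (2 * 0 + 2) * (a k t)\<^sup>2)"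
    proof (rule bounded_imp_summable[where B = m])
      show "(\<Sum>k\<le>K. lam k ^ (2 * 0 + 2) * (a k t)\<^sup>2) \<le> m" for K
      proof -
        have "(\<Sum>k\<le>K. lam k ^ (2 * 0 + 2) * (a k t)\<^sup>2) = (\<Sum>k\<in>{1..K}. (lam k)\<^sup>2 * (a k t)\<^sup>2)"
          by (rule sum.mono_neutral_cong_right) (auto simp: power2_eq_square)
        then show ?thesis using am[OF t, of K] by simp
      qed
    qed simp
    from summable_lam_power[OF this] show ?thesis by simp
  qed
  have sl: "summable (\<lambda>k. lam k ^ n * \<bar>a k t\<bar>)" if t: "t \<in> {0<..T}" for n t
  proof -
    obtain \<delta> C where "0 < \<delta>" "\<forall>k. \<bar>a k t\<bar> \<le> C * exp (- \<delta> * lam k)" using ag[OF t] by blast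
    then show ?thesis by (intro summable_exp_decay[of \<delta> _ C]) blast+
  qed
  have s6: "summable (\<lambda>k. lam k ^ 6 * (a k t)\<^sup>2)" if t: "t \<in> {0<..T}" for t
  proof -
    have s: "summable (\<lambda>k. nrm k * (lam k ^ 3 * a k t)\<^sup>2)" by (rule sums_summable[OF parseval_sder[OF sl[OF t]]])
    show ?thesis
    proof (rule summable_comparison_test'[OF summable_mult[OF s, of "2 / L"], of 0])
      fix k
      have "1 \<le> 2 / L * nrm k" using nrm_ge[of k] L_pos by (simp add: field_simps)
      then have "1 * (lam k ^ 3 * a k t)\<^sup>2 \<le> 2 / L * nrm k * (lam k ^ 3 * a k t)\<^sup>2" by (rule mult_right_mono) simp
      then show "norm (lam k ^ 6 * (a k t)\<^sup>2) \<le> 2 / L * (nrm k * (lam k ^ 3 * a k t)\<^sup>2)"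
        by (simp add: power_mult_distrib power_mult[symmetric] mult.assoc)
    qed
  qed
  have pos: "AE t in ?T. t \<in> {0<..T}"
  proof -
    have "AE t in ?T. t \<noteq> 0" by (rule AE_lebesgue_on_neq) simp
    then show ?thesis using AE_space by eventually_elim auto
  qed
  have i6k: "integrable ?T (\<lambda>s. lam k ^ 6 * (a k s)\<^sup>2)" for k
    by (rule continuous_imp_integrable_lebesgue_on) (intro continuous_intros ac)
  have p6: "(\<integral>s. (\<Sum>k\<le>K. lam k ^ 6 * (a k s)\<^sup>2) \<partial>?T) \<le> m" for K
  proof -
    have "(\<Sum>k\<le>K. lam k ^ 6 * (a k s)\<^sup>2) = (\<Sum>k\<in>{1..K}. lam k ^ 6 * (a k s)\<^sup>2)" for s
      by (rule sum.mono_neutral_right) auto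
    then show ?thesis using a6[of K] by simp
  qed
  have s6ae: "AE s in ?T. summable (\<lambda>k. lam k ^ 6 * (a k s)\<^sup>2)" using pos by eventually_elim (rule s6)
  have i6: "integrable ?T (\<lambda>s. \<Sum>k. lam k ^ 6 * (a k s)\<^sup>2)"
    and si6: "summable (\<lambda>k. \<integral>s. lam k ^ 6 * (a k s)\<^sup>2 \<partial>?T)"
    by (rule integrable_suminf_bounded[OF i6k _ s6ae p6]; simp)+
  have cs: "coef_sol T (ft u0) a"
    unfolding coef_sol_def
  proof (intro conjI allI ballI ai ae s6ae i6 exI[of _ "suminf G"])
    fix t K assume t: "t \<in> {0..T}"
    have "(\<Sum>k\<le>K. (a k t)\<^sup>2) \<le> (\<Sum>k\<le>K. G k)" by (rule sum_mono[OF aG[OF t]])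
    also have "\<dots> \<le> suminf G"
      by (rule sum_le_suminf[OF Gs]) (use order_trans[OF zero_le_power2 aG[OF t]] in simp_all)
    finally show "(\<Sum>k\<le>K. (a k t)\<^sup>2) \<le> suminf G" .
  qed
  define u where "u t = cser (\<lambda>k. a k t)" for t
  have jm: "jointly_measurable L T u" unfolding u_def by (rule jointly_measurable_cser[OF ac])
  have uc: "continuous_on {0..L} (u t)" if "t \<in> {0..T}" for t
    unfolding u_def by (rule continuous_trig_series(1)[OF sa[OF that]])
  have uL2: "L2_fun L (u t)" if "t \<in> {0..T}" for t by (rule L2_continuous[OF uc[OF that]])
  have Linf: "Linf_L2 L T u"
    unfolding Linf_L2_def
  proof (intro conjI jm exI[of _ "sqrt (L * suminf G)"])
    have "L2_norm L (u t) \<le> sqrt (L * suminf G)" if t: "t \<in> {0..T}" for t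
    proof -
      have "(\<integral>x. (u t x)\<^sup>2 \<partial>M) \<le> L * suminf G"
        unfolding u_def
      proof (rule sums_le[OF _ parseval_cser[OF sa[OF t]] sums_mult[OF summable_sums[OF Gs]]])
        show "nrm k * (a k t)\<^sup>2 \<le> L * G k" for k
          by (intro mult_mono nrm_le aG t) (use L_pos in simp_all)
      qed
      then show ?thesis unfolding L2_norm_def by simp
    qed
    then show "AE t in ?T. L2_fun L (u t) \<and> L2_norm L (u t) \<le> sqrt (L * suminf G)"
      using AE_space uL2 by (auto intro!: AE_I2)
  qed
  have H3: "L2_sobolev L T 3 u"
    unfolding L2_sobolev_def
  proof (intro conjI jm)
    show "AE t in ?T. sobolev L 3 (u t)"
      using pos by eventually_elim (unfold u_def, rule sobolev_cser(1)[OF sl])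
    let ?f = "\<lambda>t. \<Sum>j\<le>3. \<Sum>k. nrm k * (lam k ^ j * a k t)\<^sup>2"
    let ?g = "\<lambda>t. 4 * (L * C0\<^sup>2 + L * (1 + 1 / (lam 1)\<^sup>2) ^ 3 * (\<Sum>k. lam k ^ 6 * (a k t)\<^sup>2))"
    have eq: "AE t in ?T. ?f t = (sobolev_norm L 3 (u t))\<^sup>2"
      using pos
    proof eventually_elim
      case (elim t)
      show ?case unfolding u_def by (rule sobolev_cser(3)[OF sl[OF elim], symmetric])
    qed
    have fm: "?f \<in> borel_measurable ?T"
      by (intro borel_measurable_sum borel_measurable_suminf borel_measurable_times borel_measurable_power borel_measurable_const am')
    have sm: "(\<lambda>t. (sobolev_norm L 3 (u t))\<^sup>2) \<in> borel_measurable ?T"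
      by (rule borel_measurable_lebesgue_on_AE[OF fm _ eq]) simp
    have fin: "finite_measure ?T" by (rule finite_measure_lebesgue_on) simp
    have gi: "integrable ?T ?g"
      by (intro Bochner_Integration.integrable_mult_right Bochner_Integration.integrable_add i6
          finite_measure.integrable_const[OF fin])
    show "integrable ?T (\<lambda>t. (sobolev_norm L 3 (u t))\<^sup>2)"
    proof (rule Bochner_Integration.integrable_bound[OF gi sm])
      show "AE t in ?T. norm ((sobolev_norm L 3 (u t))\<^sup>2) \<le> norm (?g t)"
        using pos
      proof eventually_elim
        case (elim t)
        have "(sobolev_norm L 3 (u t))\<^sup>2 \<le> 4 * (L * (a 0 t)\<^sup>2 + L * (1 + 1 / (lam 1)\<^sup>2) ^ 3 * (\<Sum>k. lam k ^ 6 * (a k t)\<^sup>2))"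
          unfolding u_def by (rule sobolev_norm_cser_le[OF sl[OF elim] s6[OF elim]])
        moreover have "L * (a 0 t)\<^sup>2 \<le> L * C0\<^sup>2"
        proof (rule mult_left_mono)
          have "\<bar>a 0 t\<bar>\<^sup>2 \<le> C0\<^sup>2" by (rule power_mono[OF C0]) (use elim in auto)
          then show "(a 0 t)\<^sup>2 \<le> C0\<^sup>2" by simp
        qed (use L_pos in simp)
        ultimately have "(sobolev_norm L 3 (u t))\<^sup>2 \<le> ?g t" by argo
        then show ?case unfolding real_norm_def abs_of_nonneg[OF zero_le_power2] by (rule order_trans[OF _ abs_ge_self])
      qed
    qed
  qed
  have trace: "AE t in ?T. has_trace L (weak_deriv L 1 (u t)) 0 0 \<and> has_trace L (weak_deriv L 1 (u t)) L 0"
    using pos by eventually_elim (unfold u_def, intro conjI has_trace_cser sl)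
  have CL2: "C_L2 L T u"
    unfolding C_L2_def
  proof (intro conjI ballI uL2)
    fix s assume s: "s \<in> {0..T}"
    let ?f = "\<lambda>t k. nrm k * (a k t - a k s)\<^sup>2"
    have eq: "L2_norm L (\<lambda>x. u t x - u s x) = sqrt (\<Sum>k. ?f t k)" if t: "t \<in> {0..T}" for t
    proof -
      have d: "u t x - u s x = cser (\<lambda>k. a k t - a k s) x" for x
        unfolding u_def cser_def
        by (subst suminf_diff[OF summable_trig(1)[OF sa[OF t]] summable_trig(1)[OF sa[OF s]]]) (simp add: left_diff_distrib)
      have "summable (\<lambda>k. \<bar>a k t - a k s\<bar>)"
        by (rule summable_comparison_test'[OF summable_add[OF sa[OF t] sa[OF s]], of 0]) simp
      from sums_unique[OF parseval_cser[OF this]] show ?thesis unfolding L2_norm_def d by simp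
    qed
    \<comment> \<open>Uniform convergence in \<open>t\<close>, through the majorant
      \<open>G\<close>, transfers continuity from the single coefficients to the
      \<open>L\<^sup>2\<close> distance.\<close>
    have ul: "uniform_limit {0..T} (\<lambda>n t. \<Sum>k<n. ?f t k) (\<lambda>t. \<Sum>k. ?f t k) sequentially"
    proof (rule Weierstrass_m_test[OF _ summable_mult[OF Gs, of "L * 4"]])
      fix k t assume t: "t \<in> {0..T}"
      have "(a k t - a k s)\<^sup>2 \<le> 2 * (a k t)\<^sup>2 + 2 * (a k s)\<^sup>2"
        using zero_le_power2[of "a k t + a k s"] by (simp add: power2_sum power2_diff)
      then have b: "(a k t - a k s)\<^sup>2 \<le> 4 * G k" using aG[OF t, of k] aG[OF s, of k] by linarith
      have "nrm k * (a k t - a k s)\<^sup>2 \<le> L * (4 * G k)"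
        by (intro mult_mono nrm_le b) (use L_pos in simp_all)
      then show "norm (nrm k * (a k t - a k s)\<^sup>2) \<le> L * 4 * G k" by (simp add: mult.assoc)
    qed
    have "continuous_on {0..T} (\<lambda>t. \<Sum>k<n. ?f t k)" for n by (intro continuous_intros ac)
    then have "continuous_on {0..T} (\<lambda>t. \<Sum>k. ?f t k)"
      by (intro uniform_limit_theorem[OF always_eventually ul]) simp_all
    then have "continuous_on {0..T} (\<lambda>t. sqrt (\<Sum>k. ?f t k))" by (intro continuous_on_real_sqrt)
    then have "((\<lambda>t. sqrt (\<Sum>k. ?f t k)) \<longlongrightarrow> sqrt (\<Sum>k. ?f s k)) (at s within {0..T})"
      using s unfolding continuous_on_def by blast
    then have "((\<lambda>t. sqrt (\<Sum>k. ?f t k)) \<longlongrightarrow> 0) (at s within {0..T})" by simp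
    moreover have "\<forall>\<^sub>F t in at s within {0..T}. sqrt (\<Sum>k. ?f t k) = L2_norm L (\<lambda>x. u t x - u s x)"
      unfolding eventually_at_filter using eq by (intro always_eventually) simp
    ultimately show "((\<lambda>t. L2_norm L (\<lambda>x. u t x - u s x)) \<longlongrightarrow> 0) (at s within {0..T})"
      by (rule Lim_transform_eventually)
  qed
  have weak: "(\<integral>x. u t x * v x \<partial>M) - (\<integral>x. u0 x * v x \<partial>M)
           = (\<integral>s. (\<integral>x. weak_deriv L 3 (u s) x * deriv v x - weak_deriv L 2 (u s) x * v x
                        - 1 / 2 * (weak_deriv L 1 (u s) x)\<^sup>2 * v x \<partial>M) \<partial>lebesgue_on {0..t})"
    if v: "smooth_fun v" and t: "t \<in> {0..T}" for v t
  proof -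
    let ?t = "lebesgue_on {0..t}"
    define V where "V k = (\<integral>x. v x * cs k x \<partial>M)" for k
    have sV: "summable (\<lambda>k. \<bar>V k\<bar>)" unfolding V_def by (rule summable_smooth_coefficients(1)[OF v])
    obtain Cv where Cv: "\<And>k. (lam k)\<^sup>2 * \<bar>V k\<bar> \<le> Cv" using smooth_coefficient_decay[OF v] unfolding V_def by blast
    have Cv0: "0 \<le> Cv" using Cv[of 0] by simp
    have sub: "AE s in ?t. P s" if "AE s in ?T. P s" for P
      using that t by (auto simp: AE_restrict_space_iff elim: eventually_mono)
    \<comment> \<open>Collects the comparison of \<open>|mu k|\<close> with
      \<open>lam k ^ 4\<close>, the decay constant \<open>Cv\<close> and the 1/2 of Young's
      inequality.\<close>
    define c where "c = (1 + 1 / (lam 1)\<^sup>2) * Cv / 2"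
    \<comment> \<open>Majorant for exchanging the sum over \<open>k\<close> with the time integral.
      In the linear part two powers of \<open>lam k\<close> go to the decay of \<open>V k\<close>
      and two stay with \<open>a k\<close>; the result is summable in \<open>k\<close> at positive
      times and after integration over time.\<close>
    define B where "B k s = c * (lam k ^ 6 * (a k s)\<^sup>2) + (c * (1 / (lam k)\<^sup>2) + m / 2 * \<bar>V k\<bar>)" for k s
    have RB: "\<bar>rate (\<lambda>j. a j s) k * V k\<bar> \<le> B k s" if s: "s \<in> {0<..T}" for k s
    proof -
      have "\<bar>mu k * a k s\<bar> * \<bar>V k\<bar> \<le> c * (lam k ^ 6 * (a k s)\<^sup>2) + c * (1 / (lam k)\<^sup>2)"
      proof (cases "k = 0")
        case False
        have l: "0 < lam 1" "lam 1 \<le> lam k" using False lam_pos[of 1] lam_mono[of 1 k] by auto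
        have "1 \<le> 1 / (lam 1)\<^sup>2 * (lam k)\<^sup>2" using power_mono[OF l(2), of 2] l(1) by simp
        then have "(lam k)\<^sup>2 + 1 \<le> (1 + 1 / (lam 1)\<^sup>2) * (lam k)\<^sup>2" by (simp add: distrib_right)
        then have "(lam k)\<^sup>2 * ((lam k)\<^sup>2 + 1) \<le> (lam k)\<^sup>2 * ((1 + 1 / (lam 1)\<^sup>2) * (lam k)\<^sup>2)"
          by (rule mult_left_mono) simp
        moreover have "\<bar>mu k\<bar> \<le> (lam k)\<^sup>2 * ((lam k)\<^sup>2 + 1)"
          unfolding mu_def using zero_le_power2[of "(lam k)\<^sup>2"] zero_le_power2[of "lam k"]
          by (simp add: abs_le_iff algebra_simps power2_eq_square power4_eq_xxxx)
        ultimately have "\<bar>mu k\<bar> \<le> (lam k)\<^sup>2 * ((1 + 1 / (lam 1)\<^sup>2) * (lam k)\<^sup>2)" by linarith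
        then have "\<bar>mu k\<bar> * (\<bar>a k s\<bar> * \<bar>V k\<bar>) \<le> (lam k)\<^sup>2 * ((1 + 1 / (lam 1)\<^sup>2) * (lam k)\<^sup>2) * (\<bar>a k s\<bar> * \<bar>V k\<bar>)"
          by (rule mult_right_mono) simp
        also have "\<dots> = (1 + 1 / (lam 1)\<^sup>2) * (((lam k)\<^sup>2 * \<bar>V k\<bar>) * ((lam k)\<^sup>2 * \<bar>a k s\<bar>))" by (simp add: mult_ac)
        also have "\<dots> \<le> (1 + 1 / (lam 1)\<^sup>2) * (Cv * ((lam k ^ 6 * (a k s)\<^sup>2 + 1 / (lam k)\<^sup>2) / 2))"
        proof (intro mult_left_mono mult_mono Cv Cv0)
          show "(lam k)\<^sup>2 * \<bar>a k s\<bar> \<le> (lam k ^ 6 * (a k s)\<^sup>2 + 1 / (lam k)\<^sup>2) / 2"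
            using lam_power_abs_le[OF False, of 2 "a k s"] by simp
        qed simp_all
        also have "\<dots> = c * (lam k ^ 6 * (a k s)\<^sup>2 + 1 / (lam k)\<^sup>2)" unfolding c_def by simp
        finally show ?thesis by (simp add: abs_mult mult.assoc distrib_left)
      qed (simp add: mu_def)
      moreover have "\<bar>Qc (\<lambda>j. a j s) k\<bar> * \<bar>V k\<bar> \<le> m * \<bar>V k\<bar>"
      proof (rule mult_right_mono[OF abs_Qc_le])
        show "summable (\<lambda>k. lam k * \<bar>a k s\<bar>)" using sl[OF s, of 1] by simp
        show "(\<Sum>j\<in>{1..N}. (lam j)\<^sup>2 * (a j s)\<^sup>2) \<le> m" for N by (rule am) (use s in simp)
      qed simp
      moreover have "\<bar>rate (\<lambda>j. a j s) k * V k\<bar> \<le> \<bar>mu k * a k s\<bar> * \<bar>V k\<bar> + 1 / 2 * (\<bar>Qc (\<lambda>j. a j s) k\<bar> * \<bar>V k\<bar>)"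
      proof -
        have "\<bar>rate (\<lambda>j. a j s) k\<bar> \<le> \<bar>mu k * a k s\<bar> + 1 / 2 * \<bar>Qc (\<lambda>j. a j s) k\<bar>"
          unfolding rate_def by linarith
        then have "\<bar>rate (\<lambda>j. a j s) k\<bar> * \<bar>V k\<bar> \<le> (\<bar>mu k * a k s\<bar> + 1 / 2 * \<bar>Qc (\<lambda>j. a j s) k\<bar>) * \<bar>V k\<bar>"
          by (rule mult_right_mono) simp
        then show ?thesis by (simp add: abs_mult distrib_right)
      qed
      ultimately show ?thesis unfolding B_def by linarith
    qed
    have sB: "summable (\<lambda>k. B k s)" if "s \<in> {0<..T}" for s
      unfolding B_def by (intro summable_add summable_mult s6 that summable_inverse_lam2 sV)
    have fint: "finite_measure ?t" by (rule finite_measure_lebesgue_on) simp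
    have i6t: "integrable ?t (\<lambda>s. lam k ^ 6 * (a k s)\<^sup>2)" for k
      by (rule indefinite_integral_continuous_lebesgue(2)[OF i6k t])
    have iB: "integrable ?t (B k)" for k
      unfolding B_def by (intro Bochner_Integration.integrable_add Bochner_Integration.integrable_mult_right i6t finite_measure.integrable_const[OF fint])
    have IB: "(\<integral>s. B k s \<partial>?t) = c * (\<integral>s. lam k ^ 6 * (a k s)\<^sup>2 \<partial>?t) + t * (c * (1 / (lam k)\<^sup>2) + m / 2 * \<bar>V k\<bar>)" for k
    proof -
      have "(\<integral>s. B k s \<partial>?t) = (\<integral>s. c * (lam k ^ 6 * (a k s)\<^sup>2) \<partial>?t) + (\<integral>s. c * (1 / (lam k)\<^sup>2) + m / 2 * \<bar>V k\<bar> \<partial>?t)"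
        unfolding B_def by (rule Bochner_Integration.integral_add) (intro Bochner_Integration.integrable_mult_right i6t finite_measure.integrable_const[OF fint])+
      also have "(\<integral>s. c * (1 / (lam k)\<^sup>2) + m / 2 * \<bar>V k\<bar> \<partial>?t) = t * (c * (1 / (lam k)\<^sup>2) + m / 2 * \<bar>V k\<bar>)"
        using t by (subst lebesgue_integral_const) (simp add: measure_restrict_space)
      finally show ?thesis by simp
    qed
    have si6t: "summable (\<lambda>k. \<integral>s. lam k ^ 6 * (a k s)\<^sup>2 \<partial>?t)"
    proof (rule summable_comparison_test'[OF si6, of 0])
      fix k
      have "(\<integral>s. lam k ^ 6 * (a k s)\<^sup>2 \<partial>?t) \<le> (\<integral>s. lam k ^ 6 * (a k s)\<^sup>2 \<partial>?T)"
      proof -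
        have "(\<integral>s. lam k ^ 6 * (a k s)\<^sup>2 \<partial>?t) = (\<integral>s. lam k ^ 6 * (a k s)\<^sup>2 * (if s \<le> t then 1 else 0) \<partial>?T)"
          by (rule integral_lebesgue_on_restrict[OF t, symmetric])
        also have "\<dots> \<le> (\<integral>s. lam k ^ 6 * (a k s)\<^sup>2 \<partial>?T)"
          by (rule integral_mono'[OF i6k]) simp_all
        finally show ?thesis .
      qed
      then show "norm (\<integral>s. lam k ^ 6 * (a k s)\<^sup>2 \<partial>?t) \<le> (\<integral>s. lam k ^ 6 * (a k s)\<^sup>2 \<partial>?T)" by simp
    qed
    have SB: "summable (\<lambda>k. \<integral>s. B k s \<partial>?t)"
      unfolding IB by (intro summable_add summable_mult si6t summable_inverse_lam2 sV)
    have ir: "integrable ?t (\<lambda>s. rate (\<lambda>j. a j s) k)" for k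
      by (rule indefinite_integral_continuous_lebesgue(2)[OF ai t])
    have irV: "integrable ?t (\<lambda>s. rate (\<lambda>j. a j s) k * V k)" for k
      by (rule Bochner_Integration.integrable_mult_left[OF ir])
    have s1: "(\<lambda>k. \<integral>s. rate (\<lambda>j. a j s) k * V k \<partial>?t) sums (\<integral>s. (\<Sum>k. rate (\<lambda>j. a j s) k * V k) \<partial>?t)"
    proof (rule sums_integral[OF irV])
      show "AE s in ?t. summable (\<lambda>k. norm (rate (\<lambda>j. a j s) k * V k))"
        using sub[OF pos]
      proof eventually_elim
        case (elim s)
        show ?case by (rule summable_comparison_test'[OF sB[OF elim], of 0]) (use RB[OF elim] in simp)
      qed
      show "summable (\<lambda>k. \<integral>s. norm (rate (\<lambda>j. a j s) k * V k) \<partial>?t)"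
      proof (rule summable_comparison_test'[OF SB, of 0])
        fix k
        have "(\<integral>s. norm (rate (\<lambda>j. a j s) k * V k) \<partial>?t) \<le> (\<integral>s. B k s \<partial>?t)"
        proof (rule integral_mono_AE[OF integrable_norm[OF irV] iB])
          show "AE s in ?t. norm (rate (\<lambda>j. a j s) k * V k) \<le> B k s"
            using sub[OF pos]
          proof eventually_elim
            case (elim s)
            show ?case unfolding real_norm_def by (rule RB[OF elim])
          qed
        qed
        then show "norm (\<integral>s. norm (rate (\<lambda>j. a j s) k * V k) \<partial>?t) \<le> (\<integral>s. B k s \<partial>?t)" by simp
      qed
    qed
    have c: "(\<integral>s. rate (\<lambda>j. a j s) k * V k \<partial>?t) = a k t * V k - ft u0 k * V k" for k
      using ae[OF t, of k] by (simp add: algebra_simps)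
    have "(\<lambda>k. a k t * V k - ft u0 k * V k) sums ((\<integral>x. u t x * v x \<partial>M) - (\<integral>x. u0 x * v x \<partial>M))"
    proof (rule sums_diff)
      show "(\<lambda>k. ft u0 k * V k) sums (\<integral>x. u0 x * v x \<partial>M)"
        unfolding V_def by (rule integral_mult_smooth[OF u0i v])
      show "(\<lambda>k. a k t * V k) sums (\<integral>x. u t x * v x \<partial>M)"
        using integral_mult_smooth[OF continuous_integrable_M[OF uc[OF t]] v]
        unfolding V_def u_def ft_cser[OF sa[OF t]] .
    qed
    then have "(\<integral>x. u t x * v x \<partial>M) - (\<integral>x. u0 x * v x \<partial>M) = (\<integral>s. (\<Sum>k. rate (\<lambda>j. a j s) k * V k) \<partial>?t)"
      by (rule sums_unique2[OF _ s1[unfolded c]])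
    also have "\<dots> = (\<integral>s. (\<integral>x. weak_deriv L 3 (u s) x * deriv v x - weak_deriv L 2 (u s) x * v x
                        - 1 / 2 * (weak_deriv L 1 (u s) x)\<^sup>2 * v x \<partial>M) \<partial>?t)"
    proof (rule integral_lebesgue_on_cong_AE[symmetric])
      show "(\<lambda>s. \<Sum>k. rate (\<lambda>j. a j s) k * V k) \<in> borel_measurable ?t"
        by (intro borel_measurable_suminf borel_measurable_integrable irV)
      show "AE s in ?t. (\<integral>x. weak_deriv L 3 (u s) x * deriv v x - weak_deriv L 2 (u s) x * v x
                        - 1 / 2 * (weak_deriv L 1 (u s) x)\<^sup>2 * v x \<partial>M) = (\<Sum>k. rate (\<lambda>j. a j s) k * V k)"
        using sub[OF pos]
      proof eventually_elim
        case (elim s)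
        show ?case unfolding V_def u_def by (rule sums_unique[OF weak_form_cser[OF sl[OF elim] v]])
      qed
    qed simp
    finally show ?thesis .
  qed
  have "KS_solution L T u0 u"
    unfolding KS_solution_def
  proof (intro conjI allI impI Linf H3 trace)
    fix v assume v: "smooth_fun v"
    show "AE t in ?T. (\<integral>x. u t x * v x \<partial>M) - (\<integral>x. u0 x * v x \<partial>M)
           = (\<integral>s. (\<integral>x. weak_deriv L 3 (u s) x * deriv v x - weak_deriv L 2 (u s) x * v x
                        - 1 / 2 * (weak_deriv L 1 (u s) x)\<^sup>2 * v x \<partial>M) \<partial>lebesgue_on {0..t})"
      using AE_space
    proof eventually_elim
      case (elim t)
      then show ?case by (intro weak[OF v]) simp
    qed
  qed
  then show ?thesis
    unfolding u_def by (intro exI[of _ a] conjI allI ballI cs a0 sa CL2[unfolded u_def] ag)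
qed

end

theorem theorem4p1:
  fixes L T :: real and u0 :: "real \<Rightarrow> real"
  assumes "L > 0" and "T > 0" and "H1_bc L u0"
  shows "\<exists>u :: real \<Rightarrow> real \<Rightarrow> real.
     KS_solution L T u0 u \<and>
     C_L2 L T u \<and> (AE x in dom_measure L. u 0 x = u0 x) \<and>
     (\<forall>t\<in>{0<..T}. classical_bc L (u t)) \<and>
     (\<forall>w. KS_solution L T u0 w \<longrightarrow>
        (AE t in lebesgue_on {0..T}. AE x in dom_measure L. w t x = u t x)) \<and>
     (\<forall>t\<in>{0<..T}. real_analytic_on {0..L} (u t))"
proof -
  interpret interval L by unfold_locales fact
  have u0: "sobolev L 1 u0" using assms(3) unfolding H1_bc_def by blast
  then have L2: "L2_fun L u0" unfolding sobolev_def by blast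
  obtain a where cs: "coef_sol T (ft u0) a" and a: "\<forall>k. a k 0 = ft u0 k"
      "\<forall>t\<in>{0..T}. summable (\<lambda>k. \<bar>a k t\<bar>)"
    and KS: "KS_solution L T u0 (\<lambda>t. cser (\<lambda>k. a k t))" "C_L2 L T (\<lambda>t. cser (\<lambda>k. a k t))"
    and ag: "\<forall>t\<in>{0<..T}. \<exists>\<delta>>0. \<exists>C. \<forall>k. \<bar>a k t\<bar> \<le> C * exp (- \<delta> * lam k)"
    using KS_solution_exists[OF assms(2) u0] by (elim exE conjE) (rule that)
  note a0 = a(1)[rule_format] and sa = a(2)[rule_format]
  show ?thesis
  proof (intro exI[of _ "\<lambda>t. cser (\<lambda>k. a k t)"] conjI KS ballI allI impI)
    have "summable (\<lambda>k. \<bar>ft u0 k\<bar>)" using sa[of 0] assms(2) unfolding a0 by simp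
    then show "AE x in M. cser (\<lambda>k. a k 0) x = u0 x"
      unfolding a0 using AE_eq_cser_ft[OF L2_integrable[OF L2]] by (auto elim: eventually_mono)
  next
    fix t assume t: "t \<in> {0<..T}"
    obtain \<delta> C where d: "0 < \<delta>" "\<And>k. \<bar>a k t\<bar> \<le> C * exp (- \<delta> * lam k)" using bspec[OF ag t] by blast
    show "classical_bc L (cser (\<lambda>k. a k t))" by (rule classical_bc_cser[OF summable_exp_decay[OF d]])
    show "real_analytic_on {0..L} (cser (\<lambda>k. a k t))" by (rule real_analytic_cser[OF d])
  next
    fix w assume "KS_solution L T u0 w"
    \<comment> \<open>Any solution has coefficients that solve the same system with data
      \<open>ft u0\<close>; uniqueness there and completeness of the cosines give equality almost
      everywhere.\<close>
    from KS_solution_coef_sol[OF assms(2) L2 this] obtain p where p: "coef_sol T (ft u0) p"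
      and w: "AE t in lebesgue_on {0..T}. L2_fun L (w t) \<and> (\<forall>k. ft (w t) k = p k t)" by blast
    show "AE t in lebesgue_on {0..T}. AE x in M. w t x = cser (\<lambda>k. a k t) x"
      using w AE_space
    proof eventually_elim
      case (elim t)
      then have t: "t \<in> {0..T}" by simp
      have "integrable M (cser (\<lambda>k. a k t))"
        by (rule continuous_integrable_M[OF continuous_trig_series(1)[OF sa[OF t]]])
      moreover have "ft (w t) k = ft (cser (\<lambda>k. a k t)) k" for k
        unfolding ft_cser[OF sa[OF t]] using elim coef_sol_unique[OF p cs t] by simp
      ultimately show ?case using elim by (intro ft_eq_imp_AE_eq[OF L2_integrable]) auto
    qed
  qed
qed

end
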